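(* Let $k\in\mathcal K_{pol}(\mathbb R^n)$. Let $K\subset\mathbb R^n$ be a compact subset such that $(K-K)\cap\mathbb Z^n=\{0\}$, and let $\{u_\gamma\}_{\gamma\in\mathbb Z^n}$ be a family of elements of $\mathcal B_k(\mathbb R^n)\cap\mathcal D'_K(\mathbb R^n)$. Put $$u=\sum_{\gamma\in\mathbb Z^n}\tau_\gamma u_\gamma=\sum_{\gamma\in\mathbb Z^n}u_\gamma(\cdot-\gamma)\in\mathcal D'(\mathbb R^n).$$ Then the following statements are equivalent: (a) $u\in\mathcal B_k(\mathbb R^n)$. (b) $\sum_{\gamma\in\mathbb Z^n}\|u_\gamma\|_{\mathcal B_k}^2<\infty$. Moreover, there is $C\ge1$, which does not depend on the family $\{u_\gamma\}_{\gamma\in\mathbb Z^n}$, such that $$C^{-1}\|u\|_{\mathcal B_k}\le\Big(\sum_{\gamma\in\mathbb Z^n}\|u_\gamma\|_{\mathcal B_k}^2\Big)^{1/2}\le C\|u\|_{\mathcal B_k}.$$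
   Context: Notation: $\langle\xi\rangle=(1+|\xi|^2)^{1/2}$; $\widehat u(\xi)=\int e^{-i\langle x,\xi\rangle}u(x)\,dx$, extended to $\mathcal S'(\mathbb R^n)$; $\tau_\gamma u=u(\cdot-\gamma)=\delta_\gamma*u$; $\mathcal D'_K(\mathbb R^n)$ is the set of distributions supported in $K$. $\mathcal K_{pol}(\mathbb R^n)$ is the set of positive measurable functions $k$ on $\mathbb R^n$ for which there are constants $C,N>0$ with $k(\xi+\eta)\le C\langle\xi\rangle^Nk(\eta)$ for all $\xi,\eta\in\mathbb R^n$. $\mathcal B_k(\mathbb R^n)$ is the Hilbert space of $u\in\mathcal S'(\mathbb R^n)$ such that $\widehat u$ is a function and $k\widehat u\in L^2$, with norm $\|u\|_{\mathcal B_k}=\|k\widehat u\|_{L^2}$ ($=+\infty$ if $u\notin\mathcal B_k$). *)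

theory Defs
  imports "HOL-Analysis.Analysis"
begin

section \<open>Smooth functions, test functions, Schwartz functions\<close>

definition japanese :: "real ^ 'n \<Rightarrow> real" where
  "japanese \<xi> = sqrt (1 + (norm \<xi>)\<^sup>2)"

definition partial :: "'n \<Rightarrow> (real ^ 'n \<Rightarrow> complex) \<Rightarrow> real ^ 'n \<Rightarrow> complex" where
  "partial i f x = frechet_derivative f (at x) (axis i 1)"

text \<open>Multi-indices are encoded as lists of coordinate directions; the order of such a
  multi-index is the length of the list. Different orderings of one list give the same derivative
  of a smooth function.\<close>

fun partials :: "'n list \<Rightarrow> (real ^ 'n \<Rightarrow> complex) \<Rightarrow> real ^ 'n \<Rightarrow> complex" where
  "partials [] f = f"
| "partials (i # \<alpha>) f = partial i (partials \<alpha> f)"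

definition smooth :: "(real ^ 'n \<Rightarrow> complex) \<Rightarrow> bool" where
  "smooth f \<longleftrightarrow> (\<forall>\<alpha> x. partials \<alpha> f differentiable (at x))"

definition fun_support :: "(real ^ 'n \<Rightarrow> complex) \<Rightarrow> (real ^ 'n) set" where
  "fun_support f = closure {x. f x \<noteq> 0}"

definition test_functions :: "(real ^ 'n \<Rightarrow> complex) set" where
  "test_functions = {\<phi>. smooth \<phi> \<and> compact (fun_support \<phi>)}"

definition schwartz_functions :: "(real ^ 'n \<Rightarrow> complex) set" where
  "schwartz_functions =
     {\<phi>. smooth \<phi> \<and> (\<forall>\<alpha> (m::nat). \<exists>B. \<forall>x. japanese x ^ m * norm (partials \<alpha> \<phi> x) \<le> B)}"

text \<open>In the following two seminorms each partial derivative of order at most \<open>m\<close> is counted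
  once per list representing it, which only affects the constants in the continuity estimates.\<close>

definition test_seminorm :: "nat \<Rightarrow> (real ^ 'n \<Rightarrow> complex) \<Rightarrow> real" where
  "test_seminorm m \<phi> =
     (\<Sum>\<alpha> | length \<alpha> \<le> m. SUP x. norm (partials \<alpha> \<phi> x))"

definition schwartz_seminorm :: "nat \<Rightarrow> (real ^ 'n \<Rightarrow> complex) \<Rightarrow> real" where
  "schwartz_seminorm m \<phi> =
     (\<Sum>\<alpha> | length \<alpha> \<le> m. SUP x. japanese x ^ m * norm (partials \<alpha> \<phi> x))"


section \<open>Distributions\<close>

definition linear_form_on ::
    "(real ^ 'n \<Rightarrow> complex) set \<Rightarrow> ((real ^ 'n \<Rightarrow> complex) \<Rightarrow> complex) \<Rightarrow> bool" where
  "linear_form_on A u \<longleftrightarrow>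
     (\<forall>\<phi>\<in>A. \<forall>\<psi>\<in>A. u (\<lambda>x. \<phi> x + \<psi> x) = u \<phi> + u \<psi>) \<and>
     (\<forall>c. \<forall>\<phi>\<in>A. u (\<lambda>x. c * \<phi> x) = c * u \<phi>)"

text \<open>A distribution is represented by a functional on all functions of which only the values on
  test functions are relevant. Every notion below that takes a distribution
  as argument depends on these values only; likewise for tempered distributions and Schwartz
  functions.\<close>

definition distributions :: "((real ^ 'n \<Rightarrow> complex) \<Rightarrow> complex) set" where
  "distributions = {u. linear_form_on test_functions u \<and>
     (\<forall>L. compact L \<longrightarrow> (\<exists>C m. \<forall>\<phi>\<in>test_functions. fun_support \<phi> \<subseteq> L \<longrightarrow>
        norm (u \<phi>) \<le> C * test_seminorm m \<phi>))}"

definition tempered_distributions :: "((real ^ 'n \<Rightarrow> complex) \<Rightarrow> complex) set" where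
  "tempered_distributions = {U. linear_form_on schwartz_functions U \<and>
     (\<exists>C m. \<forall>\<phi>\<in>schwartz_functions. norm (U \<phi>) \<le> C * schwartz_seminorm m \<phi>)}"

definition dist_support :: "((real ^ 'n \<Rightarrow> complex) \<Rightarrow> complex) \<Rightarrow> (real ^ 'n) set" where
  "dist_support u = {x. \<not> (\<exists>V. open V \<and> x \<in> V \<and>
     (\<forall>\<phi>\<in>test_functions. fun_support \<phi> \<subseteq> V \<longrightarrow> u \<phi> = 0))}"

definition distributions_supported ::
    "(real ^ 'n) set \<Rightarrow> ((real ^ 'n \<Rightarrow> complex) \<Rightarrow> complex) set" where
  "distributions_supported K = {u \<in> distributions. dist_support u \<subseteq> K}"

definition translate ::
    "real ^ 'n \<Rightarrow> ((real ^ 'n \<Rightarrow> complex) \<Rightarrow> complex) \<Rightarrow> (real ^ 'n \<Rightarrow> complex) \<Rightarrow> complex" where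
  "translate \<gamma> u = (\<lambda>\<phi>. u (\<lambda>x. \<phi> (x + \<gamma>)))"


section \<open>Fourier transform\<close>

definition fourier :: "(real ^ 'n \<Rightarrow> complex) \<Rightarrow> real ^ 'n \<Rightarrow> complex" where
  "fourier \<phi> \<xi> = (LINT x|lebesgue. exp (- (\<i> * complex_of_real (x \<bullet> \<xi>))) * \<phi> x)"

definition fourier_dist ::
    "((real ^ 'n \<Rightarrow> complex) \<Rightarrow> complex) \<Rightarrow> (real ^ 'n \<Rightarrow> complex) \<Rightarrow> complex" where
  "fourier_dist U = (\<lambda>\<phi>. U (fourier \<phi>))"

definition locally_integrable :: "(real ^ 'n \<Rightarrow> complex) \<Rightarrow> bool" where
  "locally_integrable g \<longleftrightarrow> (\<forall>L. compact L \<longrightarrow> set_integrable lebesgue L g)"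

text \<open>The distribution \<open>u\<close> is tempered, i.e. it extends to a tempered distribution \<open>U\<close>
  (necessarily unique on Schwartz functions, by density), and the Fourier transform of \<open>U\<close> is the
  locally integrable function \<open>g\<close> (necessarily unique almost everywhere).\<close>

definition fourier_is_function ::
    "((real ^ 'n \<Rightarrow> complex) \<Rightarrow> complex) \<Rightarrow> (real ^ 'n \<Rightarrow> complex) \<Rightarrow> bool" where
  "fourier_is_function u g \<longleftrightarrow>
     (\<exists>U\<in>tempered_distributions. (\<forall>\<phi>\<in>test_functions. U \<phi> = u \<phi>) \<and>
        locally_integrable g \<and>
        (\<forall>\<phi>\<in>test_functions. fourier_dist U \<phi> = (LINT \<xi>|lebesgue. g \<xi> * \<phi> \<xi>)))"


section \<open>Weight functions and the weighted spaces\<close>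

definition Kpol :: "(real ^ 'n \<Rightarrow> real) set" where
  "Kpol = {k \<in> borel_measurable lebesgue. (\<forall>\<xi>. k \<xi> > 0) \<and>
     (\<exists>C>0. \<exists>N>0. \<forall>\<xi> \<eta>. k (\<xi> + \<eta>) \<le> C * japanese \<xi> powr N * k \<eta>)}"

definition square_integrable :: "(real ^ 'n \<Rightarrow> complex) set" where
  "square_integrable =
     {f \<in> borel_measurable lebesgue. integrable lebesgue (\<lambda>x. (norm (f x))\<^sup>2)}"

definition L2norm :: "(real ^ 'n \<Rightarrow> complex) \<Rightarrow> real" where
  "L2norm f = sqrt (LINT x|lebesgue. (norm (f x))\<^sup>2)"

definition Bspace :: "(real ^ 'n \<Rightarrow> real) \<Rightarrow> ((real ^ 'n \<Rightarrow> complex) \<Rightarrow> complex) set" where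
  "Bspace k = {u \<in> distributions. \<exists>g. fourier_is_function u g \<and>
     (\<lambda>\<xi>. complex_of_real (k \<xi>) * g \<xi>) \<in> square_integrable}"

text \<open>Since the function \<open>g\<close> is unique almost everywhere, the norm does not depend on its choice.\<close>

definition Bnorm ::
    "(real ^ 'n \<Rightarrow> real) \<Rightarrow> ((real ^ 'n \<Rightarrow> complex) \<Rightarrow> complex) \<Rightarrow> ennreal" where
  "Bnorm k u =
     (if u \<in> Bspace k
      then ennreal (L2norm (\<lambda>\<xi>. complex_of_real (k \<xi>) * (SOME g. fourier_is_function u g) \<xi>))
      else \<infinity>)"


section \<open>Sums of lattice translates\<close>

definition integer_lattice :: "(real ^ 'n) set" where
  "integer_lattice = {\<gamma>. \<forall>i. \<gamma> $ i \<in> \<int>}"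

text \<open>The sum is taken in the weak sense, i.e. pointwise on test functions.\<close>

definition translates_sum ::
    "(real ^ 'n \<Rightarrow> (real ^ 'n \<Rightarrow> complex) \<Rightarrow> complex) \<Rightarrow> (real ^ 'n \<Rightarrow> complex) \<Rightarrow> complex" where
  "translates_sum u = (\<lambda>\<phi>. \<Sum>\<^sub>\<infinity>\<gamma>\<in>integer_lattice. translate \<gamma> (u \<gamma>) \<phi>)"

definition ennreal_root2 :: "ennreal \<Rightarrow> ennreal" where
  "ennreal_root2 a = (if a = \<infinity> then \<infinity> else ennreal (sqrt (enn2real a)))"

end

theory Submission
  imports Defs "HOL-Probability.Characteristic_Functions" "HOL-Probability.Sinc_Integral"
begin

text \<open>Choose a test function \<open>h\<close> that equals \<open>1\<close> near \<open>K\<close> and whose support meets no translate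
  \<open>K + \<gamma>\<close> with \<open>\<gamma> \<noteq> 0\<close>; it exists because \<open>K - K\<close> has a positive distance from the nonzero lattice
  points (\<open>separating_cutoff\<close>). Then \<open>u\<^sub>\<gamma> = h u\<^sub>\<gamma>\<close>, and \<open>h\<close> recovers each piece from the sum: \<open>u\<^sub>\<gamma>\<close> is the
  product of \<open>h\<close> and the translate of \<open>u\<close> by \<open>- \<gamma>\<close>.

  On the Fourier side, translation by \<open>\<gamma>\<close> is multiplication by the character
  \<open>exp (- \<i> \<langle>\<gamma>, \<xi>\<rangle>)\<close>, and multiplication by \<open>h\<close> is, up to a constant, convolution with the transform \<open>H\<close> of \<open>h\<close>
  (\<open>fourier_is_function_mult\<close>). Since \<open>H\<close> decreases rapidly, it absorbs the polynomial growth of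
  the quotients \<open>k \<xi> / k \<eta>\<close> (\<open>kernel_weight\<close>). With \<open>g\<^sub>\<gamma>\<close> the transform of \<open>u\<^sub>\<gamma>\<close> and \<open>G\<close> that of \<open>u\<close>, two
  inequalities for finite sets of indices remain:

  \<^item> \<open>synthesis_estimate\<close>: the square norm of \<open>\<Sum> exp (- \<i> \<langle>\<gamma>, \<xi>\<rangle>) (H * g\<^sub>\<gamma>)\<close> is bounded by the sum of the
    square norms of the \<open>g\<^sub>\<gamma>\<close>;
  \<^item> \<open>analysis_estimate\<close>: the sum of the square norms of \<open>H * (exp (\<i> \<langle>\<gamma>, \<cdot>\<rangle>) G)\<close> is bounded by the square norm
    of \<open>G\<close>.

  Both follow by the Cauchy-Schwarz inequality from one fact on trigonometric sums
  (\<open>trig_sum_weighted\<close>): the integral of \<open>\<bar>\<Sum> c\<^sub>\<gamma> exp (- \<i> \<langle>\<gamma>, \<xi>\<rangle>)\<bar>\<^sup>2\<close> against an integrable weight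
  that is a translate of \<open>\<langle>\<xi>\<rangle> ^ (- 2 n)\<close> is at most a constant times \<open>\<Sum> \<bar>c\<^sub>\<gamma>\<bar>\<^sup>2\<close>. This is
  orthogonality of the characters on a cube of periods, averaged over the positions of the cube.
  The second inequality is a form of Bessel's inequality and gives that (a) implies (b). For the
  converse, the first one shows that the transforms of the partial sums are a Cauchy sequence in a
  weighted \<open>L\<^sup>2\<close> space; its limit (\<open>weighted_square_limit\<close>) is the transform of \<open>u\<close>, because on each test
  function the partial sums are eventually equal to \<open>u\<close>.

  The Fourier analysis that underlies these steps is developed from the definitions: inversion on
  the Schwartz space through Gaussian means, density of the test functions, uniqueness almost
  everywhere of a transform that is a function, and Parseval's formula
  \<open>u \<theta> = \<integral> g (\<xi>) F (\<xi>) d\<xi>\<close> with \<open>F\<close> the inverse transform of \<open>\<theta>\<close>, for a distribution \<open>u\<close> with transform \<open>g\<close>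
  (\<open>fourier_is_functionI\<close>, \<open>fourier_is_functionD\<close>).\<close>


section \<open>Calculus of smooth functions\<close>

lemma partial_eq_derivative:
  assumes "(f has_derivative f') (at x)"
  shows "partial i f x = f' (axis i 1)"
  using assms by (simp add: partial_def frechet_derivative_at[symmetric])

lemma partials_append: "partials (\<alpha> @ \<beta>) f = partials \<alpha> (partials \<beta> f)"
  by (induction \<alpha>) auto

text \<open>Smoothness is the largest property that implies differentiability and is inherited by partial
  derivatives.\<close>

lemma smooth_coinduct:
  assumes "f \<in> S" and "\<And>g x. g \<in> S \<Longrightarrow> g differentiable (at x)"
    and "\<And>g i. g \<in> S \<Longrightarrow> partial i g \<in> S"
  shows "smooth f"
proof -
  have "partials \<alpha> f \<in> S" for \<alpha>
    by (induction \<alpha>) (use assms in auto)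
  then show ?thesis
    unfolding smooth_def using assms(2) by blast
qed

lemma smooth_differentiable: "smooth f \<Longrightarrow> f differentiable (at x)"
  unfolding smooth_def by (metis partials.simps(1))

lemma smooth_partials: "smooth f \<Longrightarrow> smooth (partials \<alpha> f)"
  unfolding smooth_def by (metis partials_append)

lemma smooth_partial: "smooth f \<Longrightarrow> smooth (partial i f)"
  using smooth_partials[of f "[i]"] by simp

lemma smooth_continuous_on: "smooth f \<Longrightarrow> continuous_on A f"
  by (meson smooth_differentiable differentiable_imp_continuous_within continuous_at_imp_continuous_on)

lemma smooth_borel_measurable: "smooth f \<Longrightarrow> f \<in> borel_measurable borel"
  by (simp add: borel_measurable_continuous_onI smooth_continuous_on)

lemma smooth_has_derivative: "smooth f \<Longrightarrow> (f has_derivative frechet_derivative f (at x)) (at x)"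
  using frechet_derivative_works smooth_differentiable by blast

lemma partial_add:
  assumes "\<And>x. f differentiable (at x)" "\<And>x. g differentiable (at x)"
  shows "partial i (\<lambda>x. f x + g x) = (\<lambda>x. partial i f x + partial i g x)"
proof
  fix x
  have "((\<lambda>x. f x + g x) has_derivative
      (\<lambda>h. frechet_derivative f (at x) h + frechet_derivative g (at x) h)) (at x)"
    using assms by (intro has_derivative_add) (auto simp: frechet_derivative_works[symmetric])
  from partial_eq_derivative[OF this]
  show "partial i (\<lambda>x. f x + g x) x = partial i f x + partial i g x"
    by (simp add: partial_def)
qed

lemma partial_mult:
  assumes "\<And>x. f differentiable (at x)" "\<And>x. g differentiable (at x)"
  shows "partial i (\<lambda>x. f x * g x) = (\<lambda>x. partial i f x * g x + f x * partial i g x)"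
proof
  fix x
  have "((\<lambda>x. f x * g x) has_derivative
      (\<lambda>h. f x * frechet_derivative g (at x) h + frechet_derivative f (at x) h * g x)) (at x)"
    using assms by (intro has_derivative_mult) (auto simp: frechet_derivative_works[symmetric])
  from partial_eq_derivative[OF this]
  show "partial i (\<lambda>x. f x * g x) x = partial i f x * g x + f x * partial i g x"
    by (simp add: partial_def)
qed

lemma partial_const: "partial i (\<lambda>x. c) = (\<lambda>x. 0)"
  by (rule ext, subst partial_eq_derivative[OF has_derivative_const]) auto

lemma smooth_const: "smooth (\<lambda>x. c)"
proof (rule smooth_coinduct[where S = "range (\<lambda>c x. c)"])
  fix g :: "real ^ 'a \<Rightarrow> complex" and i assume "g \<in> range (\<lambda>c x. c)"
  then show "partial i g \<in> range (\<lambda>c x. c)"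
    by (auto simp: partial_const)
qed auto

text \<open>Smoothness of products and of compositions is obtained by coinduction: the functions that are
  generated from a set \<open>B\<close> and all smooth functions by sums and products are smooth as soon as the
  first derivatives of the elements of \<open>B\<close> are generated in this way.\<close>

inductive smooth_gen :: "(real ^ 'n \<Rightarrow> complex) set \<Rightarrow> (real ^ 'n \<Rightarrow> complex) \<Rightarrow> bool" for B where
  base: "f \<in> B \<Longrightarrow> smooth_gen B f"
| smooth: "smooth f \<Longrightarrow> smooth_gen B f"
| add: "smooth_gen B f \<Longrightarrow> smooth_gen B g \<Longrightarrow> smooth_gen B (\<lambda>x. f x + g x)"
| mult: "smooth_gen B f \<Longrightarrow> smooth_gen B g \<Longrightarrow> smooth_gen B (\<lambda>x. f x * g x)"

lemma smooth_gen_smooth: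
  assumes diff: "\<And>f x. f \<in> B \<Longrightarrow> f differentiable (at x)"
    and partial: "\<And>f i. f \<in> B \<Longrightarrow> smooth_gen B (partial i f)"
    and f: "smooth_gen B f"
  shows "smooth f"
proof -
  have d: "g differentiable (at x)" if "smooth_gen B g" for g x
    using that by (induction arbitrary: x) (use diff smooth_differentiable in auto)
  have p: "smooth_gen B (partial i g)" if "smooth_gen B g" for g i
    using that
  proof (induction)
    case (base f) then show ?case using partial by blast
  next
    case (smooth f) then show ?case using smooth_partial smooth_gen.smooth by blast
  next
    case (add f g) then show ?case by (simp add: partial_add d smooth_gen.add)
  next
    case (mult f g)
    then have "smooth_gen B (\<lambda>x. partial i f x * g x + f x * partial i g x)"
      using smooth_gen.add[OF smooth_gen.mult[of B "partial i f" g] smooth_gen.mult[of B f "partial i g"]]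
      by simp
    with mult show ?case by (simp add: partial_mult d)
  qed
  show ?thesis
    by (rule smooth_coinduct[where S = "Collect (smooth_gen B)"]) (use d p f in auto)
qed

lemma smooth_add: "smooth f \<Longrightarrow> smooth g \<Longrightarrow> smooth (\<lambda>x. f x + g x)"
  by (rule smooth_gen_smooth[where B = "{}"]) (auto intro: smooth_gen.intros)

lemma smooth_mult: "smooth f \<Longrightarrow> smooth g \<Longrightarrow> smooth (\<lambda>x. f x * g x)"
  by (rule smooth_gen_smooth[where B = "{}"]) (auto intro: smooth_gen.intros)

lemma smooth_cmult: "smooth f \<Longrightarrow> smooth (\<lambda>x. c * f x)"
  by (intro smooth_mult smooth_const)

lemma smooth_diff: "smooth f \<Longrightarrow> smooth g \<Longrightarrow> smooth (\<lambda>x. f x - g x)"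
  using smooth_add[OF _ smooth_cmult[of g "-1"]] by simp

lemma smooth_sum: "(\<And>i. i \<in> I \<Longrightarrow> smooth (f i)) \<Longrightarrow> smooth (\<lambda>x. \<Sum>i\<in>I. f i x)"
  by (induction I rule: infinite_finite_induct) (auto intro: smooth_const smooth_add)

lemma smooth_prod: "(\<And>i. i \<in> I \<Longrightarrow> smooth (f i)) \<Longrightarrow> smooth (\<lambda>x. \<Prod>i\<in>I. f i x)"
  by (induction I rule: infinite_finite_induct) (auto intro: smooth_const smooth_mult)

lemma partial_inner: "partial i (\<lambda>x. complex_of_real (x \<bullet> a)) = (\<lambda>x. complex_of_real (axis i 1 \<bullet> a))"
proof
  fix x :: "real ^ 'a"
  have "((\<lambda>x. complex_of_real (x \<bullet> a)) has_derivative (\<lambda>h. complex_of_real (h \<bullet> a))) (at x)"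
    by (auto intro!: derivative_eq_intros)
  from partial_eq_derivative[OF this]
  show "partial i (\<lambda>x. complex_of_real (x \<bullet> a)) x = complex_of_real (axis i 1 \<bullet> a)" .
qed

lemma smooth_inner: "smooth (\<lambda>x. complex_of_real (x \<bullet> a))"
proof (rule smooth_gen_smooth[where B = "{\<lambda>x. complex_of_real (x \<bullet> a)}"])
  show "f differentiable (at x)" if "f \<in> {\<lambda>x. complex_of_real (x \<bullet> a)}" for f x
    using that by (auto intro!: derivative_eq_intros simp: differentiable_def)
qed (auto simp: partial_inner intro: smooth_gen.intros smooth_const)

lemma partial_inner_fun:
  "partial i (\<lambda>x. complex_of_real (x $ j)) = (\<lambda>x. if i = j then 1 else 0)"
  using partial_inner[of i "axis j 1"] by (simp add: inner_axis) (auto simp: axis_def)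

lemma smooth_component: "smooth (\<lambda>x. complex_of_real (x $ j))"
  using smooth_inner[of "axis j 1"] by (simp add: inner_axis)

lemma smooth_norm_square: "smooth (\<lambda>x. complex_of_real ((norm (x - a))\<^sup>2))"
proof -
  have eq: "(\<lambda>x. complex_of_real ((norm (x - a))\<^sup>2)) =
    (\<lambda>x. \<Sum>i\<in>UNIV. (complex_of_real (x $ i) - complex_of_real (a $ i)) *
        (complex_of_real (x $ i) - complex_of_real (a $ i)))"
    by (auto simp: norm_vec_def L2_set_def sum_nonneg power2_eq_square)
  show ?thesis
    unfolding eq by (intro smooth_sum smooth_mult smooth_diff smooth_component smooth_const)
qed

text \<open>The sequence \<open>F\<close> lists the derivatives of \<open>F 0\<close>, so that the chain rule keeps the functions
  \<open>F j \<circ> q\<close> within the set that they generate.\<close>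

lemma smooth_compose:
  fixes F :: "nat \<Rightarrow> real \<Rightarrow> real" and q :: "real ^ 'n \<Rightarrow> real"
  assumes F: "\<And>j x. (F j has_real_derivative F (Suc j) x) (at x)"
    and q: "smooth (\<lambda>x. complex_of_real (q x))"
  shows "smooth (\<lambda>x. complex_of_real (F j (q x)))"
proof (rule smooth_gen_smooth[where B = "range (\<lambda>j x. complex_of_real (F j (q x)))"])
  have *: "((\<lambda>x. complex_of_real (F j (q x))) has_derivative
      (\<lambda>h. complex_of_real (F (Suc j) (q x)) * frechet_derivative (\<lambda>x. complex_of_real (q x)) (at x) h))
      (at x)" for j x
  proof -
    let ?D = "frechet_derivative (\<lambda>x. complex_of_real (q x)) (at x)"
    have D: "((\<lambda>x. complex_of_real (q x)) has_derivative ?D) (at x)"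
      by (rule smooth_has_derivative[OF q])
    have Dr: "(q has_derivative (\<lambda>h. Re (?D h))) (at x)"
      using has_derivative_Re[OF D] by simp
    have "((\<lambda>x. Im (complex_of_real (q x))) has_derivative (\<lambda>h. Im (?D h))) (at x)"
      by (rule has_derivative_Im[OF D])
    moreover have "((\<lambda>x. Im (complex_of_real (q x))) has_derivative (\<lambda>h. 0)) (at x)"
      by simp
    ultimately have "(\<lambda>h. Im (?D h)) = (\<lambda>h. 0)"
      by (rule has_derivative_unique)
    then have Dh: "?D h = complex_of_real (Re (?D h))" for h
      by (simp add: complex_eq_iff fun_eq_iff)
    have "((\<lambda>x. F j (q x)) has_derivative (\<lambda>h. F (Suc j) (q x) * Re (?D h))) (at x)"
      using has_derivative_compose[OF Dr] F[of j "q x"]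
      unfolding has_field_derivative_def by blast
    from has_derivative_of_real[OF this, where 'a = complex]
    show ?thesis using Dh by simp
  qed
  show "f differentiable (at x)" if "f \<in> range (\<lambda>j x. complex_of_real (F j (q x)))" for f x
    using that * by (auto simp: differentiable_def)
  show "smooth_gen (range (\<lambda>j x. complex_of_real (F j (q x)))) (partial i f)"
    if "f \<in> range (\<lambda>j x. complex_of_real (F j (q x)))" for f i
  proof -
    from that obtain j where f: "f = (\<lambda>x. complex_of_real (F j (q x)))" by auto
    have "partial i f = (\<lambda>x. complex_of_real (F (Suc j) (q x)) * partial i (\<lambda>x. complex_of_real (q x)) x)"
      unfolding f using partial_eq_derivative[OF *] by (auto simp: partial_def)
    moreover have "smooth_gen (range (\<lambda>j x. complex_of_real (F j (q x))))
        (\<lambda>x. complex_of_real (F (Suc j) (q x)) * partial i (\<lambda>x. complex_of_real (q x)) x)"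
      by (rule smooth_gen.mult[OF smooth_gen.base smooth_gen.smooth[OF smooth_partial[OF q]]]) auto
    ultimately show ?thesis by simp
  qed
qed (auto intro: smooth_gen.base)

lemma has_derivative_character:
  fixes a :: "real ^ 'n"
  shows "((\<lambda>x. exp (- (\<i> * complex_of_real (x \<bullet> a)))) has_derivative
    (\<lambda>h. - \<i> * complex_of_real (h \<bullet> a) * exp (- (\<i> * complex_of_real (x \<bullet> a))))) (at x)"
proof -
  have "((\<lambda>x. - (\<i> * complex_of_real (x \<bullet> a))) has_derivative
      (\<lambda>h. - (\<i> * complex_of_real (h \<bullet> a)))) (at x)"
    by (auto intro!: derivative_eq_intros)
  from has_derivative_compose[OF this DERIV_exp[unfolded has_field_derivative_def]]
  show ?thesis by (simp add: mult_ac)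
qed

lemma partial_character:
  "partial i (\<lambda>x. exp (- (\<i> * complex_of_real (x \<bullet> a)))) =
    (\<lambda>x. - \<i> * complex_of_real (a $ i) * exp (- (\<i> * complex_of_real (x \<bullet> a))))"
  by (rule ext, subst partial_eq_derivative[OF has_derivative_character]) (simp add: inner_axis inner_commute)

lemma partials_add:
  assumes "smooth f" "smooth g"
  shows "partials \<alpha> (\<lambda>x. f x + g x) = (\<lambda>x. partials \<alpha> f x + partials \<alpha> g x)"
  using assms
  by (induction \<alpha>) (auto simp: partial_add smooth_differentiable smooth_partials)

lemma partials_cmult:
  assumes "smooth f"
  shows "partials \<alpha> (\<lambda>x. c * f x) = (\<lambda>x. c * partials \<alpha> f x)"
  using assms
  by (induction \<alpha>) (auto simp: partial_mult partial_const smooth_differentiable smooth_partials)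

lemma partials_diff:
  assumes "smooth f" "smooth g"
  shows "partials \<alpha> (\<lambda>x. f x - g x) = (\<lambda>x. partials \<alpha> f x - partials \<alpha> g x)"
  using partials_add[OF assms(1) smooth_cmult[OF assms(2), of "-1"]] partials_cmult[OF assms(2), of \<alpha> "-1"]
  by simp

lemma partials_const: "partials \<alpha> (\<lambda>x. c) = (\<lambda>x. if \<alpha> = [] then c else 0)"
  by (induction \<alpha>) (auto simp: partial_const)

lemma partials_snoc: "partials (\<alpha> @ [i]) f = partials \<alpha> (partial i f)"
  by (simp add: partials_append)

text \<open>A pointwise form of the Leibniz rule: each differentiation of a product doubles the number of
  summands.\<close>

lemma partials_mult_bound:
  assumes "smooth f" "smooth g"
    and "\<And>\<beta>. length \<beta> \<le> length \<alpha> \<Longrightarrow> norm (partials \<beta> f x) \<le> A"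
    and "\<And>\<beta>. length \<beta> \<le> length \<alpha> \<Longrightarrow> norm (partials \<beta> g x) \<le> B"
  shows "norm (partials \<alpha> (\<lambda>x. f x * g x) x) \<le> 2 ^ length \<alpha> * (A * B)"
  using assms
proof (induction \<alpha> arbitrary: f g rule: rev_induct)
  case Nil
  then have "norm (f x) \<le> A" "norm (g x) \<le> B"
    by (metis le_refl partials.simps(1))+
  then show ?case
    by (simp add: norm_mult) (meson mult_mono norm_ge_zero order_trans)
next
  case (snoc i \<alpha>)
  have 1: "norm (partials \<alpha> (\<lambda>x. partial i f x * g x) x) \<le> 2 ^ length \<alpha> * (A * B)"
    by (rule snoc.IH)
      (use snoc.prems smooth_partial snoc.prems(3)[of "\<beta> @ [i]" for \<beta>] in \<open>auto simp: partials_snoc\<close>)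
  have 2: "norm (partials \<alpha> (\<lambda>x. f x * partial i g x) x) \<le> 2 ^ length \<alpha> * (A * B)"
    by (rule snoc.IH)
      (use snoc.prems smooth_partial snoc.prems(4)[of "\<beta> @ [i]" for \<beta>] in \<open>auto simp: partials_snoc\<close>)
  have "partials (\<alpha> @ [i]) (\<lambda>x. f x * g x) x =
      partials \<alpha> (\<lambda>x. partial i f x * g x) x + partials \<alpha> (\<lambda>x. f x * partial i g x) x"
    using snoc.prems(1,2)
    by (simp add: partials_snoc partial_mult smooth_differentiable partials_add smooth_mult smooth_partial)
  then have "norm (partials (\<alpha> @ [i]) (\<lambda>x. f x * g x) x) \<le> 2 ^ length \<alpha> * (A * B) + 2 ^ length \<alpha> * (A * B)"
    using norm_triangle_le[OF add_mono[OF 1 2]] by simp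
  then show ?case by (simp add: mult_ac)
qed

lemma partial_affine:
  assumes "\<And>x. f differentiable (at x)"
  shows "partial i (\<lambda>x. f (c *\<^sub>R x + a)) = (\<lambda>x. of_real c * partial i f (c *\<^sub>R x + a))"
proof
  fix x
  have 1: "((\<lambda>x. c *\<^sub>R x + a) has_derivative (\<lambda>h. c *\<^sub>R h)) (at x)"
    by (auto intro!: derivative_eq_intros)
  have f: "(f has_derivative frechet_derivative f (at (c *\<^sub>R x + a))) (at (c *\<^sub>R x + a))"
    using assms frechet_derivative_works by blast
  have "partial i (\<lambda>x. f (c *\<^sub>R x + a)) x = frechet_derivative f (at (c *\<^sub>R x + a)) (c *\<^sub>R axis i 1)"
    by (rule partial_eq_derivative[OF has_derivative_compose[OF 1 f]])
  then show "partial i (\<lambda>x. f (c *\<^sub>R x + a)) x = of_real c * partial i f (c *\<^sub>R x + a)"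
    unfolding partial_def linear_cmul[OF has_derivative_linear[OF f]]
    by (simp add: scaleR_conv_of_real)
qed

lemma partials_affine:
  assumes "smooth f"
  shows "partials \<alpha> (\<lambda>x. f (c *\<^sub>R x + a)) = (\<lambda>x. of_real c ^ length \<alpha> * partials \<alpha> f (c *\<^sub>R x + a))"
proof (induction \<alpha>)
  case (Cons i \<alpha>)
  have d: "(\<lambda>x. partials \<alpha> f (c *\<^sub>R x + a)) differentiable (at x)" for x
    by (rule differentiable_chain_at[of "\<lambda>x. c *\<^sub>R x + a", unfolded o_def])
      (auto intro!: smooth_differentiable smooth_partials assms)
  then show ?case
    using Cons by (simp add: partial_mult partial_const partial_affine smooth_differentiable smooth_partials assms mult_ac)
qed auto

lemma smooth_affine:
  assumes "smooth f"
  shows "smooth (\<lambda>x. f (c *\<^sub>R x + a))"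
proof -
  have 1: "(\<lambda>x. partials \<alpha> f (c *\<^sub>R x + a)) differentiable (at x)" for x \<alpha>
    by (rule differentiable_chain_at[of "\<lambda>x. c *\<^sub>R x + a", unfolded o_def])
      (auto intro!: smooth_differentiable smooth_partials assms)
  have "partials \<alpha> (\<lambda>x. f (c *\<^sub>R x + a)) differentiable (at x)" for x \<alpha>
    by (subst partials_affine[OF assms]) (intro differentiable_mult 1 differentiable_const)
  then show ?thesis unfolding smooth_def by blast
qed

lemma smooth_translate: "smooth f \<Longrightarrow> smooth (\<lambda>x. f (x + a))"
  using smooth_affine[of f 1 a] by simp

lemma partials_translate: "smooth f \<Longrightarrow> partials \<alpha> (\<lambda>x. f (x + a)) = (\<lambda>x. partials \<alpha> f (x + a))"
  using partials_affine[of f \<alpha> 1 a] by simp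

lemma partials_zero_open:
  assumes "open V" "\<And>x. x \<in> V \<Longrightarrow> f x = 0" "x \<in> V"
  shows "partials \<alpha> f x = 0"
  using assms(3)
proof (induction \<alpha> arbitrary: x)
  case (Cons i \<alpha>)
  have "(partials \<alpha> f has_derivative (\<lambda>h. 0)) (at x)"
    by (rule has_derivative_transform_within_open[OF has_derivative_const assms(1)])
      (use Cons in auto)
  from partial_eq_derivative[OF this] show ?case by simp
qed (use assms in auto)

lemma fun_support_partials: "fun_support (partials \<alpha> f) \<subseteq> fun_support f"
proof -
  have "partials \<alpha> f x = 0" if "x \<notin> fun_support f" for x
    by (rule partials_zero_open[where V = "- fun_support f"])
      (use that closure_subset[of "{x. f x \<noteq> 0}"] in \<open>auto simp: fun_support_def\<close>)
  then show ?thesis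
    unfolding fun_support_def[of "partials \<alpha> f"]
    by (intro closure_minimal) (auto simp: fun_support_def)
qed

lemma fun_support_zero: "x \<notin> fun_support f \<Longrightarrow> f x = 0"
  using closure_subset[of "{x. f x \<noteq> 0}"] by (auto simp: fun_support_def)

lemma fun_support_minimal: "closed A \<Longrightarrow> (\<And>x. x \<notin> A \<Longrightarrow> f x = 0) \<Longrightarrow> fun_support f \<subseteq> A"
  unfolding fun_support_def by (rule closure_minimal) (simp_all add: subset_iff, metis)

lemma closed_fun_support: "closed (fun_support f)"
  by (simp add: fun_support_def)

lemma fun_support_mult_left: "fun_support (\<lambda>x. f x * g x) \<subseteq> fun_support f"
  by (rule fun_support_minimal[OF closed_fun_support]) (simp add: fun_support_zero[of _ f])

lemma fun_support_mult_right: "fun_support (\<lambda>x. f x * g x) \<subseteq> fun_support g"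
  by (rule fun_support_minimal[OF closed_fun_support]) (simp add: fun_support_zero[of _ g])

lemma fun_support_add: "fun_support (\<lambda>x. f x + g x) \<subseteq> fun_support f \<union> fun_support g"
proof (rule fun_support_minimal)
  show "f x + g x = 0" if "x \<notin> fun_support f \<union> fun_support g" for x
    using that fun_support_zero[of x f] fun_support_zero[of x g] by simp
qed (simp add: closed_fun_support closed_Un)

lemma fun_support_translate:
  fixes a :: "real ^ 'n"
  shows "fun_support (\<lambda>x. f (x + a)) = (\<lambda>x. x - a) ` fun_support f"
proof -
  have "{x. f (x + a) \<noteq> 0} = (\<lambda>x. x - a) ` {x. f x \<noteq> 0}" (is "?A = ?B")
  proof (rule set_eqI)
    fix x
    have "x \<in> ?B" if "f (x + a) \<noteq> 0"
      by (rule image_eqI[where x = "x + a"]) (use that in simp_all)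
    moreover have "f (x + a) \<noteq> 0" if "x \<in> ?B"
      using that by (elim imageE) simp
    ultimately show "x \<in> ?A \<longleftrightarrow> x \<in> ?B"
      by blast
  qed
  then show ?thesis
    unfolding fun_support_def by (simp only: closure_translation_subtract)
qed

lemma test_functions_smooth: "\<phi> \<in> test_functions \<Longrightarrow> smooth \<phi>"
  by (simp add: test_functions_def)

lemma test_functionsI:
  assumes "smooth \<phi>" "compact L" "\<And>x. x \<notin> L \<Longrightarrow> \<phi> x = 0"
  shows "\<phi> \<in> test_functions" "fun_support \<phi> \<subseteq> L"
proof -
  show *: "fun_support \<phi> \<subseteq> L"
    by (rule fun_support_minimal) (use assms compact_imp_closed in auto)
  have "compact (L \<inter> fun_support \<phi>)"
    using assms(2) closed_fun_support by (rule compact_Int_closed)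
  then show "\<phi> \<in> test_functions"
    using assms(1) * by (simp add: test_functions_def Int_absorb1)
qed

lemma test_functions_compact: "\<phi> \<in> test_functions \<Longrightarrow> compact (fun_support \<phi>)"
  by (simp add: test_functions_def)

lemma test_functions_mult:
  assumes "smooth h" "\<phi> \<in> test_functions"
  shows "(\<lambda>x. h x * \<phi> x) \<in> test_functions"
proof (rule test_functionsI(1))
  show "smooth (\<lambda>x. h x * \<phi> x)"
    by (rule smooth_mult[OF assms(1) test_functions_smooth[OF assms(2)]])
  show "compact (fun_support \<phi>)"
    by (rule test_functions_compact[OF assms(2)])
  show "h x * \<phi> x = 0" if "x \<notin> fun_support \<phi>" for x
    using fun_support_zero[OF that] by simp
qed

lemma test_functions_add:
  assumes "\<phi> \<in> test_functions" "\<psi> \<in> test_functions"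
  shows "(\<lambda>x. \<phi> x + \<psi> x) \<in> test_functions"
proof (rule test_functionsI(1))
  show "smooth (\<lambda>x. \<phi> x + \<psi> x)"
    by (rule smooth_add[OF assms[THEN test_functions_smooth]])
  show "compact (fun_support \<phi> \<union> fun_support \<psi>)"
    by (rule compact_Un[OF assms[THEN test_functions_compact]])
  show "\<phi> x + \<psi> x = 0" if "x \<notin> fun_support \<phi> \<union> fun_support \<psi>" for x
    using that fun_support_zero[of x \<phi>] fun_support_zero[of x \<psi>] by simp
qed

lemma test_functions_cmult: "\<phi> \<in> test_functions \<Longrightarrow> (\<lambda>x. c * \<phi> x) \<in> test_functions"
  by (rule test_functions_mult[OF smooth_const])

lemma test_functions_translate:
  assumes "\<phi> \<in> test_functions"
  shows "(\<lambda>x. \<phi> (x + a)) \<in> test_functions"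
  using assms compact_translation[of "fun_support \<phi>" "- a"] smooth_translate[of \<phi> a]
  by (simp add: test_functions_def fun_support_translate[of \<phi> a])


section \<open>Cut-off functions\<close>

text \<open>The building block of all cut-offs. The derivatives of \<open>exp (- 1 / x)\<close>, extended by zero to the negative axis, are of the form
  \<open>p (1 / x) * exp (- 1 / x)\<close> with these polynomials \<open>p\<close>.\<close>

fun flat_poly :: "nat \<Rightarrow> real poly" where
  "flat_poly 0 = 1"
| "flat_poly (Suc j) = [:0, 0, 1:] * (flat_poly j - pderiv (flat_poly j))"

definition flat :: "nat \<Rightarrow> real \<Rightarrow> real" where
  "flat j x = (if x \<le> 0 then 0 else poly (flat_poly j) (1 / x) * exp (- (1 / x)))"

lemma poly_times_exp_tendsto_0:
  fixes p :: "real poly"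
  shows "((\<lambda>t. poly p t * exp (- t)) \<longlongrightarrow> 0) at_top"
proof -
  have "((\<lambda>t. \<Sum>i\<le>degree p. coeff p i * (t ^ i / exp t)) \<longlongrightarrow> (\<Sum>i\<le>degree p. coeff p i * 0)) at_top"
    by (intro tendsto_sum tendsto_mult tendsto_const tendsto_power_div_exp_0)
  moreover have "(\<Sum>i\<le>degree p. coeff p i * (t ^ i / exp t)) = poly p t * exp (- t)" for t
    by (simp add: poly_altdef sum_distrib_right exp_minus divide_inverse mult.assoc)
  ultimately show ?thesis by simp
qed

text \<open>At the origin the difference quotients tend to zero because the exponential beats every power
  of \<open>1 / x\<close>.\<close>

lemma flat_has_derivative: "(flat j has_real_derivative flat (Suc j) x) (at x)"
proof -
  consider "x < 0" | "x = 0" | "x > 0" by linarith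
  then show ?thesis
  proof cases
    case 1
    have "((\<lambda>x. 0) has_real_derivative 0) (at x)" by simp
    then have "(flat j has_real_derivative 0) (at x)"
      by (rule DERIV_cong_ev[THEN iffD1, rotated 3])
        (use 1 eventually_at_left_real in \<open>auto simp: flat_def eventually_nhds intro!: exI[of _ "{..<0}"]\<close>)
    then show ?thesis using 1 by (simp add: flat_def)
  next
    case 3
    have "((\<lambda>x. poly (flat_poly j) (1 / x) * exp (- (1 / x))) has_real_derivative
        (poly (pderiv (flat_poly j)) (1 / x) * (- (1 / x\<^sup>2))) * exp (- (1 / x)) +
        poly (flat_poly j) (1 / x) * (exp (- (1 / x)) * (1 / x\<^sup>2))) (at x)"
      using 3 by (auto intro!: derivative_eq_intros DERIV_chain'[OF _ poly_DERIV] simp: power2_eq_square)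
    moreover have "(poly (pderiv (flat_poly j)) (1 / x) * (- (1 / x\<^sup>2))) * exp (- (1 / x)) +
        poly (flat_poly j) (1 / x) * (exp (- (1 / x)) * (1 / x\<^sup>2)) = flat (Suc j) x"
      using 3 by (simp add: flat_def field_simps power2_eq_square)
    ultimately have "((\<lambda>x. poly (flat_poly j) (1 / x) * exp (- (1 / x))) has_real_derivative flat (Suc j) x) (at x)"
      by simp
    then show ?thesis
      by (rule DERIV_cong_ev[THEN iffD1, rotated 3])
        (use 3 in \<open>auto simp: flat_def eventually_nhds intro!: exI[of _ "{0<..}"]\<close>)
  next
    case 2
    have "((\<lambda>h. flat j h / h) \<longlongrightarrow> 0) (at_left 0)"
      by (rule tendsto_eventually) (auto simp: flat_def eventually_at_filter)
    moreover have "((\<lambda>h. flat j h / h) \<longlongrightarrow> 0) (at_right 0)"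
    proof -
      have "((\<lambda>t. poly ([:0, 1:] * flat_poly j) t * exp (- t)) \<longlongrightarrow> 0) at_top"
        by (rule poly_times_exp_tendsto_0)
      then have "((\<lambda>h. poly ([:0, 1:] * flat_poly j) (inverse h) * exp (- inverse h)) \<longlongrightarrow> 0) (at_right 0)"
        by (rule filterlim_compose[OF _ filterlim_inverse_at_top_right])
      then show ?thesis
        by (rule Lim_transform_eventually)
          (auto simp: flat_def eventually_at_filter field_simps)
    qed
    ultimately have "((\<lambda>h. flat j h / h) \<longlongrightarrow> 0) (at 0)"
      by (rule filterlim_split_at)
    then show ?thesis
      using 2 by (simp add: DERIV_def flat_def)
  qed
qed

lemma flat_0_mono: "x \<le> y \<Longrightarrow> flat 0 x \<le> flat 0 y"
  by (auto simp: flat_def divide_simps)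

lemma flat_0_nonneg: "0 \<le> flat 0 x"
  by (simp add: flat_def)

text \<open>With \<open>f = flat 0\<close> and \<open>c = f 1\<close>, the function \<open>f (c - f t)\<close> is constant for \<open>t \<le> 0\<close> and
  vanishes for \<open>t \<ge> 1\<close>.\<close>

lemma bump_exists:
  fixes a :: "real ^ 'n"
  assumes "0 < r"
  obtains b :: "real ^ 'n \<Rightarrow> real"
  where "smooth (\<lambda>x. complex_of_real (b x))" "\<And>x. 0 \<le> b x" "\<And>x. b x \<le> 1"
    "\<And>x. dist a x \<le> r \<Longrightarrow> b x = 1" "\<And>x. 2 * r \<le> dist a x \<Longrightarrow> b x = 0"
proof -
  define c where "c = flat 0 1"
  have c: "c > 0" by (simp add: c_def flat_def)
  then have fc: "flat 0 c > 0" by (simp add: flat_def)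
  \<comment> \<open>The function \<open>q\<close> is at most \<open>0\<close> on the inner ball and at least \<open>3\<close> off the outer one.\<close>
  define q where "q x = (norm (x - a))\<^sup>2 / r\<^sup>2 - 1" for x
  define b where "b x = flat 0 (c - flat 0 (q x)) / flat 0 c" for x
  have "smooth (\<lambda>x. complex_of_real (inverse (r\<^sup>2)) * complex_of_real ((norm (x - a))\<^sup>2) - 1)"
    by (intro smooth_diff smooth_cmult smooth_norm_square smooth_const)
  then have q: "smooth (\<lambda>x. complex_of_real (q x))"
    by (simp add: q_def divide_inverse mult.commute)
  have "smooth (\<lambda>x. complex_of_real c - complex_of_real (flat 0 (q x)))"
    by (rule smooth_diff[OF smooth_const smooth_compose[where F = flat, OF flat_has_derivative q]])
  then have "smooth (\<lambda>x. complex_of_real (c - flat 0 (q x)))" by simp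
  then have "smooth (\<lambda>x. complex_of_real (flat 0 (c - flat 0 (q x))))"
    by (rule smooth_compose[where F = flat, OF flat_has_derivative])
  from smooth_cmult[OF this, of "inverse (complex_of_real (flat 0 c))"]
  have 1: "smooth (\<lambda>x. complex_of_real (b x))"
    by (simp add: b_def divide_inverse mult.commute)
  show thesis
  proof
    show "smooth (\<lambda>x. complex_of_real (b x))" by (rule 1)
    show "0 \<le> b x" for x by (simp add: b_def flat_0_nonneg)
    show "b x \<le> 1" for x
      using fc flat_0_mono[of "c - flat 0 (q x)" c] flat_0_nonneg[of "q x"] by (simp add: b_def)
    show "b x = 1" if "dist a x \<le> r" for x
    proof -
      have "(norm (x - a))\<^sup>2 \<le> r\<^sup>2"
        using that by (intro power_mono) (auto simp: dist_norm norm_minus_commute)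
      then have "q x \<le> 0" using assms by (simp add: q_def)
      then have "flat 0 (q x) = 0" by (simp add: flat_def)
      then show ?thesis using fc by (simp add: b_def)
    qed
    show "b x = 0" if "2 * r \<le> dist a x" for x
    proof -
      have "(2 * r)\<^sup>2 \<le> (norm (x - a))\<^sup>2"
        using that assms by (intro power_mono) (auto simp: dist_norm norm_minus_commute)
      then have "2 * r\<^sup>2 \<le> (norm (x - a))\<^sup>2"
        using assms by (simp add: power2_eq_square) (smt (verit) mult_nonneg_nonneg)
      then have "1 \<le> q x" using assms by (simp add: q_def field_simps)
      then have "c \<le> flat 0 (q x)" unfolding c_def by (rule flat_0_mono)
      then show ?thesis by (simp add: b_def flat_def)
    qed
  qed
qed

lemma smooth_complement_prod:
  assumes "\<And>i. i \<in> I \<Longrightarrow> smooth (\<lambda>x. complex_of_real (b i x))"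
  shows "smooth (\<lambda>x. \<Prod>i\<in>I. 1 - complex_of_real (b i x))"
  by (intro smooth_prod smooth_diff smooth_const assms)

text \<open>Bumps that equal \<open>1\<close> on balls that cover \<open>K\<close> are combined to \<open>1 - \<Prod>(1 - b\<^sub>i)\<close>.\<close>

lemma cutoff_exists:
  fixes K :: "(real ^ 'n) set"
  assumes "compact K" "0 < \<delta>"
  obtains h :: "real ^ 'n \<Rightarrow> real" and W L
  where "smooth (\<lambda>x. complex_of_real (h x))" "\<And>x. 0 \<le> h x" "\<And>x. h x \<le> 1"
    "open W" "K \<subseteq> W" "\<And>x. x \<in> W \<Longrightarrow> h x = 1"
    "compact L" "\<And>x. x \<in> L \<Longrightarrow> \<exists>y\<in>K. dist y x \<le> \<delta>" "\<And>x. x \<notin> L \<Longrightarrow> h x = 0"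
proof -
  define r where "r = \<delta> / 2"
  have r: "r > 0" using assms by (simp add: r_def)
  have "\<exists>b :: real ^ 'n \<Rightarrow> real. smooth (\<lambda>x. complex_of_real (b x)) \<and> (\<forall>x. 0 \<le> b x \<and> b x \<le> 1) \<and>
      (\<forall>x. dist a x \<le> r \<longrightarrow> b x = 1) \<and> (\<forall>x. 2 * r \<le> dist a x \<longrightarrow> b x = 0)" for a
    using bump_exists[OF r, of a] by metis
  then obtain b :: "real ^ 'n \<Rightarrow> real ^ 'n \<Rightarrow> real"
    where b: "\<And>a. smooth (\<lambda>x. complex_of_real (b a x))" "\<And>a x. 0 \<le> b a x \<and> b a x \<le> 1"
      "\<And>a x. dist a x \<le> r \<Longrightarrow> b a x = 1" "\<And>a x. 2 * r \<le> dist a x \<Longrightarrow> b a x = 0"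
    by metis
  obtain I where I: "finite I" "I \<subseteq> K" "K \<subseteq> (\<Union>a\<in>I. ball a r)"
    using compactE_image[OF assms(1), of K "\<lambda>a. ball a r"] r by force
  define h where "h x = 1 - (\<Prod>a\<in>I. 1 - b a x)" for x
  have prod: "0 \<le> (\<Prod>a\<in>I. 1 - b a x)" "(\<Prod>a\<in>I. 1 - b a x) \<le> 1" for x
    using b(2) by (auto intro!: prod_nonneg prod_le_1)
  show thesis
  proof
    have "smooth (\<lambda>x. 1 - (\<Prod>a\<in>I. 1 - complex_of_real (b a x)))"
      by (intro smooth_diff smooth_const smooth_complement_prod b)
    then show "smooth (\<lambda>x. complex_of_real (h x))"
      by (simp add: h_def)
    show "0 \<le> h x" "h x \<le> 1" for x
      using prod[of x] by (auto simp: h_def)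
    show "open (\<Union>a\<in>I. ball a r)" by auto
    show "K \<subseteq> (\<Union>a\<in>I. ball a r)" by fact
    show "h x = 1" if "x \<in> (\<Union>a\<in>I. ball a r)" for x
    proof -
      from that obtain a where "a \<in> I" "dist a x < r" by auto
      then have "\<exists>a\<in>I. 1 - b a x = 0" using b(3)[of a x] by force
      then show ?thesis using I(1) by (simp add: h_def)
    qed
    show "compact (\<Union>a\<in>I. cball a (2 * r))"
      using I(1) by (intro compact_UN) auto
    show "\<exists>y\<in>K. dist y x \<le> \<delta>" if "x \<in> (\<Union>a\<in>I. cball a (2 * r))" for x
      using that I(2) by (auto simp: r_def)
    show "h x = 0" if "x \<notin> (\<Union>a\<in>I. cball a (2 * r))" for x
      using that b(4)[of _ x] by (auto simp: h_def intro!: prod.neutral)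
  qed
qed

lemma distributions_add:
  "u \<in> distributions \<Longrightarrow> \<phi> \<in> test_functions \<Longrightarrow> \<psi> \<in> test_functions \<Longrightarrow>
    u (\<lambda>x. \<phi> x + \<psi> x) = u \<phi> + u \<psi>"
  by (simp add: distributions_def linear_form_on_def)

lemma distributions_cmult:
  "u \<in> distributions \<Longrightarrow> \<phi> \<in> test_functions \<Longrightarrow> u (\<lambda>x. c * \<phi> x) = c * u \<phi>"
  by (simp add: distributions_def linear_form_on_def)

lemma test_functions_zero: "(\<lambda>x. 0) \<in> test_functions"
  by (rule test_functionsI(1)[where L = "{}"]) (auto intro: smooth_const)

lemma distributions_zero: "u \<in> distributions \<Longrightarrow> u (\<lambda>x. 0) = 0"
  using distributions_cmult[OF _ test_functions_zero, of u 0] by simp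

text \<open>Cover the support of \<open>\<phi>\<close> by balls on which bumps \<open>b\<^sub>i\<close> equal \<open>1\<close> and near which \<open>u\<close> vanishes.
  Replacing \<open>\<phi>\<close> by \<open>(1 - b\<^sub>i) \<phi>\<close> does not change the value of \<open>u\<close>, and after all bumps have been removed
  in this way the function \<open>\<phi> \<Prod>(1 - b\<^sub>i) = 0\<close> is left.\<close>

lemma distribution_vanishes_off_support:
  assumes u: "u \<in> distributions" and \<phi>: "\<phi> \<in> test_functions"
    and disj: "fun_support \<phi> \<inter> dist_support u = {}"
  shows "u \<phi> = 0"
proof -
  let ?S = "fun_support \<phi>"
  have "\<exists>r>0. \<forall>\<psi>\<in>test_functions. fun_support \<psi> \<subseteq> cball a (2 * r) \<longrightarrow> u \<psi> = 0" if a: "a \<in> ?S" for a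
  proof -
    from a disj obtain V where V: "open V" "a \<in> V"
      "\<forall>\<psi>\<in>test_functions. fun_support \<psi> \<subseteq> V \<longrightarrow> u \<psi> = 0"
      unfolding dist_support_def by blast
    then obtain e where e: "e > 0" "cball a e \<subseteq> V"
      using open_contains_cball by blast
    then show ?thesis using V(3) by (intro exI[of _ "e / 2"]) auto
  qed
  then obtain r where r: "\<And>a. a \<in> ?S \<Longrightarrow> r a > 0"
    "\<And>a \<psi>. a \<in> ?S \<Longrightarrow> \<psi> \<in> test_functions \<Longrightarrow> fun_support \<psi> \<subseteq> cball a (2 * r a) \<Longrightarrow> u \<psi> = 0"
    by metis
  have "\<exists>b :: real ^ 'a \<Rightarrow> real. smooth (\<lambda>x. complex_of_real (b x)) \<and>
      (\<forall>x. dist a x \<le> r a \<longrightarrow> b x = 1) \<and> (\<forall>x. 2 * r a \<le> dist a x \<longrightarrow> b x = 0)" if "a \<in> ?S" for a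
    using bump_exists[OF r(1)[OF that], of a] by metis
  then obtain b :: "real ^ 'a \<Rightarrow> real ^ 'a \<Rightarrow> real"
    where b: "\<And>a. a \<in> ?S \<Longrightarrow> smooth (\<lambda>x. complex_of_real (b a x))"
      "\<And>a x. a \<in> ?S \<Longrightarrow> dist a x \<le> r a \<Longrightarrow> b a x = 1"
      "\<And>a x. a \<in> ?S \<Longrightarrow> 2 * r a \<le> dist a x \<Longrightarrow> b a x = 0"
    by metis
  have cS: "compact ?S" by (rule test_functions_compact[OF \<phi>])
  obtain I where I: "finite I" "I \<subseteq> ?S" "?S \<subseteq> (\<Union>a\<in>I. ball a (r a))"
    using compactE_image[OF cS, of ?S "\<lambda>a. ball a (r a)"] r(1) by force
  have remove: "u (\<lambda>x. (\<Prod>a\<in>J. 1 - complex_of_real (b a x)) * \<phi> x) = u \<phi>" if "finite J" "J \<subseteq> ?S" for J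
    using that
  proof (induction J rule: finite_induct)
    case (insert c J)
    let ?\<psi> = "\<lambda>x. (\<Prod>a\<in>J. 1 - complex_of_real (b a x)) * \<phi> x"
    have \<psi>: "?\<psi> \<in> test_functions"
      by (rule test_functions_mult[OF smooth_complement_prod \<phi>]) (use b(1) insert in blast)
    have c: "c \<in> ?S" using insert by auto
    have b\<psi>: "(\<lambda>x. complex_of_real (b c x) * ?\<psi> x) \<in> test_functions"
      by (rule test_functions_mult[OF b(1)[OF c] \<psi>])
    have "u (\<lambda>x. complex_of_real (b c x) * ?\<psi> x) = 0"
    proof (rule r(2)[OF c b\<psi>])
      show "fun_support (\<lambda>x. complex_of_real (b c x) * ?\<psi> x) \<subseteq> cball c (2 * r c)"
        by (rule fun_support_minimal) (use b(3)[OF c] in auto)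
    qed
    moreover have "u (\<lambda>x. (- 1) * (complex_of_real (b c x) * ?\<psi> x)) =
        - 1 * u (\<lambda>x. complex_of_real (b c x) * ?\<psi> x)"
      by (rule distributions_cmult[OF u b\<psi>])
    moreover have "u (\<lambda>x. ?\<psi> x + (- 1) * (complex_of_real (b c x) * ?\<psi> x)) =
        u ?\<psi> + u (\<lambda>x. (- 1) * (complex_of_real (b c x) * ?\<psi> x))"
      by (rule distributions_add[OF u \<psi> test_functions_cmult[OF b\<psi>]])
    ultimately have "u (\<lambda>x. ?\<psi> x + (- 1) * (complex_of_real (b c x) * ?\<psi> x)) = u ?\<psi>"
      by (simp only: mult_zero_right add_0_right)
    moreover have "(\<lambda>x. ?\<psi> x + (- 1) * (complex_of_real (b c x) * ?\<psi> x)) =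
        (\<lambda>x. (\<Prod>a\<in>insert c J. 1 - complex_of_real (b a x)) * \<phi> x)"
      using insert.hyps by (simp add: algebra_simps)
    ultimately show ?case using insert.IH insert.prems by simp
  qed simp
  have "(\<Prod>a\<in>I. 1 - complex_of_real (b a x)) * \<phi> x = 0" for x
  proof (cases "x \<in> ?S")
    case True
    then obtain a where a: "a \<in> I" "dist a x < r a" using I(3) by auto
    then have "b a x = 1" using b(2)[of a x] I(2) by auto
    then show ?thesis using a I(1) by (auto intro!: prod_zero)
  next
    case False
    then have "\<phi> x = 0" by (rule fun_support_zero)
    then show ?thesis by simp
  qed
  then have "(\<lambda>x. (\<Prod>a\<in>I. 1 - complex_of_real (b a x)) * \<phi> x) = (\<lambda>x. 0)" by blast
  with remove[OF I(1,2)] distributions_zero[OF u] show ?thesis by metis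
qed


section \<open>Integrals of products of functions of one coordinate\<close>

text \<open>Lebesgue measure on \<open>real ^ 'n\<close> is the image of a product measure that is indexed by the
  standard basis; re-indexing by coordinates gives Fubini's theorem for products.\<close>

lemma
  fixes f :: "'n::finite \<Rightarrow> real \<Rightarrow> complex"
  assumes f: "\<And>i. integrable lborel (f i)"
  shows integrable_prod_components:
      "integrable lebesgue (\<lambda>x :: real ^ 'n. \<Prod>i\<in>UNIV. f i (x $ i))" (is ?A)
    and integral_prod_components:
      "(LINT x|lebesgue. (\<Prod>i\<in>UNIV. f i ((x :: real ^ 'n) $ i))) = (\<Prod>i\<in>UNIV. (LINT t|lborel. f i t))" (is ?B)
proof -
  interpret product_sigma_finite "\<lambda>b :: real ^ 'n. lborel :: real measure"
    unfolding product_sigma_finite_def using lborel.sigma_finite_measure_axioms by blast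
  define T where "T w = (\<Sum>b\<in>Basis. w b *\<^sub>R b)" for w :: "real ^ 'n \<Rightarrow> real"
  have bij: "bij_betw (\<lambda>i. axis i 1) UNIV (Basis :: (real ^ 'n) set)"
    by (auto simp: bij_betw_def inj_on_def Basis_vec_def axis_eq_axis)
  define ix where "ix = inv_into UNIV (\<lambda>i. axis i (1 :: real) :: real ^ 'n)"
  have ix: "ix (axis i 1) = i" for i
    unfolding ix_def by (rule inv_into_f_f) (auto simp: inj_on_def axis_eq_axis)
  have T: "T w $ i = w (axis i 1)" for w i
  proof -
    have "T w \<bullet> axis i 1 = w (axis i 1)"
      unfolding T_def by (rule inner_sum_left_Basis) (auto simp: Basis_vec_def)
    then show ?thesis by (simp add: inner_axis)
  qed
  have eq: "(\<Prod>i\<in>UNIV. f i (T w $ i)) = (\<Prod>b\<in>Basis. f (ix b) (w b))" for w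
    using prod.reindex_bij_betw[OF bij, of "\<lambda>b. f (ix b) (w b)"] by (simp add: T ix)
  have eq': "(\<Prod>i\<in>UNIV. (LINT t|lborel. f i t)) = (\<Prod>b\<in>Basis. (LINT t|lborel. f (ix b) t))"
    using prod.reindex_bij_betw[OF bij, of "\<lambda>b. LINT t|lborel. f (ix b) t"] by (simp add: ix)
  have [measurable]: "f i \<in> borel_measurable borel" for i
    using f[of i] by auto
  have [measurable]: "(\<lambda>x :: real ^ 'n. \<Prod>i\<in>UNIV. f i (x $ i)) \<in> borel_measurable borel"
    by measurable
  have [measurable]: "T \<in> Pi\<^sub>M Basis (\<lambda>b. lborel) \<rightarrow>\<^sub>M borel"
    unfolding T_def by measurable
  have lb: "lborel = distr (Pi\<^sub>M Basis (\<lambda>b. lborel)) borel T"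
    unfolding T_def by (rule lborel_eq)
  have "integrable (Pi\<^sub>M Basis (\<lambda>b. lborel)) (\<lambda>w. \<Prod>b\<in>Basis. f (ix b) (w b))"
    by (rule product_integrable_prod) (use f in auto)
  then have "integrable lborel (\<lambda>x :: real ^ 'n. \<Prod>i\<in>UNIV. f i (x $ i))"
    by (subst lb) (simp add: integrable_distr_eq eq)
  then show ?A by (simp add: integrable_completion)
  have "(LINT x|lebesgue. (\<Prod>i\<in>UNIV. f i ((x :: real ^ 'n) $ i))) =
      (LINT x|lborel. (\<Prod>i\<in>UNIV. f i ((x :: real ^ 'n) $ i)))"
    by (simp add: integral_completion)
  also have "\<dots> = (LINT w|Pi\<^sub>M Basis (\<lambda>b. lborel). (\<Prod>b\<in>Basis. f (ix b) (w b)))"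
    by (subst lb) (simp add: integral_distr eq)
  also have "\<dots> = (\<Prod>b\<in>Basis. (LINT t|lborel. f (ix b) t))"
    by (rule product_integral_prod) (use f in auto)
  finally show ?B by (simp add: eq')
qed


section \<open>The weights \<open>japanese\<close>\<close>

lemma japanese_square: "(japanese x)\<^sup>2 = 1 + (norm x)\<^sup>2"
  by (simp add: japanese_def)

lemma japanese_ge_1: "1 \<le> japanese x"
  by (simp add: japanese_def)

lemma japanese_pos: "0 < japanese x"
  using japanese_ge_1[of x] by linarith

lemma norm_le_japanese: "norm x \<le> japanese x"
  unfolding japanese_def by (rule real_le_rsqrt) simp

lemma component_le_japanese: "\<bar>x $ i\<bar> \<le> japanese x"
  using component_le_norm_cart[of x i] norm_le_japanese[of x] by linarith

lemma japanese_minus: "japanese (- x) = japanese x"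
  by (simp add: japanese_def)

lemma japanese_minus_commute: "japanese (x - y) = japanese (y - x)"
  by (simp add: japanese_def norm_minus_commute)

lemma japanese_add_le: "japanese (x + y) \<le> 2 * japanese x * japanese y"
proof (rule power2_le_imp_le)
  have "(norm (x + y))\<^sup>2 \<le> (norm x + norm y)\<^sup>2"
    by (intro power_mono norm_triangle_ineq) auto
  also have "\<dots> \<le> 2 * (norm x)\<^sup>2 + 2 * (norm y)\<^sup>2"
    using zero_le_power2[of "norm x - norm y"] by (simp add: power2_eq_square algebra_simps)
  finally have "1 + (norm (x + y))\<^sup>2 \<le> 4 * ((1 + (norm x)\<^sup>2) * (1 + (norm y)\<^sup>2))"
    by (simp add: algebra_simps) (smt (verit) mult_nonneg_nonneg zero_le_power2)
  then show "(japanese (x + y))\<^sup>2 \<le> (2 * japanese x * japanese y)\<^sup>2"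
    by (simp add: power_mult_distrib japanese_square mult.assoc)
  show "0 \<le> 2 * japanese x * japanese y"
    using japanese_pos[of x] japanese_pos[of y] by simp
qed

lemma japanese_power_add_le: "japanese (x + y) ^ m \<le> 2 ^ m * japanese x ^ m * japanese y ^ m"
  using power_mono[OF japanese_add_le[of x y], of m] japanese_pos[of "x + y"]
  by (simp add: power_mult_distrib)

lemma continuous_on_japanese: "continuous_on A japanese"
  unfolding japanese_def by (intro continuous_intros)

lemma borel_measurable_japanese [measurable]: "japanese \<in> borel_measurable borel"
  by (intro borel_measurable_continuous_onI continuous_on_japanese)

lemma measurable_lebesgue_of_borel: "f \<in> borel_measurable borel \<Longrightarrow> f \<in> borel_measurable lebesgue"
  by (simp add: measurable_completion)

text \<open>An exponent for which the weight is integrable, by comparison with a product.\<close>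

lemma integrable_japanese:
  "integrable lebesgue (\<lambda>x :: real ^ 'n. inverse (japanese x ^ (2 * CARD('n))))"
proof -
  have "einterval (-\<infinity>) \<infinity> = UNIV" by (auto simp: einterval_def)
  then have "integrable lborel (\<lambda>t :: real. inverse (1 + t\<^sup>2))"
    using integrable_inverse_1_plus_square by (simp add: set_integrable_def)
  then have "integrable lborel (\<lambda>t :: real. complex_of_real (inverse (1 + t\<^sup>2)))"
    by (rule integrable_of_real)
  then have *: "integrable lebesgue (\<lambda>x :: real ^ 'n. \<Prod>i\<in>UNIV. complex_of_real (inverse (1 + (x $ i)\<^sup>2)))"
    by (rule integrable_prod_components)
  show ?thesis
  proof (rule Bochner_Integration.integrable_bound[OF *])
    show "(\<lambda>x :: real ^ 'n. inverse (japanese x ^ (2 * CARD('n)))) \<in> borel_measurable lebesgue"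
      by (rule measurable_lebesgue_of_borel) measurable
    have "inverse (japanese x ^ (2 * CARD('n))) \<le> (\<Prod>i\<in>UNIV. inverse (1 + (x $ i)\<^sup>2))" for x :: "real ^ 'n"
    proof -
      have "(\<Prod>i\<in>UNIV. 1 + (x $ i)\<^sup>2) \<le> (\<Prod>i::'n\<in>UNIV. (japanese x)\<^sup>2)"
        by (intro prod_mono) (auto simp: japanese_square component_le_norm_cart abs_le_square_iff[symmetric])
      also have "\<dots> = japanese x ^ (2 * CARD('n))"
        by (simp add: power_mult)
      finally have "inverse (japanese x ^ (2 * CARD('n))) \<le> inverse (\<Prod>i\<in>UNIV. 1 + (x $ i)\<^sup>2)"
        by (intro le_imp_inverse_le prod_pos) (auto intro: add_pos_nonneg)
      also have "inverse (\<Prod>i\<in>UNIV. 1 + (x $ i)\<^sup>2) = (\<Prod>i\<in>UNIV. inverse (1 + (x $ i)\<^sup>2))"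
        using prod_inversef[of "\<lambda>i. 1 + (x $ i)\<^sup>2" UNIV] by (simp add: comp_def)
      finally show ?thesis .
    qed
    moreover have "norm (\<Prod>i\<in>UNIV. complex_of_real (inverse (1 + (x $ i)\<^sup>2))) =
        (\<Prod>i\<in>UNIV. inverse (1 + (x $ i)\<^sup>2))" for x :: "real ^ 'n"
      unfolding prod_norm[symmetric] by (intro prod.cong) (auto simp: norm_inverse simp flip: of_real_add of_real_power of_real_inverse)
    ultimately show "AE x in lebesgue. norm (inverse (japanese (x :: real ^ 'n) ^ (2 * CARD('n)))) \<le>
        norm (\<Prod>i\<in>UNIV. complex_of_real (inverse (1 + (x $ i)\<^sup>2)))"
      using japanese_pos by (intro AE_I2) (simp add: less_imp_le)
  qed
qed


section \<open>Quantitative Schwartz bounds\<close>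

text \<open>One index controls the number of derivatives and the order of decay. Stating the bound as a
  predicate, in place of a supremum, lets estimates be composed without proofs of boundedness.\<close>

definition schwartz_bound :: "nat \<Rightarrow> real \<Rightarrow> (real ^ 'n \<Rightarrow> complex) \<Rightarrow> bool" where
  "schwartz_bound M B f \<longleftrightarrow>
    (\<forall>\<alpha> x. length \<alpha> \<le> M \<longrightarrow> japanese x ^ M * norm (partials \<alpha> f x) \<le> B)"

lemma schwartz_bound_mono:
  assumes f: "schwartz_bound M B f" and "m \<le> M" "B \<le> B'"
  shows "schwartz_bound m B' f"
  unfolding schwartz_bound_def
proof (intro allI impI)
  fix \<alpha> :: "'a list" and x assume "length \<alpha> \<le> m"
  then have "japanese x ^ M * norm (partials \<alpha> f x) \<le> B"
    using f assms by (auto simp: schwartz_bound_def)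
  moreover have "japanese x ^ m * norm (partials \<alpha> f x) \<le> japanese x ^ M * norm (partials \<alpha> f x)"
    by (intro mult_right_mono power_increasing assms japanese_ge_1) auto
  ultimately show "japanese x ^ m * norm (partials \<alpha> f x) \<le> B'"
    using assms by linarith
qed

lemma schwartz_bound_nonneg:
  assumes "schwartz_bound M B f" shows "0 \<le> B"
proof -
  have "japanese (0 :: real ^ 'a) ^ M * norm (partials [] f 0) \<le> B"
    using assms unfolding schwartz_bound_def by (metis le0 list.size(3))
  moreover have "0 \<le> japanese (0 :: real ^ 'a) ^ M * norm (partials [] f 0)"
    using japanese_pos[of "0 :: real ^ 'a"] by simp
  ultimately show ?thesis by linarith
qed

lemma schwartz_boundD:
  assumes "schwartz_bound M B f" "length \<alpha> \<le> M" "m \<le> M"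
  shows "norm (partials \<alpha> f x) \<le> B / japanese x ^ m"
proof -
  have "japanese x ^ M * norm (partials \<alpha> f x) \<le> B"
    using assms by (auto simp: schwartz_bound_def)
  moreover have "japanese x ^ m * norm (partials \<alpha> f x) \<le> japanese x ^ M * norm (partials \<alpha> f x)"
    by (intro mult_right_mono power_increasing assms japanese_ge_1) auto
  ultimately show ?thesis
    using japanese_pos[of x] by (simp add: pos_le_divide_eq mult.commute)
qed

lemma schwartz_boundD0:
  assumes "schwartz_bound M B f" "m \<le> M"
  shows "norm (f x) \<le> B / japanese x ^ m"
  using schwartz_boundD[OF assms(1) _ assms(2), of "[]" x] by simp

lemma schwartz_iff: "f \<in> schwartz_functions \<longleftrightarrow> smooth f \<and> (\<forall>M. \<exists>B. schwartz_bound M B f)"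
proof
  assume f: "f \<in> schwartz_functions"
  have "\<exists>B. schwartz_bound M B f" for M
  proof -
    from f have "\<forall>\<alpha>. \<exists>B. \<forall>x. japanese x ^ M * norm (partials \<alpha> f x) \<le> B"
      by (auto simp: schwartz_functions_def)
    then obtain B where B: "\<And>\<alpha> x. japanese x ^ M * norm (partials \<alpha> f x) \<le> B \<alpha>"
      by metis
    have fin: "finite {\<alpha> :: 'a list. length \<alpha> \<le> M}"
      using finite_lists_length_le[of "UNIV :: 'a set" M] by simp
    have B0: "0 \<le> B \<alpha>" for \<alpha>
      using B[of 0 \<alpha>] japanese_pos[of 0] by (meson less_imp_le mult_nonneg_nonneg norm_ge_zero order_trans zero_le_power)
    have "schwartz_bound M (\<Sum>\<alpha> | length \<alpha> \<le> M. B \<alpha>) f"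
      unfolding schwartz_bound_def
    proof (intro allI impI)
      fix \<alpha> :: "'a list" and x assume "length \<alpha> \<le> M"
      then have "B \<alpha> \<le> (\<Sum>\<alpha> | length \<alpha> \<le> M. B \<alpha>)"
        using fin B0 by (intro member_le_sum) auto
      then show "japanese x ^ M * norm (partials \<alpha> f x) \<le> (\<Sum>\<alpha> | length \<alpha> \<le> M. B \<alpha>)"
        using B[of x \<alpha>] by linarith
    qed
    then show ?thesis ..
  qed
  then show "smooth f \<and> (\<forall>M. \<exists>B. schwartz_bound M B f)"
    using f by (auto simp: schwartz_functions_def)
next
  assume f: "smooth f \<and> (\<forall>M. \<exists>B. schwartz_bound M B f)"
  have "\<exists>B. \<forall>x. japanese x ^ m * norm (partials \<alpha> f x) \<le> B" for \<alpha> m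
  proof -
    obtain B where "schwartz_bound (max m (length \<alpha>)) B f" using f by blast
    then have *: "norm (partials \<alpha> f x) \<le> B / japanese x ^ m" for x
      by (rule schwartz_boundD) auto
    have "japanese x ^ m * norm (partials \<alpha> f x) \<le> B" for x
      using *[of x] japanese_pos[of x]
      by (simp add: pos_le_divide_eq mult.commute)
    then show ?thesis by blast
  qed
  then show "f \<in> schwartz_functions" using f by (auto simp: schwartz_functions_def)
qed

lemma schwartz_smooth: "f \<in> schwartz_functions \<Longrightarrow> smooth f"
  by (simp add: schwartz_iff)

lemma schwartz_bound_exists:
  assumes "f \<in> schwartz_functions" obtains B where "schwartz_bound M B f"
  using assms by (auto simp: schwartz_iff)

text \<open>The seminorm is a sum over finitely many multi-indices, each term being at most \<open>B\<close>; this and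
  \<open>schwartz_bound_le_seminorm\<close> translate between continuity and \<open>schwartz_bound\<close>.\<close>

lemma tempered_bound:
  fixes U :: "(real ^ 'n \<Rightarrow> complex) \<Rightarrow> complex"
  assumes "U \<in> tempered_distributions"
  obtains C M where "0 \<le> C"
    "\<And>f B. f \<in> schwartz_functions \<Longrightarrow> schwartz_bound M B f \<Longrightarrow> norm (U f) \<le> C * B"
proof -
  obtain C M where C: "\<And>f. f \<in> schwartz_functions \<Longrightarrow> norm (U f) \<le> C * schwartz_seminorm M f"
    using assms by (auto simp: tempered_distributions_def)
  define N where "N = card {\<alpha> :: 'n list. length \<alpha> \<le> M}"
  show thesis
  proof
    show "0 \<le> \<bar>C\<bar> * real N" by simp
    fix f :: "real ^ 'n \<Rightarrow> complex" and B
    assume f: "f \<in> schwartz_functions" and B: "schwartz_bound M B f"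
    have "(SUP x. japanese x ^ M * norm (partials \<alpha> f x)) \<le> B" if "length \<alpha> \<le> M" for \<alpha>
      using B that by (intro cSUP_least) (auto simp: schwartz_bound_def)
    then have "schwartz_seminorm M f \<le> (\<Sum>\<alpha> :: 'n list | length \<alpha> \<le> M. B)"
      unfolding schwartz_seminorm_def by (intro sum_mono) auto
    then have 1: "schwartz_seminorm M f \<le> real N * B" by (simp add: N_def)
    have 0: "0 \<le> schwartz_seminorm M f"
      unfolding schwartz_seminorm_def
    proof (intro sum_nonneg)
      fix \<alpha> :: "'n list" assume "\<alpha> \<in> {\<alpha>. length \<alpha> \<le> M}"
      then have "bdd_above (range (\<lambda>x. japanese x ^ M * norm (partials \<alpha> f x)))"
        using B by (auto simp: schwartz_bound_def bdd_above_def)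
      then have "japanese (0 :: real ^ 'n) ^ M * norm (partials \<alpha> f 0) \<le> (SUP x. japanese x ^ M * norm (partials \<alpha> f x))"
        by (rule cSUP_upper[OF UNIV_I])
      then show "0 \<le> (SUP x. japanese x ^ M * norm (partials \<alpha> f x))"
        using japanese_pos[of "0 :: real ^ 'n"]
        by (meson less_imp_le mult_nonneg_nonneg norm_ge_zero order_trans zero_le_power)
    qed
    have "norm (U f) \<le> \<bar>C\<bar> * schwartz_seminorm M f"
      using C[OF f] 0 by (meson abs_ge_self mult_right_mono order_trans)
    also have "\<dots> \<le> \<bar>C\<bar> * (real N * B)"
      by (intro mult_left_mono 1) auto
    finally show "norm (U f) \<le> \<bar>C\<bar> * real N * B" by (simp add: mult.assoc)
  qed
qed

lemma schwartz_bound_le_seminorm: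
  fixes f :: "real ^ 'n \<Rightarrow> complex"
  assumes "f \<in> schwartz_functions"
  shows "schwartz_bound M (schwartz_seminorm M f) f"
  unfolding schwartz_bound_def
proof (intro allI impI)
  fix \<alpha> :: "'n list" and x assume \<alpha>: "length \<alpha> \<le> M"
  obtain B where B: "schwartz_bound M B f" using assms by (rule schwartz_bound_exists)
  have up: "japanese x ^ M * norm (partials \<beta> f x) \<le> (SUP x. japanese x ^ M * norm (partials \<beta> f x))"
    if "length \<beta> \<le> M" for \<beta> x
    by (intro cSUP_upper) (use B that in \<open>auto simp: schwartz_bound_def bdd_above_def\<close>)
  have nn: "0 \<le> (SUP x. japanese x ^ M * norm (partials \<beta> f x))" if "length \<beta> \<le> M" for \<beta>
    using up[OF that, of 0] japanese_pos[of "0 :: real ^ 'n"]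
    by (meson less_imp_le mult_nonneg_nonneg norm_ge_zero order_trans zero_le_power)
  have "finite {\<alpha> :: 'n list. length \<alpha> \<le> M}"
    using finite_lists_length_le[of "UNIV :: 'n set" M] by simp
  then have "(SUP x. japanese x ^ M * norm (partials \<alpha> f x)) \<le> schwartz_seminorm M f"
    unfolding schwartz_seminorm_def
    using member_le_sum[of \<alpha> "{\<alpha>. length \<alpha> \<le> M}" "\<lambda>\<alpha>. SUP x. japanese x ^ M * norm (partials \<alpha> f x)"]
      nn \<alpha> by simp
  then show "japanese x ^ M * norm (partials \<alpha> f x) \<le> schwartz_seminorm M f"
    using up[OF \<alpha>, of x] by linarith
qed

lemma schwartz_bound_add:
  assumes "smooth f" "smooth g" "schwartz_bound M A f" "schwartz_bound M B g"
  shows "schwartz_bound M (A + B) (\<lambda>x. f x + g x)"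
  unfolding schwartz_bound_def partials_add[OF assms(1,2)]
proof (intro allI impI)
  fix \<alpha> :: "'a list" and x assume \<alpha>: "length \<alpha> \<le> M"
  have "japanese x ^ M * norm (partials \<alpha> f x + partials \<alpha> g x) \<le>
      japanese x ^ M * (norm (partials \<alpha> f x) + norm (partials \<alpha> g x))"
    using japanese_pos[of x] by (intro mult_left_mono norm_triangle_ineq) (simp add: less_imp_le)
  moreover have "japanese x ^ M * norm (partials \<alpha> f x) \<le> A" "japanese x ^ M * norm (partials \<alpha> g x) \<le> B"
    using assms \<alpha> by (auto simp: schwartz_bound_def)
  ultimately show "japanese x ^ M * norm (partials \<alpha> f x + partials \<alpha> g x) \<le> A + B"
    by (simp add: distrib_left)
qed

lemma schwartz_bound_cmult:
  assumes "smooth f" "schwartz_bound M B f"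
  shows "schwartz_bound M (norm c * B) (\<lambda>x. c * f x)"
  unfolding schwartz_bound_def partials_cmult[OF assms(1)]
proof (intro allI impI)
  fix \<alpha> :: "'a list" and x assume "length \<alpha> \<le> M"
  then have "norm c * (japanese x ^ M * norm (partials \<alpha> f x)) \<le> norm c * B"
    using assms by (intro mult_left_mono) (auto simp: schwartz_bound_def)
  then show "japanese x ^ M * norm (c * partials \<alpha> f x) \<le> norm c * B"
    by (simp add: norm_mult mult_ac)
qed

lemma schwartz_bound_sum:
  assumes "finite I" "\<And>i. i \<in> I \<Longrightarrow> smooth (f i)" "\<And>i. i \<in> I \<Longrightarrow> schwartz_bound M B (f i)"
  shows "schwartz_bound M (real (card I) * B) (\<lambda>x. \<Sum>i\<in>I. f i x)"
  using assms
proof (induction I rule: finite_induct)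
  case empty
  then show ?case by (simp add: schwartz_bound_def partials_const)
next
  case (insert i I)
  have "schwartz_bound M (B + real (card I) * B) (\<lambda>x. f i x + (\<Sum>i\<in>I. f i x))"
    by (rule schwartz_bound_add) (use insert in \<open>auto intro!: smooth_sum\<close>)
  then show ?case using insert by (simp add: algebra_simps)
qed

lemma schwartz_bound_partial:
  assumes "schwartz_bound (Suc M) B f"
  shows "schwartz_bound M B (partial i f)"
  unfolding schwartz_bound_def
proof (intro allI impI)
  fix \<alpha> :: "'a list" and x assume "length \<alpha> \<le> M"
  then have "norm (partials (\<alpha> @ [i]) f x) \<le> B / japanese x ^ M"
    using assms by (intro schwartz_boundD) auto
  then show "japanese x ^ M * norm (partials \<alpha> (partial i f) x) \<le> B"
    using japanese_pos[of x] by (simp add: partials_snoc pos_le_divide_eq mult.commute)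
qed

lemma schwartz_bound_component:
  assumes "smooth f" "schwartz_bound (Suc M) B f"
  shows "schwartz_bound M (2 ^ M * B) (\<lambda>x. complex_of_real (x $ i) * f x)"
  unfolding schwartz_bound_def
proof (intro allI impI)
  fix \<alpha> :: "'a list" and x assume \<alpha>: "length \<alpha> \<le> M"
  note B0 = schwartz_bound_nonneg[OF assms(2)]
  have A: "norm (partials \<beta> (\<lambda>x. complex_of_real (x $ i)) x) \<le> japanese x" for \<beta>
  proof (cases \<beta> rule: rev_cases)
    case Nil
    then show ?thesis by (simp add: component_le_japanese)
  next
    case (snoc \<beta>' j)
    have "partials \<beta> (\<lambda>x. complex_of_real (x $ i)) x = (if \<beta>' = [] then if j = i then 1 else 0 else 0)"
      by (simp add: snoc partials_snoc partial_inner_fun partials_const)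
    then show ?thesis using japanese_ge_1[of x] by auto
  qed
  have "norm (partials \<alpha> (\<lambda>x. complex_of_real (x $ i) * f x) x) \<le>
      2 ^ length \<alpha> * (japanese x * (B / japanese x ^ Suc M))"
    by (rule partials_mult_bound[OF smooth_component assms(1) A])
      (rule schwartz_boundD[OF assms(2)], use \<alpha> in auto)
  also have "\<dots> \<le> 2 ^ M * (japanese x * (B / japanese x ^ Suc M))"
    using B0 japanese_pos[of x] \<alpha> by (intro mult_right_mono power_increasing) (auto simp: less_imp_le)
  also have "\<dots> = 2 ^ M * B / japanese x ^ M"
    using japanese_pos[of x] by simp
  finally show "japanese x ^ M * norm (partials \<alpha> (\<lambda>x. complex_of_real (x $ i) * f x) x) \<le> 2 ^ M * B"
    using japanese_pos[of x] by (simp add: pos_le_divide_eq mult.commute)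
qed

lemma schwartz_bound_mult:
  assumes "smooth h" "\<And>\<beta> x. length \<beta> \<le> M \<Longrightarrow> norm (partials \<beta> h x) \<le> A"
    and "smooth f" "schwartz_bound M B f"
  shows "schwartz_bound M (2 ^ M * A * B) (\<lambda>x. h x * f x)"
  unfolding schwartz_bound_def
proof (intro allI impI)
  fix \<alpha> :: "'a list" and x assume \<alpha>: "length \<alpha> \<le> M"
  note B0 = schwartz_bound_nonneg[OF assms(4)]
  have A0: "0 \<le> A" using assms(2)[of "[]" x] norm_ge_zero[of "h x"] by (simp del: norm_ge_zero)
  have "norm (partials \<alpha> (\<lambda>x. h x * f x) x) \<le> 2 ^ length \<alpha> * (A * (B / japanese x ^ M))"
    using \<alpha> by (intro partials_mult_bound assms schwartz_boundD[OF assms(4)]) auto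
  also have "\<dots> \<le> 2 ^ M * (A * (B / japanese x ^ M))"
    using B0 A0 japanese_pos[of x] \<alpha> by (intro mult_right_mono power_increasing) (auto simp: less_imp_le)
  finally show "japanese x ^ M * norm (partials \<alpha> (\<lambda>x. h x * f x) x) \<le> 2 ^ M * A * B"
    using japanese_pos[of x] by (simp add: pos_le_divide_eq field_simps)
qed

lemma schwartzI: "smooth f \<Longrightarrow> (\<And>M. \<exists>B. schwartz_bound M B f) \<Longrightarrow> f \<in> schwartz_functions"
  by (simp add: schwartz_iff)

lemma schwartz_add:
  assumes f: "f \<in> schwartz_functions" and g: "g \<in> schwartz_functions"
  shows "(\<lambda>x. f x + g x) \<in> schwartz_functions"
proof (rule schwartzI[OF smooth_add[OF f[THEN schwartz_smooth] g[THEN schwartz_smooth]]])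
  fix M
  obtain A where A: "schwartz_bound M A f" by (rule schwartz_bound_exists[OF f])
  obtain B where B: "schwartz_bound M B g" by (rule schwartz_bound_exists[OF g])
  show "\<exists>B. schwartz_bound M B (\<lambda>x. f x + g x)"
    by (rule exI, rule schwartz_bound_add[OF f[THEN schwartz_smooth] g[THEN schwartz_smooth] A B])
qed

lemma schwartz_cmult:
  assumes f: "f \<in> schwartz_functions" shows "(\<lambda>x. c * f x) \<in> schwartz_functions"
proof (rule schwartzI[OF smooth_cmult[OF f[THEN schwartz_smooth]]])
  fix M
  obtain A where A: "schwartz_bound M A f" by (rule schwartz_bound_exists[OF f])
  show "\<exists>B. schwartz_bound M B (\<lambda>x. c * f x)"
    by (rule exI, rule schwartz_bound_cmult[OF f[THEN schwartz_smooth] A])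
qed

lemma schwartz_partial:
  assumes f: "f \<in> schwartz_functions" shows "partial i f \<in> schwartz_functions"
proof (rule schwartzI[OF smooth_partial[OF f[THEN schwartz_smooth]]])
  fix M
  obtain A where A: "schwartz_bound (Suc M) A f" by (rule schwartz_bound_exists[OF f])
  show "\<exists>B. schwartz_bound M B (partial i f)"
    by (rule exI, rule schwartz_bound_partial[OF A])
qed

lemma schwartz_component:
  assumes f: "f \<in> schwartz_functions"
  shows "(\<lambda>x. complex_of_real (x $ i) * f x) \<in> schwartz_functions"
proof (rule schwartzI[OF smooth_mult[OF smooth_component f[THEN schwartz_smooth]]])
  fix M
  obtain A where A: "schwartz_bound (Suc M) A f" by (rule schwartz_bound_exists[OF f])
  show "\<exists>B. schwartz_bound M B (\<lambda>x. complex_of_real (x $ i) * f x)"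
    by (rule exI, rule schwartz_bound_component[OF f[THEN schwartz_smooth] A])
qed

lemma schwartz_zero: "(\<lambda>x. 0) \<in> schwartz_functions"
  by (rule schwartzI[OF smooth_const]) (auto simp: schwartz_bound_def partials_const)

lemma schwartz_sum:
  "(\<And>i. i \<in> I \<Longrightarrow> f i \<in> schwartz_functions) \<Longrightarrow> (\<lambda>x. \<Sum>i\<in>I. f i x) \<in> schwartz_functions"
proof (induction I rule: infinite_finite_induct)
  case (insert i I)
  have "(\<lambda>x. f i x + (\<Sum>i\<in>I. f i x)) \<in> schwartz_functions"
    by (rule schwartz_add) (use insert in auto)
  then show ?case using insert.hyps by simp
qed (simp_all add: schwartz_zero)

lemma test_functions_schwartz:
  assumes "\<phi> \<in> test_functions" shows "\<phi> \<in> schwartz_functions"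
proof -
  let ?L = "fun_support \<phi>"
  have "\<exists>B. \<forall>x. japanese x ^ m * norm (partials \<alpha> \<phi> x) \<le> B" for \<alpha> m
  proof -
    have "continuous_on ?L (partials \<alpha> \<phi>)"
      by (rule smooth_continuous_on[OF smooth_partials[OF test_functions_smooth[OF assms]]])
    then have "continuous_on ?L (\<lambda>x. japanese x ^ m * norm (partials \<alpha> \<phi> x))"
      by (intro continuous_on_mult continuous_on_power continuous_on_norm continuous_on_japanese)
    then have "compact ((\<lambda>x. japanese x ^ m * norm (partials \<alpha> \<phi> x)) ` ?L)"
      by (rule compact_continuous_image[OF _ test_functions_compact[OF assms]])
    then obtain B where B: "\<And>x. x \<in> ?L \<Longrightarrow> norm (japanese x ^ m * norm (partials \<alpha> \<phi> x)) \<le> B"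
      using compact_imp_bounded bounded_iff by (metis (mono_tags, lifting) imageI)
    have "japanese x ^ m * norm (partials \<alpha> \<phi> x) \<le> max B 0" for x
    proof (cases "x \<in> ?L")
      case True
      have "japanese x ^ m * norm (partials \<alpha> \<phi> x) \<le> norm (japanese x ^ m * norm (partials \<alpha> \<phi> x))"
        by simp
      then show ?thesis using B[OF True] by linarith
    next
      case False
      then have "x \<notin> fun_support (partials \<alpha> \<phi>)" using fun_support_partials by blast
      then have "partials \<alpha> \<phi> x = 0" by (rule fun_support_zero)
      then show ?thesis by simp
    qed
    then show ?thesis by blast
  qed
  then show ?thesis
    using assms by (auto simp: schwartz_functions_def test_functions_smooth)
qed


section \<open>Change of variables and Fubini's theorem\<close>

text \<open>The affine transformation rule for \<open>lborel\<close>, transferred to its completion. Borel measurability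
  of \<open>f\<close> makes both sides computable on \<open>lborel\<close>.\<close>

lemma
  fixes f :: "real ^ 'n \<Rightarrow> 'b :: {banach, second_countable_topology}"
  assumes f [measurable]: "f \<in> borel_measurable borel" and c: "c \<noteq> 0"
  shows integral_affine: "(LINT x|lebesgue. f x) = \<bar>c\<bar> ^ CARD('n) *\<^sub>R (LINT x|lebesgue. f (t + c *\<^sub>R x))"
    and integrable_affine: "integrable lebesgue f \<Longrightarrow> integrable lebesgue (\<lambda>x. f (t + c *\<^sub>R x))"
proof -
  have lb: "(lborel :: (real ^ 'n) measure) =
      density (distr lborel borel (\<lambda>x. t + c *\<^sub>R x)) (\<lambda>_. ennreal (\<bar>c\<bar> ^ CARD('n)))"
    using lborel_affine[OF c, of t] by simp
  have "(LINT x|lborel. f x) = \<bar>c\<bar> ^ CARD('n) *\<^sub>R (LINT x|lborel. f (t + c *\<^sub>R x))"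
    by (subst lb) (simp add: integral_density integral_distr)
  then show "(LINT x|lebesgue. f x) = \<bar>c\<bar> ^ CARD('n) *\<^sub>R (LINT x|lebesgue. f (t + c *\<^sub>R x))"
    by (simp add: integral_completion)
  assume "integrable lebesgue f"
  then have "integrable lborel f" by (simp add: integrable_completion)
  then have "integrable (distr lborel borel (\<lambda>x. t + c *\<^sub>R x)) (\<lambda>x. \<bar>c\<bar> ^ CARD('n) *\<^sub>R f x)"
    by (subst (asm) lb) (simp add: integrable_density)
  then have "integrable lborel (\<lambda>x. f (t + c *\<^sub>R x))"
    using c integrable_scaleR_right[of "inverse (\<bar>c\<bar> ^ CARD('n))" lborel "\<lambda>x. \<bar>c\<bar> ^ CARD('n) *\<^sub>R f (t + c *\<^sub>R x)"]
    by (simp add: integrable_distr_eq)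
  then show "integrable lebesgue (\<lambda>x. f (t + c *\<^sub>R x))"
    by (simp add: integrable_completion)
qed

lemma
  fixes f :: "real ^ 'n \<Rightarrow> 'b :: {banach, second_countable_topology}"
  assumes f: "f \<in> borel_measurable borel"
  shows integral_translation: "(LINT x|lebesgue. f (x + a)) = (LINT x|lebesgue. f x)"
    and integrable_translation: "integrable lebesgue f \<Longrightarrow> integrable lebesgue (\<lambda>x. f (x + a))"
    and integral_reflection: "(LINT x|lebesgue. f (a - x)) = (LINT x|lebesgue. f x)"
    and integrable_reflection: "integrable lebesgue f \<Longrightarrow> integrable lebesgue (\<lambda>x. f (a - x))"
  using integral_affine[OF f, of 1 a] integrable_affine[OF f, of 1 a]
    integral_affine[OF f, of "-1" a] integrable_affine[OF f, of "-1" a]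
  by (simp_all add: add.commute)

lemma nn_integral_translation:
  fixes f :: "real ^ 'n \<Rightarrow> ennreal"
  assumes f [measurable]: "f \<in> borel_measurable borel"
  shows "(\<integral>\<^sup>+x. f (x + a) \<partial>lebesgue) = (\<integral>\<^sup>+x. f x \<partial>lebesgue)"
proof -
  have "(\<integral>\<^sup>+x. f x \<partial>lborel) = (\<integral>\<^sup>+x. f x \<partial>distr lborel borel ((+) a))"
    by (simp only: lborel_distr_plus)
  then show ?thesis
    by (simp add: nn_integral_completion nn_integral_distr add.commute)
qed

lemma nn_integral_reflection:
  fixes f :: "real ^ 'n \<Rightarrow> ennreal"
  assumes f [measurable]: "f \<in> borel_measurable borel"
  shows "(\<integral>\<^sup>+x. f (a - x) \<partial>lebesgue) = (\<integral>\<^sup>+x. f x \<partial>lebesgue)"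
proof -
  have "(\<integral>\<^sup>+x. f x \<partial>lborel) = (\<integral>\<^sup>+x. f (a - x) \<partial>lborel)"
    by (subst lborel_affine[of "-1" a]) (simp_all add: nn_integral_density nn_integral_distr)
  then show ?thesis by (simp add: nn_integral_completion)
qed

lemma sigma_finite_lebesgue: "sigma_finite_measure (lebesgue :: 'a::euclidean_space measure)"
proof -
  obtain A :: "'a set set" where "countable A" "A \<subseteq> sets lborel" "\<Union>A = space lborel"
    "\<forall>a\<in>A. emeasure lborel a \<noteq> \<infinity>"
    using lborel.sigma_finite_countable by blast
  then show ?thesis
    by unfold_locales (intro exI[of _ A], auto)
qed

lemma pair_lebesgue: "pair_sigma_finite (lebesgue :: 'a::euclidean_space measure) (lebesgue :: 'b::euclidean_space measure)"
  by (simp add: pair_sigma_finite_def sigma_finite_lebesgue)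

interpretation lebesgue: sigma_finite_measure "lebesgue :: (real ^ 'n) measure"
  by (rule sigma_finite_lebesgue)

interpretation lebesgue_pair: pair_sigma_finite "lebesgue :: (real ^ 'n) measure" "lebesgue :: (real ^ 'n) measure"
  by (rule pair_lebesgue)

lemma measurable_pair_lebesgue_of_borel:
  fixes k :: "(real ^ 'n) \<times> (real ^ 'n) \<Rightarrow> 'c :: topological_space"
  assumes "k \<in> borel_measurable borel"
  shows "k \<in> borel_measurable (lebesgue \<Otimes>\<^sub>M lebesgue)"
proof -
  have "(\<lambda>p. (fst p, snd p)) \<in> (lebesgue \<Otimes>\<^sub>M lebesgue) \<rightarrow>\<^sub>M (borel \<Otimes>\<^sub>M borel :: ((real ^ 'n) \<times> (real ^ 'n)) measure)"
    by (intro measurable_Pair measurable_compose[OF measurable_fst] measurable_compose[OF measurable_snd])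
      (auto intro: measurable_completion)
  then have "(\<lambda>p. p) \<in> (lebesgue \<Otimes>\<^sub>M lebesgue) \<rightarrow>\<^sub>M (borel :: ((real ^ 'n) \<times> (real ^ 'n)) measure)"
    by (simp add: borel_prod)
  from measurable_compose[OF this assms] show ?thesis .
qed

text \<open>A bounded kernel makes \<open>f x * k x y * w y\<close> integrable on the product space. Kernels of
  polynomial growth are reduced to this case by moving powers of \<open>japanese\<close> between the kernel and
  the functions \<open>f\<close> and \<open>w\<close>.\<close>

lemma Fubini_bounded_kernel:
  fixes f w :: "real ^ 'n \<Rightarrow> complex" and k :: "real ^ 'n \<Rightarrow> real ^ 'n \<Rightarrow> complex"
  assumes f: "integrable lebesgue f" and w: "integrable lebesgue w"
    and k: "(\<lambda>p. k (fst p) (snd p)) \<in> borel_measurable borel" and B: "\<And>x y. norm (k x y) \<le> B"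
  shows "(LINT x|lebesgue. f x * (LINT y|lebesgue. k x y * w y)) =
    (LINT y|lebesgue. w y * (LINT x|lebesgue. k x y * f x))"
proof -
  have [measurable]: "f \<in> borel_measurable lebesgue" "w \<in> borel_measurable lebesgue"
    using f w by auto
  have B0: "0 \<le> B" using B[of 0 0] norm_ge_zero order_trans by blast
  have [measurable]: "(\<lambda>p. k (fst p) (snd p)) \<in> borel_measurable (lebesgue \<Otimes>\<^sub>M lebesgue)"
    by (rule measurable_pair_lebesgue_of_borel[OF k])
  have meas: "(\<lambda>p. f (fst p) * (k (fst p) (snd p) * w (snd p))) \<in> borel_measurable (lebesgue \<Otimes>\<^sub>M lebesgue)"
    by measurable
  have km: "k x \<in> borel_measurable lebesgue" for x
    using measurable_compose[OF _ k, of "\<lambda>y. (x, y)" lebesgue] measurable_lebesgue_of_borel[of "\<lambda>y. (x, y)"]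
    by (simp add: borel_measurable_Pair measurable_completion)
  have kw: "integrable lebesgue (\<lambda>y. k x y * w y)" for x
  proof (rule Bochner_Integration.integrable_bound[OF integrable_mult_right[OF integrable_norm[OF w], of B]])
    show "(\<lambda>y. k x y * w y) \<in> borel_measurable lebesgue" using km[of x] by measurable
    show "AE y in lebesgue. norm (k x y * w y) \<le> norm (B * norm (w y))"
      using B[of x] by (intro AE_I2) (simp add: norm_mult abs_mult mult_right_mono order_trans[OF _ abs_ge_self])
  qed
  have "integrable (lebesgue \<Otimes>\<^sub>M lebesgue) (\<lambda>(x, y). f x * (k x y * w y))"
  proof (rule lebesgue_pair.Fubini_integrable)
    show "(\<lambda>(x, y). f x * (k x y * w y)) \<in> borel_measurable (lebesgue \<Otimes>\<^sub>M lebesgue)"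
      using meas by (simp add: case_prod_beta')
    show "AE x in lebesgue. integrable lebesgue (\<lambda>y. case (x, y) of (x, y) \<Rightarrow> f x * (k x y * w y))"
      using kw by simp
    show "integrable lebesgue (\<lambda>x. LINT y|lebesgue. norm (case (x, y) of (x, y) \<Rightarrow> f x * (k x y * w y)))"
    proof (rule Bochner_Integration.integrable_bound[OF integrable_mult_left[OF integrable_norm[OF f], of "B * (LINT y|lebesgue. norm (w y))"]])
      have "(\<lambda>p. norm (f (fst p) * (k (fst p) (snd p) * w (snd p)))) \<in> borel_measurable (lebesgue \<Otimes>\<^sub>M lebesgue)"
        using meas by measurable
      then show "(\<lambda>x. LINT y|lebesgue. norm (case (x, y) of (x, y) \<Rightarrow> f x * (k x y * w y))) \<in> borel_measurable lebesgue"
        by (intro lebesgue.borel_measurable_lebesgue_integral) (simp add: case_prod_beta')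
      show "AE x in lebesgue. norm (LINT y|lebesgue. norm (case (x, y) of (x, y) \<Rightarrow> f x * (k x y * w y)))
          \<le> norm (norm (f x) * (B * (LINT y|lebesgue. norm (w y))))"
      proof (rule AE_I2)
        fix x
        have "(LINT y|lebesgue. norm (k x y * w y)) \<le> (LINT y|lebesgue. B * norm (w y))"
          using kw w B[of x] by (intro integral_mono integrable_norm integrable_mult_right)
            (auto simp: norm_mult mult_right_mono)
        then have "norm (f x) * (LINT y|lebesgue. norm (k x y * w y)) \<le> norm (f x) * (B * (LINT y|lebesgue. norm (w y)))"
          by (intro mult_left_mono) auto
        then show "norm (LINT y|lebesgue. norm (case (x, y) of (x, y) \<Rightarrow> f x * (k x y * w y)))
          \<le> norm (norm (f x) * (B * (LINT y|lebesgue. norm (w y))))"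
          using B0 by (simp add: norm_mult abs_mult)
      qed
    qed
  qed
  from lebesgue_pair.Fubini_integral[OF this, symmetric]
  have "(LINT x|lebesgue. (LINT y|lebesgue. f x * (k x y * w y))) =
      (LINT y|lebesgue. (LINT x|lebesgue. f x * (k x y * w y)))" .
  also have "(\<lambda>y. LINT x|lebesgue. f x * (k x y * w y)) = (\<lambda>y. w y * (LINT x|lebesgue. k x y * f x))"
    by (subst integral_mult_right_zero[symmetric]) (simp add: mult_ac)
  finally show ?thesis by simp
qed


section \<open>The Fourier transform of Schwartz functions\<close>

abbreviation character :: "real ^ 'n \<Rightarrow> real ^ 'n \<Rightarrow> complex" where
  "character \<xi> x \<equiv> exp (- (\<i> * complex_of_real (x \<bullet> \<xi>)))"

lemma norm_character: "norm (character \<xi> x) = 1"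
  using norm_exp_i_times[of "- (x \<bullet> \<xi>)"] by simp

lemma borel_measurable_character: "character \<xi> \<in> borel_measurable borel"
  by measurable

lemma borel_measurable_character_pair: "(\<lambda>p. character (fst p) (snd p)) \<in> borel_measurable borel"
  by (intro borel_measurable_continuous_onI continuous_intros)

lemma character_add: "character \<xi> (x + y) = character \<xi> x * character \<xi> y"
  by (simp add: inner_add_left algebra_simps flip: exp_add)

lemma character_add_left: "character (\<xi> + \<eta>) x = character \<xi> x * character \<eta> x"
  by (simp add: inner_add_right algebra_simps flip: exp_add)

lemma smooth_character: "smooth (character \<xi>)"
proof (rule smooth_gen_smooth[where B = "{character \<xi>}"])
  show "f differentiable (at x)" if "f \<in> {character \<xi>}" for f x
    using that has_derivative_character by (auto simp: differentiable_def)
  show "smooth_gen {character \<xi>} (partial i f)" if "f \<in> {character \<xi>}" for f i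
    using that smooth_gen.mult[OF smooth_gen.smooth[OF smooth_const, of _ "- \<i> * complex_of_real (\<xi> $ i)"]
        smooth_gen.base[of "character \<xi>" "{character \<xi>}"]]
    by (simp add: partial_character)
qed (simp add: smooth_gen.base)

definition japanese_int :: "'n::finite itself \<Rightarrow> real" where
  "japanese_int _ = (LINT x|lebesgue. inverse (japanese (x :: real ^ 'n) ^ (2 * CARD('n))))"

lemma japanese_int_nonneg: "0 \<le> japanese_int TYPE('n::finite)"
  unfolding japanese_int_def by (intro integral_nonneg_AE AE_I2) (simp add: japanese_pos less_imp_le)

lemma
  fixes f :: "real ^ 'n \<Rightarrow> 'b :: {banach, second_countable_topology}"
  assumes f: "f \<in> borel_measurable lebesgue" and B: "\<And>x. norm (f x) \<le> B / japanese x ^ (2 * CARD('n))"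
  shows integrable_of_decay: "integrable lebesgue f"
    and integral_norm_of_decay: "(LINT x|lebesgue. norm (f x)) \<le> B * japanese_int TYPE('n)"
proof -
  have I: "integrable lebesgue (\<lambda>x :: real ^ 'n. B * inverse (japanese x ^ (2 * CARD('n))))"
    by (intro integrable_mult_right integrable_japanese)
  have le: "norm (f x) \<le> B * inverse (japanese x ^ (2 * CARD('n)))" for x
    using B[of x] by (simp add: divide_inverse)
  show int: "integrable lebesgue f"
    by (rule Bochner_Integration.integrable_bound[OF I f]) (use le in \<open>auto intro: order_trans[OF _ abs_ge_self]\<close>)
  have "(LINT x|lebesgue. norm (f x)) \<le> (LINT x|lebesgue. B * inverse (japanese (x :: real ^ 'n) ^ (2 * CARD('n))))"
    by (intro integral_mono int integrable_norm I le)
  then show "(LINT x|lebesgue. norm (f x)) \<le> B * japanese_int TYPE('n)"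
    by (simp add: japanese_int_def)
qed

lemma schwartz_measurable: "f \<in> schwartz_functions \<Longrightarrow> f \<in> borel_measurable borel"
  by (simp add: schwartz_smooth smooth_borel_measurable)

lemma schwartz_integrable:
  assumes f: "f \<in> schwartz_functions" shows "integrable lebesgue f"
proof -
  obtain B where "schwartz_bound (2 * CARD('a)) B f" by (rule schwartz_bound_exists[OF f])
  then have "norm (f x) \<le> B / japanese x ^ (2 * CARD('a))" for x
    by (rule schwartz_boundD0) simp
  then show ?thesis
    by (rule integrable_of_decay[OF measurable_lebesgue_of_borel[OF schwartz_measurable[OF f]]])
qed

lemma schwartz_integrable_weight:
  fixes f :: "real ^ 'n \<Rightarrow> complex"
  assumes f: "f \<in> schwartz_functions"
  shows "integrable lebesgue (\<lambda>x. japanese x ^ m * norm (f x))"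
proof -
  obtain B where B: "schwartz_bound (m + 2 * CARD('n)) B f" by (rule schwartz_bound_exists[OF f])
  have "norm (japanese x ^ m * norm (f x)) \<le> B / japanese x ^ (2 * CARD('n))" for x
    using schwartz_boundD0[OF B order_refl, of x] japanese_pos[of x]
    by (simp add: power_add field_simps abs_mult)
  then show ?thesis
    using schwartz_measurable[OF f]
    by (intro integrable_of_decay measurable_lebesgue_of_borel) auto
qed

lemma integrable_character_mult:
  assumes "integrable lebesgue f" shows "integrable lebesgue (\<lambda>x. character \<xi> x * f x)"
proof (rule Bochner_Integration.integrable_bound[OF assms])
  show "(\<lambda>x. character \<xi> x * f x) \<in> borel_measurable lebesgue"
    using assms measurable_lebesgue_of_borel[OF borel_measurable_character[of \<xi>]] by measurable
qed (simp add: norm_mult norm_character)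

lemma norm_fourier_le: "norm (fourier f \<xi>) \<le> (LINT x|lebesgue. norm (f x))"
  unfolding fourier_def
  using integral_norm_bound[of lebesgue "\<lambda>x. character \<xi> x * f x"] by (simp add: norm_mult norm_character)

lemma fourier_cmult: "fourier (\<lambda>x. c * f x) \<xi> = c * fourier f \<xi>"
  unfolding fourier_def by (subst integral_mult_right_zero[symmetric]) (simp add: mult_ac)

lemma fourier_add:
  assumes "integrable lebesgue f" "integrable lebesgue g"
  shows "fourier (\<lambda>x. f x + g x) \<xi> = fourier f \<xi> + fourier g \<xi>"
  unfolding fourier_def
  by (simp add: distrib_left assms integrable_character_mult)

lemma fourier_sum:
  assumes "\<And>i. i \<in> I \<Longrightarrow> integrable lebesgue (f i)"
  shows "fourier (\<lambda>x. \<Sum>i\<in>I. f i x) \<xi> = (\<Sum>i\<in>I. fourier (f i) \<xi>)"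
  unfolding fourier_def
  by (simp add: sum_distrib_left assms integrable_character_mult)

text \<open>Differentiation under the integral sign: by \<open>\<bar>exp (- \<i> t) - 1 + \<i> t\<bar> \<le> t\<^sup>2 / 2\<close> the error of
  the linear approximation at \<open>\<xi>\<close> is at most \<open>\<bar>\<eta> - \<xi>\<bar>\<^sup>2\<close> times an integral that does not depend on \<open>\<eta>\<close>.\<close>

lemma exp_remainder: "norm (exp (- (\<i> * complex_of_real t)) - 1 + \<i> * complex_of_real t) \<le> t\<^sup>2 / 2"
  using iexp_approx1[of "- t" 1] by (simp add: power2_eq_square algebra_simps)

lemma fourier_has_derivative:
  fixes f :: "real ^ 'n \<Rightarrow> complex"
  assumes f: "f \<in> schwartz_functions"
  shows "(fourier f has_derivative
    (\<lambda>h. LINT x|lebesgue. character \<xi> x * (- \<i> * complex_of_real (x \<bullet> h) * f x))) (at \<xi>)"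
proof -
  define D where "D h = (LINT x|lebesgue. character \<xi> x * (- \<i> * complex_of_real (x \<bullet> h) * f x))" for h
  have m: "f \<in> borel_measurable lebesgue" by (rule measurable_lebesgue_of_borel[OF schwartz_measurable[OF f]])
  have w: "integrable lebesgue (\<lambda>x. japanese x ^ k * norm (f x))" for k
    by (rule schwartz_integrable_weight[OF f])
  have inn: "\<bar>x \<bullet> h\<bar> \<le> norm h * japanese x" for x h :: "real ^ 'n"
    using Cauchy_Schwarz_ineq2[of x h] norm_le_japanese[of x]
    by (metis mult.commute mult_left_mono norm_ge_zero order_trans)
  have xm: "(\<lambda>x :: real ^ 'n. complex_of_real (x \<bullet> h)) \<in> borel_measurable lebesgue" for h
    by (rule measurable_lebesgue_of_borel) measurable
  have int1: "integrable lebesgue (\<lambda>x. - \<i> * complex_of_real (x \<bullet> h) * f x)" for h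
  proof (rule Bochner_Integration.integrable_bound[OF integrable_mult_right[OF w[of 1], of "norm h"]])
    show "(\<lambda>x. - \<i> * complex_of_real (x \<bullet> h) * f x) \<in> borel_measurable lebesgue"
      using m xm by measurable
    show "AE x in lebesgue. norm (- \<i> * complex_of_real (x \<bullet> h) * f x) \<le> norm (norm h * (japanese x ^ 1 * norm (f x)))"
      using inn by (intro AE_I2)
        (simp add: norm_mult abs_mult mult.assoc[symmetric] mult_right_mono abs_of_pos[OF japanese_pos])
  qed
  note int2 = integrable_character_mult[OF int1]
  have D: "bounded_linear D"
  proof (rule bounded_linear_intro[where K = "LINT x|lebesgue. japanese x ^ 1 * norm (f x)"])
    show "D (a + b) = D a + D b" for a b
      unfolding D_def by (subst Bochner_Integration.integral_add[OF int2 int2, symmetric])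
        (simp add: inner_add_right algebra_simps)
    show "D (r *\<^sub>R a) = r *\<^sub>R D a" for r a
    proof -
      have "(\<lambda>x. character \<xi> x * (- \<i> * complex_of_real (x \<bullet> (r *\<^sub>R a)) * f x)) =
          (\<lambda>x. complex_of_real r * (character \<xi> x * (- \<i> * complex_of_real (x \<bullet> a) * f x)))"
        by (simp add: mult_ac)
      then show ?thesis
        unfolding D_def by (simp only: integral_mult_right_zero) (simp add: scaleR_conv_of_real)
    qed
    show "norm (D h) \<le> norm h * (LINT x|lebesgue. japanese x ^ 1 * norm (f x))" for h
    proof -
      have "norm (D h) \<le> (LINT x|lebesgue. norm (character \<xi> x * (- \<i> * complex_of_real (x \<bullet> h) * f x)))"
        unfolding D_def by (rule integral_norm_bound)
      also have "\<dots> \<le> (LINT x|lebesgue. norm h * (japanese x ^ 1 * norm (f x)))"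
        using inn by (intro integral_mono integrable_norm int2 integrable_mult_right w)
          (simp add: norm_mult norm_character mult.assoc[symmetric] mult_right_mono)
      finally show ?thesis by simp
    qed
  qed
  define K where "K = (LINT x|lebesgue. japanese x ^ 2 * norm (f x))"
  have rem: "norm (fourier f \<eta> - fourier f \<xi> - D (\<eta> - \<xi>)) \<le> (norm (\<eta> - \<xi>))\<^sup>2 * K" for \<eta>
  proof -
    define h where "h = \<eta> - \<xi>"
    have \<eta>: "\<eta> = \<xi> + h" by (simp add: h_def)
    note fi = integrable_character_mult[OF schwartz_integrable[OF f]]
    define R where "R x = character \<eta> x * f x - character \<xi> x * f x -
        character \<xi> x * (- \<i> * complex_of_real (x \<bullet> h) * f x)" for x
    have R: "integrable lebesgue R"
      unfolding R_def by (intro Bochner_Integration.integrable_diff fi int2)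
    have "fourier f \<eta> - fourier f \<xi> - D h = (LINT x|lebesgue. R x)"
      unfolding R_def fourier_def D_def
      by (simp only: Bochner_Integration.integral_diff fi int2 Bochner_Integration.integrable_diff)
    also have "norm \<dots> \<le> (LINT x|lebesgue. norm (R x))"
      by (rule integral_norm_bound)
    also have "\<dots> \<le> (LINT x|lebesgue. (norm h)\<^sup>2 * (japanese x ^ 2 * norm (f x)))"
    proof (intro integral_mono integrable_norm R integrable_mult_right w)
      fix x
      have "R x = character \<xi> x * ((character h x - 1 + \<i> * complex_of_real (x \<bullet> h)) * f x)"
        unfolding R_def \<eta> character_add_left by (simp add: algebra_simps)
      then have "norm (R x) = norm (character h x - 1 + \<i> * complex_of_real (x \<bullet> h)) * norm (f x)"
        by (simp add: norm_mult norm_character)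
      also have "\<dots> \<le> ((x \<bullet> h)\<^sup>2 / 2) * norm (f x)"
        by (intro mult_right_mono exp_remainder) auto
      also have "\<dots> \<le> (norm h * japanese x)\<^sup>2 * norm (f x)"
      proof (rule mult_right_mono)
        have "(x \<bullet> h)\<^sup>2 \<le> (norm h * japanese x)\<^sup>2"
          using power_mono[OF inn[of x h], of 2] by simp
        then show "(x \<bullet> h)\<^sup>2 / 2 \<le> (norm h * japanese x)\<^sup>2"
          using zero_le_power2[of "x \<bullet> h"] by linarith
      qed simp
      finally show "norm (R x) \<le> (norm h)\<^sup>2 * (japanese x ^ 2 * norm (f x))"
        by (simp add: power_mult_distrib)
    qed
    finally show ?thesis by (simp add: h_def K_def)
  qed
  have "(fourier f has_derivative D) (at \<xi>)"
  proof (rule has_derivativeI_sandwich[where e = 1 and H = "\<lambda>\<eta>. norm (\<eta> - \<xi>) * K"])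
    show "norm (fourier f \<eta> - fourier f \<xi> - D (\<eta> - \<xi>)) / norm (\<eta> - \<xi>) \<le> norm (\<eta> - \<xi>) * K"
      if "\<eta> \<noteq> \<xi>" for \<eta>
      using rem[of \<eta>] that by (simp add: pos_divide_le_eq power2_eq_square mult_ac)
    have "((\<lambda>\<eta>. norm (\<eta> - \<xi>) * K) \<longlongrightarrow> norm (\<xi> - \<xi>) * K) (at \<xi>)"
      by (intro tendsto_intros)
    then show "((\<lambda>\<eta>. norm (\<eta> - \<xi>) * K) \<longlongrightarrow> 0) (at \<xi>)" by simp
  qed (use D in auto)
  then show ?thesis by (simp add: D_def[abs_def])
qed

lemma partial_fourier:
  assumes f: "f \<in> schwartz_functions"
  shows "partial i (fourier f) = fourier (\<lambda>x. - \<i> * (complex_of_real (x $ i) * f x))"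
  by (rule ext, subst partial_eq_derivative[OF fourier_has_derivative[OF f]])
    (simp add: fourier_def inner_axis mult.assoc)

lemma smooth_fourier:
  assumes f: "f \<in> schwartz_functions" shows "smooth (fourier f)"
proof (rule smooth_coinduct[where S = "fourier ` schwartz_functions"])
  show "g differentiable (at x)" if "g \<in> fourier ` schwartz_functions" for g x
    using that fourier_has_derivative by (auto simp: differentiable_def)
  show "partial i g \<in> fourier ` schwartz_functions" if "g \<in> fourier ` schwartz_functions" for g i
  proof -
    from that obtain f where f: "f \<in> schwartz_functions" and g: "g = fourier f" by auto
    show ?thesis
      unfolding g partial_fourier[OF f] by (intro imageI schwartz_cmult schwartz_component f)
  qed
qed (use f in auto)

text \<open>The integral of a difference quotient vanishes by translation invariance, and the mean value
  theorem provides an integrable majorant for the passage to the limit. Applied to \<open>character \<xi> x * f x\<close>,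
  this is the integration by parts in \<open>fourier_partial\<close>.\<close>

lemma integral_partial_eq_0:
  fixes \<phi> :: "real ^ 'n \<Rightarrow> complex"
  assumes s: "smooth \<phi>" and B: "\<And>x. norm (\<phi> x) \<le> B / japanese x ^ (2 * CARD('n))"
    and B': "\<And>x. norm (partial i \<phi> x) \<le> B / japanese x ^ (2 * CARD('n))"
  shows "(LINT x|lebesgue. partial i \<phi> x) = 0"
proof -
  define d where "d = 2 * CARD('n)"
  define e :: "real ^ 'n" where "e = axis i 1"
  define q where "q j x = complex_of_real (real (Suc j)) * (\<phi> (x + (1 / real (Suc j)) *\<^sub>R e) - \<phi> x)" for j x
  have B0: "0 \<le> B" using order_trans[OF norm_ge_zero B[of 0]] by (simp add: japanese_def)
  have m: "\<phi> \<in> borel_measurable borel" by (rule smooth_borel_measurable[OF s])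
  have mt: "(\<lambda>x. \<phi> (x + a)) \<in> borel_measurable borel" for a
    by (rule measurable_compose[OF _ m]) simp
  have int: "integrable lebesgue \<phi>"
    by (rule integrable_of_decay[OF measurable_lebesgue_of_borel[OF m] B])
  have der: "((\<lambda>t. \<phi> (x + t *\<^sub>R e)) has_vector_derivative partial i \<phi> (x + t *\<^sub>R e)) (at t within A)" for x t A
  proof -
    have "((\<lambda>t. x + t *\<^sub>R e) has_derivative (\<lambda>h. h *\<^sub>R e)) (at t within A)"
      by (auto intro!: derivative_eq_intros)
    from has_derivative_compose[OF this smooth_has_derivative[OF s]]
    have D: "((\<lambda>t. \<phi> (x + t *\<^sub>R e)) has_derivative
        (\<lambda>h. frechet_derivative \<phi> (at (x + t *\<^sub>R e)) (h *\<^sub>R e))) (at t within A)" .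
    have "linear (frechet_derivative \<phi> (at (x + t *\<^sub>R e)))"
      using smooth_has_derivative[OF s] has_derivative_linear by blast
    then have "frechet_derivative \<phi> (at (x + t *\<^sub>R e)) (h *\<^sub>R e) = h *\<^sub>R partial i \<phi> (x + t *\<^sub>R e)" for h
      by (simp add: linear_cmul partial_def e_def)
    with D show ?thesis by (simp add: has_vector_derivative_def)
  qed
  have lim: "(\<lambda>j. q j x) \<longlonglongrightarrow> partial i \<phi> x" for x
  proof -
    have "((\<lambda>t. \<phi> (x + t *\<^sub>R e)) has_vector_derivative partial i \<phi> x) (at 0)"
      using der[of x 0 UNIV] by simp
    then have "((\<lambda>h. norm (\<phi> (x + h *\<^sub>R e) - \<phi> x - h *\<^sub>R partial i \<phi> x) / norm h) \<longlongrightarrow> 0) (at 0)"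
      by (simp add: has_vector_derivative_def has_derivative_at)
    then have "((\<lambda>h. norm ((\<phi> (x + h *\<^sub>R e) - \<phi> x) /\<^sub>R h - partial i \<phi> x)) \<longlongrightarrow> 0) (at 0)"
    proof (rule Lim_transform_eventually)
      have "norm (a - h *\<^sub>R p) / norm h = norm (a /\<^sub>R h - p)" if "h \<noteq> 0" for a p :: complex and h :: real
      proof -
        have "a /\<^sub>R h - p = (a - h *\<^sub>R p) /\<^sub>R h" using that by (simp add: scaleR_diff_right)
        then show ?thesis by (simp add: divide_inverse mult.commute)
      qed
      then show "\<forall>\<^sub>F h in at 0. norm (\<phi> (x + h *\<^sub>R e) - \<phi> x - h *\<^sub>R partial i \<phi> x) / norm h =
          norm ((\<phi> (x + h *\<^sub>R e) - \<phi> x) /\<^sub>R h - partial i \<phi> x)"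
        unfolding eventually_at_filter by (intro always_eventually allI impI) blast
    qed
    then have "((\<lambda>h. (\<phi> (x + h *\<^sub>R e) - \<phi> x) /\<^sub>R h) \<longlongrightarrow> partial i \<phi> x) (at 0)"
      by (rule LIM_zero_cancel[OF tendsto_norm_zero_cancel])
    moreover have "filterlim (\<lambda>j. 1 / real (Suc j)) (at 0) sequentially"
      using LIMSEQ_inverse_real_of_nat unfolding filterlim_at by (simp add: divide_inverse)
    ultimately have "(\<lambda>j. (\<phi> (x + (1 / real (Suc j)) *\<^sub>R e) - \<phi> x) /\<^sub>R (1 / real (Suc j))) \<longlonglongrightarrow> partial i \<phi> x"
      by (rule filterlim_compose)
    then show ?thesis by (simp add: q_def scaleR_conv_of_real)
  qed
  have bound: "norm (q j x) \<le> (4 ^ d * B) / japanese x ^ d" for j x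
  proof -
    define t where "t = 1 / real (Suc j)"
    have t: "0 < t" "t \<le> 1" by (auto simp: t_def)
    have pb: "norm (partial i \<phi> (x + r *\<^sub>R e)) \<le> (4 ^ d * B) / japanese x ^ d" if r: "r \<in> {0..t}" for r
    proof -
      have "(japanese (- (r *\<^sub>R e)))\<^sup>2 \<le> 2\<^sup>2"
        using r t power_le_one[of r 2] by (simp add: japanese_square e_def)
      then have je: "japanese (- (r *\<^sub>R e)) \<le> 2"
        by (rule power2_le_imp_le) simp
      have "japanese x \<le> 2 * japanese (x + r *\<^sub>R e) * japanese (- (r *\<^sub>R e))"
        using japanese_add_le[of "x + r *\<^sub>R e" "- (r *\<^sub>R e)"] by simp
      also have "\<dots> \<le> 2 * japanese (x + r *\<^sub>R e) * 2"
        using je japanese_pos[of "x + r *\<^sub>R e"] by (intro mult_left_mono) auto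
      finally have "japanese x ^ d \<le> (4 * japanese (x + r *\<^sub>R e)) ^ d"
        using japanese_pos[of x] by (intro power_mono) auto
      then have j: "japanese x ^ d \<le> 4 ^ d * japanese (x + r *\<^sub>R e) ^ d"
        by (simp add: power_mult_distrib)
      have "norm (partial i \<phi> (x + r *\<^sub>R e)) \<le> B / japanese (x + r *\<^sub>R e) ^ d"
        using B' by (simp add: d_def)
      also have "\<dots> \<le> (4 ^ d * B) / japanese x ^ d"
        using mult_left_mono[OF j B0] japanese_pos[of x] japanese_pos[of "x + r *\<^sub>R e"]
        by (simp add: divide_simps mult_ac)
      finally show ?thesis .
    qed
    have "norm (\<phi> (x + t *\<^sub>R e) - \<phi> (x + 0 *\<^sub>R e)) \<le> (4 ^ d * B) / japanese x ^ d * norm (t - 0)"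
    proof (rule differentiable_bound[where S = "{0..t}" and f' = "\<lambda>r h. h *\<^sub>R partial i \<phi> (x + r *\<^sub>R e)"])
      show "((\<lambda>t. \<phi> (x + t *\<^sub>R e)) has_derivative (\<lambda>h. h *\<^sub>R partial i \<phi> (x + r *\<^sub>R e))) (at r within {0..t})" for r
        using der by (simp add: has_vector_derivative_def)
      show "onorm (\<lambda>h. h *\<^sub>R partial i \<phi> (x + r *\<^sub>R e)) \<le> (4 ^ d * B) / japanese x ^ d" if "r \<in> {0..t}" for r
      proof (rule onorm_bound)
        show "norm (h *\<^sub>R partial i \<phi> (x + r *\<^sub>R e)) \<le> (4 ^ d * B) / japanese x ^ d * norm h" for h
          using mult_left_mono[OF pb[OF that], of "norm h"] by (simp add: mult.commute)
        show "0 \<le> (4 ^ d * B) / japanese x ^ d"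
          using B0 japanese_pos[of x] by simp
      qed
    qed (use t in auto)
    then have "norm (\<phi> (x + t *\<^sub>R e) - \<phi> x) \<le> (4 ^ d * B) / japanese x ^ d * t"
      using t by simp
    moreover have "q j x = complex_of_real (1 / t) * (\<phi> (x + t *\<^sub>R e) - \<phi> x)"
      by (simp add: q_def t_def)
    ultimately have "norm (q j x) = (1 / t) * norm (\<phi> (x + t *\<^sub>R e) - \<phi> x)"
      using t by (simp add: norm_mult norm_divide)
    also have "\<dots> \<le> (1 / t) * ((4 ^ d * B) / japanese x ^ d * t)"
      using \<open>norm (\<phi> (x + t *\<^sub>R e) - \<phi> x) \<le> (4 ^ d * B) / japanese x ^ d * t\<close> t
      by (intro mult_left_mono) auto
    finally show ?thesis using t by simp
  qed
  have qm: "q j \<in> borel_measurable borel" for j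
    unfolding q_def[abs_def]
    by (intro borel_measurable_times borel_measurable_diff borel_measurable_const m mt)
  have "partial i \<phi> \<in> borel_measurable lebesgue"
    by (intro measurable_lebesgue_of_borel smooth_borel_measurable smooth_partial s)
  then have "(\<lambda>j. LINT x|lebesgue. q j x) \<longlonglongrightarrow> (LINT x|lebesgue. partial i \<phi> x)"
  proof (rule integral_dominated_convergence)
    show "integrable lebesgue (\<lambda>x :: real ^ 'n. (4 ^ d * B) * inverse (japanese x ^ d))"
      unfolding d_def by (intro integrable_mult_right integrable_japanese)
    show "AE x in lebesgue. norm (q j x) \<le> (4 ^ d * B) * inverse (japanese x ^ d)" for j
      using bound by (simp add: divide_inverse)
    show "q j \<in> borel_measurable lebesgue" for j
      by (rule measurable_lebesgue_of_borel[OF qm])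
  qed (simp add: lim)
  moreover have "(LINT x|lebesgue. q j x) = 0" for j
    unfolding q_def integral_mult_right_zero
      Bochner_Integration.integral_diff[OF integrable_translation[OF m int] int]
      integral_translation[OF m] by simp
  ultimately have "(\<lambda>j :: nat. 0) \<longlonglongrightarrow> (LINT x|lebesgue. partial i \<phi> x)"
    by simp
  then show ?thesis
    by (simp add: LIMSEQ_const_iff)
qed

lemma fourier_partial:
  fixes f :: "real ^ 'n \<Rightarrow> complex"
  assumes f: "f \<in> schwartz_functions"
  shows "fourier (partial i f) \<xi> = \<i> * complex_of_real (\<xi> $ i) * fourier f \<xi>"
proof -
  define d where "d = 2 * CARD('n)"
  obtain B where B: "schwartz_bound (Suc d) B f" by (rule schwartz_bound_exists[OF f])
  note B0 = schwartz_bound_nonneg[OF B]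
  note sf = schwartz_smooth[OF f]
  let ?\<phi> = "\<lambda>x. character \<xi> x * f x"
  have p: "partial i ?\<phi> = (\<lambda>x. - \<i> * complex_of_real (\<xi> $ i) * (character \<xi> x * f x) + character \<xi> x * partial i f x)"
    unfolding partial_mult[OF smooth_differentiable[OF smooth_character] smooth_differentiable[OF sf]]
      partial_character by (simp add: mult.assoc)
  have b1: "norm (f x) \<le> B / japanese x ^ d" for x
    by (rule schwartz_boundD0[OF B]) simp
  have b2: "norm (partial i f x) \<le> B / japanese x ^ d" for x
    using schwartz_boundD[OF B, of "[i]" d x] by simp
  have "(LINT x|lebesgue. partial i ?\<phi> x) = 0"
  proof (rule integral_partial_eq_0[where B = "(1 + \<bar>\<xi> $ i\<bar>) * B"])
    show "smooth ?\<phi>" by (rule smooth_mult[OF smooth_character sf])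
    show "norm (?\<phi> x) \<le> (1 + \<bar>\<xi> $ i\<bar>) * B / japanese x ^ (2 * CARD('n))" for x
    proof -
      have "norm (?\<phi> x) \<le> 1 * (B / japanese x ^ d)" using b1[of x] by (simp add: norm_mult norm_character)
      also have "\<dots> \<le> (1 + \<bar>\<xi> $ i\<bar>) * (B / japanese x ^ d)"
        using B0 japanese_pos[of x] by (intro mult_right_mono) auto
      finally show ?thesis by (simp add: d_def)
    qed
    show "norm (partial i ?\<phi> x) \<le> (1 + \<bar>\<xi> $ i\<bar>) * B / japanese x ^ (2 * CARD('n))" for x
    proof -
      have "norm (partial i ?\<phi> x) \<le> norm (- \<i> * complex_of_real (\<xi> $ i) * (character \<xi> x * f x)) + norm (character \<xi> x * partial i f x)"
        unfolding p by (rule norm_triangle_ineq)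
      also have "\<dots> = \<bar>\<xi> $ i\<bar> * norm (f x) + norm (partial i f x)"
        by (simp add: norm_mult norm_character)
      also have "\<dots> \<le> \<bar>\<xi> $ i\<bar> * (B / japanese x ^ d) + B / japanese x ^ d"
        by (intro add_mono mult_left_mono b1 b2) auto
      finally show ?thesis by (simp add: d_def algebra_simps add_divide_distrib)
    qed
  qed
  moreover have "(LINT x|lebesgue. partial i ?\<phi> x) =
      - \<i> * complex_of_real (\<xi> $ i) * fourier f \<xi> + fourier (partial i f) \<xi>"
    unfolding p fourier_def
    by (subst Bochner_Integration.integral_add[OF integrable_mult_right
          integrable_character_mult[OF schwartz_integrable[OF schwartz_partial[OF f]]]])
      (simp_all only: integral_mult_right_zero integrable_character_mult[OF schwartz_integrable[OF f]])
  ultimately have "- \<i> * complex_of_real (\<xi> $ i) * fourier f \<xi> + fourier (partial i f) \<xi> = 0"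
    by simp
  then show ?thesis by (simp add: eq_neg_iff_add_eq_0 add.commute)
qed

lemma integrable_mult_bounded:
  fixes f h :: "real ^ 'n \<Rightarrow> complex"
  assumes f: "integrable lebesgue f" and h: "h \<in> borel_measurable lebesgue" and B: "\<And>x. norm (h x) \<le> B"
  shows "integrable lebesgue (\<lambda>x. h x * f x)"
proof (rule Bochner_Integration.integrable_bound[OF integrable_mult_right[OF integrable_norm[OF f], of B]])
  have "f \<in> borel_measurable lebesgue" using f by auto
  then show "(\<lambda>x. h x * f x) \<in> borel_measurable lebesgue"
    using h by measurable
  have "0 \<le> B" using B[of 0] norm_ge_zero order_trans by blast
  then show "AE x in lebesgue. norm (h x * f x) \<le> norm (B * norm (f x))"
    using B by (intro AE_I2) (simp add: norm_mult mult_right_mono)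
qed

text \<open>The operator \<open>1 - \<Delta>\<close>; the Fourier transform turns it into multiplication by
  \<open>japanese\<^sup>2\<close>.\<close>

definition one_minus_laplace :: "(real ^ 'n \<Rightarrow> complex) \<Rightarrow> real ^ 'n \<Rightarrow> complex" where
  "one_minus_laplace f x = f x + (\<Sum>i\<in>UNIV. (- 1) * partial i (partial i f) x)"

lemma one_minus_laplace_schwartz:
  assumes f: "f \<in> schwartz_functions" shows "one_minus_laplace f \<in> schwartz_functions"
  unfolding one_minus_laplace_def[abs_def]
  by (intro schwartz_add schwartz_sum schwartz_cmult schwartz_partial f)

lemma one_minus_laplace_bound:
  fixes f :: "real ^ 'n \<Rightarrow> complex"
  assumes f: "f \<in> schwartz_functions" and B: "schwartz_bound (M + 2) B f"
  shows "schwartz_bound M ((1 + real CARD('n)) * B) (one_minus_laplace f)"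
proof -
  have s: "smooth (\<lambda>x. (- 1) * partial i (partial i f) x)" for i
    by (intro smooth_cmult smooth_partial schwartz_smooth[OF f])
  have "schwartz_bound M (norm (- 1 :: complex) * B) (\<lambda>x. (- 1) * partial i (partial i f) x)" for i
  proof (rule schwartz_bound_cmult)
    show "smooth (partial i (partial i f))" by (intro smooth_partial schwartz_smooth[OF f])
    show "schwartz_bound M B (partial i (partial i f))"
      by (rule schwartz_bound_partial, rule schwartz_bound_partial) (use B in simp)
  qed
  then have "schwartz_bound M (real CARD('n) * B) (\<lambda>x. \<Sum>i\<in>UNIV. (- 1) * partial i (partial i f) x)"
    using s by (intro schwartz_bound_sum) auto
  moreover have "schwartz_bound M B f"
    by (rule schwartz_bound_mono[OF B]) auto
  ultimately have "schwartz_bound M (B + real CARD('n) * B) (one_minus_laplace f)"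
    unfolding one_minus_laplace_def[abs_def]
    by (intro schwartz_bound_add smooth_sum s schwartz_smooth[OF f])
  then show ?thesis by (simp add: distrib_right)
qed

lemma fourier_one_minus_laplace:
  fixes f :: "real ^ 'n \<Rightarrow> complex"
  assumes f: "f \<in> schwartz_functions"
  shows "fourier (one_minus_laplace f) \<xi> = complex_of_real ((japanese \<xi>)\<^sup>2) * fourier f \<xi>"
proof -
  note pp = schwartz_partial[OF schwartz_partial[OF f]]
  have pi: "integrable lebesgue (\<lambda>x. (- 1) * partial i (partial i f) x)" for i
    by (rule schwartz_integrable[OF schwartz_cmult[OF pp]])
  have "fourier (one_minus_laplace f) \<xi> =
      fourier f \<xi> + (\<Sum>i\<in>UNIV. (- 1) * fourier (partial i (partial i f)) \<xi>)"
    unfolding one_minus_laplace_def[abs_def]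
    by (subst fourier_add[OF schwartz_integrable[OF f]])
      (simp_all only: fourier_sum[OF pi] fourier_cmult Bochner_Integration.integrable_sum[OF pi])
  also have "\<dots> = fourier f \<xi> + (\<Sum>i\<in>UNIV. complex_of_real ((\<xi> $ i)\<^sup>2) * fourier f \<xi>)"
    unfolding fourier_partial[OF schwartz_partial[OF f]] fourier_partial[OF f]
    by (simp add: power2_eq_square algebra_simps)
  also have "\<dots> = complex_of_real ((japanese \<xi>)\<^sup>2) * fourier f \<xi>"
    by (simp add: japanese_square norm_vec_def L2_set_def sum_nonneg distrib_right sum_distrib_right)
  finally show ?thesis .
qed

text \<open>Induction on \<open>m\<close>: replacing \<open>f\<close> by \<open>one_minus_laplace f\<close> multiplies the transform by
  \<open>japanese\<^sup>2\<close> and costs two indices of \<open>schwartz_bound\<close>. The constants are uniform in \<open>f\<close> since continuity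
  of the transform is needed later.\<close>

lemma fourier_decay:
  "\<exists>C\<ge>0. \<exists>M. \<forall>f\<in>schwartz_functions. \<forall>B. schwartz_bound M B f \<longrightarrow>
    (\<forall>\<xi> :: real ^ 'n. japanese \<xi> ^ (2 * m) * norm (fourier f \<xi>) \<le> C * B)"
proof (induction m)
  case 0
  show ?case
  proof (intro exI conjI ballI allI impI)
    show "0 \<le> japanese_int TYPE('n)" by (rule japanese_int_nonneg)
    fix f :: "real ^ 'n \<Rightarrow> complex" and B \<xi>
    assume f: "f \<in> schwartz_functions" and B: "schwartz_bound (2 * CARD('n)) B f"
    have "norm (fourier f \<xi>) \<le> (LINT x|lebesgue. norm (f x))" by (rule norm_fourier_le)
    also have "\<dots> \<le> B * japanese_int TYPE('n)"
      by (rule integral_norm_of_decay[OF measurable_lebesgue_of_borel[OF schwartz_measurable[OF f]]])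
        (rule schwartz_boundD0[OF B order_refl])
    finally show "japanese \<xi> ^ (2 * 0) * norm (fourier f \<xi>) \<le> japanese_int TYPE('n) * B"
      by (simp add: mult.commute)
  qed
next
  case (Suc m)
  then obtain C M where C: "0 \<le> C"
    "\<And>f B \<xi>. f \<in> schwartz_functions \<Longrightarrow> schwartz_bound M B f \<Longrightarrow>
      japanese (\<xi> :: real ^ 'n) ^ (2 * m) * norm (fourier f \<xi>) \<le> C * B"
    by metis
  show ?case
  proof (intro exI conjI ballI allI impI)
    show "0 \<le> C * (1 + real CARD('n))" using C by simp
    fix f :: "real ^ 'n \<Rightarrow> complex" and B \<xi>
    assume f: "f \<in> schwartz_functions" and B: "schwartz_bound (M + 2) B f"
    have "japanese \<xi> ^ (2 * m) * norm (fourier (one_minus_laplace f) \<xi>) \<le> C * ((1 + real CARD('n)) * B)"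
      by (rule C(2)[OF one_minus_laplace_schwartz[OF f] one_minus_laplace_bound[OF f B]])
    then show "japanese \<xi> ^ (2 * Suc m) * norm (fourier f \<xi>) \<le> C * (1 + real CARD('n)) * B"
      unfolding fourier_one_minus_laplace[OF f] by (simp add: norm_mult power2_eq_square mult_ac)
  qed
qed

lemma fourier_partials_decay:
  "\<exists>C\<ge>0. \<exists>M. \<forall>f\<in>schwartz_functions. \<forall>B. schwartz_bound M B f \<longrightarrow>
    (\<forall>\<xi> :: real ^ 'n. japanese \<xi> ^ m * norm (partials \<alpha> (fourier f) \<xi>) \<le> C * B)"
proof (induction \<alpha> rule: rev_induct)
  case Nil
  obtain C M where C: "0 \<le> C"
    "\<And>f B \<xi>. f \<in> schwartz_functions \<Longrightarrow> schwartz_bound M B f \<Longrightarrow>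
      japanese (\<xi> :: real ^ 'n) ^ (2 * m) * norm (fourier f \<xi>) \<le> C * B"
    using fourier_decay[of m] by metis
  show ?case
  proof (intro exI conjI ballI allI impI)
    show "0 \<le> C" by (rule C)
    fix f :: "real ^ 'n \<Rightarrow> complex" and B \<xi>
    assume f: "f \<in> schwartz_functions" and B: "schwartz_bound M B f"
    have "japanese \<xi> ^ m * norm (fourier f \<xi>) \<le> japanese \<xi> ^ (2 * m) * norm (fourier f \<xi>)"
      by (intro mult_right_mono power_increasing japanese_ge_1) auto
    also have "\<dots> \<le> C * B" by (rule C(2)[OF f B])
    finally show "japanese \<xi> ^ m * norm (partials [] (fourier f) \<xi>) \<le> C * B" by simp
  qed
next
  case (snoc i \<alpha>)
  then obtain C M where C: "0 \<le> C"
    "\<And>f B \<xi>. f \<in> schwartz_functions \<Longrightarrow> schwartz_bound M B f \<Longrightarrow>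
      japanese (\<xi> :: real ^ 'n) ^ m * norm (partials \<alpha> (fourier f) \<xi>) \<le> C * B"
    by metis
  show ?case
  proof (intro exI conjI ballI allI impI)
    show "0 \<le> C * 2 ^ M" using C by simp
    fix f :: "real ^ 'n \<Rightarrow> complex" and B \<xi>
    assume f: "f \<in> schwartz_functions" and B: "schwartz_bound (Suc M) B f"
    have "schwartz_bound M (norm (- \<i>) * (2 ^ M * B)) (\<lambda>x. - \<i> * (complex_of_real (x $ i) * f x))"
      by (rule schwartz_bound_cmult[OF smooth_mult[OF smooth_component schwartz_smooth[OF f]]])
        (rule schwartz_bound_component[OF schwartz_smooth[OF f] B])
    from C(2)[OF schwartz_cmult[OF schwartz_component[OF f]] this]
    show "japanese \<xi> ^ m * norm (partials (\<alpha> @ [i]) (fourier f) \<xi>) \<le> C * 2 ^ M * B"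
      by (simp add: partials_snoc partial_fourier[OF f] mult.assoc)
  qed
qed

text \<open>Finitely many instances of \<open>fourier_partials_decay\<close>, one for each multi-index of length at most
  \<open>m\<close>; this is the continuity of the Fourier transform on the Schwartz space.\<close>

lemma fourier_schwartz_bound:
  obtains C M where "0 \<le> C"
    "\<And>(f :: real ^ 'n \<Rightarrow> complex) B. f \<in> schwartz_functions \<Longrightarrow> schwartz_bound M B f \<Longrightarrow>
      schwartz_bound m (C * B) (fourier f)"
proof -
  have "\<forall>\<alpha>. \<exists>C M. 0 \<le> C \<and> (\<forall>f\<in>schwartz_functions. \<forall>B. schwartz_bound M B f \<longrightarrow>
    (\<forall>\<xi> :: real ^ 'n. japanese \<xi> ^ m * norm (partials \<alpha> (fourier f) \<xi>) \<le> C * B))"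
    using fourier_partials_decay by meson
  then obtain C M where C: "\<And>\<alpha>. 0 \<le> C \<alpha>"
    "\<And>\<alpha> f B \<xi>. f \<in> schwartz_functions \<Longrightarrow> schwartz_bound (M \<alpha>) B f \<Longrightarrow>
      japanese (\<xi> :: real ^ 'n) ^ m * norm (partials \<alpha> (fourier f) \<xi>) \<le> C \<alpha> * B"
    by metis
  define A where "A = {\<alpha> :: 'n list. length \<alpha> \<le> m}"
  have fin: "finite A"
    unfolding A_def using finite_lists_length_le[of "UNIV :: 'n set" m] by simp
  show thesis
  proof
    show "0 \<le> (\<Sum>\<alpha>\<in>A. C \<alpha>)" using C(1) by (intro sum_nonneg)
    fix f :: "real ^ 'n \<Rightarrow> complex" and B
    assume f: "f \<in> schwartz_functions" and B: "schwartz_bound (\<Sum>\<alpha>\<in>A. M \<alpha>) B f"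
    show "schwartz_bound m ((\<Sum>\<alpha>\<in>A. C \<alpha>) * B) (fourier f)"
      unfolding schwartz_bound_def
    proof (intro allI impI)
      fix \<alpha> :: "'n list" and \<xi> assume "length \<alpha> \<le> m"
      then have \<alpha>: "\<alpha> \<in> A" by (simp add: A_def)
      have "schwartz_bound (M \<alpha>) B f"
        by (rule schwartz_bound_mono[OF B member_le_sum[OF \<alpha> _ fin]]) auto
      from C(2)[OF f this] have "japanese \<xi> ^ m * norm (partials \<alpha> (fourier f) \<xi>) \<le> C \<alpha> * B" .
      also have "\<dots> \<le> (\<Sum>\<alpha>\<in>A. C \<alpha>) * B"
        using schwartz_bound_nonneg[OF B] member_le_sum[OF \<alpha> _ fin, of C] C(1) by (intro mult_right_mono) auto
      finally show "japanese \<xi> ^ m * norm (partials \<alpha> (fourier f) \<xi>) \<le> (\<Sum>\<alpha>\<in>A. C \<alpha>) * B" .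
    qed
  qed
qed

lemma fourier_schwartz:
  assumes f: "f \<in> schwartz_functions" shows "fourier f \<in> schwartz_functions"
proof (rule schwartzI[OF smooth_fourier[OF f]])
  fix m
  obtain C M where C: "\<And>(f :: real ^ 'a \<Rightarrow> complex) B. f \<in> schwartz_functions \<Longrightarrow> schwartz_bound M B f \<Longrightarrow>
      schwartz_bound m (C * B) (fourier f)"
    using fourier_schwartz_bound[of m] by metis
  obtain B where B: "schwartz_bound M B f" by (rule schwartz_bound_exists[OF f])
  show "\<exists>B. schwartz_bound m B (fourier f)" using C[OF f B] by blast
qed


section \<open>Fourier inversion\<close>

definition inverse_fourier :: "(real ^ 'n \<Rightarrow> complex) \<Rightarrow> real ^ 'n \<Rightarrow> complex" where
  "inverse_fourier f \<xi> = inverse ((2 * complex_of_real pi) ^ CARD('n)) * fourier f (- \<xi>)"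

lemma gaussian_fourier_1d:
  "integrable lborel (\<lambda>t :: real. exp (- (\<i> * complex_of_real (t * s))) * complex_of_real (exp (- t\<^sup>2 / 2)))" (is ?A)
  "(LINT t|lborel. exp (- (\<i> * complex_of_real (t * s))) * complex_of_real (exp (- t\<^sup>2 / 2))) =
    complex_of_real (sqrt (2 * pi) * exp (- s\<^sup>2 / 2))" (is ?B)
proof -
  have *: "complex_of_real (exp (- t\<^sup>2 / 2)) = complex_of_real (sqrt (2 * pi) * std_normal_density t)" for t
    by (simp add: std_normal_density_def)
  have i: "integrable lborel (\<lambda>t. complex_of_real (sqrt (2 * pi) * std_normal_density t))"
    by (intro integrable_of_real integrable_mult_right) (simp add: integrable_normal_density)
  show ?A
    unfolding *
  proof (rule Bochner_Integration.integrable_bound[OF i])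
    show "AE t in lborel. norm (exp (- (\<i> * complex_of_real (t * s))) * complex_of_real (sqrt (2 * pi) * std_normal_density t))
        \<le> norm (complex_of_real (sqrt (2 * pi) * std_normal_density t))"
      using norm_exp_i_times[of "- (t * s)" for t] by (intro AE_I2) (simp add: norm_mult)
  qed measurable
  have "char std_normal_distribution (- s) = (LINT t|lborel. std_normal_density t *\<^sub>R iexp (- s * t))"
    unfolding char_def by (subst integral_density) auto
  then have "(LINT t|lborel. std_normal_density t *\<^sub>R iexp (- s * t)) = complex_of_real (exp (- s\<^sup>2 / 2))"
    by (simp add: char_std_normal_distribution)
  moreover have "(\<lambda>t. exp (- (\<i> * complex_of_real (t * s))) * complex_of_real (exp (- t\<^sup>2 / 2))) =
      (\<lambda>t. complex_of_real (sqrt (2 * pi)) * (std_normal_density t *\<^sub>R iexp (- s * t)))"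
    unfolding * by (simp add: scaleR_conv_of_real mult_ac)
  ultimately show ?B
    by (simp only: integral_mult_right_zero of_real_mult)
qed

definition gaussian :: "real ^ 'n \<Rightarrow> complex" where
  "gaussian x = complex_of_real (exp (- (norm x)\<^sup>2 / 2))"

lemma gaussian_prod: "gaussian x = (\<Prod>i\<in>UNIV. complex_of_real (exp (- (x $ i)\<^sup>2 / 2)))"
proof -
  have "- (norm x)\<^sup>2 / 2 = (\<Sum>i\<in>UNIV. - (x $ i)\<^sup>2 / 2)"
    by (simp add: norm_vec_def L2_set_def sum_nonneg sum_negf sum_divide_distrib)
  then show ?thesis by (simp add: gaussian_def exp_sum)
qed

lemma character_prod: "character \<xi> x = (\<Prod>i\<in>UNIV. exp (- (\<i> * complex_of_real (x $ i * \<xi> $ i))))"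
proof -
  have "- (\<i> * complex_of_real (x \<bullet> \<xi>)) = (\<Sum>i\<in>UNIV. - (\<i> * complex_of_real (x $ i * \<xi> $ i)))"
    by (simp add: inner_vec_def sum_negf sum_distrib_left)
  then show ?thesis by (simp only: exp_sum finite)
qed

lemma
  fixes \<xi> :: "real ^ 'n"
  shows gaussian_integrable: "integrable lebesgue (gaussian :: real ^ 'n \<Rightarrow> complex)"
    and fourier_gaussian: "fourier gaussian \<xi> = complex_of_real (sqrt (2 * pi)) ^ CARD('n) * gaussian \<xi>"
proof -
  have eq: "character \<xi> x * gaussian x =
      (\<Prod>i\<in>UNIV. exp (- (\<i> * complex_of_real (x $ i * \<xi> $ i))) * complex_of_real (exp (- (x $ i)\<^sup>2 / 2)))"
    for x \<xi> :: "real ^ 'n"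
    unfolding character_prod gaussian_prod prod.distrib ..
  have "integrable lebesgue (\<lambda>x :: real ^ 'n. character 0 x * gaussian x)"
    unfolding eq
    by (rule integrable_prod_components[where f = "\<lambda>i t. exp (- (\<i> * complex_of_real (t * 0 $ i))) * complex_of_real (exp (- t\<^sup>2 / 2))"])
      (rule gaussian_fourier_1d)
  then show "integrable lebesgue (gaussian :: real ^ 'n \<Rightarrow> complex)" by simp
  show "fourier gaussian \<xi> = complex_of_real (sqrt (2 * pi)) ^ CARD('n) * gaussian \<xi>"
    unfolding fourier_def eq
    by (subst integral_prod_components[where f = "\<lambda>i t. exp (- (\<i> * complex_of_real (t * \<xi> $ i))) * complex_of_real (exp (- t\<^sup>2 / 2))"])
      (rule gaussian_fourier_1d, simp only: gaussian_fourier_1d(2), simp add: prod.distrib gaussian_prod)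
qed

lemma norm_gaussian_le: "norm (gaussian x) \<le> 1"
  by (simp add: gaussian_def)

lemma gaussian_measurable: "gaussian \<in> borel_measurable borel"
  unfolding gaussian_def[abs_def] by (intro borel_measurable_continuous_onI continuous_intros) auto

text \<open>Inversion: by Fubini's theorem, the Gaussian means of the inversion integral are averages of
  \<open>f (x + \<epsilon> z)\<close> with respect to a Gaussian weight in \<open>z\<close>.\<close>

lemma fourier_inversion_gaussian_mean:
  fixes f :: "real ^ 'n \<Rightarrow> complex"
  assumes f: "f \<in> schwartz_functions" and \<epsilon>: "0 < \<epsilon>"
  shows "(LINT \<xi>|lebesgue. character (- x) \<xi> * fourier f \<xi> * gaussian (\<epsilon> *\<^sub>R \<xi>)) =
    complex_of_real (sqrt (2 * pi)) ^ CARD('n) * (LINT z|lebesgue. f (x + \<epsilon> *\<^sub>R z) * gaussian z)"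
proof -
  define w where "w \<xi> = character (- x) \<xi> * gaussian (\<epsilon> *\<^sub>R \<xi>)" for \<xi> :: "real ^ 'n"
  have g\<epsilon>: "integrable lebesgue (\<lambda>\<xi> :: real ^ 'n. gaussian (\<epsilon> *\<^sub>R \<xi>))"
    using integrable_affine[OF gaussian_measurable, of \<epsilon> 0] \<epsilon> gaussian_integrable by simp
  have w: "integrable lebesgue w"
    unfolding w_def by (rule integrable_character_mult[OF g\<epsilon>])
  have wm: "w \<in> borel_measurable borel"
    unfolding w_def[abs_def]
    by (intro borel_measurable_times borel_measurable_character measurable_compose[OF _ gaussian_measurable]) simp
  define c where "c = complex_of_real (sqrt (2 * pi)) ^ CARD('n)"
  have fw: "complex_of_real (\<epsilon> ^ CARD('n)) * fourier w y = c * gaussian ((1 / \<epsilon>) *\<^sub>R (y - x))" for y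
  proof -
    have *: "character (y - x) \<xi> = character y \<xi> * character (- x) \<xi>" for \<xi>
      using character_add_left[where \<xi> = y and \<eta> = "- x" and x = \<xi>] by (simp only: add_uminus_conv_diff)
    have "fourier w y = (LINT \<xi>|lebesgue. character (y - x) \<xi> * gaussian (\<epsilon> *\<^sub>R \<xi>))"
      unfolding fourier_def w_def * by (simp only: mult.assoc)
    also have "\<dots> = (LINT \<xi>|lebesgue. character ((1 / \<epsilon>) *\<^sub>R (y - x)) (0 + \<epsilon> *\<^sub>R \<xi>) * gaussian (0 + \<epsilon> *\<^sub>R \<xi>))"
      using \<epsilon> by simp
    finally have "complex_of_real (\<epsilon> ^ CARD('n)) * fourier w y =
        \<bar>\<epsilon>\<bar> ^ CARD('n) *\<^sub>R (LINT \<xi>|lebesgue. character ((1 / \<epsilon>) *\<^sub>R (y - x)) (0 + \<epsilon> *\<^sub>R \<xi>) * gaussian (0 + \<epsilon> *\<^sub>R \<xi>))"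
      using \<epsilon> by (simp add: scaleR_conv_of_real)
    also have "\<dots> = (LINT \<xi>|lebesgue. character ((1 / \<epsilon>) *\<^sub>R (y - x)) \<xi> * gaussian \<xi>)"
      by (rule integral_affine[symmetric])
        (use \<epsilon> in \<open>auto intro!: borel_measurable_times borel_measurable_character gaussian_measurable\<close>)
    also have "\<dots> = c * gaussian ((1 / \<epsilon>) *\<^sub>R (y - x))"
      using fourier_gaussian[of "(1 / \<epsilon>) *\<^sub>R (y - x)"] by (simp add: fourier_def c_def)
    finally show ?thesis .
  qed
  have "(LINT \<xi>|lebesgue. character (- x) \<xi> * fourier f \<xi> * gaussian (\<epsilon> *\<^sub>R \<xi>)) = (LINT \<xi>|lebesgue. w \<xi> * fourier f \<xi>)"
    by (simp add: w_def mult_ac)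
  also have "\<dots> = (LINT y|lebesgue. f y * (LINT \<xi>|lebesgue. character \<xi> y * w \<xi>))"
    unfolding fourier_def
  proof (rule Fubini_bounded_kernel[OF w schwartz_integrable[OF f], where k = "\<lambda>\<xi> y. character \<xi> y" and B = 1])
    show "norm (character \<xi> y) \<le> 1" for \<xi> y :: "real ^ 'n" by (simp only: norm_character)
  qed (rule borel_measurable_character_pair)
  also have "\<dots> = (LINT y|lebesgue. f y * fourier w y)"
    by (simp add: fourier_def inner_commute)
  also have "\<dots> = (LINT z|lebesgue. complex_of_real (\<epsilon> ^ CARD('n)) * (f (x + \<epsilon> *\<^sub>R z) * fourier w (x + \<epsilon> *\<^sub>R z)))"
  proof (subst integral_affine[where c = \<epsilon> and t = x])
    have "fourier w = (\<lambda>y. complex_of_real (inverse (\<epsilon> ^ CARD('n))) * (c * gaussian ((1 / \<epsilon>) *\<^sub>R (y - x))))"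
      using \<epsilon> by (auto simp flip: fw)
    then have "fourier w \<in> borel_measurable borel"
      by (simp only:) (intro borel_measurable_times borel_measurable_const measurable_compose[OF _ gaussian_measurable], simp)
    then show "(\<lambda>y. f y * fourier w y) \<in> borel_measurable borel"
      by (intro borel_measurable_times schwartz_measurable[OF f])
  qed (use \<epsilon> in \<open>simp_all add: scaleR_conv_of_real\<close>)
  also have "\<dots> = (LINT z|lebesgue. c * (f (x + \<epsilon> *\<^sub>R z) * gaussian z))"
  proof (rule Bochner_Integration.integral_cong[OF refl])
    fix z :: "real ^ 'n"
    have "complex_of_real (\<epsilon> ^ CARD('n)) * fourier w (x + \<epsilon> *\<^sub>R z) = c * gaussian z"
      using fw[of "x + \<epsilon> *\<^sub>R z"] \<epsilon> by simp
    then show "complex_of_real (\<epsilon> ^ CARD('n)) * (f (x + \<epsilon> *\<^sub>R z) * fourier w (x + \<epsilon> *\<^sub>R z)) =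
        c * (f (x + \<epsilon> *\<^sub>R z) * gaussian z)"
      by (metis mult.assoc mult.commute)
  qed
  finally show ?thesis by (simp add: c_def)
qed

text \<open>Let the width \<open>\<epsilon>\<close> of the average tend to zero. The constant comes out right since the Gaussian
  has the integral \<open>(2 \<pi>) ^ (n / 2)\<close>.\<close>

lemma inverse_fourier_fourier:
  fixes f :: "real ^ 'n \<Rightarrow> complex"
  assumes f: "f \<in> schwartz_functions"
  shows "inverse_fourier (fourier f) = f"
proof
  fix x
  define c where "c = complex_of_real (sqrt (2 * pi)) ^ CARD('n)"
  define e where "e j = 1 / real (Suc j)" for j
  have e: "e \<longlonglongrightarrow> 0"
    unfolding e_def using LIMSEQ_inverse_real_of_nat by (simp add: divide_inverse)
  have e0: "0 < e j" for j by (simp add: e_def)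
  note ff = fourier_schwartz[OF f]
  have gc: "isCont (gaussian :: real ^ 'n \<Rightarrow> complex) y" for y
    unfolding gaussian_def[abs_def] by (intro continuous_intros) auto
  have fc: "isCont f y" for y
    using smooth_differentiable[OF schwartz_smooth[OF f]] by (rule differentiable_imp_continuous_within)
  have "(\<lambda>j. LINT \<xi>|lebesgue. character (- x) \<xi> * fourier f \<xi> * gaussian (e j *\<^sub>R \<xi>))
      \<longlonglongrightarrow> (LINT \<xi>|lebesgue. character (- x) \<xi> * fourier f \<xi>)"
  proof (rule integral_dominated_convergence[where w = "\<lambda>\<xi>. norm (fourier f \<xi>)"])
    have m: "(\<lambda>\<xi>. character (- x) \<xi> * fourier f \<xi>) \<in> borel_measurable borel"
      by (intro borel_measurable_times borel_measurable_character schwartz_measurable[OF ff])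
    then show "(\<lambda>\<xi>. character (- x) \<xi> * fourier f \<xi>) \<in> borel_measurable lebesgue"
      by (rule measurable_lebesgue_of_borel)
    show "(\<lambda>\<xi>. character (- x) \<xi> * fourier f \<xi> * gaussian (e j *\<^sub>R \<xi>)) \<in> borel_measurable lebesgue" for j
      by (rule measurable_lebesgue_of_borel, rule borel_measurable_times[OF m])
        (rule measurable_compose[OF _ gaussian_measurable], simp)
    show "integrable lebesgue (\<lambda>\<xi>. norm (fourier f \<xi>))"
      by (rule integrable_norm[OF schwartz_integrable[OF ff]])
    show "AE \<xi> in lebesgue. norm (character (- x) \<xi> * fourier f \<xi> * gaussian (e j *\<^sub>R \<xi>)) \<le> norm (fourier f \<xi>)" for j
      by (intro AE_I2) (simp add: norm_mult norm_character norm_gaussian_le mult_left_le del: inner_minus_right)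
    show "AE \<xi> in lebesgue. (\<lambda>j. character (- x) \<xi> * fourier f \<xi> * gaussian (e j *\<^sub>R \<xi>))
        \<longlonglongrightarrow> character (- x) \<xi> * fourier f \<xi>"
    proof (rule AE_I2)
      fix \<xi> :: "real ^ 'n"
      have "(\<lambda>j. gaussian (e j *\<^sub>R \<xi>)) \<longlonglongrightarrow> gaussian (0 *\<^sub>R \<xi>)"
        by (intro isCont_tendsto_compose[OF gc] tendsto_scaleR e tendsto_const)
      then have "(\<lambda>j. character (- x) \<xi> * fourier f \<xi> * gaussian (e j *\<^sub>R \<xi>))
          \<longlonglongrightarrow> character (- x) \<xi> * fourier f \<xi> * gaussian (0 *\<^sub>R \<xi>)"
        by (rule tendsto_mult_left)
      then show "(\<lambda>j. character (- x) \<xi> * fourier f \<xi> * gaussian (e j *\<^sub>R \<xi>))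
          \<longlonglongrightarrow> character (- x) \<xi> * fourier f \<xi>"
        by (simp add: gaussian_def)
    qed
  qed
  then have l1: "(\<lambda>j. c * (LINT z|lebesgue. f (x + e j *\<^sub>R z) * gaussian z)) \<longlonglongrightarrow> fourier (fourier f) (- x)"
    unfolding fourier_inversion_gaussian_mean[OF f e0] c_def[symmetric] by (simp only: fourier_def)
  obtain B where B: "schwartz_bound 0 B f" by (rule schwartz_bound_exists[OF f])
  have fB: "norm (f y) \<le> B" for y using schwartz_boundD0[OF B order_refl, of y] by simp
  have "(\<lambda>j. LINT z|lebesgue. f (x + e j *\<^sub>R z) * gaussian z) \<longlonglongrightarrow> (LINT z|lebesgue. f x * gaussian (z :: real ^ 'n))"
  proof (rule integral_dominated_convergence[where w = "\<lambda>z :: real ^ 'n. B * norm (gaussian z)"])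
    show "(\<lambda>z :: real ^ 'n. f x * gaussian z) \<in> borel_measurable lebesgue"
      by (intro measurable_lebesgue_of_borel borel_measurable_times borel_measurable_const gaussian_measurable)
    show "(\<lambda>z. f (x + e j *\<^sub>R z) * gaussian z) \<in> borel_measurable lebesgue" for j
      by (rule measurable_lebesgue_of_borel, rule borel_measurable_times[OF _ gaussian_measurable])
        (rule measurable_compose[OF _ schwartz_measurable[OF f]], simp)
    show "integrable lebesgue (\<lambda>z :: real ^ 'n. B * norm (gaussian z))"
      by (intro integrable_mult_right integrable_norm gaussian_integrable)
    show "AE z in lebesgue. norm (f (x + e j *\<^sub>R z) * gaussian z) \<le> B * norm (gaussian z)" for j
      using fB by (intro AE_I2) (simp add: norm_mult mult_right_mono)
    show "AE z in lebesgue. (\<lambda>j. f (x + e j *\<^sub>R z) * gaussian z) \<longlonglongrightarrow> f x * gaussian z"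
    proof (rule AE_I2)
      fix z :: "real ^ 'n"
      have "(\<lambda>j. x + e j *\<^sub>R z) \<longlonglongrightarrow> x + 0 *\<^sub>R z"
        by (intro tendsto_add tendsto_scaleR e tendsto_const)
      then have "(\<lambda>j. x + e j *\<^sub>R z) \<longlonglongrightarrow> x" by simp
      then show "(\<lambda>j. f (x + e j *\<^sub>R z) * gaussian z) \<longlonglongrightarrow> f x * gaussian z"
        by (intro tendsto_mult_right isCont_tendsto_compose[OF fc])
    qed
  qed
  then have l2: "(\<lambda>j. c * (LINT z|lebesgue. f (x + e j *\<^sub>R z) * gaussian z)) \<longlonglongrightarrow> c * (LINT z|lebesgue. f x * gaussian (z :: real ^ 'n))"
    by (rule tendsto_mult_left)
  have "fourier (fourier f) (- x) = c * (f x * (LINT z|lebesgue. gaussian (z :: real ^ 'n)))"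
    using LIMSEQ_unique[OF l1 l2] by (simp only: integral_mult_right_zero)
  moreover have "(LINT z|lebesgue. gaussian (z :: real ^ 'n)) = c"
    using fourier_gaussian[of "0 :: real ^ 'n"] by (simp add: fourier_def c_def gaussian_def)
  moreover have "c * c = (2 * complex_of_real pi) ^ CARD('n)"
    unfolding c_def power_mult_distrib[symmetric] of_real_mult[symmetric] by simp
  ultimately have "fourier (fourier f) (- x) = (2 * complex_of_real pi) ^ CARD('n) * f x"
    by (metis mult.assoc mult.commute)
  moreover have "inverse a * (a * f x) = f x" if "a \<noteq> 0" for a
    using that by (simp add: mult.assoc[symmetric])
  moreover have "(2 * complex_of_real pi) ^ CARD('n) \<noteq> 0" by simp
  ultimately show "inverse_fourier (fourier f) x = f x"
    unfolding inverse_fourier_def by metis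
qed

lemma schwartz_bound_reflect:
  assumes "smooth f" "schwartz_bound M B f"
  shows "schwartz_bound M B (\<lambda>x. f (- x))"
  unfolding schwartz_bound_def
proof (intro allI impI)
  fix \<alpha> :: "'a list" and x assume "length \<alpha> \<le> M"
  then have "japanese (- x) ^ M * norm (partials \<alpha> f (- x)) \<le> B"
    using assms(2) by (auto simp: schwartz_bound_def)
  moreover have "norm (partials \<alpha> (\<lambda>x. f (- x)) x) = norm (partials \<alpha> f (- x))"
    using partials_affine[OF assms(1), of \<alpha> "-1" 0] by (simp add: norm_mult norm_power)
  ultimately show "japanese x ^ M * norm (partials \<alpha> (\<lambda>x. f (- x)) x) \<le> B"
    by (simp add: japanese_minus)
qed

lemma schwartz_reflect:
  assumes f: "f \<in> schwartz_functions" shows "(\<lambda>x. f (- x)) \<in> schwartz_functions"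
proof (rule schwartzI)
  show "smooth (\<lambda>x. f (- x))"
    using smooth_affine[OF schwartz_smooth[OF f], of "-1" 0] by simp
  fix M obtain B where "schwartz_bound M B f" by (rule schwartz_bound_exists[OF f])
  then show "\<exists>B. schwartz_bound M B (\<lambda>x. f (- x))"
    using schwartz_bound_reflect[OF schwartz_smooth[OF f]] by blast
qed

lemma inverse_fourier_schwartz:
  assumes f: "f \<in> schwartz_functions" shows "inverse_fourier f \<in> schwartz_functions"
  unfolding inverse_fourier_def[abs_def]
  by (rule schwartz_cmult[OF schwartz_reflect[OF fourier_schwartz[OF f]]])

lemma inverse_fourier_schwartz_bound:
  obtains C M where "0 \<le> C"
    "\<And>(f :: real ^ 'n \<Rightarrow> complex) B. f \<in> schwartz_functions \<Longrightarrow> schwartz_bound M B f \<Longrightarrow>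
      schwartz_bound m (C * B) (inverse_fourier f)"
proof -
  obtain C M where C: "0 \<le> C"
    "\<And>(f :: real ^ 'n \<Rightarrow> complex) B. f \<in> schwartz_functions \<Longrightarrow> schwartz_bound M B f \<Longrightarrow>
      schwartz_bound m (C * B) (fourier f)"
    using fourier_schwartz_bound[of m] by metis
  let ?c = "inverse ((2 * complex_of_real pi) ^ CARD('n))"
  show thesis
  proof
    show "0 \<le> norm ?c * C" using C(1) by simp
    fix f :: "real ^ 'n \<Rightarrow> complex" and B
    assume f: "f \<in> schwartz_functions" and B: "schwartz_bound M B f"
    note sf = schwartz_smooth[OF fourier_schwartz[OF f]]
    have "schwartz_bound m (norm ?c * (C * B)) (inverse_fourier f)"
      unfolding inverse_fourier_def[abs_def]
      by (rule schwartz_bound_cmult[OF _ schwartz_bound_reflect[OF sf C(2)[OF f B]]])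
        (rule schwartz_smooth[OF schwartz_reflect[OF fourier_schwartz[OF f]]])
    then show "schwartz_bound m (norm ?c * C * B) (inverse_fourier f)"
      by (simp only: mult.assoc)
  qed
qed

lemma fourier_reflect:
  assumes "f \<in> borel_measurable borel"
  shows "fourier (\<lambda>x. f (- x)) \<xi> = fourier f (- \<xi>)"
proof -
  have "fourier f (- \<xi>) = (LINT x|lebesgue. character (- \<xi>) (0 - x) * f (0 - x))"
    unfolding fourier_def
    by (rule integral_reflection[symmetric]) (intro borel_measurable_times borel_measurable_character assms)
  then show ?thesis by (simp add: fourier_def)
qed

lemma fourier_inverse_fourier:
  fixes f :: "real ^ 'n \<Rightarrow> complex"
  assumes f: "f \<in> schwartz_functions" shows "fourier (inverse_fourier f) = f"
proof
  fix x
  let ?g = "\<lambda>x. f (- x)"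
  have eq: "inverse_fourier f = (\<lambda>\<xi>. inverse ((2 * complex_of_real pi) ^ CARD('n)) * fourier ?g \<xi>)"
    by (simp add: inverse_fourier_def fun_eq_iff fourier_reflect[OF schwartz_measurable[OF f]])
  have "fourier (inverse_fourier f) x = inverse ((2 * complex_of_real pi) ^ CARD('n)) * fourier (fourier ?g) x"
    unfolding eq by (rule fourier_cmult)
  also have "\<dots> = inverse_fourier (fourier ?g) (- x)"
    by (simp add: inverse_fourier_def)
  finally show "fourier (inverse_fourier f) x = f x"
    by (simp add: inverse_fourier_fourier[OF schwartz_reflect[OF f]])
qed


section \<open>Density of test functions\<close>

text \<open>Take \<open>F\<^sub>j x = b (x / (j + 1)) * f x\<close> with a bump \<open>b\<close> that equals \<open>1\<close> on the unit ball. The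
  error \<open>(b (x / (j + 1)) - 1) * f x\<close> lives where \<open>\<bar>x\<bar> \<ge> j + 1\<close>, so that one spare power of
  \<open>japanese x\<close> in the bound for \<open>f\<close> yields the factor \<open>1 / (j + 1)\<close>.\<close>

lemma schwartz_approx:
  fixes f :: "real ^ 'n \<Rightarrow> complex"
  assumes f: "f \<in> schwartz_functions"
  obtains F where "\<And>j :: nat. F j \<in> test_functions"
    "\<And>M. \<exists>C. \<forall>j. schwartz_bound M (C / real (Suc j)) (\<lambda>x. F j x + (- 1) * f x)"
proof -
  obtain b :: "real ^ 'n \<Rightarrow> real" where b: "smooth (\<lambda>x. complex_of_real (b x))"
    "\<And>x. dist 0 x \<le> 1 \<Longrightarrow> b x = 1" "\<And>x. 2 * 1 \<le> dist 0 x \<Longrightarrow> b x = 0"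
    using bump_exists[of 1 "0 :: real ^ 'n"] by (metis zero_less_one)
  let ?b = "\<lambda>x. complex_of_real (b x)"
  have bt: "?b \<in> test_functions"
    by (rule test_functionsI(1)[OF b(1), of "cball 0 2"]) (use b(3) in auto)
  define c where "c j = 1 / real (Suc j)" for j
  have c: "0 < c j" "c j \<le> 1" for j by (auto simp: c_def)
  define F where "F j x = ?b (c j *\<^sub>R x) * f x" for j x
  have sb: "smooth (\<lambda>x. ?b (c j *\<^sub>R x))" for j
    using smooth_affine[OF b(1), of "c j" 0] by simp
  note sf = schwartz_smooth[OF f]
  show thesis
  proof
    fix j
    show "F j \<in> test_functions"
    proof (rule test_functionsI(1))
      show "smooth (F j)" unfolding F_def[abs_def] by (rule smooth_mult[OF sb sf])
      show "compact (cball (0 :: real ^ 'n) (2 / c j))" by simp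
      fix x :: "real ^ 'n" assume "x \<notin> cball 0 (2 / c j)"
      then have "2 * 1 \<le> dist 0 (c j *\<^sub>R x)" using c[of j] by (simp add: field_simps)
      then show "F j x = 0" by (simp add: F_def b(3))
    qed
  next
    fix M
    obtain A where A: "schwartz_bound (Suc M) A ?b"
      by (rule schwartz_bound_exists[OF test_functions_schwartz[OF bt]])
    obtain B where B: "schwartz_bound (Suc M) B f" by (rule schwartz_bound_exists[OF f])
    define C where "C = 2 ^ Suc M * (A + 1) * B"
    have C0: "0 \<le> C"
      using schwartz_bound_nonneg[OF A] schwartz_bound_nonneg[OF B] by (simp add: C_def)
    have "schwartz_bound M (C / real (Suc j)) (\<lambda>x. F j x + (- 1) * f x)" for j
    proof -
      define h where "h x = ?b (c j *\<^sub>R x) - 1" for x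
      have sh: "smooth h" unfolding h_def[abs_def] by (intro smooth_diff sb smooth_const)
      have eq: "(\<lambda>x. F j x + (- 1) * f x) = (\<lambda>x. h x * f x)"
        by (simp add: F_def h_def algebra_simps)
      have hb: "norm (partials \<beta> h x) \<le> A + 1" if "length \<beta> \<le> Suc M" for \<beta> x
      proof -
        have "partials \<beta> h x = of_real (c j) ^ length \<beta> * partials \<beta> ?b (c j *\<^sub>R x) - (if \<beta> = [] then 1 else 0)"
          unfolding h_def[abs_def] partials_diff[OF sb smooth_const] partials_const
          using partials_affine[OF b(1), of \<beta> "c j" 0] by simp
        then have "norm (partials \<beta> h x) \<le> norm (of_real (c j) ^ length \<beta> * partials \<beta> ?b (c j *\<^sub>R x)) + norm (if \<beta> = [] then 1 else 0 :: complex)"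
          by (metis norm_triangle_ineq4)
        also have "norm (of_real (c j) ^ length \<beta> * partials \<beta> ?b (c j *\<^sub>R x)) \<le> 1 * A"
          unfolding norm_mult
        proof (rule mult_mono)
          show "norm (of_real (c j) ^ length \<beta> :: complex) \<le> 1"
            using c[of j] by (simp add: norm_power power_le_one)
          show "norm (partials \<beta> ?b (c j *\<^sub>R x)) \<le> A"
            using schwartz_boundD[OF A that, of 0] by simp
        qed auto
        finally show ?thesis by (auto split: if_splits)
      qed
      have hf: "schwartz_bound (Suc M) C (\<lambda>x. h x * f x)"
        unfolding C_def by (rule schwartz_bound_mult[OF sh hb sf B])
      show ?thesis
        unfolding eq schwartz_bound_def
      proof (intro allI impI)
        fix \<alpha> :: "'n list" and x assume \<alpha>: "length \<alpha> \<le> M"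
        show "japanese x ^ M * norm (partials \<alpha> (\<lambda>x. h x * f x) x) \<le> C / real (Suc j)"
        proof (cases "norm x < real (Suc j)")
          case True
          have "partials \<alpha> (\<lambda>x. h x * f x) x = 0"
          proof (rule partials_zero_open[where V = "ball 0 (real (Suc j))"])
            fix y :: "real ^ 'n" assume "y \<in> ball 0 (real (Suc j))"
            then have "dist 0 (c j *\<^sub>R y) \<le> 1" by (simp add: c_def field_simps)
            then show "h y * f y = 0" by (simp add: h_def b(2))
          qed (use True in auto)
          then show ?thesis using C0 by simp
        next
          case False
          then have J: "real (Suc j) \<le> japanese x" using norm_le_japanese[of x] by linarith
          have "japanese x * (japanese x ^ M * norm (partials \<alpha> (\<lambda>x. h x * f x) x)) \<le> C"
            using hf \<alpha> by (auto simp: schwartz_bound_def mult.assoc)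
          moreover have "real (Suc j) * (japanese x ^ M * norm (partials \<alpha> (\<lambda>x. h x * f x) x)) \<le>
              japanese x * (japanese x ^ M * norm (partials \<alpha> (\<lambda>x. h x * f x) x))"
            using J japanese_pos[of x] by (intro mult_right_mono) auto
          ultimately have "real (Suc j) * (japanese x ^ M * norm (partials \<alpha> (\<lambda>x. h x * f x) x)) \<le> C"
            by linarith
          then show ?thesis by (simp add: pos_le_divide_eq mult.commute)
        qed
      qed
    qed
    then show "\<exists>C. \<forall>j. schwartz_bound M (C / real (Suc j)) (\<lambda>x. F j x + (- 1) * f x)"
      by blast
  qed
qed

lemma tempered_add:
  "U \<in> tempered_distributions \<Longrightarrow> f \<in> schwartz_functions \<Longrightarrow> g \<in> schwartz_functions \<Longrightarrow>
    U (\<lambda>x. f x + g x) = U f + U g"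
  by (simp add: tempered_distributions_def linear_form_on_def)

lemma tempered_cmult:
  "U \<in> tempered_distributions \<Longrightarrow> f \<in> schwartz_functions \<Longrightarrow> U (\<lambda>x. c * f x) = c * U f"
  by (simp add: tempered_distributions_def linear_form_on_def)

lemma tendsto_const_over_nat: "(\<lambda>j. C / real (Suc j)) \<longlonglongrightarrow> 0"
  using tendsto_mult_right_zero[OF LIMSEQ_inverse_real_of_nat, of C] by (simp add: divide_inverse)

lemma tendsto_zero_of_le_over_nat:
  assumes "\<And>j. norm (a j) \<le> C / real (Suc j)" shows "a \<longlonglongrightarrow> 0"
  by (rule Lim_null_comparison[OF always_eventually tendsto_const_over_nat]) (use assms in blast)

lemma tempered_limit:
  assumes U: "U \<in> tempered_distributions" and f: "f \<in> schwartz_functions"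
    and F: "\<And>j :: nat. F j \<in> schwartz_functions"
      "\<And>M. \<exists>C. \<forall>j. schwartz_bound M (C / real (Suc j)) (\<lambda>x. F j x + (- 1) * f x)"
  shows "(\<lambda>j. U (F j)) \<longlonglongrightarrow> U f"
proof (rule tempered_bound[OF U])
  fix K M
  assume K: "0 \<le> K"
    "\<And>f B. f \<in> schwartz_functions \<Longrightarrow> schwartz_bound M B f \<Longrightarrow> norm (U f) \<le> K * B"
  obtain C where C: "\<And>j. schwartz_bound M (C / real (Suc j)) (\<lambda>x. F j x + (- 1) * f x)"
    using F(2)[of M] by blast
  have "norm (U (F j) - U f) \<le> K * (C / real (Suc j))" for j
  proof -
    have "U (\<lambda>x. F j x + (- 1) * f x) = U (F j) + U (\<lambda>x. (- 1) * f x)"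
      by (rule tempered_add[OF U F(1) schwartz_cmult[OF f]])
    moreover have "U (\<lambda>x. (- 1) * f x) = (- 1) * U f"
      by (rule tempered_cmult[OF U f])
    moreover have "norm (U (\<lambda>x. F j x + (- 1) * f x)) \<le> K * (C / real (Suc j))"
      by (rule K(2)[OF schwartz_add[OF F(1) schwartz_cmult[OF f]] C])
    ultimately have "norm (U (F j) + (- 1) * U f) \<le> K * (C / real (Suc j))"
      by (simp only:)
    then show ?thesis by simp
  qed
  then have "(\<lambda>j. U (F j) - U f) \<longlonglongrightarrow> 0"
    by (intro tendsto_zero_of_le_over_nat[where C = "K * C"]) simp
  then show ?thesis by (rule LIM_zero_cancel)
qed

lemma tempered_determined:
  assumes U: "U \<in> tempered_distributions" and V: "V \<in> tempered_distributions"
    and eq: "\<And>\<phi>. \<phi> \<in> test_functions \<Longrightarrow> U \<phi> = V \<phi>" and f: "f \<in> schwartz_functions"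
  shows "U f = V f"
proof -
  obtain F where F: "\<And>j :: nat. F j \<in> test_functions"
    "\<And>M. \<exists>C. \<forall>j. schwartz_bound M (C / real (Suc j)) (\<lambda>x. F j x + (- 1) * f x)"
    using schwartz_approx[OF f] by metis
  note Fs = test_functions_schwartz[OF F(1)]
  have "(\<lambda>j. U (F j)) \<longlonglongrightarrow> V f"
    using tempered_limit[OF V f Fs F(2)] by (simp add: eq F(1))
  with tempered_limit[OF U f Fs F(2)] show ?thesis
    by (rule LIMSEQ_unique)
qed


section \<open>Functions are determined by their integrals against test functions\<close>

lemma integrable_locally_integrable_mult:
  fixes g :: "real ^ 'n \<Rightarrow> complex"
  assumes g: "locally_integrable g" and \<phi>: "\<phi> \<in> borel_measurable lebesgue"
    and L: "compact L" "\<And>x. x \<notin> L \<Longrightarrow> \<phi> x = 0" and B: "\<And>x. norm (\<phi> x) \<le> B"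
  shows "integrable lebesgue (\<lambda>x. g x * \<phi> x)"
proof -
  have i: "integrable lebesgue (\<lambda>x. indicator L x *\<^sub>R g x)"
    using g L(1) unfolding locally_integrable_def set_integrable_def by blast
  have "(\<lambda>x. \<phi> x * (indicator L x *\<^sub>R g x)) = (\<lambda>x. g x * \<phi> x)"
  proof
    fix x show "\<phi> x * (indicator L x *\<^sub>R g x) = g x * \<phi> x"
      using L(2)[of x] by (cases "x \<in> L") (auto simp: mult.commute)
  qed
  with integrable_mult_bounded[OF i \<phi> B] show ?thesis by simp
qed

text \<open>The indicator function of \<open>K\<close> is the pointwise limit of cut-offs whose supports shrink to \<open>K\<close>.\<close>

lemma integral_compact_eq_0:
  fixes g :: "real ^ 'n \<Rightarrow> complex"
  assumes g: "locally_integrable g"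
    and 0: "\<And>\<phi>. \<phi> \<in> test_functions \<Longrightarrow> (LINT x|lebesgue. g x * \<phi> x) = 0" and K: "compact K"
  shows "(LINT x|lebesgue. indicator K x *\<^sub>R g x) = 0"
proof -
  have "\<exists>h :: real ^ 'n \<Rightarrow> real. smooth (\<lambda>x. complex_of_real (h x)) \<and> (\<forall>x. 0 \<le> h x \<and> h x \<le> 1) \<and>
      (\<forall>x\<in>K. h x = 1) \<and> (\<forall>x. h x \<noteq> 0 \<longrightarrow> (\<exists>y\<in>K. dist y x \<le> 1 / real (Suc j)))" for j
  proof -
    obtain h :: "real ^ 'n \<Rightarrow> real" and W L
      where "smooth (\<lambda>x. complex_of_real (h x))" "\<And>x. 0 \<le> h x" "\<And>x. h x \<le> 1"
        "open W" "K \<subseteq> W" "\<And>x. x \<in> W \<Longrightarrow> h x = 1"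
        "compact L" "\<And>x. x \<in> L \<Longrightarrow> \<exists>y\<in>K. dist y x \<le> 1 / real (Suc j)" "\<And>x. x \<notin> L \<Longrightarrow> h x = 0"
      using cutoff_exists[OF K, of "1 / real (Suc j)"] by (metis of_nat_0_less_iff zero_less_Suc zero_less_divide_1_iff)
    then show ?thesis by (intro exI[of _ h]) blast
  qed
  then obtain h :: "nat \<Rightarrow> real ^ 'n \<Rightarrow> real" where h: "\<And>j. smooth (\<lambda>x. complex_of_real (h j x))"
    "\<And>j x. 0 \<le> h j x \<and> h j x \<le> 1" "\<And>j x. x \<in> K \<Longrightarrow> h j x = 1"
    "\<And>j x. h j x \<noteq> 0 \<Longrightarrow> \<exists>y\<in>K. dist y x \<le> 1 / real (Suc j)"
    by metis
  obtain R where R: "\<And>y. y \<in> K \<Longrightarrow> norm y \<le> R"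
    using compact_imp_bounded[OF K] bounded_iff by blast
  define L where "L = cball (0 :: real ^ 'n) (R + 1)"
  have L: "compact L" by (simp add: L_def)
  have out: "h j x = 0" if "x \<notin> L" for j x
  proof (rule ccontr)
    assume "h j x \<noteq> 0"
    then obtain y where y: "y \<in> K" "dist y x \<le> 1 / real (Suc j)" using h(4) by blast
    have "1 / real (Suc j) \<le> 1" by simp
    then have "dist y x \<le> 1" using y(2) by linarith
    then have "norm x \<le> R + 1"
      using R[OF y(1)] norm_triangle_ineq[of y "x - y"] by (simp add: dist_norm norm_minus_commute)
    then show False using that by (simp add: L_def)
  qed
  have ht: "(\<lambda>x. complex_of_real (h j x)) \<in> test_functions" for j
    by (rule test_functionsI(1)[OF h(1) L]) (simp add: out)
  have hm: "(\<lambda>x. complex_of_real (h j x)) \<in> borel_measurable lebesgue" for j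
    by (rule measurable_lebesgue_of_borel[OF smooth_borel_measurable[OF h(1)]])
  have i: "integrable lebesgue (\<lambda>x. indicator L x *\<^sub>R g x)" "integrable lebesgue (\<lambda>x. indicator K x *\<^sub>R g x)"
    using g L K unfolding locally_integrable_def set_integrable_def by blast+
  have "(\<lambda>j. LINT x|lebesgue. g x * complex_of_real (h j x)) \<longlonglongrightarrow> (LINT x|lebesgue. indicator K x *\<^sub>R g x)"
  proof (rule integral_dominated_convergence[where w = "\<lambda>x. norm (indicator L x *\<^sub>R g x)"])
    show "(\<lambda>x. indicator K x *\<^sub>R g x) \<in> borel_measurable lebesgue" using i(2) by auto
    show "(\<lambda>x. g x * complex_of_real (h j x)) \<in> borel_measurable lebesgue" for j
      by (rule borel_measurable_integrable, rule integrable_locally_integrable_mult[OF g hm L, of _ 1])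
        (use out h(2) in auto)
    show "integrable lebesgue (\<lambda>x. norm (indicator L x *\<^sub>R g x))" using i(1) by (rule integrable_norm)
    show "AE x in lebesgue. norm (g x * complex_of_real (h j x)) \<le> norm (indicator L x *\<^sub>R g x)" for j
    proof (rule AE_I2)
      fix x
      have "norm (g x * complex_of_real (h j x)) \<le> norm (g x)"
        using h(2)[of j x] by (simp add: norm_mult mult_left_le)
      then show "norm (g x * complex_of_real (h j x)) \<le> norm (indicator L x *\<^sub>R g x)"
        using out[of x j] by (cases "x \<in> L") auto
    qed
    show "AE x in lebesgue. (\<lambda>j. g x * complex_of_real (h j x)) \<longlonglongrightarrow> indicator K x *\<^sub>R g x"
    proof (rule AE_I2)
      fix x
      show "(\<lambda>j. g x * complex_of_real (h j x)) \<longlonglongrightarrow> indicator K x *\<^sub>R g x"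
      proof (cases "x \<in> K")
        case True
        then show ?thesis using h(3)[OF True] by simp
      next
        case False
        have "open (- K)" using K by (simp add: compact_imp_closed open_Compl)
        then obtain e where e: "e > 0" "ball x e \<subseteq> - K" using False open_contains_ball by blast
        obtain N where N: "1 / real (Suc N) < e" using nat_approx_posE[OF e(1)] by blast
        have "h j x = 0" if "N \<le> j" for j
        proof (rule ccontr)
          assume "h j x \<noteq> 0"
          then obtain y where y: "y \<in> K" "dist y x \<le> 1 / real (Suc j)" using h(4) by blast
          have "1 / real (Suc j) \<le> 1 / real (Suc N)" using that by (simp add: frac_le)
          then have "y \<in> ball x e" using y N by (simp add: dist_commute)
          then show False using e y by blast
        qed
        then have "\<forall>\<^sub>F j in sequentially. g x * complex_of_real (h j x) = 0"
          unfolding eventually_sequentially by (intro exI[of _ N]) simp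
        then show ?thesis using False by (simp add: tendsto_eventually)
      qed
    qed
  qed
  then show ?thesis using 0[OF ht] by (simp add: LIMSEQ_const_iff)
qed

text \<open>By inner regularity, \<open>{x. 0 < r x}\<close> would contain a compact set of positive measure if it were
  not a null set, and the integral of \<open>r\<close> over that set would be positive.\<close>

lemma AE_nonpos_of_compact_integrals:
  fixes r :: "real ^ 'n \<Rightarrow> real"
  assumes r: "r \<in> borel_measurable lebesgue"
    and i: "\<And>K. compact K \<Longrightarrow> integrable lebesgue (\<lambda>x. indicator K x *\<^sub>R r x)"
    and 0: "\<And>K. compact K \<Longrightarrow> (LINT x|lebesgue. indicator K x *\<^sub>R r x) = 0"
  shows "AE x in lebesgue. r x \<le> 0"
proof -
  define A where "A j = {x. 0 < r x} \<inter> cball 0 (real j)" for j :: nat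
  have A: "A j \<in> sets lebesgue" for j
  proof -
    have "{x \<in> space lebesgue. 0 < r x} \<in> sets lebesgue" using r by measurable
    then show ?thesis unfolding A_def by (intro sets.Int) auto
  qed
  have "A j \<in> null_sets lebesgue" for j
  proof -
    have "emeasure lebesgue (A j) \<le> 0 + e" if e: "0 < e" "e < top" for e :: ennreal
    proof -
      obtain d where d: "e = ennreal d" "0 < d" using e by (cases e) (auto simp: ennreal_less_zero_iff)
      obtain T where T: "closed T" "T \<subseteq> A j" "A j - T \<in> lmeasurable" "emeasure lebesgue (A j - T) < ennreal d"
        using sets_lebesgue_inner_closed[OF A d(2)] by metis
      have "T \<subseteq> cball 0 (real j)" using T(2) by (auto simp: A_def)
      then have "bounded T" by (rule bounded_subset[OF bounded_cball])
      then have cT: "compact T" using T(1) compact_eq_bounded_closed by blast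
      have nn: "0 \<le> indicator T x *\<^sub>R r x" for x
        using T(2) by (cases "x \<in> T") (auto simp: A_def)
      have "AE x in lebesgue. indicator T x *\<^sub>R r x = 0"
        by (rule iffD1[OF integral_nonneg_eq_0_iff_AE[OF i[OF cT]] 0[OF cT]]) (use nn in blast)
      then have "AE x in lebesgue. x \<notin> T"
      proof (rule AE_mp, intro AE_I2 impI notI)
        fix x assume "indicator T x *\<^sub>R r x = 0" "x \<in> T"
        moreover from \<open>x \<in> T\<close> have "0 < r x" using T(2) by (auto simp: A_def)
        ultimately show False by simp
      qed
      moreover have Ts: "T \<in> sets lebesgue"
        using T(1) by (intro sets_completionI_sets) (simp add: borel_closed)
      ultimately have "emeasure lebesgue T = 0"
        using AE_iff_null_sets[OF Ts] by blast
      moreover have "emeasure lebesgue (A j) \<le> emeasure lebesgue T + emeasure lebesgue (A j - T)"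
        using emeasure_subadditive[OF Ts fmeasurableD[OF T(3)]] T(2) by (simp add: Un_absorb1)
      ultimately show ?thesis using T(4) d by simp
    qed
    then have "emeasure lebesgue (A j) \<le> 0"
      by (rule ennreal_le_epsilon) auto
    then show ?thesis using A by (auto simp: null_sets_def)
  qed
  then have "(\<Union>j. A j) \<in> null_sets lebesgue" by (rule null_sets_UN)
  then have "AE x in lebesgue. x \<notin> (\<Union>j. A j)" by (rule AE_not_in)
  then show ?thesis
  proof (rule AE_mp, intro AE_I2 impI)
    fix x assume "x \<notin> (\<Union>j. A j)"
    moreover obtain j :: nat where "norm x \<le> real j" using real_arch_simple by blast
    ultimately show "r x \<le> 0" by (auto simp: A_def not_less)
  qed
qed

lemma AE_zero_of_test_integrals:
  fixes g :: "real ^ 'n \<Rightarrow> complex"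
  assumes g: "locally_integrable g" "g \<in> borel_measurable lebesgue"
    and 0: "\<And>\<phi>. \<phi> \<in> test_functions \<Longrightarrow> (LINT x|lebesgue. g x * \<phi> x) = 0"
  shows "AE x in lebesgue. g x = 0"
proof -
  have i: "integrable lebesgue (\<lambda>x. indicator K x *\<^sub>R g x)" if "compact K" for K
    using g that unfolding locally_integrable_def set_integrable_def by blast
  have z: "(LINT x|lebesgue. indicator K x *\<^sub>R g x) = 0" if "compact K" for K
    by (rule integral_compact_eq_0[OF g(1) _ that]) (rule 0)
  have ri: "integrable lebesgue (\<lambda>x. indicator K x *\<^sub>R L (g x)) \<and> (LINT x|lebesgue. indicator K x *\<^sub>R L (g x)) = 0"
    if K: "compact K" and L: "bounded_linear L" for K and L :: "complex \<Rightarrow> real"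
  proof -
    have eq: "(\<lambda>x. indicator K x *\<^sub>R L (g x)) = (\<lambda>x. L (indicator K x *\<^sub>R g x))"
      using bounded_linear.linear[OF L] by (simp add: linear_cmul)
    show ?thesis
      unfolding eq using integrable_bounded_linear[OF L i[OF K]] integral_bounded_linear[OF L i[OF K]] z[OF K]
        linear_0[OF bounded_linear.linear[OF L]] by simp
  qed
  have n: "AE x in lebesgue. L (g x) \<le> 0" if L: "bounded_linear L" for L :: "complex \<Rightarrow> real"
  proof (rule AE_nonpos_of_compact_integrals)
    have "L \<in> borel_measurable borel"
      using L by (intro borel_measurable_continuous_onI linear_continuous_on)
    from measurable_compose[OF g(2) this] show "(\<lambda>x. L (g x)) \<in> borel_measurable lebesgue" .
  qed (use ri[OF _ L] in blast)+
  have "AE x in lebesgue. Re (g x) \<le> 0" "AE x in lebesgue. - Re (g x) \<le> 0"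
    "AE x in lebesgue. Im (g x) \<le> 0" "AE x in lebesgue. - Im (g x) \<le> 0"
    by (rule n; intro bounded_linear_Re bounded_linear_Im bounded_linear_minus)+
  then show ?thesis
    by eventually_elim (simp add: complex_eq_iff)
qed

lemma locally_integrable_measurable:
  fixes g :: "real ^ 'n \<Rightarrow> complex"
  assumes "locally_integrable g" shows "g \<in> borel_measurable lebesgue"
proof (rule borel_measurable_LIMSEQ_metric)
  show "(\<lambda>x. indicator (cball 0 (real j)) x *\<^sub>R g x) \<in> borel_measurable lebesgue" for j :: nat
    using assms unfolding locally_integrable_def set_integrable_def by (auto dest: spec[of _ "cball 0 (real j)"])
  fix x :: "real ^ 'n"
  obtain N :: nat where N: "norm x \<le> real N" using real_arch_simple by blast
  have "\<forall>\<^sub>F j :: nat in sequentially. indicator (cball 0 (real j)) x *\<^sub>R g x = g x"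
    unfolding eventually_sequentially by (intro exI[of _ N]) (use N in auto)
  then show "(\<lambda>j :: nat. indicator (cball 0 (real j)) x *\<^sub>R g x) \<longlonglongrightarrow> g x"
    by (rule tendsto_eventually)
qed

text \<open>The two tempered extensions of \<open>u\<close> agree on test functions, hence by density on all Schwartz
  functions, in particular on the transforms of test functions.\<close>

lemma fourier_is_function_unique:
  fixes g g' :: "real ^ 'n \<Rightarrow> complex"
  assumes "fourier_is_function u g" "fourier_is_function u g'"
  shows "AE x in lebesgue. g x = g' x"
proof -
  obtain U where U: "U \<in> tempered_distributions" "\<forall>\<phi>\<in>test_functions. U \<phi> = u \<phi>" and g: "locally_integrable g"
    and Ug: "\<forall>\<phi>\<in>test_functions. fourier_dist U \<phi> = (LINT \<xi>|lebesgue. g \<xi> * \<phi> \<xi>)"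
    using assms(1) unfolding fourier_is_function_def by blast
  obtain V where V: "V \<in> tempered_distributions" "\<forall>\<phi>\<in>test_functions. V \<phi> = u \<phi>" and g': "locally_integrable g'"
    and Vg: "\<forall>\<phi>\<in>test_functions. fourier_dist V \<phi> = (LINT \<xi>|lebesgue. g' \<xi> * \<phi> \<xi>)"
    using assms(2) unfolding fourier_is_function_def by blast
  have "AE x in lebesgue. g x + (- 1) * g' x = 0"
  proof (rule AE_zero_of_test_integrals)
    have "integrable lebesgue (\<lambda>x. indicator K x *\<^sub>R g x + (- 1) * (indicator K x *\<^sub>R g' x))" if "compact K" for K
      using g g' that unfolding locally_integrable_def set_integrable_def
      by (intro Bochner_Integration.integrable_add integrable_mult_right) auto
    then show "locally_integrable (\<lambda>x. g x + (- 1) * g' x)"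
      unfolding locally_integrable_def set_integrable_def by (simp add: scaleR_right_diff_distrib)
    show "(\<lambda>x. g x + (- 1) * g' x) \<in> borel_measurable lebesgue"
      by (intro borel_measurable_add borel_measurable_times borel_measurable_const
          locally_integrable_measurable g g')
    fix \<phi> :: "real ^ 'n \<Rightarrow> complex" assume \<phi>: "\<phi> \<in> test_functions"
    obtain B where "schwartz_bound 0 B \<phi>" by (rule schwartz_bound_exists[OF test_functions_schwartz[OF \<phi>]])
    then have B: "norm (\<phi> x) \<le> B" for x using schwartz_boundD0[of 0 B \<phi> 0 x] by simp
    have m: "\<phi> \<in> borel_measurable lebesgue"
      by (rule measurable_lebesgue_of_borel[OF smooth_borel_measurable[OF test_functions_smooth[OF \<phi>]]])
    have i: "integrable lebesgue (\<lambda>x. k x * \<phi> x)" if "locally_integrable k" for k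
      by (rule integrable_locally_integrable_mult[OF that m test_functions_compact[OF \<phi>] fun_support_zero[of _ \<phi>] B])
    have "U (fourier \<phi>) = V (fourier \<phi>)"
      by (rule tempered_determined[OF U(1) V(1) _ fourier_schwartz[OF test_functions_schwartz[OF \<phi>]]])
        (simp add: U V)
    then have "(LINT x|lebesgue. g x * \<phi> x) = (LINT x|lebesgue. g' x * \<phi> x)"
      using Ug Vg \<phi> by (simp add: fourier_dist_def)
    moreover have "(LINT x|lebesgue. g x * \<phi> x - g' x * \<phi> x) = (LINT x|lebesgue. g x * \<phi> x) - (LINT x|lebesgue. g' x * \<phi> x)"
      by (rule Bochner_Integration.integral_diff[OF i[OF g] i[OF g']])
    ultimately show "(LINT x|lebesgue. (g x + (- 1) * g' x) * \<phi> x) = 0"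
      by (simp add: left_diff_distrib)
  qed
  then show ?thesis by eventually_elim simp
qed


section \<open>Parseval's formula\<close>

text \<open>Functions that define tempered distributions by integration.\<close>

definition tempered_function :: "(real ^ 'n \<Rightarrow> complex) \<Rightarrow> bool" where
  "tempered_function g \<longleftrightarrow> g \<in> borel_measurable lebesgue \<and>
    (\<exists>M. integrable lebesgue (\<lambda>x. norm (g x) / japanese x ^ M))"

lemma tempered_function_pairing:
  fixes g :: "real ^ 'n \<Rightarrow> complex"
  assumes g: "tempered_function g"
  shows "\<exists>C M. 0 \<le> C \<and> (\<forall>\<psi> B. \<psi> \<in> borel_measurable lebesgue \<longrightarrow> (\<forall>x. norm (\<psi> x) \<le> B / japanese x ^ M) \<longrightarrow>
    integrable lebesgue (\<lambda>x. g x * \<psi> x) \<and> norm (LINT x|lebesgue. g x * \<psi> x) \<le> C * B)"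
proof -
  obtain M where M: "integrable lebesgue (\<lambda>x. norm (g x) / japanese x ^ M)" and gm: "g \<in> borel_measurable lebesgue"
    using g by (auto simp: tempered_function_def)
  show ?thesis
  proof (intro exI conjI allI impI)
    show "0 \<le> (LINT x|lebesgue. norm (g x) / japanese x ^ M)"
      by (intro integral_nonneg_AE AE_I2 divide_nonneg_nonneg) (auto simp: japanese_pos less_imp_le)
    fix \<psi> :: "real ^ 'n \<Rightarrow> complex" and B
    assume \<psi>: "\<psi> \<in> borel_measurable lebesgue" "\<forall>x. norm (\<psi> x) \<le> B / japanese x ^ M"
    have le: "norm (g x * \<psi> x) \<le> B * (norm (g x) / japanese x ^ M)" for x
      using mult_left_mono[OF \<psi>(2)[rule_format, of x], of "norm (g x)"] by (simp add: norm_mult mult_ac)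
    show i: "integrable lebesgue (\<lambda>x. g x * \<psi> x)"
    proof (rule Bochner_Integration.integrable_bound[OF integrable_mult_right[OF M, of B]])
      show "(\<lambda>x. g x * \<psi> x) \<in> borel_measurable lebesgue" by (rule borel_measurable_times[OF gm \<psi>(1)])
      show "AE x in lebesgue. norm (g x * \<psi> x) \<le> norm (B * (norm (g x) / japanese x ^ M))"
        using le by (intro AE_I2) (metis abs_ge_self order_trans real_norm_def)
    qed
    have "norm (LINT x|lebesgue. g x * \<psi> x) \<le> (LINT x|lebesgue. norm (g x * \<psi> x))"
      by (rule integral_norm_bound)
    also have "\<dots> \<le> (LINT x|lebesgue. B * (norm (g x) / japanese x ^ M))"
      by (intro integral_mono integrable_norm i integrable_mult_right M le)
    also have "\<dots> = (LINT x|lebesgue. norm (g x) / japanese x ^ M) * B"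
      by (simp only: integral_mult_right_zero mult.commute)
    finally show "norm (LINT x|lebesgue. g x * \<psi> x) \<le> (LINT x|lebesgue. norm (g x) / japanese x ^ M) * B" .
  qed
qed

lemma tempered_function_pairing_schwartz:
  fixes g :: "real ^ 'n \<Rightarrow> complex"
  assumes g: "tempered_function g"
  shows "\<exists>C M. 0 \<le> C \<and> (\<forall>\<psi>\<in>schwartz_functions. \<forall>B. schwartz_bound M B \<psi> \<longrightarrow>
    integrable lebesgue (\<lambda>x. g x * \<psi> x) \<and> norm (LINT x|lebesgue. g x * \<psi> x) \<le> C * B)"
proof -
  obtain C M where C: "0 \<le> C" "\<forall>\<psi> B. \<psi> \<in> borel_measurable lebesgue \<longrightarrow> (\<forall>x. norm (\<psi> x) \<le> B / japanese x ^ M) \<longrightarrow>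
      integrable lebesgue (\<lambda>x. g x * \<psi> x) \<and> norm (LINT x|lebesgue. g x * \<psi> x) \<le> C * B"
    using tempered_function_pairing[OF g] by blast
  show ?thesis
  proof (rule exI[of _ C], rule exI[of _ M], rule conjI[OF C(1)], intro ballI allI impI)
    fix \<psi> :: "real ^ 'n \<Rightarrow> complex" and B
    assume \<psi>: "\<psi> \<in> schwartz_functions" and B: "schwartz_bound M B \<psi>"
    have "\<forall>x. norm (\<psi> x) \<le> B / japanese x ^ M"
      using schwartz_boundD0[OF B order_refl] by blast
    with C(2) measurable_lebesgue_of_borel[OF schwartz_measurable[OF \<psi>]]
    show "integrable lebesgue (\<lambda>x. g x * \<psi> x) \<and> norm (LINT x|lebesgue. g x * \<psi> x) \<le> C * B"
      by blast
  qed
qed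

lemma tempered_function_integrable_schwartz:
  assumes g: "tempered_function g" and \<psi>: "\<psi> \<in> schwartz_functions"
  shows "integrable lebesgue (\<lambda>x. g x * \<psi> x)"
proof -
  obtain C M where C: "\<forall>\<psi>\<in>schwartz_functions. \<forall>B. schwartz_bound M B \<psi> \<longrightarrow>
      integrable lebesgue (\<lambda>x. g x * \<psi> x) \<and> norm (LINT x|lebesgue. g x * \<psi> x) \<le> C * B"
    using tempered_function_pairing_schwartz[OF g] by blast
  obtain B where "schwartz_bound M B \<psi>" by (rule schwartz_bound_exists[OF \<psi>])
  with C \<psi> show ?thesis by blast
qed

lemma tempered_function_locally_integrable:
  fixes g :: "real ^ 'n \<Rightarrow> complex"
  assumes g: "tempered_function g" shows "locally_integrable g"
  unfolding locally_integrable_def set_integrable_def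
proof (intro allI impI)
  fix L :: "(real ^ 'n) set" assume L: "compact L"
  obtain M where M: "integrable lebesgue (\<lambda>x. norm (g x) / japanese x ^ M)" and gm: "g \<in> borel_measurable lebesgue"
    using g by (auto simp: tempered_function_def)
  have "compact ((\<lambda>x. japanese x ^ M) ` L)"
    by (intro compact_continuous_image continuous_on_power continuous_on_japanese L)
  then obtain B where B: "\<And>x. x \<in> L \<Longrightarrow> norm (japanese x ^ M) \<le> B"
    using compact_imp_bounded bounded_iff by (metis (no_types, lifting) imageI)
  show "integrable lebesgue (\<lambda>x. indicator L x *\<^sub>R g x)"
  proof (rule Bochner_Integration.integrable_bound[OF integrable_mult_right[OF M, of "\<bar>B\<bar>"]])
    have "L \<in> sets lebesgue" using L by (simp add: compact_imp_closed borel_closed)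
    then show "(\<lambda>x. indicator L x *\<^sub>R g x) \<in> borel_measurable lebesgue" using gm by measurable
    show "AE x in lebesgue. norm (indicator L x *\<^sub>R g x) \<le> norm (\<bar>B\<bar> * (norm (g x) / japanese x ^ M))"
    proof (rule AE_I2)
      fix x
      show "norm (indicator L x *\<^sub>R g x) \<le> norm (\<bar>B\<bar> * (norm (g x) / japanese x ^ M))"
      proof (cases "x \<in> L")
        case True
        have "japanese x ^ M \<le> \<bar>B\<bar>" using B[OF True] japanese_pos[of x] by simp
        then have "norm (g x) * japanese x ^ M \<le> norm (g x) * \<bar>B\<bar>" by (intro mult_left_mono) auto
        then show ?thesis using True japanese_pos[of x] by (simp add: abs_mult field_simps)
      qed simp
    qed
  qed
qed

text \<open>The tempered extension of \<open>u\<close> is the right hand side of the formula, read for all Schwartz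
  functions \<open>\<theta>\<close>; by inversion its transform is \<open>g\<close>.\<close>

lemma fourier_is_functionI:
  fixes g :: "real ^ 'n \<Rightarrow> complex"
  assumes g: "tempered_function g"
    and u: "\<And>\<theta>. \<theta> \<in> test_functions \<Longrightarrow> u \<theta> = (LINT \<xi>|lebesgue. g \<xi> * inverse_fourier \<theta> \<xi>)"
  shows "fourier_is_function u g"
proof -
  obtain K m where K: "0 \<le> K" "\<forall>\<psi>\<in>schwartz_functions. \<forall>B. schwartz_bound m B \<psi> \<longrightarrow>
      integrable lebesgue (\<lambda>x. g x * \<psi> x) \<and> norm (LINT x|lebesgue. g x * \<psi> x) \<le> K * B"
    using tempered_function_pairing_schwartz[OF g] by blast
  obtain C M where C: "0 \<le> C"
    "\<And>(f :: real ^ 'n \<Rightarrow> complex) B. f \<in> schwartz_functions \<Longrightarrow> schwartz_bound M B f \<Longrightarrow>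
      schwartz_bound m (C * B) (inverse_fourier f)"
    using inverse_fourier_schwartz_bound[of m] by metis
  define U where "U f = (LINT \<xi>|lebesgue. g \<xi> * inverse_fourier f \<xi>)" for f
  have i: "integrable lebesgue (\<lambda>\<xi>. g \<xi> * inverse_fourier f \<xi>)" if "f \<in> schwartz_functions" for f
    by (rule tempered_function_integrable_schwartz[OF g inverse_fourier_schwartz[OF that]])
  have "U \<in> tempered_distributions"
    unfolding tempered_distributions_def linear_form_on_def
  proof (intro CollectI conjI ballI allI exI)
    fix f h :: "real ^ 'n \<Rightarrow> complex" and c
    assume f: "f \<in> schwartz_functions"
    have "inverse_fourier (\<lambda>x. c * f x) \<xi> = c * inverse_fourier f \<xi>" for \<xi>
      unfolding inverse_fourier_def fourier_cmult by (simp only: mult.left_commute)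
    then have eq: "(\<lambda>\<xi>. g \<xi> * inverse_fourier (\<lambda>x. c * f x) \<xi>) = (\<lambda>\<xi>. c * (g \<xi> * inverse_fourier f \<xi>))"
      by (simp only: mult.left_commute)
    show "U (\<lambda>x. c * f x) = c * U f"
      unfolding U_def eq by (rule integral_mult_right_zero)
    show "norm (U f) \<le> K * C * schwartz_seminorm M f"
      unfolding U_def mult.assoc
      using K(2) inverse_fourier_schwartz[OF f] C(2)[OF f schwartz_bound_le_seminorm[OF f]] by blast
    assume h: "h \<in> schwartz_functions"
    have "inverse_fourier (\<lambda>x. f x + h x) \<xi> = inverse_fourier f \<xi> + inverse_fourier h \<xi>" for \<xi>
      unfolding inverse_fourier_def fourier_add[OF schwartz_integrable[OF f] schwartz_integrable[OF h]]
      by (rule distrib_left)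
    then have eq': "(\<lambda>\<xi>. g \<xi> * inverse_fourier (\<lambda>x. f x + h x) \<xi>) =
        (\<lambda>\<xi>. g \<xi> * inverse_fourier f \<xi> + g \<xi> * inverse_fourier h \<xi>)"
      by (simp only: distrib_left)
    show "U (\<lambda>x. f x + h x) = U f + U h"
      unfolding U_def eq' by (rule Bochner_Integration.integral_add[OF i[OF f] i[OF h]])
  qed
  moreover have "\<forall>\<phi>\<in>test_functions. U \<phi> = u \<phi>"
    using u by (simp add: U_def)
  moreover have "\<forall>\<phi>\<in>test_functions. fourier_dist U \<phi> = (LINT \<xi>|lebesgue. g \<xi> * \<phi> \<xi>)"
    by (simp add: fourier_dist_def U_def inverse_fourier_fourier[OF test_functions_schwartz])
  ultimately show ?thesis
    unfolding fourier_is_function_def using tempered_function_locally_integrable[OF g] by blast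
qed

text \<open>The definition of \<open>fourier_is_function\<close> describes the transform on test functions, but
  \<open>inverse_fourier \<theta>\<close> is only a Schwartz function. Approximating it by test functions gives the
  formula in the limit, since both sides are continuous.\<close>

lemma fourier_is_functionD:
  fixes g :: "real ^ 'n \<Rightarrow> complex"
  assumes ug: "fourier_is_function u g" and g: "tempered_function g" and \<theta>: "\<theta> \<in> test_functions"
  shows "u \<theta> = (LINT \<xi>|lebesgue. g \<xi> * inverse_fourier \<theta> \<xi>)"
proof -
  obtain U where U: "U \<in> tempered_distributions" "\<forall>\<phi>\<in>test_functions. U \<phi> = u \<phi>"
    and Ug: "\<forall>\<phi>\<in>test_functions. fourier_dist U \<phi> = (LINT \<xi>|lebesgue. g \<xi> * \<phi> \<xi>)"
    using ug unfolding fourier_is_function_def by blast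
  define f where "f = inverse_fourier \<theta>"
  have f: "f \<in> schwartz_functions"
    unfolding f_def by (rule inverse_fourier_schwartz[OF test_functions_schwartz[OF \<theta>]])
  obtain F where F: "\<And>j :: nat. F j \<in> test_functions"
    "\<And>M. \<exists>C. \<forall>j. schwartz_bound M (C / real (Suc j)) (\<lambda>x. F j x + (- 1) * f x)"
    using schwartz_approx[OF f] by metis
  note Fs = test_functions_schwartz[OF F(1)]
  note Fd = schwartz_add[OF Fs schwartz_cmult[OF f]]
  have "(\<lambda>j. U (fourier (F j))) \<longlonglongrightarrow> U (fourier f)"
  proof (rule tempered_limit[OF U(1) fourier_schwartz[OF f] fourier_schwartz[OF Fs]])
    fix m
    obtain C M where C: "\<And>(f :: real ^ 'n \<Rightarrow> complex) B. f \<in> schwartz_functions \<Longrightarrow> schwartz_bound M B f \<Longrightarrow>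
        schwartz_bound m (C * B) (fourier f)"
      using fourier_schwartz_bound[of m] by metis
    obtain A where A: "\<And>j. schwartz_bound M (A / real (Suc j)) (\<lambda>x. F j x + (- 1) * f x)"
      using F(2)[of M] by blast
    have "schwartz_bound m (C * A / real (Suc j)) (\<lambda>x. fourier (F j) x + (- 1) * fourier f x)" for j
    proof -
      have "fourier (\<lambda>x. F j x + (- 1) * f x) = (\<lambda>\<xi>. fourier (F j) \<xi> + (- 1) * fourier f \<xi>)"
        by (rule ext) (simp only: fourier_add[OF schwartz_integrable[OF Fs] schwartz_integrable[OF schwartz_cmult[OF f]]] fourier_cmult)
      then show ?thesis using C[OF Fd A, of j] by simp
    qed
    then show "\<exists>C. \<forall>j. schwartz_bound m (C / real (Suc j)) (\<lambda>x. fourier (F j) x + (- 1) * fourier f x)"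
      by blast
  qed
  moreover have "U (fourier f) = u \<theta>"
    unfolding f_def fourier_inverse_fourier[OF test_functions_schwartz[OF \<theta>]] using U(2) \<theta> by blast
  moreover have "U (fourier (F j)) = (LINT \<xi>|lebesgue. g \<xi> * F j \<xi>)" for j
    using Ug F(1) by (simp add: fourier_dist_def)
  ultimately have l1: "(\<lambda>j. LINT \<xi>|lebesgue. g \<xi> * F j \<xi>) \<longlonglongrightarrow> u \<theta>"
    by simp
  obtain K M where K: "0 \<le> K" "\<forall>\<psi>\<in>schwartz_functions. \<forall>B. schwartz_bound M B \<psi> \<longrightarrow>
      integrable lebesgue (\<lambda>x. g x * \<psi> x) \<and> norm (LINT x|lebesgue. g x * \<psi> x) \<le> K * B"
    using tempered_function_pairing_schwartz[OF g] by blast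
  obtain A where A: "\<And>j. schwartz_bound M (A / real (Suc j)) (\<lambda>x. F j x + (- 1) * f x)"
    using F(2)[of M] by blast
  have "norm ((LINT \<xi>|lebesgue. g \<xi> * F j \<xi>) - (LINT \<xi>|lebesgue. g \<xi> * f \<xi>)) \<le> K * (A / real (Suc j))" for j
  proof -
    have "(LINT \<xi>|lebesgue. g \<xi> * F j \<xi>) - (LINT \<xi>|lebesgue. g \<xi> * f \<xi>) = (LINT \<xi>|lebesgue. g \<xi> * F j \<xi> - g \<xi> * f \<xi>)"
      by (rule Bochner_Integration.integral_diff[symmetric, OF tempered_function_integrable_schwartz[OF g Fs] tempered_function_integrable_schwartz[OF g f]])
    also have "\<dots> = (LINT \<xi>|lebesgue. g \<xi> * (F j \<xi> + (- 1) * f \<xi>))"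
      by (simp add: right_diff_distrib)
    also have "norm \<dots> \<le> K * (A / real (Suc j))"
      using K(2) Fd[of j "- 1"] A[of j] by blast
    finally show ?thesis .
  qed
  then have "(\<lambda>j. (LINT \<xi>|lebesgue. g \<xi> * F j \<xi>) - (LINT \<xi>|lebesgue. g \<xi> * f \<xi>)) \<longlonglongrightarrow> 0"
    by (intro tendsto_zero_of_le_over_nat[where C = "K * A"]) simp
  then have "(\<lambda>j. LINT \<xi>|lebesgue. g \<xi> * F j \<xi>) \<longlonglongrightarrow> (LINT \<xi>|lebesgue. g \<xi> * f \<xi>)"
    by (rule LIM_zero_cancel)
  with l1 show ?thesis unfolding f_def by (rule LIMSEQ_unique)
qed


section \<open>Trigonometric sums over the integer lattice\<close>

lemma integral_exp_period:
  fixes m :: real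
  assumes m: "m \<in> \<int>"
  shows "integrable lborel (\<lambda>t :: real. indicator {0..2 * pi} t * exp (- (\<i> * complex_of_real (t * m))))" (is ?A)
    and "(LINT t|lborel. indicator {0..2 * pi} t * exp (- (\<i> * complex_of_real (t * m)))) =
      (if m = 0 then complex_of_real (2 * pi) else 0)" (is ?B)
proof -
  let ?f = "\<lambda>t :: real. exp (- (\<i> * complex_of_real (t * m)))"
  have eq: "indicator {0..2 * pi} t *\<^sub>R ?f t = indicator {0..2 * pi} t * ?f t" for t
    by (simp add: indicator_def)
  have c: "continuous_on {0..2 * pi} ?f" by (intro continuous_intros)
  have "set_integrable lborel {0..2 * pi} ?f" by (rule borel_integrable_atLeastAtMost'[OF c])
  then show ?A unfolding set_integrable_def eq .
  show ?B
  proof (cases "m = 0")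
    case True
    have "(LINT t|lborel. complex_of_real (indicator {0..2 * pi} t)) = complex_of_real (2 * pi)"
      unfolding integral_complex_of_real by simp
    moreover have "(\<lambda>t. indicator {0..2 * pi} t * ?f t) = (\<lambda>t. complex_of_real (indicator {0..2 * pi} t))"
      using True by (simp add: indicator_def fun_eq_iff)
    ultimately show ?thesis by (simp only: if_P[OF True])
  next
    case False
    define G where "G t = ?f t * (\<i> / complex_of_real m)" for t :: real
    have "((\<lambda>t. - (\<i> * complex_of_real (t * m))) has_vector_derivative (- (\<i> * complex_of_real m))) (at t within A)" for t A
      by (auto intro!: derivative_eq_intros simp: has_vector_derivative_def scaleR_conv_of_real)
    from field_vector_diff_chain_within[OF this DERIV_exp[THEN has_field_derivative_at_within]]
    have "(?f has_vector_derivative (- (\<i> * complex_of_real m) * ?f t)) (at t within A)" for t A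
      by (simp add: o_def)
    then have "(G has_vector_derivative (- (\<i> * complex_of_real m) * ?f t * (\<i> / complex_of_real m))) (at t within A)" for t A
      unfolding G_def[abs_def] by (rule has_vector_derivative_mult_left)
    moreover have "- (\<i> * complex_of_real m) * ?f t * (\<i> / complex_of_real m) = ?f t" for t
      using False by (simp add: field_simps)
    ultimately have "(G has_vector_derivative ?f t) (at t within A)" for t A
      by simp
    then have "(LINT t|lborel. indicator {0..2 * pi} t *\<^sub>R ?f t) = G (2 * pi) - G 0"
      by (intro integral_FTC_Icc c) auto
    moreover have "?f (2 * pi) = 1"
    proof -
      obtain j where j: "m = real_of_int j" using m by (auto elim: Ints_cases)
      show ?thesis
        by (subst exp_eq_1) (auto simp: j intro!: exI[of _ "- j"])
    qed
    ultimately have "(LINT t|lborel. indicator {0..2 * pi} t *\<^sub>R ?f t) = 0"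
      by (simp add: G_def)
    then show ?thesis using False by (simp only: eq if_False)
  qed
qed

definition cube :: "(real ^ 'n) set" where
  "cube = {x. \<forall>i. 0 \<le> x $ i \<and> x $ i \<le> 2 * pi}"

lemma indicator_cube: "indicator cube x = (\<Prod>i\<in>UNIV. indicator {0..2 * pi} (x $ i) :: complex)"
proof (cases "x \<in> cube")
  case True
  then show ?thesis by (simp add: cube_def)
next
  case False
  then obtain i where "x $ i \<notin> {0..2 * pi}" by (auto simp: cube_def)
  then have "(indicator {0..2 * pi} (x $ i) :: complex) = 0" by simp
  then have "\<exists>i\<in>UNIV. (indicator {0..2 * pi} (x $ i) :: complex) = 0" by blast
  then have "(\<Prod>i\<in>UNIV. indicator {0..2 * pi} (x $ i) :: complex) = 0" by (intro prod_zero) auto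
  then show ?thesis using False by simp
qed

lemma closed_cube: "closed (cube :: (real ^ 'n) set)"
proof -
  have eq: "(cube :: (real ^ 'n) set) = cbox 0 (\<chi> i. 2 * pi)" by (auto simp: cube_def mem_box_cart)
  show "closed (cube :: (real ^ 'n) set)" unfolding eq by (rule closed_cbox)
qed

lemma
  fixes \<gamma> :: "real ^ 'n"
  assumes \<gamma>: "\<gamma> \<in> integer_lattice"
  shows character_cube_integrable: "integrable lebesgue (\<lambda>x. indicator cube x * character \<gamma> x)"
    and character_cube_integral: "(LINT x|lebesgue. indicator cube x * character \<gamma> x) =
      (if \<gamma> = 0 then complex_of_real (2 * pi) ^ CARD('n) else 0)"
proof -
  have eq: "indicator cube x * character \<gamma> x =
      (\<Prod>i\<in>UNIV. indicator {0..2 * pi} (x $ i) * exp (- (\<i> * complex_of_real (x $ i * \<gamma> $ i))))" for x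
    unfolding indicator_cube character_prod prod.distrib ..
  have \<gamma>i: "\<gamma> $ i \<in> \<int>" for i using \<gamma> by (simp add: integer_lattice_def)
  note I = integral_exp_period[OF \<gamma>i]
  show "integrable lebesgue (\<lambda>x. indicator cube x * character \<gamma> x)"
    unfolding eq
    by (rule integrable_prod_components[where f = "\<lambda>i t. indicator {0..2 * pi} t * exp (- (\<i> * complex_of_real (t * \<gamma> $ i)))"])
      (rule I(1))
  have "(LINT x|lebesgue. indicator cube x * character \<gamma> x) =
      (\<Prod>i\<in>UNIV. if \<gamma> $ i = 0 then complex_of_real (2 * pi) else 0)"
    unfolding eq
    by (subst integral_prod_components[where f = "\<lambda>i t. indicator {0..2 * pi} t * exp (- (\<i> * complex_of_real (t * \<gamma> $ i)))"])
      (rule I(1), simp only: I(2))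
  also have "\<dots> = (if \<gamma> = 0 then complex_of_real (2 * pi) ^ CARD('n) else 0)"
  proof (cases "\<gamma> = 0")
    case False
    then obtain i where "\<gamma> $ i \<noteq> 0" by (auto simp: vec_eq_iff)
    then have "(\<Prod>i\<in>UNIV. if \<gamma> $ i = 0 then complex_of_real (2 * pi) else 0) = 0"
      by (intro prod_zero) auto
    with False show ?thesis by simp
  qed simp
  finally show "(LINT x|lebesgue. indicator cube x * character \<gamma> x) =
      (if \<gamma> = 0 then complex_of_real (2 * pi) ^ CARD('n) else 0)" .
qed

lemma integer_lattice_diff: "a \<in> integer_lattice \<Longrightarrow> b \<in> integer_lattice \<Longrightarrow> a - b \<in> integer_lattice"
  by (simp add: integer_lattice_def)

lemma cnj_character: "cnj (character \<gamma> x) = character (- \<gamma>) x"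
  by (simp add: exp_cnj)

text \<open>Expand the square; the characters are orthogonal on each translate of the cube of periods.\<close>

lemma trig_sum_cube:
  fixes c :: "real ^ 'n \<Rightarrow> complex"
  assumes \<Gamma>: "finite \<Gamma>" "\<Gamma> \<subseteq> integer_lattice"
  shows "(\<integral>\<^sup>+x. indicator cube x * ennreal ((norm (\<Sum>\<gamma>\<in>\<Gamma>. c \<gamma> * character \<gamma> (x + a)))\<^sup>2) \<partial>lebesgue) =
    ennreal ((2 * pi) ^ CARD('n) * (\<Sum>\<gamma>\<in>\<Gamma>. (norm (c \<gamma>))\<^sup>2))"
proof -
  define P where "P x = (\<Sum>\<gamma>\<in>\<Gamma>. c \<gamma> * character \<gamma> (x + a))" for x
  have eq: "complex_of_real (indicator cube x * (norm (P x))\<^sup>2) = (\<Sum>\<gamma>\<in>\<Gamma>. \<Sum>\<delta>\<in>\<Gamma>.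
      (c \<gamma> * cnj (c \<delta>) * character (\<gamma> - \<delta>) a) * (indicator cube x * character (\<gamma> - \<delta>) x))" for x
  proof -
    have "complex_of_real ((norm (P x))\<^sup>2) = P x * cnj (P x)" by (rule complex_norm_square)
    also have "\<dots> = (\<Sum>\<gamma>\<in>\<Gamma>. \<Sum>\<delta>\<in>\<Gamma>. (c \<gamma> * character \<gamma> (x + a)) * (cnj (c \<delta>) * character (- \<delta>) (x + a)))"
      unfolding P_def by (simp add: sum_product cnj_sum exp_cnj)
    also have "\<dots> = (\<Sum>\<gamma>\<in>\<Gamma>. \<Sum>\<delta>\<in>\<Gamma>. (c \<gamma> * cnj (c \<delta>) * character (\<gamma> - \<delta>) a) * character (\<gamma> - \<delta>) x)"
    proof (intro sum.cong refl)
      fix \<gamma> \<delta> :: "real ^ 'n"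
      have "character (\<gamma> - \<delta>) y = character \<gamma> y * character (- \<delta>) y" for y
        using character_add_left[where \<xi> = \<gamma> and \<eta> = "- \<delta>" and x = y] by (simp only: add_uminus_conv_diff)
      then show "(c \<gamma> * character \<gamma> (x + a)) * (cnj (c \<delta>) * character (- \<delta>) (x + a)) =
          (c \<gamma> * cnj (c \<delta>) * character (\<gamma> - \<delta>) a) * character (\<gamma> - \<delta>) x"
        by (simp only: character_add mult_ac)
    qed
    finally have *: "complex_of_real ((norm (P x))\<^sup>2) = (\<Sum>\<gamma>\<in>\<Gamma>. \<Sum>\<delta>\<in>\<Gamma>. (c \<gamma> * cnj (c \<delta>) * character (\<gamma> - \<delta>) a) * character (\<gamma> - \<delta>) x)" .
    show ?thesis
    proof (cases "x \<in> cube")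
      case True
      then have "indicator cube x = (1 :: complex)" "indicator cube x = (1 :: real)" by simp_all
      then show ?thesis using * by (simp only: mult_1_left)
    next
      case False
      then have "indicator cube x = (0 :: complex)" "indicator cube x = (0 :: real)" by simp_all
      then show ?thesis by (simp only: mult_zero_left mult_zero_right sum.neutral_const of_real_0)
    qed
  qed
  have i: "integrable lebesgue (\<lambda>x. (c \<gamma> * cnj (c \<delta>) * character (\<gamma> - \<delta>) a) * (indicator cube x * character (\<gamma> - \<delta>) x))"
    if "\<gamma> \<in> \<Gamma>" "\<delta> \<in> \<Gamma>" for \<gamma> \<delta>
    using that \<Gamma>(2) by (intro integrable_mult_right character_cube_integrable integer_lattice_diff) auto
  have I: "integrable lebesgue (\<lambda>x. complex_of_real (indicator cube x * (norm (P x))\<^sup>2))"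
    unfolding eq by (intro Bochner_Integration.integrable_sum i)
  have "(LINT x|lebesgue. complex_of_real (indicator cube x * (norm (P x))\<^sup>2)) =
      (\<Sum>\<gamma>\<in>\<Gamma>. (LINT x|lebesgue. (\<Sum>\<delta>\<in>\<Gamma>.
        (c \<gamma> * cnj (c \<delta>) * character (\<gamma> - \<delta>) a) * (indicator cube x * character (\<gamma> - \<delta>) x))))"
    unfolding eq by (rule Bochner_Integration.integral_sum) (rule Bochner_Integration.integrable_sum, rule i)
  also have "\<dots> = (\<Sum>\<gamma>\<in>\<Gamma>. \<Sum>\<delta>\<in>\<Gamma>. (LINT x|lebesgue.
        (c \<gamma> * cnj (c \<delta>) * character (\<gamma> - \<delta>) a) * (indicator cube x * character (\<gamma> - \<delta>) x)))"
    by (intro sum.cong refl Bochner_Integration.integral_sum i)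
  also have "\<dots> = (\<Sum>\<gamma>\<in>\<Gamma>. \<Sum>\<delta>\<in>\<Gamma>.
        (c \<gamma> * cnj (c \<delta>) * character (\<gamma> - \<delta>) a) * (LINT x|lebesgue. indicator cube x * character (\<gamma> - \<delta>) x))"
    by (simp only: integral_mult_right_zero)
  also have "\<dots> = (\<Sum>\<gamma>\<in>\<Gamma>. \<Sum>\<delta>\<in>\<Gamma>. if \<gamma> = \<delta> then complex_of_real ((2 * pi) ^ CARD('n) * (norm (c \<gamma>))\<^sup>2) else 0)"
  proof (intro sum.cong refl)
    fix \<gamma> \<delta> assume *: "\<gamma> \<in> \<Gamma>" "\<delta> \<in> \<Gamma>"
    have "\<gamma> - \<delta> \<in> integer_lattice" using * \<Gamma>(2) integer_lattice_diff by blast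
    note C = character_cube_integral[OF this]
    show "(c \<gamma> * cnj (c \<delta>) * character (\<gamma> - \<delta>) a) * (LINT x|lebesgue. indicator cube x * character (\<gamma> - \<delta>) x) =
        (if \<gamma> = \<delta> then complex_of_real ((2 * pi) ^ CARD('n) * (norm (c \<gamma>))\<^sup>2) else 0)"
    proof (cases "\<gamma> = \<delta>")
      case True
      then have "c \<gamma> * cnj (c \<delta>) = complex_of_real ((norm (c \<gamma>))\<^sup>2)"
        using complex_norm_square[of "c \<gamma>"] by simp
      moreover have "character (\<gamma> - \<delta>) a = 1" using True by simp
      ultimately show ?thesis unfolding C using True by simp
    next
      case False
      then show ?thesis unfolding C by simp
    qed
  qed
  also have "\<dots> = complex_of_real ((2 * pi) ^ CARD('n) * (\<Sum>\<gamma>\<in>\<Gamma>. (norm (c \<gamma>))\<^sup>2))"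
    using \<Gamma>(1) by (simp add: sum_distrib_left)
  finally have "(LINT x|lebesgue. indicator cube x * (norm (P x))\<^sup>2) = (2 * pi) ^ CARD('n) * (\<Sum>\<gamma>\<in>\<Gamma>. (norm (c \<gamma>))\<^sup>2)"
    unfolding integral_complex_of_real of_real_eq_iff .
  moreover have "integrable lebesgue (\<lambda>x. indicator cube x * (norm (P x))\<^sup>2)"
    using I by (simp only: complex_of_real_integrable_eq)
  then have "(\<integral>\<^sup>+x. ennreal (indicator cube x * (norm (P x))\<^sup>2) \<partial>lebesgue) = ennreal (LINT x|lebesgue. indicator cube x * (norm (P x))\<^sup>2)"
    by (rule nn_integral_eq_integral) simp
  moreover have "indicator cube x * ennreal ((norm (P x))\<^sup>2) = ennreal (indicator cube x * (norm (P x))\<^sup>2)" for x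
    by (simp add: indicator_def)
  ultimately show ?thesis unfolding P_def by simp
qed

lemma japanese_cube:
  assumes "x \<in> cube" shows "japanese (x :: real ^ 'n) \<le> 1 + 2 * pi * CARD('n)"
proof -
  have "norm x \<le> (\<Sum>i\<in>UNIV. \<bar>x $ i\<bar>)" by (rule norm_le_l1_cart)
  also have "\<dots> \<le> (\<Sum>i::'n\<in>UNIV. 2 * pi)"
    using assms by (intro sum_mono) (auto simp: cube_def)
  finally have *: "norm x \<le> 2 * pi * CARD('n)" by (simp add: mult.commute)
  have "japanese x \<le> 1 + norm x"
    unfolding japanese_def by (rule real_le_lsqrt) (auto simp: power2_sum)
  then show ?thesis using * by linarith
qed

text \<open>The weight \<open>w\<close> changes by at most a constant factor under shifts by points of the cube.
  Averaging \<open>w (\<xi> - \<eta> - x)\<close> over such shifts \<open>x\<close> and exchanging the integrals, one integrates the square of the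
  sum over a translated cube for each value of the weight, and \<open>trig_sum_cube\<close> applies with a result
  that does not depend on the translation.\<close>

lemma trig_sum_weighted:
  "\<exists>C\<ge>0. \<forall>\<Gamma> (c :: real ^ 'n \<Rightarrow> complex) \<eta>. finite \<Gamma> \<longrightarrow> \<Gamma> \<subseteq> integer_lattice \<longrightarrow>
    (\<integral>\<^sup>+\<xi>. ennreal (inverse (japanese (\<xi> - \<eta>) ^ (2 * CARD('n)))) *
        ennreal ((norm (\<Sum>\<gamma>\<in>\<Gamma>. c \<gamma> * character \<gamma> \<xi>))\<^sup>2) \<partial>lebesgue)
      \<le> ennreal (C * (\<Sum>\<gamma>\<in>\<Gamma>. (norm (c \<gamma>))\<^sup>2))"
proof -
  define d where "d = 2 * CARD('n)"
  define K where "K = (2 * (1 + 2 * pi * CARD('n))) ^ d"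
  have K0: "0 \<le> K" by (simp add: K_def)
  define L where "L = (2 * pi) ^ CARD('n)"
  have L0: "0 < L" by (simp add: L_def)
  define w where "w \<xi> = inverse (japanese (\<xi> :: real ^ 'n) ^ d)" for \<xi>
  have w0: "0 \<le> w \<xi>" for \<xi> by (simp add: w_def japanese_pos less_imp_le)
  have [measurable]: "w \<in> borel_measurable borel" unfolding w_def[abs_def] by measurable
  define J where "J = (LINT \<xi>|lebesgue. w \<xi>)"
  have J: "(\<integral>\<^sup>+\<xi>. ennreal (w \<xi>) \<partial>lebesgue) = ennreal J"
    unfolding J_def using w0 integrable_japanese by (intro nn_integral_eq_integral) (auto simp: w_def d_def)
  have J0: "0 \<le> J" unfolding J_def using w0 by simp
  have ww: "w \<zeta> \<le> K * w (\<zeta> - x)" if "x \<in> cube" for \<zeta> x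
  proof -
    have "japanese (\<zeta> - x) \<le> 2 * japanese \<zeta> * japanese x"
      using japanese_add_le[of \<zeta> "- x"] by (simp add: japanese_minus)
    also have "\<dots> \<le> 2 * japanese \<zeta> * (1 + 2 * pi * CARD('n))"
      using japanese_cube[OF that] japanese_pos[of \<zeta>] by (intro mult_left_mono) auto
    finally have "japanese (\<zeta> - x) ^ d \<le> (2 * (1 + 2 * pi * CARD('n)) * japanese \<zeta>) ^ d"
      using japanese_pos[of "\<zeta> - x"] by (intro power_mono) (auto simp: mult_ac)
    then have "japanese (\<zeta> - x) ^ d \<le> K * japanese \<zeta> ^ d"
      by (simp add: K_def power_mult_distrib)
    then show ?thesis
      using japanese_pos[of \<zeta>] japanese_pos[of "\<zeta> - x"] by (simp add: w_def field_simps)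
  qed
  have cm: "cube \<in> sets borel" using closed_cube by (rule borel_closed)
  have Lc: "(\<integral>\<^sup>+x. indicator (cube :: (real ^ 'n) set) x \<partial>lebesgue) = ennreal L"
    using trig_sum_cube[of "{0 :: real ^ 'n}" "\<lambda>_. 1" 0] by (simp add: integer_lattice_def L_def del: nn_integral_indicator)
  show ?thesis
  proof (intro exI conjI allI impI)
    show "0 \<le> K * J" using K0 J0 by simp
    fix \<Gamma> :: "(real ^ 'n) set" and c :: "real ^ 'n \<Rightarrow> complex" and \<eta> :: "real ^ 'n"
    assume \<Gamma>: "finite \<Gamma>" "\<Gamma> \<subseteq> integer_lattice"
    define S where "S = (\<Sum>\<gamma>\<in>\<Gamma>. (norm (c \<gamma>))\<^sup>2)"
    define p where "p \<xi> = ennreal ((norm (\<Sum>\<gamma>\<in>\<Gamma>. c \<gamma> * character \<gamma> \<xi>))\<^sup>2)" for \<xi> :: "real ^ 'n"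
    define Q where "Q x = (indicator cube x :: ennreal)" for x :: "real ^ 'n"
    have pm [measurable]: "p \<in> borel_measurable borel" unfolding p_def[abs_def] by measurable
    have cube_p: "(\<integral>\<^sup>+x. Q x * p (x + a) \<partial>lebesgue) = ennreal (L * S)" for a
      unfolding p_def L_def S_def Q_def by (rule trig_sum_cube[OF \<Gamma>])
    have pc [measurable]: "Q \<in> borel_measurable borel"
      unfolding Q_def[abs_def] using cm by measurable
    have LQ: "(\<integral>\<^sup>+x. Q x \<partial>lebesgue) = ennreal L" unfolding Q_def by (rule Lc)
    have m1: "(\<lambda>q. Q (fst q) * (ennreal (w (snd q - \<eta> - fst q)) * p (snd q))) \<in> borel_measurable (lebesgue \<Otimes>\<^sub>M lebesgue)"
      by (rule measurable_pair_lebesgue_of_borel, unfold borel_prod[symmetric]) measurable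
    have m2: "(\<lambda>q. Q (fst q) * (ennreal (w (snd q)) * p (snd q + (\<eta> + fst q)))) \<in> borel_measurable (lebesgue \<Otimes>\<^sub>M lebesgue)"
      by (rule measurable_pair_lebesgue_of_borel, unfold borel_prod[symmetric]) measurable
    have "ennreal L * (\<integral>\<^sup>+\<xi>. ennreal (w (\<xi> - \<eta>)) * p \<xi> \<partial>lebesgue) =
        (\<integral>\<^sup>+\<xi>. (\<integral>\<^sup>+x. Q x * (ennreal (w (\<xi> - \<eta>)) * p \<xi>) \<partial>lebesgue) \<partial>lebesgue)"
    proof -
      have "(\<lambda>\<xi>. ennreal (w (\<xi> - \<eta>)) * p \<xi>) \<in> borel_measurable lebesgue"
        by (rule measurable_lebesgue_of_borel) measurable
      moreover have "(\<integral>\<^sup>+x. Q x * (ennreal (w (\<xi> - \<eta>)) * p \<xi>) \<partial>lebesgue) = ennreal L * (ennreal (w (\<xi> - \<eta>)) * p \<xi>)" for \<xi>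
        by (subst nn_integral_multc[OF measurable_lebesgue_of_borel[OF pc]]) (simp only: LQ)
      ultimately show ?thesis by (simp add: nn_integral_cmult)
    qed
    also have "\<dots> \<le> (\<integral>\<^sup>+\<xi>. (\<integral>\<^sup>+x. ennreal K * (Q x * (ennreal (w (\<xi> - \<eta> - x)) * p \<xi>)) \<partial>lebesgue) \<partial>lebesgue)"
    proof (intro nn_integral_mono)
      fix \<xi> x
      have "Q x * ennreal (w (\<xi> - \<eta>)) \<le> Q x * (ennreal K * ennreal (w (\<xi> - \<eta> - x)))"
        using ww[of x "\<xi> - \<eta>"] K0 w0 by (cases "x \<in> cube") (auto simp: Q_def ennreal_mult[symmetric] intro!: ennreal_leI)
      from mult_right_mono[OF this, of "p \<xi>"]
      show "Q x * (ennreal (w (\<xi> - \<eta>)) * p \<xi>) \<le> ennreal K * (Q x * (ennreal (w (\<xi> - \<eta> - x)) * p \<xi>))"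
        by (simp add: mult_ac)
    qed
    also have "\<dots> = ennreal K * (\<integral>\<^sup>+\<xi>. (\<integral>\<^sup>+x. Q x * (ennreal (w (\<xi> - \<eta> - x)) * p \<xi>) \<partial>lebesgue) \<partial>lebesgue)"
    proof -
      have "(\<lambda>\<xi>. \<integral>\<^sup>+x. Q x * (ennreal (w (\<xi> - \<eta> - x)) * p \<xi>) \<partial>lebesgue) \<in> borel_measurable lebesgue"
        by (rule lebesgue.borel_measurable_nn_integral, unfold case_prod_beta') (rule measurable_pair_lebesgue_of_borel, unfold borel_prod[symmetric], measurable)
      moreover have "(\<lambda>x. Q x * (ennreal (w (\<xi> - \<eta> - x)) * p \<xi>)) \<in> borel_measurable lebesgue" for \<xi>
        by (rule measurable_lebesgue_of_borel) measurable
      ultimately show ?thesis by (simp add: nn_integral_cmult)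
    qed
    also have "(\<integral>\<^sup>+\<xi>. (\<integral>\<^sup>+x. Q x * (ennreal (w (\<xi> - \<eta> - x)) * p \<xi>) \<partial>lebesgue) \<partial>lebesgue) =
        (\<integral>\<^sup>+x. (\<integral>\<^sup>+\<xi>. Q x * (ennreal (w (\<xi> - \<eta> - x)) * p \<xi>) \<partial>lebesgue) \<partial>lebesgue)"
      by (rule lebesgue_pair.Fubini') (use m1 in \<open>simp add: case_prod_beta'\<close>)
    also have "\<dots> = (\<integral>\<^sup>+x. (\<integral>\<^sup>+\<xi>. Q x * (ennreal (w \<xi>) * p (\<xi> + (\<eta> + x))) \<partial>lebesgue) \<partial>lebesgue)"
    proof (rule nn_integral_cong)
      fix x
      have "(\<lambda>\<xi>. Q x * (ennreal (w (\<xi> - \<eta> - x)) * p \<xi>)) \<in> borel_measurable borel" by measurable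
      moreover have "\<xi> + (\<eta> + x) - \<eta> - x = \<xi>" for \<xi> by simp
      ultimately
      show "(\<integral>\<^sup>+\<xi>. Q x * (ennreal (w (\<xi> - \<eta> - x)) * p \<xi>) \<partial>lebesgue) =
          (\<integral>\<^sup>+\<xi>. Q x * (ennreal (w \<xi>) * p (\<xi> + (\<eta> + x))) \<partial>lebesgue)"
        using nn_integral_translation[of "\<lambda>\<xi>. Q x * (ennreal (w (\<xi> - \<eta> - x)) * p \<xi>)" "\<eta> + x"] by (simp only:)
    qed
    also have "\<dots> = (\<integral>\<^sup>+\<xi>. (\<integral>\<^sup>+x. Q x * (ennreal (w \<xi>) * p (\<xi> + (\<eta> + x))) \<partial>lebesgue) \<partial>lebesgue)"
      by (rule lebesgue_pair.Fubini'[symmetric]) (use m2 in \<open>simp add: case_prod_beta'\<close>)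
    also have "\<dots> = (\<integral>\<^sup>+\<xi>. ennreal (w \<xi>) * ennreal (L * S) \<partial>lebesgue)"
    proof (rule nn_integral_cong)
      fix \<xi>
      have "(\<lambda>x. Q x * p (x + (\<xi> + \<eta>))) \<in> borel_measurable lebesgue"
        by (rule measurable_lebesgue_of_borel) measurable
      from nn_integral_cmult[OF this, of "ennreal (w \<xi>)"]
      show "(\<integral>\<^sup>+x. Q x * (ennreal (w \<xi>) * p (\<xi> + (\<eta> + x))) \<partial>lebesgue) = ennreal (w \<xi>) * ennreal (L * S)"
        unfolding cube_p by (simp add: mult_ac add_ac)
    qed
    also have "\<dots> = ennreal J * ennreal (L * S)"
      by (subst nn_integral_multc) (auto simp: J measurable_lebesgue_of_borel)
    finally have "ennreal L * (\<integral>\<^sup>+\<xi>. ennreal (w (\<xi> - \<eta>)) * p \<xi> \<partial>lebesgue) \<le> ennreal K * (ennreal J * ennreal (L * S))" .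
    also have "\<dots> = ennreal L * ennreal (K * J * S)"
      using K0 J0 L0 by (simp add: ennreal_mult'[symmetric] S_def sum_nonneg mult_ac)
    finally have "(\<integral>\<^sup>+\<xi>. ennreal (w (\<xi> - \<eta>)) * p \<xi> \<partial>lebesgue) \<le> ennreal (K * J * S)"
      using L0 by (simp add: ennreal_mult_le_mult_iff)
    then show "(\<integral>\<^sup>+\<xi>. ennreal (inverse (japanese (\<xi> - \<eta>) ^ (2 * CARD('n)))) *
        ennreal ((norm (\<Sum>\<gamma>\<in>\<Gamma>. c \<gamma> * character \<gamma> \<xi>))\<^sup>2) \<partial>lebesgue) \<le> ennreal (K * J * (\<Sum>\<gamma>\<in>\<Gamma>. (norm (c \<gamma>))\<^sup>2))"
      by (simp add: w_def d_def p_def S_def)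
  qed
qed


section \<open>Convolution with the transform of a cut-off\<close>

definition convolve :: "(real ^ 'n \<Rightarrow> complex) \<Rightarrow> (real ^ 'n \<Rightarrow> complex) \<Rightarrow> real ^ 'n \<Rightarrow> complex" where
  "convolve H g y = (LINT \<xi>|lebesgue. H (y - \<xi>) * g \<xi>)"

lemma schwartz_shift_bound:
  fixes H :: "real ^ 'n \<Rightarrow> complex"
  assumes H: "schwartz_bound M A H"
  shows "norm (H (y - \<xi>)) \<le> (A * 2 ^ M * japanese y ^ M) / japanese \<xi> ^ M"
proof -
  note A = schwartz_bound_nonneg[OF H]
  have j: "japanese \<xi> ^ M \<le> 2 ^ M * japanese y ^ M * japanese (y - \<xi>) ^ M"
    using japanese_power_add_le[of y "\<xi> - y" M] by (simp add: japanese_minus_commute)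
  have "norm (H (y - \<xi>)) \<le> A / japanese (y - \<xi>) ^ M"
    by (rule schwartz_boundD0[OF H order_refl])
  also have "\<dots> \<le> (A * 2 ^ M * japanese y ^ M) / japanese \<xi> ^ M"
    using mult_left_mono[OF j A] japanese_pos[of \<xi>] japanese_pos[of "y - \<xi>"]
    by (simp add: divide_simps mult_ac)
  finally show ?thesis .
qed

lemma schwartz_shift_measurable:
  fixes H :: "real ^ 'n \<Rightarrow> complex"
  assumes "H \<in> schwartz_functions"
  shows "(\<lambda>\<xi>. H (y - \<xi>)) \<in> borel_measurable borel"
  by (rule measurable_compose[OF _ schwartz_measurable[OF assms]]) simp

lemma schwartz_shift_measurable_pair:
  fixes H :: "real ^ 'n \<Rightarrow> complex"
  assumes "H \<in> schwartz_functions"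
  shows "(\<lambda>p. H (fst p - snd p)) \<in> borel_measurable (lebesgue \<Otimes>\<^sub>M lebesgue)"
proof (rule measurable_pair_lebesgue_of_borel)
  have "continuous_on UNIV (\<lambda>p :: (real ^ 'n) \<times> (real ^ 'n). fst p - snd p)"
    by (intro continuous_intros)
  then have "(\<lambda>p :: (real ^ 'n) \<times> (real ^ 'n). fst p - snd p) \<in> borel_measurable borel"
    by (rule borel_measurable_continuous_onI)
  from measurable_compose[OF this schwartz_measurable[OF assms]]
  show "(\<lambda>p. H (fst p - snd p)) \<in> borel_measurable borel" .
qed

lemma convolve_integrable:
  assumes g: "tempered_function g" and H: "H \<in> schwartz_functions"
  shows "integrable lebesgue (\<lambda>\<xi>. H (y - \<xi>) * g \<xi>)"
proof -
  obtain C M where C: "\<forall>\<psi> B. \<psi> \<in> borel_measurable lebesgue \<longrightarrow> (\<forall>x. norm (\<psi> x) \<le> B / japanese x ^ M) \<longrightarrow>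
      integrable lebesgue (\<lambda>x. g x * \<psi> x) \<and> norm (LINT x|lebesgue. g x * \<psi> x) \<le> C * B"
    using tempered_function_pairing[OF g] by blast
  obtain A where A: "schwartz_bound M A H" by (rule schwartz_bound_exists[OF H])
  have "integrable lebesgue (\<lambda>\<xi>. g \<xi> * H (y - \<xi>))"
    using C measurable_lebesgue_of_borel[OF schwartz_shift_measurable[OF H, of y]] schwartz_shift_bound[OF A, of y]
    by blast
  then show ?thesis by (simp only: mult.commute)
qed

lemma convolve_tempered:
  fixes g H :: "real ^ 'n \<Rightarrow> complex"
  assumes g: "tempered_function g" and H: "H \<in> schwartz_functions"
  shows "tempered_function (convolve H g)"
proof -
  obtain C M where C: "\<forall>\<psi> B. \<psi> \<in> borel_measurable lebesgue \<longrightarrow> (\<forall>x. norm (\<psi> x) \<le> B / japanese x ^ M) \<longrightarrow>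
      integrable lebesgue (\<lambda>x. g x * \<psi> x) \<and> norm (LINT x|lebesgue. g x * \<psi> x) \<le> C * B"
    using tempered_function_pairing[OF g] by blast
  obtain A where A: "schwartz_bound M A H" by (rule schwartz_bound_exists[OF H])
  have bound: "norm (convolve H g y) \<le> C * (A * 2 ^ M * japanese y ^ M)" for y
  proof -
    have "norm (LINT \<xi>|lebesgue. g \<xi> * H (y - \<xi>)) \<le> C * (A * 2 ^ M * japanese y ^ M)"
      using C measurable_lebesgue_of_borel[OF schwartz_shift_measurable[OF H, of y]] schwartz_shift_bound[OF A, of y]
      by blast
    then show ?thesis by (simp only: convolve_def mult.commute)
  qed
  have gm: "g \<in> borel_measurable lebesgue" using g by (simp add: tempered_function_def)
  have "(\<lambda>p. H (fst p - snd p) * g (snd p)) \<in> borel_measurable (lebesgue \<Otimes>\<^sub>M lebesgue)"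
    by (rule borel_measurable_times[OF schwartz_shift_measurable_pair[OF H] measurable_compose[OF measurable_snd gm]])
  then have m: "convolve H g \<in> borel_measurable lebesgue"
    unfolding convolve_def[abs_def]
    by (intro lebesgue.borel_measurable_lebesgue_integral) (simp add: case_prod_beta')
  let ?d = "2 * CARD('n)"
  have "integrable lebesgue (\<lambda>y. norm (convolve H g y) / japanese y ^ (M + ?d))"
  proof (rule integrable_of_decay)
    show "(\<lambda>y. norm (convolve H g y) / japanese y ^ (M + ?d)) \<in> borel_measurable lebesgue"
      using m measurable_lebesgue_of_borel[OF borel_measurable_japanese] by measurable
    show "norm (norm (convolve H g y) / japanese y ^ (M + ?d)) \<le> (C * (A * 2 ^ M)) / japanese y ^ ?d" for y
    proof -
      have "norm (convolve H g y) / japanese y ^ (M + ?d) \<le> C * (A * 2 ^ M * japanese y ^ M) / japanese y ^ (M + ?d)"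
        using bound[of y] japanese_pos[of y] by (intro divide_right_mono) auto
      also have "\<dots> = (C * (A * 2 ^ M)) / japanese y ^ ?d"
        using japanese_pos[of y] by (simp add: power_add)
      finally show ?thesis using japanese_pos[of y] by simp
    qed
  qed
  with m show ?thesis unfolding tempered_function_def by blast
qed

text \<open>Insert the inversion formula for \<open>\<theta>\<close> and exchange the integrals.\<close>

lemma inverse_fourier_mult:
  fixes h \<theta> :: "real ^ 'n \<Rightarrow> complex"
  assumes h: "h \<in> schwartz_functions" and \<theta>: "\<theta> \<in> schwartz_functions"
  shows "inverse_fourier (\<lambda>x. h x * \<theta> x) \<xi> = inverse ((2 * complex_of_real pi) ^ CARD('n)) *
    (LINT y|lebesgue. fourier h (y - \<xi>) * inverse_fourier \<theta> y)"
proof -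
  define \<psi> where "\<psi> = inverse_fourier \<theta>"
  have \<psi>: "\<psi> \<in> schwartz_functions" unfolding \<psi>_def by (rule inverse_fourier_schwartz[OF \<theta>])
  have \<theta>\<psi>: "\<theta> x = (LINT y|lebesgue. character x y * \<psi> y)" for x
  proof -
    have "fourier \<psi> x = \<theta> x" unfolding \<psi>_def by (rule fun_cong[OF fourier_inverse_fourier[OF \<theta>]])
    then show ?thesis unfolding fourier_def by (rule sym)
  qed
  define w where "w x = character (- \<xi>) x * h x" for x
  have w: "integrable lebesgue w"
    unfolding w_def by (rule integrable_character_mult[OF schwartz_integrable[OF h]])
  have "fourier (\<lambda>x. h x * \<theta> x) (- \<xi>) = (LINT x|lebesgue. w x * (LINT y|lebesgue. character x y * \<psi> y))"
    unfolding fourier_def w_def \<theta>\<psi>[symmetric] by (simp only: mult.assoc)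
  also have "\<dots> = (LINT y|lebesgue. \<psi> y * (LINT x|lebesgue. character x y * w x))"
  proof (rule Fubini_bounded_kernel[OF w schwartz_integrable[OF \<psi>], where k = "\<lambda>x y. character x y" and B = 1])
    show "norm (character x y) \<le> 1" for x y :: "real ^ 'n" by (simp only: norm_character)
  qed (rule borel_measurable_character_pair)
  also have "(\<lambda>y. \<psi> y * (LINT x|lebesgue. character x y * w x)) = (\<lambda>y. fourier h (y - \<xi>) * \<psi> y)"
  proof
    fix y
    have "character x y * w x = character (y - \<xi>) x * h x" for x
    proof -
      have "character x y = character y x" by (simp only: inner_commute)
      moreover have "character (y - \<xi>) x = character y x * character (- \<xi>) x"
        using character_add_left[where \<xi> = y and \<eta> = "- \<xi>" and x = x] by (simp only: add_uminus_conv_diff)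
      ultimately show ?thesis unfolding w_def by (simp only: mult.assoc)
    qed
    then show "\<psi> y * (LINT x|lebesgue. character x y * w x) = fourier h (y - \<xi>) * \<psi> y"
      by (simp only: fourier_def mult.commute[of "\<psi> y"])
  qed
  finally show ?thesis unfolding inverse_fourier_def \<psi>_def by simp
qed

text \<open>By Parseval's formula for \<open>u\<close>, the number \<open>v \<theta>\<close> is an integral of \<open>g\<close> against the convolution
  in \<open>inverse_fourier_mult\<close>; exchanging the integrals moves the convolution from \<open>\<theta>\<close> to \<open>g\<close>.\<close>

lemma fourier_is_function_mult:
  fixes g h :: "real ^ 'n \<Rightarrow> complex"
  assumes ug: "fourier_is_function u g" and g: "tempered_function g" and h: "h \<in> test_functions"
    and v: "\<And>\<theta>. \<theta> \<in> test_functions \<Longrightarrow> v \<theta> = u (\<lambda>x. h x * \<theta> x)"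
  shows "fourier_is_function v (\<lambda>y. inverse ((2 * complex_of_real pi) ^ CARD('n)) * convolve (fourier h) g y)"
proof -
  let ?c = "inverse ((2 * complex_of_real pi) ^ CARD('n))"
  define H where "H = fourier h"
  note hS = test_functions_schwartz[OF h]
  have H: "H \<in> schwartz_functions" unfolding H_def by (rule fourier_schwartz[OF hS])
  note cH = convolve_tempered[OF g H]
  have t: "tempered_function (\<lambda>y. ?c * convolve H g y)"
  proof -
    obtain M where M: "integrable lebesgue (\<lambda>x. norm (convolve H g x) / japanese x ^ M)"
      and m: "convolve H g \<in> borel_measurable lebesgue"
      using cH by (auto simp: tempered_function_def)
    have "integrable lebesgue (\<lambda>x. norm ?c * (norm (convolve H g x) / japanese x ^ M))"
      by (rule integrable_mult_right[OF M])
    then have "integrable lebesgue (\<lambda>x. norm (?c * convolve H g x) / japanese x ^ M)"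
      by (simp only: norm_mult times_divide_eq_right)
    moreover have "(\<lambda>y. ?c * convolve H g y) \<in> borel_measurable lebesgue"
      by (intro borel_measurable_times borel_measurable_const m)
    ultimately show ?thesis unfolding tempered_function_def by blast
  qed
  have *: "v \<theta> = (LINT y|lebesgue. (?c * convolve H g y) * inverse_fourier \<theta> y)" if \<theta>: "\<theta> \<in> test_functions" for \<theta>
  proof -
    define \<psi> where "\<psi> = inverse_fourier \<theta>"
    note \<theta>S = test_functions_schwartz[OF \<theta>]
    have \<psi>: "\<psi> \<in> schwartz_functions" unfolding \<psi>_def by (rule inverse_fourier_schwartz[OF \<theta>S])
    obtain M where M: "integrable lebesgue (\<lambda>x. norm (g x) / japanese x ^ M)" and gm: "g \<in> borel_measurable lebesgue"
      using g by (auto simp: tempered_function_def)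
    \<comment> \<open>Moving the weights into the kernel makes it bounded and both functions integrable.\<close>
    define J where "J x = complex_of_real (japanese x ^ M)" for x :: "real ^ 'n"
    have J0: "J x \<noteq> 0" for x using japanese_pos[of x] by (simp add: J_def)
    have nJ: "norm (J x) = japanese x ^ M" for x using japanese_pos[of x] by (simp add: J_def norm_power)
    have Jm: "J \<in> borel_measurable borel"
      unfolding J_def[abs_def] by measurable
    define g' where "g' x = g x * inverse (J x)" for x
    define \<psi>' where "\<psi>' x = J x * \<psi> x" for x
    define k where "k \<xi> y = H (y - \<xi>) * (J \<xi> * inverse (J y))" for \<xi> y
    have g': "integrable lebesgue g'"
    proof (rule Bochner_Integration.integrable_bound[OF M])
      show "g' \<in> borel_measurable lebesgue"
        unfolding g'_def[abs_def]
        by (intro borel_measurable_times gm borel_measurable_inverse measurable_lebesgue_of_borel[OF Jm])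
      show "AE x in lebesgue. norm (g' x) \<le> norm (norm (g x) / japanese x ^ M)"
        using japanese_pos by (intro AE_I2) (simp add: g'_def norm_mult norm_inverse nJ divide_inverse less_imp_le)
    qed
    have \<psi>': "integrable lebesgue \<psi>'"
    proof (rule Bochner_Integration.integrable_bound[OF schwartz_integrable_weight[OF \<psi>, of M]])
      show "\<psi>' \<in> borel_measurable lebesgue"
        unfolding \<psi>'_def[abs_def]
        by (rule measurable_lebesgue_of_borel[OF borel_measurable_times[OF Jm schwartz_measurable[OF \<psi>]]])
      show "AE x in lebesgue. norm (\<psi>' x) \<le> norm (japanese x ^ M * norm (\<psi> x))"
        using japanese_pos by (intro AE_I2) (simp add: \<psi>'_def norm_mult nJ less_imp_le)
    qed
    obtain A where A: "schwartz_bound M A H" by (rule schwartz_bound_exists[OF H])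
    have kB: "norm (k \<xi> y) \<le> A * 2 ^ M" for \<xi> y
    proof -
      have "norm (k \<xi> y) = norm (H (y - \<xi>)) * (japanese \<xi> ^ M / japanese y ^ M)"
        by (simp add: k_def norm_mult norm_inverse nJ divide_inverse)
      also have "\<dots> \<le> ((A * 2 ^ M * japanese y ^ M) / japanese \<xi> ^ M) * (japanese \<xi> ^ M / japanese y ^ M)"
        using japanese_pos[of \<xi>] japanese_pos[of y] by (intro mult_right_mono schwartz_shift_bound[OF A]) simp
      also have "\<dots> = A * 2 ^ M" using japanese_pos[of y] japanese_pos[of \<xi>] by simp
      finally show ?thesis .
    qed
    have km: "(\<lambda>p. k (fst p) (snd p)) \<in> borel_measurable borel"
    proof -
      have Hc: "continuous_on UNIV H" by (rule smooth_continuous_on[OF schwartz_smooth[OF H]])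
      have Jc: "continuous_on UNIV J"
        unfolding J_def[abs_def] by (intro continuous_on_of_real continuous_on_power continuous_on_japanese)
      have c1: "continuous_on UNIV (\<lambda>p :: (real ^ 'n) \<times> (real ^ 'n). snd p - fst p)"
        by (intro continuous_intros)
      have c2: "continuous_on UNIV (\<lambda>p. H (snd p - fst p))"
        by (rule continuous_on_compose2[OF Hc c1]) simp
      have c3: "continuous_on UNIV (\<lambda>p :: (real ^ 'n) \<times> (real ^ 'n). J (fst p))"
        by (rule continuous_on_compose2[OF Jc continuous_on_fst[OF continuous_on_id]]) simp
      have c4: "continuous_on UNIV (\<lambda>p :: (real ^ 'n) \<times> (real ^ 'n). J (snd p))"
        by (rule continuous_on_compose2[OF Jc continuous_on_snd[OF continuous_on_id]]) simp
      have "continuous_on UNIV (\<lambda>p. k (fst p) (snd p))"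
        unfolding k_def by (rule continuous_on_mult[OF c2 continuous_on_mult[OF c3 continuous_on_inverse[OF c4]]]) (simp add: J0)
      then show ?thesis by (rule borel_measurable_continuous_onI)
    qed
    have "v \<theta> = u (\<lambda>x. h x * \<theta> x)" by (rule v[OF \<theta>])
    also have "\<dots> = (LINT \<xi>|lebesgue. g \<xi> * inverse_fourier (\<lambda>x. h x * \<theta> x) \<xi>)"
      by (rule fourier_is_functionD[OF ug g test_functions_mult[OF test_functions_smooth[OF h] \<theta>]])
    also have "\<dots> = (LINT \<xi>|lebesgue. ?c * (g' \<xi> * (LINT y|lebesgue. k \<xi> y * \<psi>' y)))"
    proof (rule Bochner_Integration.integral_cong[OF refl])
      fix \<xi>
      have "(\<lambda>y. k \<xi> y * \<psi>' y) = (\<lambda>y. J \<xi> * (H (y - \<xi>) * \<psi> y))"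
        using J0 by (simp add: k_def \<psi>'_def fun_eq_iff)
      then have "(LINT y|lebesgue. k \<xi> y * \<psi>' y) = J \<xi> * (LINT y|lebesgue. H (y - \<xi>) * \<psi> y)"
        by (simp only: integral_mult_right_zero)
      then show "g \<xi> * inverse_fourier (\<lambda>x. h x * \<theta> x) \<xi> = ?c * (g' \<xi> * (LINT y|lebesgue. k \<xi> y * \<psi>' y))"
        unfolding inverse_fourier_mult[OF hS \<theta>S] H_def[symmetric] \<psi>_def[symmetric] g'_def
        using J0[of \<xi>] by simp
    qed
    also have "\<dots> = ?c * (LINT y|lebesgue. \<psi>' y * (LINT \<xi>|lebesgue. k \<xi> y * g' \<xi>))"
      by (subst integral_mult_right_zero) (rule arg_cong[OF Fubini_bounded_kernel[OF g' \<psi>' km kB]])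
    also have "\<dots> = (LINT y|lebesgue. ?c * (\<psi>' y * (LINT \<xi>|lebesgue. k \<xi> y * g' \<xi>)))"
      by (rule integral_mult_right_zero[symmetric])
    also have "\<dots> = (LINT y|lebesgue. (?c * convolve H g y) * inverse_fourier \<theta> y)"
    proof (rule Bochner_Integration.integral_cong[OF refl])
      fix y
      have "(\<lambda>\<xi>. k \<xi> y * g' \<xi>) = (\<lambda>\<xi>. inverse (J y) * (H (y - \<xi>) * g \<xi>))"
        using J0 by (simp add: k_def g'_def fun_eq_iff)
      then have "(LINT \<xi>|lebesgue. k \<xi> y * g' \<xi>) = inverse (J y) * convolve H g y"
        by (simp only: integral_mult_right_zero convolve_def)
      then show "?c * (\<psi>' y * (LINT \<xi>|lebesgue. k \<xi> y * g' \<xi>)) = (?c * convolve H g y) * inverse_fourier \<theta> y"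
        using J0[of y] by (simp add: \<psi>'_def \<psi>_def)
    qed
    finally show ?thesis .
  qed
  show ?thesis unfolding H_def[symmetric] by (rule fourier_is_functionI[OF t *])
qed

lemma inverse_fourier_translate:
  assumes \<theta>: "\<theta> \<in> test_functions"
  shows "inverse_fourier (\<lambda>x. \<theta> (x + \<gamma>)) \<xi> = character \<gamma> \<xi> * inverse_fourier \<theta> \<xi>"
proof -
  have m: "(\<lambda>x. character (- \<xi>) (x + (- \<gamma>)) * \<theta> x) \<in> borel_measurable borel"
    by (intro borel_measurable_times smooth_borel_measurable[OF test_functions_smooth[OF \<theta>]]) measurable
  have c: "character (- \<xi>) (x + (- \<gamma>)) = character \<gamma> \<xi> * character (- \<xi>) x" for x
  proof -
    have "character (- \<xi>) (- \<gamma>) = character \<gamma> \<xi>" by (simp add: inner_commute)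
    then show ?thesis using character_add[where \<xi> = "- \<xi>" and x = x and y = "- \<gamma>"] by (simp only: mult.commute)
  qed
  have "fourier (\<lambda>x. \<theta> (x + \<gamma>)) (- \<xi>) = (LINT x|lebesgue. character (- \<xi>) (x + \<gamma> + (- \<gamma>)) * \<theta> (x + \<gamma>))"
    by (simp add: fourier_def)
  also have "\<dots> = (LINT x|lebesgue. character (- \<xi>) (x + (- \<gamma>)) * \<theta> x)"
    by (rule integral_translation[OF m])
  also have "\<dots> = character \<gamma> \<xi> * fourier \<theta> (- \<xi>)"
    unfolding c mult.assoc integral_mult_right_zero fourier_def ..
  finally show ?thesis by (simp add: inverse_fourier_def)
qed

lemma tempered_function_modulate:
  assumes g: "tempered_function g" shows "tempered_function (\<lambda>\<xi>. character \<gamma> \<xi> * g \<xi>)"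
proof -
  have "(\<lambda>\<xi>. character \<gamma> \<xi> * g \<xi>) \<in> borel_measurable lebesgue"
    using g by (intro borel_measurable_times measurable_lebesgue_of_borel[OF borel_measurable_character])
      (simp add: tempered_function_def)
  then show ?thesis using g unfolding tempered_function_def norm_mult norm_character mult_1_left by blast
qed

lemma fourier_is_function_translate:
  fixes g :: "real ^ 'n \<Rightarrow> complex"
  assumes ug: "fourier_is_function u g" and g: "tempered_function g"
  shows "fourier_is_function (translate \<gamma> u) (\<lambda>\<xi>. character \<gamma> \<xi> * g \<xi>)"
proof (rule fourier_is_functionI[OF tempered_function_modulate[OF g]])
  fix \<theta> :: "real ^ 'n \<Rightarrow> complex" assume \<theta>: "\<theta> \<in> test_functions"
  have "translate \<gamma> u \<theta> = (LINT \<xi>|lebesgue. g \<xi> * inverse_fourier (\<lambda>x. \<theta> (x + \<gamma>)) \<xi>)"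
    unfolding translate_def by (rule fourier_is_functionD[OF ug g test_functions_translate[OF \<theta>]])
  then show "translate \<gamma> u \<theta> = (LINT \<xi>|lebesgue. character \<gamma> \<xi> * g \<xi> * inverse_fourier \<theta> \<xi>)"
    unfolding inverse_fourier_translate[OF \<theta>] by (simp only: mult_ac)
qed


section \<open>Weighted square norms\<close>

definition weighted_square :: "(real ^ 'n \<Rightarrow> real) \<Rightarrow> (real ^ 'n \<Rightarrow> complex) \<Rightarrow> ennreal" where
  "weighted_square k g = (\<integral>\<^sup>+\<xi>. ennreal ((k \<xi> * norm (g \<xi>))\<^sup>2) \<partial>lebesgue)"

lemma Kpol_measurable: "k \<in> Kpol \<Longrightarrow> k \<in> borel_measurable lebesgue"
  by (simp add: Kpol_def)

lemma Kpol_pos: "k \<in> Kpol \<Longrightarrow> 0 < k \<xi>"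
  by (simp add: Kpol_def)

lemma Kpol_temperate:
  fixes k :: "real ^ 'n \<Rightarrow> real"
  assumes "k \<in> Kpol"
  shows "\<exists>C N. 0 < C \<and> (\<forall>\<xi> \<eta>. k (\<xi> + \<eta>) \<le> C * japanese \<xi> ^ N * k \<eta>)"
proof -
  obtain C M where C: "0 < C" "0 < M" "\<And>\<xi> \<eta>. k (\<xi> + \<eta>) \<le> C * japanese \<xi> powr M * k \<eta>"
    using assms unfolding Kpol_def by blast
  obtain N :: nat where N: "M \<le> real N" using real_arch_simple by blast
  show ?thesis
  proof (rule exI[of _ C], rule exI[of _ N], rule conjI[OF C(1)], intro allI)
    fix \<xi> \<eta> :: "real ^ 'n"
    have "japanese \<xi> powr M \<le> japanese \<xi> powr real N"
      by (rule powr_mono[OF N japanese_ge_1])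
    also have "\<dots> = japanese \<xi> ^ N" by (rule powr_realpow[OF japanese_pos])
    finally have "C * japanese \<xi> powr M * k \<eta> \<le> C * japanese \<xi> ^ N * k \<eta>"
      using C(1) Kpol_pos[OF assms, of \<eta>] by (intro mult_right_mono mult_left_mono) auto
    then show "k (\<xi> + \<eta>) \<le> C * japanese \<xi> ^ N * k \<eta>" using C(3)[of \<xi> \<eta>] by linarith
  qed
qed

lemma square_integrable_weighted:
  assumes k: "k \<in> Kpol"
  shows "(\<lambda>\<xi>. complex_of_real (k \<xi>) * g \<xi>) \<in> square_integrable \<longleftrightarrow>
    g \<in> borel_measurable lebesgue \<and> weighted_square k g < \<infinity>"
proof -
  note km = Kpol_measurable[OF k]
  have m: "(\<lambda>\<xi>. complex_of_real (k \<xi>) * g \<xi>) \<in> borel_measurable lebesgue \<longleftrightarrow> g \<in> borel_measurable lebesgue"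
  proof
    assume *: "(\<lambda>\<xi>. complex_of_real (k \<xi>) * g \<xi>) \<in> borel_measurable lebesgue"
    have "(\<lambda>\<xi>. inverse (complex_of_real (k \<xi>)) * (complex_of_real (k \<xi>) * g \<xi>)) \<in> borel_measurable lebesgue"
      using km * by measurable
    moreover have "inverse (complex_of_real (k \<xi>)) * (complex_of_real (k \<xi>) * g \<xi>) = g \<xi>" for \<xi>
      using Kpol_pos[OF k, of \<xi>] by simp
    ultimately show "g \<in> borel_measurable lebesgue" by simp
  next
    assume "g \<in> borel_measurable lebesgue"
    then show "(\<lambda>\<xi>. complex_of_real (k \<xi>) * g \<xi>) \<in> borel_measurable lebesgue" using km by measurable
  qed
  have n: "(norm (complex_of_real (k \<xi>) * g \<xi>))\<^sup>2 = (k \<xi> * norm (g \<xi>))\<^sup>2" for \<xi>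
    using Kpol_pos[OF k, of \<xi>] by (simp add: norm_mult)
  have "integrable lebesgue (\<lambda>\<xi>. (k \<xi> * norm (g \<xi>))\<^sup>2) \<longleftrightarrow> weighted_square k g < \<infinity>"
    if "g \<in> borel_measurable lebesgue"
  proof -
    have "(\<lambda>\<xi>. (k \<xi> * norm (g \<xi>))\<^sup>2) \<in> borel_measurable lebesgue" using km that by measurable
    then show ?thesis by (simp add: integrable_iff_bounded weighted_square_def)
  qed
  then show ?thesis unfolding square_integrable_def mem_Collect_eq n m by blast
qed

text \<open>The weight \<open>k\<close> is bounded below by a negative power of \<open>japanese\<close>, and \<open>a b \<le> a\<^sup>2 + b\<close> for
  \<open>0 \<le> a\<close> and \<open>0 \<le> b \<le> 1\<close> passes from square integrability to integrability.\<close>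

lemma tempered_function_of_weighted_square:
  fixes g :: "real ^ 'n \<Rightarrow> complex"
  assumes k: "k \<in> Kpol" and g: "g \<in> borel_measurable lebesgue" "weighted_square k g < \<infinity>"
  shows "tempered_function g"
proof -
  obtain C N where C: "0 < C" "\<And>\<xi> \<eta>. k (\<xi> + \<eta>) \<le> C * japanese \<xi> ^ N * k \<eta>"
    using Kpol_temperate[OF k] by blast
  note km = Kpol_measurable[OF k]
  let ?d = "2 * CARD('n)"
  define K where "K = C / k 0"
  have K0: "0 < K" using C(1) Kpol_pos[OF k, of 0] by (simp add: K_def)
  have k1: "1 \<le> K * japanese \<eta> ^ N * k \<eta>" for \<eta>
    using C(2)[of "- \<eta>" \<eta>] Kpol_pos[OF k, of 0] by (simp add: K_def japanese_minus field_simps)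
  have m2: "(\<lambda>\<xi>. (k \<xi> * norm (g \<xi>))\<^sup>2) \<in> borel_measurable lebesgue" using km g(1) by measurable
  have I: "integrable lebesgue (\<lambda>\<xi>. (k \<xi> * norm (g \<xi>))\<^sup>2)"
    using g(2) m2 by (simp add: integrable_iff_bounded weighted_square_def)
  have "integrable lebesgue (\<lambda>\<xi>. norm (g \<xi>) / japanese \<xi> ^ (N + ?d))"
  proof (rule Bochner_Integration.integrable_bound)
    show "integrable lebesgue (\<lambda>\<xi>. K * ((k \<xi> * norm (g \<xi>))\<^sup>2 + inverse (japanese \<xi> ^ ?d)))"
      by (intro integrable_mult_right Bochner_Integration.integrable_add I integrable_japanese)
    show "(\<lambda>\<xi>. norm (g \<xi>) / japanese \<xi> ^ (N + ?d)) \<in> borel_measurable lebesgue"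
      using g(1) measurable_lebesgue_of_borel[OF borel_measurable_japanese] by measurable
    show "AE \<xi> in lebesgue. norm (norm (g \<xi>) / japanese \<xi> ^ (N + ?d))
        \<le> norm (K * ((k \<xi> * norm (g \<xi>))\<^sup>2 + inverse (japanese \<xi> ^ ?d)))"
    proof (rule AE_I2)
      fix \<xi>
      define a where "a = k \<xi> * norm (g \<xi>)"
      define b where "b = inverse (japanese \<xi> ^ ?d)"
      have b: "0 \<le> b" "b \<le> 1"
        using japanese_pos[of \<xi>] japanese_ge_1[of \<xi>] by (auto simp: b_def less_imp_le intro!: inverse_le_1_iff[THEN iffD2] one_le_power)
      have a: "0 \<le> a" using Kpol_pos[OF k, of \<xi>] by (simp add: a_def)
      have "norm (g \<xi>) * 1 \<le> norm (g \<xi>) * (K * japanese \<xi> ^ N * k \<xi>)"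
        by (intro mult_left_mono k1) auto
      then have "norm (g \<xi>) / japanese \<xi> ^ N \<le> K * a"
        using japanese_pos[of \<xi>] by (simp add: a_def pos_divide_le_eq mult_ac)
      then have "norm (g \<xi>) / japanese \<xi> ^ N * b \<le> K * a * b"
        using b by (intro mult_right_mono)
      moreover have "a * b \<le> a\<^sup>2 + b"
      proof (cases "a \<le> 1")
        case True
        then show ?thesis using mult_right_mono[OF True b(1)] zero_le_power2[of a] by linarith
      next
        case False
        then have "a * b \<le> a * 1" "a * 1 \<le> a * a" using b a by (auto intro!: mult_left_mono)
        then show ?thesis using b by (simp add: power2_eq_square)
      qed
      then have "K * a * b \<le> K * (a\<^sup>2 + b)" using K0 by (simp add: mult.assoc)
      ultimately have "norm (g \<xi>) / japanese \<xi> ^ N * b \<le> K * (a\<^sup>2 + b)" by linarith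
      moreover have "norm (g \<xi>) / japanese \<xi> ^ N * b = norm (g \<xi>) / japanese \<xi> ^ (N + ?d)"
        by (simp add: b_def power_add divide_inverse)
      ultimately have "norm (g \<xi>) / japanese \<xi> ^ (N + ?d) \<le> K * (a\<^sup>2 + b)" by simp
      then show "norm (norm (g \<xi>) / japanese \<xi> ^ (N + ?d)) \<le> norm (K * ((k \<xi> * norm (g \<xi>))\<^sup>2 + inverse (japanese \<xi> ^ ?d)))"
        using japanese_pos[of \<xi>] K0 b unfolding a_def[symmetric] b_def[symmetric] by (simp add: abs_mult)
    qed
  qed
  with g(1) show ?thesis unfolding tempered_function_def by blast
qed

lemma weighted_square_cong_AE:
  "AE \<xi> in lebesgue. g \<xi> = g' \<xi> \<Longrightarrow> weighted_square k g = weighted_square k g'"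
  unfolding weighted_square_def by (rule nn_integral_cong_AE) auto

lemma weighted_square_cmult:
  assumes "k \<in> borel_measurable lebesgue" "g \<in> borel_measurable lebesgue"
  shows "weighted_square k (\<lambda>\<xi>. c * g \<xi>) = ennreal ((norm c)\<^sup>2) * weighted_square k g"
proof -
  have "(\<lambda>\<xi>. ennreal ((k \<xi> * norm (g \<xi>))\<^sup>2)) \<in> borel_measurable lebesgue" using assms by measurable
  from nn_integral_cmult[OF this, of "ennreal ((norm c)\<^sup>2)"] show ?thesis
    unfolding weighted_square_def by (simp add: ennreal_mult'[symmetric] norm_mult power_mult_distrib mult_ac)
qed


section \<open>The two estimates for finite families\<close>

abbreviation decay_weight :: "real ^ 'n \<Rightarrow> real" where
  "decay_weight \<zeta> \<equiv> inverse (japanese \<zeta> ^ (2 * CARD('n)))"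

lemma decay_weight_nonneg: "0 \<le> decay_weight \<zeta>"
  by (simp add: japanese_pos less_imp_le)

lemma nn_integral_decay_weight:
  fixes \<xi> :: "real ^ 'n"
  shows "(\<integral>\<^sup>+\<eta>. ennreal (decay_weight (\<xi> - \<eta>)) \<partial>lebesgue) = ennreal (japanese_int TYPE('n))"
    and "(\<integral>\<^sup>+\<eta>. ennreal (decay_weight (\<eta> - \<xi>)) \<partial>lebesgue) = ennreal (japanese_int TYPE('n))"
proof -
  have m: "(\<lambda>\<eta> :: real ^ 'n. ennreal (decay_weight \<eta>)) \<in> borel_measurable borel" by measurable
  have *: "(\<integral>\<^sup>+\<eta>. ennreal (decay_weight \<eta>) \<partial>(lebesgue :: (real ^ 'n) measure)) = ennreal (japanese_int TYPE('n))"
    unfolding japanese_int_def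
    by (rule nn_integral_eq_integral[OF integrable_japanese]) (simp add: decay_weight_nonneg)
  show "(\<integral>\<^sup>+\<eta>. ennreal (decay_weight (\<xi> - \<eta>)) \<partial>lebesgue) = ennreal (japanese_int TYPE('n))"
    using nn_integral_reflection[OF m, of \<xi>] * by (simp only:)
  show "(\<integral>\<^sup>+\<eta>. ennreal (decay_weight (\<eta> - \<xi>)) \<partial>lebesgue) = ennreal (japanese_int TYPE('n))"
    using nn_integral_translation[OF m, of "- \<xi>"] * by (simp only: add_uminus_conv_diff)
qed

lemma Cauchy_Schwarz_weight:
  fixes w a b :: "'x \<Rightarrow> real"
  assumes [measurable]: "w \<in> borel_measurable M" "a \<in> borel_measurable M" "b \<in> borel_measurable M"
    and nn: "\<And>x. 0 \<le> w x" "\<And>x. 0 \<le> a x" "\<And>x. 0 \<le> b x"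
  shows "(\<integral>\<^sup>+x. ennreal (w x * a x * b x) \<partial>M)\<^sup>2 \<le>
    (\<integral>\<^sup>+x. ennreal (w x * (a x)\<^sup>2) \<partial>M) * (\<integral>\<^sup>+x. ennreal (w x * (b x)\<^sup>2) \<partial>M)"
proof -
  have 1: "ennreal (w x * a x * b x) = ennreal (sqrt (w x) * a x) * ennreal (sqrt (w x) * b x)" for x
  proof -
    have "w x * a x * b x = (sqrt (w x) * sqrt (w x)) * a x * b x" using nn(1)[of x] by simp
    then have "w x * a x * b x = (sqrt (w x) * a x) * (sqrt (w x) * b x)" by (simp only: mult_ac)
    then have "ennreal (w x * a x * b x) = ennreal ((sqrt (w x) * a x) * (sqrt (w x) * b x))" by (simp only:)
    also have "\<dots> = ennreal (sqrt (w x) * a x) * ennreal (sqrt (w x) * b x)"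
      by (rule ennreal_mult) (use nn in simp_all)
    finally show ?thesis .
  qed
  have 2: "(ennreal (sqrt (w x) * c))\<^sup>2 = ennreal (w x * c\<^sup>2)" if "0 \<le> c" for c x
    using nn(1)[of x] that by (simp add: ennreal_power power_mult_distrib)
  show ?thesis
    using Cauchy_Schwarz_nn_integral[of "\<lambda>x. ennreal (sqrt (w x) * a x)" M "\<lambda>x. ennreal (sqrt (w x) * b x)"]
    by (simp add: 1 2[OF nn(2)] 2[OF nn(3)])
qed

text \<open>The quotient \<open>(k \<xi> / k \<eta>)\<^sup>2\<close> is at most a constant times \<open>japanese (\<xi> - \<eta>) ^ (2 * N)\<close>. A bound for
  \<open>H\<close> with \<open>2 * N\<close> additional powers absorbs this growth.\<close>

lemma kernel_weight:
  fixes k :: "real ^ 'n \<Rightarrow> real" and H :: "real ^ 'n \<Rightarrow> complex"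
  assumes k: "k \<in> Kpol" and H: "H \<in> schwartz_functions"
  shows "\<exists>A. 0 \<le> A \<and> (\<forall>\<zeta>. norm (H \<zeta>) \<le> A * decay_weight \<zeta>) \<and>
    (\<forall>\<xi> \<eta>. norm (H (\<xi> - \<eta>)) * (k \<xi>)\<^sup>2 \<le> A * decay_weight (\<xi> - \<eta>) * (k \<eta>)\<^sup>2)"
proof -
  obtain C N where C: "0 < C" "\<forall>\<xi> \<eta>. k (\<xi> + \<eta>) \<le> C * japanese \<xi> ^ N * k \<eta>"
    using Kpol_temperate[OF k] by blast
  let ?d = "2 * CARD('n)"
  obtain B where B: "schwartz_bound (?d + 2 * N) B H" by (rule schwartz_bound_exists[OF H])
  note B0 = schwartz_bound_nonneg[OF B]
  show ?thesis
  proof (intro exI[of _ "B * (1 + C\<^sup>2)"] conjI allI)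
    show "0 \<le> B * (1 + C\<^sup>2)" using B0 by simp
    show "norm (H \<zeta>) \<le> B * (1 + C\<^sup>2) * decay_weight \<zeta>" for \<zeta>
    proof -
      have "norm (H \<zeta>) \<le> B * decay_weight \<zeta>"
        using schwartz_boundD0[OF B, of ?d \<zeta>] by (simp add: divide_inverse)
      also have "\<dots> \<le> (B * (1 + C\<^sup>2)) * decay_weight \<zeta>"
        using B0 by (intro mult_right_mono decay_weight_nonneg) (simp add: distrib_left)
      finally show ?thesis .
    qed
    show "norm (H (\<xi> - \<eta>)) * (k \<xi>)\<^sup>2 \<le> B * (1 + C\<^sup>2) * decay_weight (\<xi> - \<eta>) * (k \<eta>)\<^sup>2" for \<xi> \<eta>
    proof -
      let ?J = "japanese (\<xi> - \<eta>)"
      have J: "0 < ?J" by (rule japanese_pos)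
      have "k \<xi> \<le> C * ?J ^ N * k \<eta>" using C(2)[rule_format, of "\<xi> - \<eta>" \<eta>] by simp
      then have "(k \<xi>)\<^sup>2 \<le> (C * ?J ^ N * k \<eta>)\<^sup>2"
        using Kpol_pos[OF k, of \<xi>] by (intro power_mono) auto
      also have "\<dots> = ?J ^ (2 * N) * (C\<^sup>2 * (k \<eta>)\<^sup>2)"
        by (simp add: power_mult_distrib power_mult[symmetric] mult_ac)
      finally have *: "(k \<xi>)\<^sup>2 \<le> ?J ^ (2 * N) * (C\<^sup>2 * (k \<eta>)\<^sup>2)" .
      have "norm (H (\<xi> - \<eta>)) * (k \<xi>)\<^sup>2 \<le> (B / ?J ^ (?d + 2 * N)) * (?J ^ (2 * N) * (C\<^sup>2 * (k \<eta>)\<^sup>2))"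
        using schwartz_boundD0[OF B order_refl, of "\<xi> - \<eta>"] * B0 J by (intro mult_mono) auto
      also have "\<dots> = B * C\<^sup>2 * decay_weight (\<xi> - \<eta>) * (k \<eta>)\<^sup>2"
        using J by (simp add: power_add field_simps)
      also have "\<dots> \<le> B * (1 + C\<^sup>2) * decay_weight (\<xi> - \<eta>) * (k \<eta>)\<^sup>2"
        using B0 by (intro mult_right_mono mult_left_mono decay_weight_nonneg) auto
      finally show ?thesis .
    qed
  qed
qed

lemma measurable_snd_lebesgue:
  fixes f :: "real ^ 'n \<Rightarrow> 'b::topological_space"
  assumes "f \<in> borel_measurable lebesgue"
  shows "(\<lambda>p. f (snd p)) \<in> borel_measurable (lebesgue \<Otimes>\<^sub>M (lebesgue :: (real ^ 'n) measure))"
  by (rule measurable_compose[OF measurable_snd assms])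

lemma measurable_fst_lebesgue:
  fixes f :: "real ^ 'n \<Rightarrow> 'b::topological_space"
  assumes "f \<in> borel_measurable lebesgue"
  shows "(\<lambda>p. f (fst p)) \<in> borel_measurable ((lebesgue :: (real ^ 'n) measure) \<Otimes>\<^sub>M lebesgue)"
  by (rule measurable_compose[OF measurable_fst assms])

lemma decay_weight_measurable_pair:
  "(\<lambda>p. decay_weight (fst p - snd p)) \<in> borel_measurable ((lebesgue :: (real ^ 'n) measure) \<Otimes>\<^sub>M lebesgue)"
  by (rule measurable_pair_lebesgue_of_borel, unfold borel_prod[symmetric]) measurable

text \<open>Synthesis: the translates are almost orthogonal. Write the sum as
  \<open>\<integral> H (\<xi> - \<eta>) (\<Sum> g\<^sub>\<gamma> \<eta> * character \<gamma> \<xi>) d\<eta>\<close>; for fixed \<open>\<eta>\<close> the inner sum is a trigonometric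
  polynomial in \<open>\<xi>\<close>, so that \<open>trig_sum_weighted\<close> applies after integrating in \<open>\<xi>\<close> first.\<close>

lemma synthesis_estimate:
  fixes k :: "real ^ 'n \<Rightarrow> real" and H :: "real ^ 'n \<Rightarrow> complex"
  assumes k: "k \<in> Kpol" and H: "H \<in> schwartz_functions"
  shows "\<exists>C\<ge>0. \<forall>\<Gamma> g. finite \<Gamma> \<longrightarrow> \<Gamma> \<subseteq> integer_lattice \<longrightarrow> (\<forall>\<gamma>\<in>\<Gamma>. tempered_function (g \<gamma>)) \<longrightarrow>
    weighted_square k (\<lambda>\<xi>. \<Sum>\<gamma>\<in>\<Gamma>. character \<gamma> \<xi> * convolve H (g \<gamma>) \<xi>) \<le>
      ennreal C * (\<Sum>\<gamma>\<in>\<Gamma>. weighted_square k (g \<gamma>))"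
proof -
  obtain A where A: "0 \<le> A" "\<forall>\<zeta>. norm (H \<zeta>) \<le> A * decay_weight \<zeta>"
    "\<forall>\<xi> \<eta>. norm (H (\<xi> - \<eta>)) * (k \<xi>)\<^sup>2 \<le> A * decay_weight (\<xi> - \<eta>) * (k \<eta>)\<^sup>2"
    using kernel_weight[OF k H] by blast
  obtain T where T: "0 \<le> T" "\<forall>\<Gamma> (c :: real ^ 'n \<Rightarrow> complex) \<eta>. finite \<Gamma> \<longrightarrow> \<Gamma> \<subseteq> integer_lattice \<longrightarrow>
    (\<integral>\<^sup>+\<xi>. ennreal (decay_weight (\<xi> - \<eta>)) * ennreal ((norm (\<Sum>\<gamma>\<in>\<Gamma>. c \<gamma> * character \<gamma> \<xi>))\<^sup>2) \<partial>lebesgue)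
      \<le> ennreal (T * (\<Sum>\<gamma>\<in>\<Gamma>. (norm (c \<gamma>))\<^sup>2))"
    using trig_sum_weighted by blast
  define J where "J = japanese_int TYPE('n)"
  have J: "0 \<le> J" unfolding J_def by (rule japanese_int_nonneg)
  note km = Kpol_measurable[OF k]
  show ?thesis
  proof (intro exI[of _ "A * J * A * T"] conjI allI impI)
    show "0 \<le> A * J * A * T" using A(1) J T(1) by simp
    fix \<Gamma> :: "(real ^ 'n) set" and g :: "real ^ 'n \<Rightarrow> real ^ 'n \<Rightarrow> complex"
    assume \<Gamma>: "finite \<Gamma>" "\<Gamma> \<subseteq> integer_lattice" and g: "\<forall>\<gamma>\<in>\<Gamma>. tempered_function (g \<gamma>)"
    have gm: "g \<gamma> \<in> borel_measurable lebesgue" if "\<gamma> \<in> \<Gamma>" for \<gamma>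
      using g that by (simp add: tempered_function_def)
    define P where "P \<eta> \<xi> = (\<Sum>\<gamma>\<in>\<Gamma>. g \<gamma> \<eta> * character \<gamma> \<xi>)" for \<eta> \<xi>
    define S where "S \<xi> = (\<Sum>\<gamma>\<in>\<Gamma>. character \<gamma> \<xi> * convolve H (g \<gamma>) \<xi>)" for \<xi>
    have Pm: "(\<lambda>p. P (snd p) (fst p)) \<in> borel_measurable (lebesgue \<Otimes>\<^sub>M lebesgue)"
      unfolding P_def
      by (intro borel_measurable_sum borel_measurable_times measurable_snd_lebesgue[OF gm]
          measurable_fst_lebesgue[OF measurable_lebesgue_of_borel[OF borel_measurable_character]])
    have Pm1: "(\<lambda>\<eta>. P \<eta> \<xi>) \<in> borel_measurable lebesgue" for \<xi>
      unfolding P_def by (intro borel_measurable_sum borel_measurable_times gm borel_measurable_const)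
    have Hm1: "(\<lambda>\<eta>. norm (H (\<xi> - \<eta>))) \<in> borel_measurable lebesgue" for \<xi>
      by (rule measurable_lebesgue_of_borel[OF measurable_compose[OF schwartz_shift_measurable[OF H] borel_measurable_norm]])
    have i: "integrable lebesgue (\<lambda>\<eta>. character \<gamma> \<xi> * (H (\<xi> - \<eta>) * g \<gamma> \<eta>))" if "\<gamma> \<in> \<Gamma>" for \<gamma> \<xi>
      by (rule integrable_mult_right, rule convolve_integrable[OF _ H]) (use g that in blast)
    have eq: "H (\<xi> - \<eta>) * P \<eta> \<xi> = (\<Sum>\<gamma>\<in>\<Gamma>. character \<gamma> \<xi> * (H (\<xi> - \<eta>) * g \<gamma> \<eta>))" for \<xi> \<eta>
      unfolding P_def sum_distrib_left by (simp only: mult_ac)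
    have I: "integrable lebesgue (\<lambda>\<eta>. H (\<xi> - \<eta>) * P \<eta> \<xi>)" for \<xi>
      unfolding eq by (rule Bochner_Integration.integrable_sum[OF i])
    have S: "S \<xi> = (LINT \<eta>|lebesgue. H (\<xi> - \<eta>) * P \<eta> \<xi>)" for \<xi>
    proof -
      have "(LINT \<eta>|lebesgue. (\<Sum>\<gamma>\<in>\<Gamma>. character \<gamma> \<xi> * (H (\<xi> - \<eta>) * g \<gamma> \<eta>))) =
          (\<Sum>\<gamma>\<in>\<Gamma>. (LINT \<eta>|lebesgue. character \<gamma> \<xi> * (H (\<xi> - \<eta>) * g \<gamma> \<eta>)))"
        by (rule Bochner_Integration.integral_sum[OF i])
      then show ?thesis
        unfolding eq S_def convolve_def by (simp only: integral_mult_right_zero)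
    qed
    have point: "ennreal ((k \<xi> * norm (S \<xi>))\<^sup>2) \<le>
        ennreal (A * J * A) * (\<integral>\<^sup>+\<eta>. ennreal (decay_weight (\<xi> - \<eta>) * (k \<eta>)\<^sup>2 * (norm (P \<eta> \<xi>))\<^sup>2) \<partial>lebesgue)" for \<xi>
    proof -
      have "ennreal (norm (S \<xi>)) \<le> (\<integral>\<^sup>+\<eta>. ennreal (norm (H (\<xi> - \<eta>)) * 1 * norm (P \<eta> \<xi>)) \<partial>lebesgue)"
        unfolding S using integral_norm_bound_ennreal[OF I[of \<xi>]] by (simp only: norm_mult mult_1_right)
      then have "(ennreal (norm (S \<xi>)))\<^sup>2 \<le> (\<integral>\<^sup>+\<eta>. ennreal (norm (H (\<xi> - \<eta>)) * 1 * norm (P \<eta> \<xi>)) \<partial>lebesgue)\<^sup>2"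
        by (rule power_mono) simp
      also have "\<dots> \<le> (\<integral>\<^sup>+\<eta>. ennreal (norm (H (\<xi> - \<eta>)) * 1\<^sup>2) \<partial>lebesgue) *
          (\<integral>\<^sup>+\<eta>. ennreal (norm (H (\<xi> - \<eta>)) * (norm (P \<eta> \<xi>))\<^sup>2) \<partial>lebesgue)"
        by (rule Cauchy_Schwarz_weight[OF Hm1 borel_measurable_const measurable_compose[OF Pm1 borel_measurable_norm]]) auto
      also have "(\<integral>\<^sup>+\<eta>. ennreal (norm (H (\<xi> - \<eta>)) * 1\<^sup>2) \<partial>lebesgue) \<le>
          (\<integral>\<^sup>+\<eta>. ennreal A * ennreal (decay_weight (\<xi> - \<eta>)) \<partial>lebesgue)"
        using A(1) by (intro nn_integral_mono) (simp add: ennreal_mult[symmetric] decay_weight_nonneg A(2) del: inverse_nonnegative_iff_nonnegative)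
      also have "\<dots> = ennreal A * ennreal J"
      proof -
        have "(\<lambda>\<eta>. ennreal (decay_weight (\<xi> - \<eta>))) \<in> borel_measurable lebesgue"
          by (rule measurable_lebesgue_of_borel) measurable
        from nn_integral_cmult[OF this] show ?thesis by (simp only: nn_integral_decay_weight J_def)
      qed
      finally have 1: "(ennreal (norm (S \<xi>)))\<^sup>2 \<le> ennreal A * ennreal J *
          (\<integral>\<^sup>+\<eta>. ennreal (norm (H (\<xi> - \<eta>)) * (norm (P \<eta> \<xi>))\<^sup>2) \<partial>lebesgue)"
        by (simp add: mult_right_mono)
      have "ennreal ((k \<xi> * norm (S \<xi>))\<^sup>2) = ennreal ((k \<xi>)\<^sup>2) * (ennreal (norm (S \<xi>)))\<^sup>2"
        by (simp add: power_mult_distrib ennreal_mult ennreal_power)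
      also have "\<dots> \<le> ennreal ((k \<xi>)\<^sup>2) * (ennreal A * ennreal J *
          (\<integral>\<^sup>+\<eta>. ennreal (norm (H (\<xi> - \<eta>)) * (norm (P \<eta> \<xi>))\<^sup>2) \<partial>lebesgue))"
        by (rule mult_left_mono[OF 1]) simp
      also have "\<dots> = ennreal (A * J) * (ennreal ((k \<xi>)\<^sup>2) *
          (\<integral>\<^sup>+\<eta>. ennreal (norm (H (\<xi> - \<eta>)) * (norm (P \<eta> \<xi>))\<^sup>2) \<partial>lebesgue))"
        using A(1) J by (simp add: ennreal_mult mult_ac)
      also have "ennreal ((k \<xi>)\<^sup>2) * (\<integral>\<^sup>+\<eta>. ennreal (norm (H (\<xi> - \<eta>)) * (norm (P \<eta> \<xi>))\<^sup>2) \<partial>lebesgue) =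
          (\<integral>\<^sup>+\<eta>. ennreal ((k \<xi>)\<^sup>2) * ennreal (norm (H (\<xi> - \<eta>)) * (norm (P \<eta> \<xi>))\<^sup>2) \<partial>lebesgue)"
      proof (rule nn_integral_cmult[symmetric])
        show "(\<lambda>\<eta>. ennreal (norm (H (\<xi> - \<eta>)) * (norm (P \<eta> \<xi>))\<^sup>2)) \<in> borel_measurable lebesgue"
          using Hm1 Pm1 by measurable
      qed
      also have "\<dots> \<le> (\<integral>\<^sup>+\<eta>. ennreal A * ennreal (decay_weight (\<xi> - \<eta>) * (k \<eta>)\<^sup>2 * (norm (P \<eta> \<xi>))\<^sup>2) \<partial>lebesgue)"
      proof (rule nn_integral_mono)
        fix \<eta>
        have "(k \<xi>)\<^sup>2 * (norm (H (\<xi> - \<eta>)) * (norm (P \<eta> \<xi>))\<^sup>2) \<le> A * (decay_weight (\<xi> - \<eta>) * (k \<eta>)\<^sup>2 * (norm (P \<eta> \<xi>))\<^sup>2)"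
          using mult_right_mono[OF A(3)[rule_format, of \<xi> \<eta>], of "(norm (P \<eta> \<xi>))\<^sup>2"] by (simp add: mult_ac)
        then show "ennreal ((k \<xi>)\<^sup>2) * ennreal (norm (H (\<xi> - \<eta>)) * (norm (P \<eta> \<xi>))\<^sup>2) \<le>
            ennreal A * ennreal (decay_weight (\<xi> - \<eta>) * (k \<eta>)\<^sup>2 * (norm (P \<eta> \<xi>))\<^sup>2)"
          using A(1) by (simp add: ennreal_mult'[symmetric] ennreal_leI)
      qed
      also have "\<dots> = ennreal A * (\<integral>\<^sup>+\<eta>. ennreal (decay_weight (\<xi> - \<eta>) * (k \<eta>)\<^sup>2 * (norm (P \<eta> \<xi>))\<^sup>2) \<partial>lebesgue)"
      proof (rule nn_integral_cmult)
        have "(\<lambda>\<eta>. decay_weight (\<xi> - \<eta>)) \<in> borel_measurable lebesgue"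
          by (rule measurable_lebesgue_of_borel) measurable
        then show "(\<lambda>\<eta>. ennreal (decay_weight (\<xi> - \<eta>) * (k \<eta>)\<^sup>2 * (norm (P \<eta> \<xi>))\<^sup>2)) \<in> borel_measurable lebesgue"
          using km Pm1 by measurable
      qed
      finally show ?thesis
        using A(1) J by (simp add: mult_left_mono ennreal_mult mult.assoc)
    qed
    have Fm: "(\<lambda>p. ennreal (decay_weight (fst p - snd p) * (k (snd p))\<^sup>2 * (norm (P (snd p) (fst p)))\<^sup>2))
        \<in> borel_measurable (lebesgue \<Otimes>\<^sub>M lebesgue)"
      using decay_weight_measurable_pair measurable_snd_lebesgue[OF km] Pm by measurable
    have "weighted_square k S \<le> (\<integral>\<^sup>+\<xi>. ennreal (A * J * A) *
        (\<integral>\<^sup>+\<eta>. ennreal (decay_weight (\<xi> - \<eta>) * (k \<eta>)\<^sup>2 * (norm (P \<eta> \<xi>))\<^sup>2) \<partial>lebesgue) \<partial>lebesgue)"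
      unfolding weighted_square_def by (rule nn_integral_mono) (rule point)
    also have "\<dots> = ennreal (A * J * A) * (\<integral>\<^sup>+\<xi>. (\<integral>\<^sup>+\<eta>. ennreal (decay_weight (\<xi> - \<eta>) * (k \<eta>)\<^sup>2 * (norm (P \<eta> \<xi>))\<^sup>2) \<partial>lebesgue) \<partial>lebesgue)"
      by (rule nn_integral_cmult, rule lebesgue.borel_measurable_nn_integral) (use Fm in \<open>simp add: case_prod_beta'\<close>)
    also have "(\<integral>\<^sup>+\<xi>. (\<integral>\<^sup>+\<eta>. ennreal (decay_weight (\<xi> - \<eta>) * (k \<eta>)\<^sup>2 * (norm (P \<eta> \<xi>))\<^sup>2) \<partial>lebesgue) \<partial>lebesgue) =
        (\<integral>\<^sup>+\<eta>. (\<integral>\<^sup>+\<xi>. ennreal (decay_weight (\<xi> - \<eta>) * (k \<eta>)\<^sup>2 * (norm (P \<eta> \<xi>))\<^sup>2) \<partial>lebesgue) \<partial>lebesgue)"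
      by (rule lebesgue_pair.Fubini'[symmetric]) (use Fm in \<open>simp add: case_prod_beta'\<close>)
    also have "\<dots> \<le> (\<integral>\<^sup>+\<eta>. ennreal T * (\<Sum>\<gamma>\<in>\<Gamma>. ennreal ((k \<eta> * norm (g \<gamma> \<eta>))\<^sup>2)) \<partial>lebesgue)"
    proof (rule nn_integral_mono)
      fix \<eta>
      have m: "(\<lambda>\<xi>. ennreal (decay_weight (\<xi> - \<eta>)) * ennreal ((norm (P \<eta> \<xi>))\<^sup>2)) \<in> borel_measurable lebesgue"
        unfolding P_def by (rule measurable_lebesgue_of_borel) measurable
      have "(\<integral>\<^sup>+\<xi>. ennreal (decay_weight (\<xi> - \<eta>) * (k \<eta>)\<^sup>2 * (norm (P \<eta> \<xi>))\<^sup>2) \<partial>lebesgue) =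
          (\<integral>\<^sup>+\<xi>. ennreal ((k \<eta>)\<^sup>2) * (ennreal (decay_weight (\<xi> - \<eta>)) * ennreal ((norm (P \<eta> \<xi>))\<^sup>2)) \<partial>lebesgue)"
        by (rule nn_integral_cong) (simp add: ennreal_mult'[symmetric] ennreal_mult''[symmetric] mult_ac)
      also have "\<dots> = ennreal ((k \<eta>)\<^sup>2) * (\<integral>\<^sup>+\<xi>. ennreal (decay_weight (\<xi> - \<eta>)) * ennreal ((norm (P \<eta> \<xi>))\<^sup>2) \<partial>lebesgue)"
        by (rule nn_integral_cmult[OF m])
      also have "\<dots> \<le> ennreal ((k \<eta>)\<^sup>2) * ennreal (T * (\<Sum>\<gamma>\<in>\<Gamma>. (norm (g \<gamma> \<eta>))\<^sup>2))"
        unfolding P_def using T(2) \<Gamma> by (intro mult_left_mono) auto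
      also have "\<dots> = ennreal T * (\<Sum>\<gamma>\<in>\<Gamma>. ennreal ((k \<eta> * norm (g \<gamma> \<eta>))\<^sup>2))"
        using T(1) by (simp add: ennreal_mult'[symmetric] power_mult_distrib sum_distrib_left sum_nonneg mult_ac)
      finally show "(\<integral>\<^sup>+\<xi>. ennreal (decay_weight (\<xi> - \<eta>) * (k \<eta>)\<^sup>2 * (norm (P \<eta> \<xi>))\<^sup>2) \<partial>lebesgue) \<le>
          ennreal T * (\<Sum>\<gamma>\<in>\<Gamma>. ennreal ((k \<eta> * norm (g \<gamma> \<eta>))\<^sup>2))" .
    qed
    also have "\<dots> = ennreal T * (\<Sum>\<gamma>\<in>\<Gamma>. weighted_square k (g \<gamma>))"
    proof -
      have m: "(\<lambda>\<eta>. ennreal ((k \<eta> * norm (g \<gamma> \<eta>))\<^sup>2)) \<in> borel_measurable lebesgue" if "\<gamma> \<in> \<Gamma>" for \<gamma>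
        using km gm[OF that] by measurable
      have "(\<integral>\<^sup>+\<eta>. ennreal T * (\<Sum>\<gamma>\<in>\<Gamma>. ennreal ((k \<eta> * norm (g \<gamma> \<eta>))\<^sup>2)) \<partial>lebesgue) =
          ennreal T * (\<integral>\<^sup>+\<eta>. (\<Sum>\<gamma>\<in>\<Gamma>. ennreal ((k \<eta> * norm (g \<gamma> \<eta>))\<^sup>2)) \<partial>lebesgue)"
        by (rule nn_integral_cmult, rule borel_measurable_sum, rule m)
      also have "(\<integral>\<^sup>+\<eta>. (\<Sum>\<gamma>\<in>\<Gamma>. ennreal ((k \<eta> * norm (g \<gamma> \<eta>))\<^sup>2)) \<partial>lebesgue) =
          (\<Sum>\<gamma>\<in>\<Gamma>. \<integral>\<^sup>+\<eta>. ennreal ((k \<eta> * norm (g \<gamma> \<eta>))\<^sup>2) \<partial>lebesgue)"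
        by (rule nn_integral_sum[OF m])
      finally show ?thesis unfolding weighted_square_def .
    qed
    finally have "weighted_square k S \<le> ennreal (A * J * A) * (ennreal T * (\<Sum>\<gamma>\<in>\<Gamma>. weighted_square k (g \<gamma>)))"
      by (simp add: mult_left_mono)
    also have "\<dots> = ennreal (A * J * A * T) * (\<Sum>\<gamma>\<in>\<Gamma>. weighted_square k (g \<gamma>))"
      using A(1) J T(1) by (simp add: ennreal_mult mult.assoc)
    finally show "weighted_square k (\<lambda>\<xi>. \<Sum>\<gamma>\<in>\<Gamma>. character \<gamma> \<xi> * convolve H (g \<gamma>) \<xi>) \<le>
        ennreal (A * J * A * T) * (\<Sum>\<gamma>\<in>\<Gamma>. weighted_square k (g \<gamma>))"
      by (simp only: S_def[abs_def])
  qed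
qed

lemma ennreal_le_of_square_le:
  assumes "(ennreal s)\<^sup>2 \<le> X * ennreal (B * s)" "0 \<le> s" "0 \<le> B"
  shows "ennreal s \<le> ennreal B * X"
proof (cases "s = 0 \<or> B = 0")
  case True
  then show ?thesis using assms by (auto simp: ennreal_power)
next
  case False
  then have s: "0 < s" "0 < B" using assms by auto
  show ?thesis
  proof (cases X)
    case (real x)
    have "ennreal (s * s) \<le> ennreal (x * (B * s))"
      using assms real s by (simp add: ennreal_power power2_eq_square ennreal_mult)
    then have "s * s \<le> (x * B) * s" using real s by (simp add: mult.assoc)
    then have "s \<le> x * B" using s by simp
    then show ?thesis using real s by (simp add: ennreal_mult'[symmetric] mult.commute ennreal_leI)
  next
    case top
    then show ?thesis using s by (simp add: ennreal_mult_top)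
  qed
qed

text \<open>Analysis: a Bessel inequality. With \<open>a\<^sub>\<gamma> = convolve H (character (- \<gamma>) * g) y\<close>, the sum
  \<open>\<Sum> \<bar>a\<^sub>\<gamma>\<bar>\<^sup>2\<close> is the pairing of \<open>H (y - \<cdot>) * g\<close> with the conjugate of the trigonometric polynomial with
  coefficients \<open>a\<^sub>\<gamma>\<close>; now apply Cauchy-Schwarz and \<open>trig_sum_weighted\<close>.\<close>

lemma analysis_estimate:
  fixes k :: "real ^ 'n \<Rightarrow> real" and H :: "real ^ 'n \<Rightarrow> complex"
  assumes k: "k \<in> Kpol" and H: "H \<in> schwartz_functions"
  shows "\<exists>C\<ge>0. \<forall>\<Gamma> g. finite \<Gamma> \<longrightarrow> \<Gamma> \<subseteq> integer_lattice \<longrightarrow> tempered_function g \<longrightarrow>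
    (\<Sum>\<gamma>\<in>\<Gamma>. weighted_square k (convolve H (\<lambda>\<xi>. character (- \<gamma>) \<xi> * g \<xi>))) \<le> ennreal C * weighted_square k g"
proof -
  obtain A where A: "0 \<le> A" "\<forall>\<zeta>. norm (H \<zeta>) \<le> A * decay_weight \<zeta>"
    "\<forall>\<xi> \<eta>. norm (H (\<xi> - \<eta>)) * (k \<xi>)\<^sup>2 \<le> A * decay_weight (\<xi> - \<eta>) * (k \<eta>)\<^sup>2"
    using kernel_weight[OF k H] by blast
  obtain T where T: "0 \<le> T" "\<forall>\<Gamma> (c :: real ^ 'n \<Rightarrow> complex) \<eta>. finite \<Gamma> \<longrightarrow> \<Gamma> \<subseteq> integer_lattice \<longrightarrow>
    (\<integral>\<^sup>+\<xi>. ennreal (decay_weight (\<xi> - \<eta>)) * ennreal ((norm (\<Sum>\<gamma>\<in>\<Gamma>. c \<gamma> * character \<gamma> \<xi>))\<^sup>2) \<partial>lebesgue)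
      \<le> ennreal (T * (\<Sum>\<gamma>\<in>\<Gamma>. (norm (c \<gamma>))\<^sup>2))"
    using trig_sum_weighted by blast
  define J where "J = japanese_int TYPE('n)"
  have J: "0 \<le> J" unfolding J_def by (rule japanese_int_nonneg)
  note km = Kpol_measurable[OF k]
  show ?thesis
  proof (intro exI[of _ "A * T * A * J"] conjI allI impI)
    show "0 \<le> A * T * A * J" using A(1) J T(1) by simp
    fix \<Gamma> :: "(real ^ 'n) set" and g :: "real ^ 'n \<Rightarrow> complex"
    assume \<Gamma>: "finite \<Gamma>" "\<Gamma> \<subseteq> integer_lattice" and g: "tempered_function g"
    have gm: "g \<in> borel_measurable lebesgue" using g by (simp add: tempered_function_def)
    define a where "a \<gamma> = convolve H (\<lambda>\<xi>. character (- \<gamma>) \<xi> * g \<xi>)" for \<gamma>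
    have tm: "tempered_function (\<lambda>\<xi>. character (- \<gamma>) \<xi> * g \<xi>)" for \<gamma>
      by (rule tempered_function_modulate[OF g])
    have am: "a \<gamma> \<in> borel_measurable lebesgue" for \<gamma>
      using convolve_tempered[OF tm H] by (simp add: a_def tempered_function_def)
    have Hm1: "(\<lambda>\<xi>. norm (H (y - \<xi>))) \<in> borel_measurable lebesgue" for y
      by (rule measurable_lebesgue_of_borel[OF measurable_compose[OF schwartz_shift_measurable[OF H] borel_measurable_norm]])
    have wm1: "(\<lambda>\<xi>. decay_weight (y - \<xi>)) \<in> borel_measurable lebesgue" for y :: "real ^ 'n"
      by (rule measurable_lebesgue_of_borel) measurable
    have point: "(\<Sum>\<gamma>\<in>\<Gamma>. ennreal ((k y * norm (a \<gamma> y))\<^sup>2)) \<le>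
        ennreal (A * T * A) * (\<integral>\<^sup>+\<xi>. ennreal (decay_weight (y - \<xi>) * (k \<xi> * norm (g \<xi>))\<^sup>2) \<partial>lebesgue)" for y
    proof -
      define s where "s = (\<Sum>\<gamma>\<in>\<Gamma>. (norm (a \<gamma> y))\<^sup>2)"
      define P where "P \<xi> = (\<Sum>\<gamma>\<in>\<Gamma>. a \<gamma> y * character \<gamma> \<xi>)" for \<xi>
      have s0: "0 \<le> s" by (simp add: s_def sum_nonneg)
      have Pm: "P \<in> borel_measurable lebesgue"
        unfolding P_def[abs_def] by (rule measurable_lebesgue_of_borel) measurable
      have i: "integrable lebesgue (\<lambda>\<xi>. cnj (a \<gamma> y) * (H (y - \<xi>) * (character (- \<gamma>) \<xi> * g \<xi>)))" for \<gamma>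
        by (intro integrable_mult_right convolve_integrable H tm)
      have eq: "(H (y - \<xi>) * g \<xi>) * cnj (P \<xi>) = (\<Sum>\<gamma>\<in>\<Gamma>. cnj (a \<gamma> y) * (H (y - \<xi>) * (character (- \<gamma>) \<xi> * g \<xi>)))" for \<xi>
        unfolding P_def cnj_sum complex_cnj_mult cnj_character sum_distrib_left by (simp only: mult_ac)
      have I: "integrable lebesgue (\<lambda>\<xi>. (H (y - \<xi>) * g \<xi>) * cnj (P \<xi>))"
        unfolding eq by (rule Bochner_Integration.integrable_sum[OF i])
      have "(LINT \<xi>|lebesgue. (H (y - \<xi>) * g \<xi>) * cnj (P \<xi>)) =
          (\<Sum>\<gamma>\<in>\<Gamma>. (LINT \<xi>|lebesgue. cnj (a \<gamma> y) * (H (y - \<xi>) * (character (- \<gamma>) \<xi> * g \<xi>))))"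
        unfolding eq by (rule Bochner_Integration.integral_sum[OF i])
      also have "\<dots> = (\<Sum>\<gamma>\<in>\<Gamma>. cnj (a \<gamma> y) * a \<gamma> y)"
        unfolding integral_mult_right_zero by (simp only: a_def convolve_def)
      also have "\<dots> = complex_of_real s"
        unfolding s_def of_real_sum complex_norm_square by (simp only: mult.commute)
      finally have "norm (complex_of_real s) = norm (LINT \<xi>|lebesgue. (H (y - \<xi>) * g \<xi>) * cnj (P \<xi>))"
        by (simp only:)
      then have "ennreal s = ennreal (norm (LINT \<xi>|lebesgue. (H (y - \<xi>) * g \<xi>) * cnj (P \<xi>)))"
        using s0 by simp
      also have "\<dots> \<le> (\<integral>\<^sup>+\<xi>. ennreal (norm (H (y - \<xi>)) * norm (g \<xi>) * norm (P \<xi>)) \<partial>lebesgue)"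
        using integral_norm_bound_ennreal[OF I] by (simp only: norm_mult complex_mod_cnj)
      finally have "(ennreal s)\<^sup>2 \<le> (\<integral>\<^sup>+\<xi>. ennreal (norm (H (y - \<xi>)) * norm (g \<xi>) * norm (P \<xi>)) \<partial>lebesgue)\<^sup>2"
        by (rule power_mono) simp
      also have "\<dots> \<le> (\<integral>\<^sup>+\<xi>. ennreal (norm (H (y - \<xi>)) * (norm (g \<xi>))\<^sup>2) \<partial>lebesgue) *
          (\<integral>\<^sup>+\<xi>. ennreal (norm (H (y - \<xi>)) * (norm (P \<xi>))\<^sup>2) \<partial>lebesgue)"
        by (rule Cauchy_Schwarz_weight[OF Hm1 measurable_compose[OF gm borel_measurable_norm] measurable_compose[OF Pm borel_measurable_norm]]) auto
      also have "(\<integral>\<^sup>+\<xi>. ennreal (norm (H (y - \<xi>)) * (norm (P \<xi>))\<^sup>2) \<partial>lebesgue) \<le>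
          (\<integral>\<^sup>+\<xi>. ennreal A * (ennreal (decay_weight (\<xi> - y)) * ennreal ((norm (P \<xi>))\<^sup>2)) \<partial>lebesgue)"
      proof (rule nn_integral_mono)
        fix \<xi>
        have "norm (H (y - \<xi>)) * (norm (P \<xi>))\<^sup>2 \<le> (A * decay_weight (y - \<xi>)) * (norm (P \<xi>))\<^sup>2"
          using A(2) by (intro mult_right_mono) auto
        then show "ennreal (norm (H (y - \<xi>)) * (norm (P \<xi>))\<^sup>2) \<le> ennreal A * (ennreal (decay_weight (\<xi> - y)) * ennreal ((norm (P \<xi>))\<^sup>2))"
          using A(1) by (simp add: ennreal_mult'[symmetric] ennreal_mult''[symmetric] ennreal_leI mult_ac japanese_minus_commute[of \<xi> y])
      qed
      also have "\<dots> = ennreal A * (\<integral>\<^sup>+\<xi>. ennreal (decay_weight (\<xi> - y)) * ennreal ((norm (P \<xi>))\<^sup>2) \<partial>lebesgue)"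
        unfolding P_def by (rule nn_integral_cmult, rule measurable_lebesgue_of_borel) measurable
      also have "\<dots> \<le> ennreal A * ennreal (T * s)"
        unfolding P_def s_def using T(2) \<Gamma> by (intro mult_left_mono) auto
      also have "\<dots> = ennreal (A * T * s)" using A(1) by (simp add: ennreal_mult'[symmetric] mult.assoc)
      finally have sq: "(ennreal s)\<^sup>2 \<le> (\<integral>\<^sup>+\<xi>. ennreal (norm (H (y - \<xi>)) * (norm (g \<xi>))\<^sup>2) \<partial>lebesgue) * ennreal (A * T * s)"
        by (simp add: mult_left_mono)
      have "ennreal s \<le> ennreal (A * T) * (\<integral>\<^sup>+\<xi>. ennreal (norm (H (y - \<xi>)) * (norm (g \<xi>))\<^sup>2) \<partial>lebesgue)"
        by (rule ennreal_le_of_square_le[OF sq s0]) (use A(1) T(1) in simp)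
      then have "ennreal ((k y)\<^sup>2) * ennreal s \<le> ennreal ((k y)\<^sup>2) * (ennreal (A * T) * (\<integral>\<^sup>+\<xi>. ennreal (norm (H (y - \<xi>)) * (norm (g \<xi>))\<^sup>2) \<partial>lebesgue))"
        by (rule mult_left_mono) simp
      also have "\<dots> = ennreal (A * T) * (\<integral>\<^sup>+\<xi>. ennreal ((k y)\<^sup>2) * ennreal (norm (H (y - \<xi>)) * (norm (g \<xi>))\<^sup>2) \<partial>lebesgue)"
      proof -
        have "(\<lambda>\<xi>. ennreal (norm (H (y - \<xi>)) * (norm (g \<xi>))\<^sup>2)) \<in> borel_measurable lebesgue"
          using Hm1 gm by measurable
        from nn_integral_cmult[OF this] show ?thesis by (simp only: mult.left_commute)
      qed
      also have "(\<integral>\<^sup>+\<xi>. ennreal ((k y)\<^sup>2) * ennreal (norm (H (y - \<xi>)) * (norm (g \<xi>))\<^sup>2) \<partial>lebesgue) \<le>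
          (\<integral>\<^sup>+\<xi>. ennreal A * ennreal (decay_weight (y - \<xi>) * (k \<xi> * norm (g \<xi>))\<^sup>2) \<partial>lebesgue)"
      proof (rule nn_integral_mono)
        fix \<xi>
        have "(k y)\<^sup>2 * (norm (H (y - \<xi>)) * (norm (g \<xi>))\<^sup>2) \<le> A * (decay_weight (y - \<xi>) * (k \<xi> * norm (g \<xi>))\<^sup>2)"
          using mult_right_mono[OF A(3)[rule_format, of y \<xi>], of "(norm (g \<xi>))\<^sup>2"] by (simp add: power_mult_distrib mult_ac)
        then show "ennreal ((k y)\<^sup>2) * ennreal (norm (H (y - \<xi>)) * (norm (g \<xi>))\<^sup>2) \<le>
            ennreal A * ennreal (decay_weight (y - \<xi>) * (k \<xi> * norm (g \<xi>))\<^sup>2)"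
          using A(1) by (simp add: ennreal_mult'[symmetric] ennreal_leI)
      qed
      also have "\<dots> = ennreal A * (\<integral>\<^sup>+\<xi>. ennreal (decay_weight (y - \<xi>) * (k \<xi> * norm (g \<xi>))\<^sup>2) \<partial>lebesgue)"
        by (rule nn_integral_cmult) (use wm1 km gm in measurable)
      finally have "ennreal ((k y)\<^sup>2) * ennreal s \<le> ennreal (A * T) * (ennreal A * (\<integral>\<^sup>+\<xi>. ennreal (decay_weight (y - \<xi>) * (k \<xi> * norm (g \<xi>))\<^sup>2) \<partial>lebesgue))"
        by (simp add: mult_left_mono)
      moreover have "ennreal ((k y)\<^sup>2) * ennreal s = (\<Sum>\<gamma>\<in>\<Gamma>. ennreal ((k y * norm (a \<gamma> y))\<^sup>2))"
        by (simp add: s_def ennreal_mult'[symmetric] sum_distrib_left power_mult_distrib)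
      ultimately show ?thesis
        using A(1) T(1) by (simp add: ennreal_mult mult.assoc)
    qed
    have Fm: "(\<lambda>p. ennreal (decay_weight (fst p - snd p) * (k (snd p) * norm (g (snd p)))\<^sup>2)) \<in> borel_measurable (lebesgue \<Otimes>\<^sub>M lebesgue)"
      using decay_weight_measurable_pair measurable_snd_lebesgue[OF km] measurable_snd_lebesgue[OF gm] by measurable
    have sm: "(\<lambda>y. ennreal ((k y * norm (a \<gamma> y))\<^sup>2)) \<in> borel_measurable lebesgue" for \<gamma>
      using km am by measurable
    have gm2: "(\<lambda>\<xi>. ennreal ((k \<xi> * norm (g \<xi>))\<^sup>2)) \<in> borel_measurable lebesgue"
      using km gm by measurable
    have "(\<Sum>\<gamma>\<in>\<Gamma>. weighted_square k (a \<gamma>)) = (\<integral>\<^sup>+y. (\<Sum>\<gamma>\<in>\<Gamma>. ennreal ((k y * norm (a \<gamma> y))\<^sup>2)) \<partial>lebesgue)"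
      unfolding weighted_square_def by (rule nn_integral_sum[symmetric]) (rule sm)
    also have "\<dots> \<le> (\<integral>\<^sup>+y. ennreal (A * T * A) * (\<integral>\<^sup>+\<xi>. ennreal (decay_weight (y - \<xi>) * (k \<xi> * norm (g \<xi>))\<^sup>2) \<partial>lebesgue) \<partial>lebesgue)"
      by (rule nn_integral_mono) (rule point)
    also have "\<dots> = ennreal (A * T * A) * (\<integral>\<^sup>+y. (\<integral>\<^sup>+\<xi>. ennreal (decay_weight (y - \<xi>) * (k \<xi> * norm (g \<xi>))\<^sup>2) \<partial>lebesgue) \<partial>lebesgue)"
      by (rule nn_integral_cmult, rule lebesgue.borel_measurable_nn_integral) (use Fm in \<open>simp add: case_prod_beta'\<close>)
    also have "(\<integral>\<^sup>+y. (\<integral>\<^sup>+\<xi>. ennreal (decay_weight (y - \<xi>) * (k \<xi> * norm (g \<xi>))\<^sup>2) \<partial>lebesgue) \<partial>lebesgue) =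
        (\<integral>\<^sup>+\<xi>. (\<integral>\<^sup>+y. ennreal (decay_weight (y - \<xi>) * (k \<xi> * norm (g \<xi>))\<^sup>2) \<partial>lebesgue) \<partial>lebesgue)"
      by (rule lebesgue_pair.Fubini'[symmetric]) (use Fm in \<open>simp add: case_prod_beta'\<close>)
    also have "\<dots> = (\<integral>\<^sup>+\<xi>. ennreal J * ennreal ((k \<xi> * norm (g \<xi>))\<^sup>2) \<partial>lebesgue)"
    proof (rule nn_integral_cong)
      fix \<xi> :: "real ^ 'n"
      have m: "(\<lambda>y. ennreal (decay_weight (y - \<xi>))) \<in> borel_measurable lebesgue"
        by (rule measurable_lebesgue_of_borel) measurable
      have "(\<integral>\<^sup>+y. ennreal (decay_weight (y - \<xi>) * (k \<xi> * norm (g \<xi>))\<^sup>2) \<partial>lebesgue) =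
          (\<integral>\<^sup>+y. ennreal (decay_weight (y - \<xi>)) * ennreal ((k \<xi> * norm (g \<xi>))\<^sup>2) \<partial>lebesgue)"
        by (rule nn_integral_cong) (simp add: ennreal_mult''[symmetric])
      then show "(\<integral>\<^sup>+y. ennreal (decay_weight (y - \<xi>) * (k \<xi> * norm (g \<xi>))\<^sup>2) \<partial>lebesgue) = ennreal J * ennreal ((k \<xi> * norm (g \<xi>))\<^sup>2)"
        by (simp only: nn_integral_multc[OF m] nn_integral_decay_weight J_def)
    qed
    also have "\<dots> = ennreal J * weighted_square k g"
      unfolding weighted_square_def by (rule nn_integral_cmult[OF gm2])
    finally have "(\<Sum>\<gamma>\<in>\<Gamma>. weighted_square k (a \<gamma>)) \<le> ennreal (A * T * A * J) * weighted_square k g"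
      using A(1) J T(1) by (simp add: ennreal_mult mult_ac)
    then show "(\<Sum>\<gamma>\<in>\<Gamma>. weighted_square k (convolve H (\<lambda>\<xi>. character (- \<gamma>) \<xi> * g \<xi>))) \<le>
        ennreal (A * T * A * J) * weighted_square k g"
      by (simp only: a_def)
  qed
qed


section \<open>Completeness and norms\<close>

text \<open>Completeness of the weighted square norm, for sequences that converge geometrically. The
  factor \<open>2 ^ m\<close> leaves room to conclude pointwise summability almost everywhere; the two bounds
  for the limit are instances of Fatou's lemma.\<close>

lemma weighted_square_limit:
  fixes k :: "real ^ 'n \<Rightarrow> real" and G :: "nat \<Rightarrow> real ^ 'n \<Rightarrow> complex"
  assumes k: "k \<in> Kpol" and Gm: "\<And>m. G m \<in> borel_measurable lebesgue"
    and S: "\<And>m. weighted_square k (G m) \<le> S"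
    and B: "0 \<le> B" "\<And>m j. m \<le> j \<Longrightarrow> weighted_square k (\<lambda>\<xi>. G j \<xi> - G m \<xi>) \<le> ennreal (B * (1 / 4) ^ m)"
  obtains g where "g \<in> borel_measurable lebesgue" "weighted_square k g \<le> S"
    "\<And>m. weighted_square k (\<lambda>\<xi>. g \<xi> - G m \<xi>) \<le> ennreal (B * (1 / 4) ^ m)"
proof -
  note km = Kpol_measurable[OF k]
  define d where "d m \<xi> = (k \<xi> * norm (G (Suc m) \<xi> - G m \<xi>))\<^sup>2" for m \<xi>
  have dm: "d m \<in> borel_measurable lebesgue" for m
    unfolding d_def[abs_def] using km Gm[of m] Gm[of "Suc m"] by measurable
  have d0: "0 \<le> d m \<xi>" for m \<xi> by (simp add: d_def)
  have em: "(\<lambda>\<xi>. ennreal (2 ^ m * d m \<xi>)) \<in> borel_measurable lebesgue" for m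
    using dm[of m] by measurable
  have "(\<integral>\<^sup>+\<xi>. (\<Sum>m. ennreal (2 ^ m * d m \<xi>)) \<partial>lebesgue) = (\<Sum>m. (\<integral>\<^sup>+\<xi>. ennreal (2 ^ m * d m \<xi>) \<partial>lebesgue))"
    by (rule nn_integral_suminf[OF em])
  also have "\<dots> \<le> (\<Sum>m. ennreal (B * (1 / 2) ^ m))"
  proof (rule suminf_le)
    fix m
    have "(\<lambda>\<xi>. ennreal (d m \<xi>)) \<in> borel_measurable lebesgue" using dm[of m] by measurable
    from nn_integral_cmult[OF this, of "ennreal (2 ^ m)"]
    have "(\<integral>\<^sup>+\<xi>. ennreal (2 ^ m * d m \<xi>) \<partial>lebesgue) = ennreal (2 ^ m) * weighted_square k (\<lambda>\<xi>. G (Suc m) \<xi> - G m \<xi>)"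
      unfolding weighted_square_def d_def[symmetric] by (simp add: ennreal_mult d0)
    also have "\<dots> \<le> ennreal (2 ^ m) * ennreal (B * (1 / 4) ^ m)"
      by (intro mult_left_mono B(2)) auto
    also have "\<dots> = ennreal (2 ^ m * (B * (1 / 4) ^ m))"
      by (rule ennreal_mult[symmetric]) (use B(1) in auto)
    also have "2 ^ m * (B * (1 / 4) ^ m) = B * (1 / 2) ^ m"
      using power_mult_distrib[of 2 "1 / 4 :: real" m] by simp
    finally show "(\<integral>\<^sup>+\<xi>. ennreal (2 ^ m * d m \<xi>) \<partial>lebesgue) \<le> ennreal (B * (1 / 2) ^ m)" .
  qed auto
  also have "\<dots> = ennreal (\<Sum>m. B * (1 / 2) ^ m)"
    by (rule suminf_ennreal2) (use B(1) in \<open>auto intro: summable_mult summable_geometric\<close>)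
  also have "\<dots> < \<infinity>" by simp
  finally have "(\<integral>\<^sup>+\<xi>. (\<Sum>m. ennreal (2 ^ m * d m \<xi>)) \<partial>lebesgue) \<noteq> \<infinity>" by simp
  then have "AE \<xi> in lebesgue. (\<Sum>m. ennreal (2 ^ m * d m \<xi>)) \<noteq> \<infinity>"
    by (intro nn_integral_PInf_AE borel_measurable_suminf_order em)
  then have conv: "AE \<xi> in lebesgue. (\<lambda>m. G m \<xi>) \<longlonglongrightarrow> lim (\<lambda>m. G m \<xi>)"
  proof (rule AE_mp, intro AE_I2 impI)
    fix \<xi> assume fin: "(\<Sum>m. ennreal (2 ^ m * d m \<xi>)) \<noteq> \<infinity>"
    then obtain R where R: "(\<Sum>m. ennreal (2 ^ m * d m \<xi>)) = ennreal R" "0 \<le> R"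
      by (cases "\<Sum>m. ennreal (2 ^ m * d m \<xi>)") auto
    have kp: "0 < k \<xi>" by (rule Kpol_pos[OF k])
    \<comment> \<open>Since \<open>2 ^ m * d m \<xi>\<close> is bounded, the increments are at most of the order \<open>2 ^ (- m / 2)\<close>.\<close>
    define q where "q = 1 / sqrt 2"
    have q: "0 < q" "q < 1" by (auto simp: q_def)
    have "norm (G (Suc m) \<xi> - G m \<xi>) \<le> (sqrt R / k \<xi>) * q ^ m" for m
    proof -
      have "ennreal (2 ^ m * d m \<xi>) \<le> ennreal R"
        unfolding R(1)[symmetric] using sum_le_suminf[of "\<lambda>m. ennreal (2 ^ m * d m \<xi>)" "{m}"] by simp
      then have "2 ^ m * d m \<xi> \<le> R" using R(2) by simp
      then have "d m \<xi> \<le> R * (1 / 2) ^ m" by (simp add: power_one_over field_simps)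
      then have "sqrt (d m \<xi>) \<le> sqrt (R * (1 / 2) ^ m)" by (rule real_sqrt_le_mono)
      also have "\<dots> = sqrt R * q ^ m" by (simp add: q_def real_sqrt_mult real_sqrt_power real_sqrt_divide power_one_over)
      finally have "k \<xi> * norm (G (Suc m) \<xi> - G m \<xi>) \<le> sqrt R * q ^ m"
        using kp by (simp add: d_def)
      then show ?thesis using kp by (simp add: field_simps)
    qed
    then have "summable (\<lambda>m. G (Suc m) \<xi> - G m \<xi>)"
      by (rule summable_comparison_test'[rotated]) (use q in \<open>auto intro!: summable_mult summable_geometric\<close>)
    then have "convergent (\<lambda>n. \<Sum>m<n. (G (Suc m) \<xi> - G m \<xi>))"
      by (simp add: summable_iff_convergent)
    then have "convergent (\<lambda>n. G n \<xi> - G 0 \<xi>)"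
      by (simp only: sum_lessThan_telescope[of "\<lambda>m. G m \<xi>"])
    from convergent_add[OF this convergent_const[of "G 0 \<xi>"]] have "convergent (\<lambda>n. G n \<xi>)"
      by simp
    then show "(\<lambda>m. G m \<xi>) \<longlonglongrightarrow> lim (\<lambda>m. G m \<xi>)" by (simp add: convergent_LIMSEQ_iff)
  qed
  define g where "g \<xi> = lim (\<lambda>m. G m \<xi>)" for \<xi>
  have gm: "g \<in> borel_measurable lebesgue"
    unfolding g_def[abs_def] by (rule borel_measurable_lim_metric) (rule Gm)
  have fatou: "weighted_square k (\<lambda>\<xi>. g \<xi> - f \<xi>) \<le> X"
    if f: "f \<in> borel_measurable lebesgue"
      and X: "\<forall>\<^sub>F j in sequentially. weighted_square k (\<lambda>\<xi>. G j \<xi> - f \<xi>) \<le> X" for f X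
  proof -
    have "AE \<xi> in lebesgue. ennreal ((k \<xi> * norm (g \<xi> - f \<xi>))\<^sup>2) = liminf (\<lambda>j. ennreal ((k \<xi> * norm (G j \<xi> - f \<xi>))\<^sup>2))"
      using conv
    proof (rule AE_mp, intro AE_I2 impI)
      fix \<xi> assume "(\<lambda>m. G m \<xi>) \<longlonglongrightarrow> lim (\<lambda>m. G m \<xi>)"
      then have "(\<lambda>j. ennreal ((k \<xi> * norm (G j \<xi> - f \<xi>))\<^sup>2)) \<longlonglongrightarrow> ennreal ((k \<xi> * norm (g \<xi> - f \<xi>))\<^sup>2)"
        unfolding g_def by (intro tendsto_ennrealI tendsto_power tendsto_mult tendsto_norm tendsto_diff tendsto_const)
      from lim_imp_Liminf[OF _ this]
      show "ennreal ((k \<xi> * norm (g \<xi> - f \<xi>))\<^sup>2) = liminf (\<lambda>j. ennreal ((k \<xi> * norm (G j \<xi> - f \<xi>))\<^sup>2))"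
        by simp
    qed
    then have "weighted_square k (\<lambda>\<xi>. g \<xi> - f \<xi>) = (\<integral>\<^sup>+\<xi>. liminf (\<lambda>j. ennreal ((k \<xi> * norm (G j \<xi> - f \<xi>))\<^sup>2)) \<partial>lebesgue)"
      unfolding weighted_square_def by (rule nn_integral_cong_AE)
    also have "\<dots> \<le> liminf (\<lambda>j. weighted_square k (\<lambda>\<xi>. G j \<xi> - f \<xi>))"
      unfolding weighted_square_def
    proof (rule nn_integral_liminf)
      show "(\<lambda>\<xi>. ennreal ((k \<xi> * norm (G j \<xi> - f \<xi>))\<^sup>2)) \<in> borel_measurable lebesgue" for j
        using km Gm[of j] f by measurable
    qed
    also have "\<dots> \<le> liminf (\<lambda>j :: nat. X)"
      by (rule Liminf_mono[OF X])
    also have "\<dots> = X" by (simp add: Liminf_const)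
    finally show ?thesis .
  qed
  show thesis
  proof (rule that[OF gm])
    show "weighted_square k g \<le> S"
      using fatou[of "\<lambda>_. 0" S] S by simp
    show "weighted_square k (\<lambda>\<xi>. g \<xi> - G m \<xi>) \<le> ennreal (B * (1 / 4) ^ m)" for m
      by (rule fatou[OF Gm]) (use B(2)[of m] in \<open>auto simp: eventually_sequentially\<close>)
  qed
qed

text \<open>The exponent in the definition of \<open>Kpol\<close> has to be positive, hence the summand \<open>1\<close>.\<close>

lemma Kpol_inverse:
  fixes k :: "real ^ 'n \<Rightarrow> real"
  assumes k: "k \<in> Kpol" shows "(\<lambda>\<xi>. inverse (k \<xi>)) \<in> Kpol"
proof -
  obtain C N where C: "0 < C" "\<forall>\<xi> \<eta>. k (\<xi> + \<eta>) \<le> C * japanese \<xi> ^ N * k \<eta>"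
    using Kpol_temperate[OF k] by blast
  have "inverse (k (\<xi> + \<eta>)) \<le> C * japanese \<xi> powr (real N + 1) * inverse (k \<eta>)" for \<xi> \<eta>
  proof -
    have "k \<eta> \<le> C * japanese \<xi> ^ N * k (\<xi> + \<eta>)"
      using C(2)[rule_format, of "- \<xi>" "\<xi> + \<eta>"] by (simp add: japanese_minus)
    then have "inverse (k (\<xi> + \<eta>)) \<le> C * japanese \<xi> ^ N * inverse (k \<eta>)"
      using Kpol_pos[OF k, of \<eta>] Kpol_pos[OF k, of "\<xi> + \<eta>"] by (simp add: field_simps)
    also have "japanese \<xi> ^ N \<le> japanese \<xi> powr (real N + 1)"
      using powr_mono[of "real N" "real N + 1" "japanese \<xi>"] japanese_ge_1[of \<xi>] japanese_pos[of \<xi>]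
      by (simp add: powr_realpow)
    finally show ?thesis
      using C(1) Kpol_pos[OF k, of \<eta>] by (simp add: mult_left_mono mult_right_mono)
  qed
  moreover have "(\<lambda>\<xi>. inverse (k \<xi>)) \<in> borel_measurable lebesgue"
    using Kpol_measurable[OF k] by measurable
  moreover have "0 < real N + 1" by simp
  ultimately show ?thesis
    using C(1) Kpol_pos[OF k] unfolding Kpol_def by (simp (no_asm_simp)) blast
qed

lemma weighted_square_schwartz:
  fixes k :: "real ^ 'n \<Rightarrow> real"
  assumes k: "k \<in> Kpol" and \<psi>: "\<psi> \<in> schwartz_functions"
  shows "weighted_square k \<psi> < \<infinity>"
proof -
  obtain C N where C: "0 < C" "\<forall>\<xi> \<eta>. k (\<xi> + \<eta>) \<le> C * japanese \<xi> ^ N * k \<eta>"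
    using Kpol_temperate[OF k] by blast
  let ?d = "2 * CARD('n)"
  obtain B where B: "schwartz_bound (N + ?d) B \<psi>" by (rule schwartz_bound_exists[OF \<psi>])
  define D where "D = C * k 0 * B"
  have D0: "0 \<le> D" using C(1) Kpol_pos[OF k, of 0] schwartz_bound_nonneg[OF B] by (simp add: D_def)
  have "(k \<xi> * norm (\<psi> \<xi>))\<^sup>2 \<le> D\<^sup>2 * decay_weight \<xi>" for \<xi>
  proof -
    have J: "0 < japanese \<xi>" "1 \<le> japanese \<xi>" by (rule japanese_pos, rule japanese_ge_1)
    have "k \<xi> \<le> C * japanese \<xi> ^ N * k 0" using C(2)[rule_format, of \<xi> 0] by simp
    then have "k \<xi> * norm (\<psi> \<xi>) \<le> (C * japanese \<xi> ^ N * k 0) * (B / japanese \<xi> ^ (N + ?d))"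
      using schwartz_boundD0[OF B order_refl, of \<xi>] Kpol_pos[OF k, of \<xi>] by (intro mult_mono) auto
    also have "\<dots> = D * decay_weight \<xi>" using J by (simp add: D_def power_add field_simps)
    finally have "(k \<xi> * norm (\<psi> \<xi>))\<^sup>2 \<le> (D * decay_weight \<xi>)\<^sup>2"
      using Kpol_pos[OF k, of \<xi>] by (intro power_mono) auto
    also have "\<dots> = D\<^sup>2 * (decay_weight \<xi> * decay_weight \<xi>)"
      by (simp add: power_mult_distrib power2_eq_square)
    also have "\<dots> \<le> D\<^sup>2 * (decay_weight \<xi> * 1)"
      using J by (intro mult_left_mono decay_weight_nonneg) (auto simp: inverse_le_1_iff)
    finally show ?thesis by simp
  qed
  then have "weighted_square k \<psi> \<le> (\<integral>\<^sup>+\<xi>. ennreal (D\<^sup>2 * decay_weight (\<xi> :: real ^ 'n)) \<partial>lebesgue)"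
    unfolding weighted_square_def by (intro nn_integral_mono ennreal_leI)
  also have "\<dots> = ennreal (LINT \<xi>|lebesgue. D\<^sup>2 * decay_weight (\<xi> :: real ^ 'n))"
    by (rule nn_integral_eq_integral[OF integrable_mult_right[OF integrable_japanese]]) (simp add: decay_weight_nonneg)
  also have "\<dots> < \<infinity>" by simp
  finally show ?thesis .
qed

text \<open>The pairing of the space with weight \<open>k\<close> and its dual, the space with weight \<open>1 / k\<close>.\<close>

lemma weighted_pairing:
  fixes k :: "real ^ 'n \<Rightarrow> real"
  assumes k: "k \<in> Kpol" and f: "f \<in> borel_measurable lebesgue" and \<psi>: "\<psi> \<in> borel_measurable lebesgue"
    and i: "integrable lebesgue (\<lambda>\<xi>. f \<xi> * \<psi> \<xi>)"
  shows "(ennreal (norm (LINT \<xi>|lebesgue. f \<xi> * \<psi> \<xi>)))\<^sup>2 \<le>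
    weighted_square k f * weighted_square (\<lambda>\<xi>. inverse (k \<xi>)) \<psi>"
proof -
  note km = Kpol_measurable[OF k]
  have m1: "(\<lambda>\<xi>. k \<xi> * norm (f \<xi>)) \<in> borel_measurable lebesgue" using km f by measurable
  have m2: "(\<lambda>\<xi>. inverse (k \<xi>) * norm (\<psi> \<xi>)) \<in> borel_measurable lebesgue" using km \<psi> by measurable
  have kp: "0 < k \<xi>" for \<xi> by (rule Kpol_pos[OF k])
  have eq: "norm (f \<xi> * \<psi> \<xi>) = 1 * (k \<xi> * norm (f \<xi>)) * (inverse (k \<xi>) * norm (\<psi> \<xi>))" for \<xi>
    using kp[of \<xi>] by (simp add: norm_mult)
  have "(ennreal (norm (LINT \<xi>|lebesgue. f \<xi> * \<psi> \<xi>)))\<^sup>2 \<le> (\<integral>\<^sup>+\<xi>. ennreal (norm (f \<xi> * \<psi> \<xi>)) \<partial>lebesgue)\<^sup>2"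
    by (rule power_mono[OF integral_norm_bound_ennreal[OF i]]) simp
  also have "\<dots> \<le> (\<integral>\<^sup>+\<xi>. ennreal (1 * (k \<xi> * norm (f \<xi>))\<^sup>2) \<partial>lebesgue) *
      (\<integral>\<^sup>+\<xi>. ennreal (1 * (inverse (k \<xi>) * norm (\<psi> \<xi>))\<^sup>2) \<partial>lebesgue)"
    unfolding eq
  proof (rule Cauchy_Schwarz_weight[OF borel_measurable_const m1 m2])
    show "0 \<le> k \<xi> * norm (f \<xi>)" "0 \<le> inverse (k \<xi>) * norm (\<psi> \<xi>)" for \<xi>
      using kp[of \<xi>] by simp_all
  qed simp
  finally show ?thesis unfolding weighted_square_def by (simp only: mult_1_left)
qed

lemma Bspace_elim:
  assumes k: "k \<in> Kpol" and u: "u \<in> Bspace k"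
  obtains g where "fourier_is_function u g" "tempered_function g" "g \<in> borel_measurable lebesgue"
    "weighted_square k g < \<infinity>"
proof -
  obtain g where g: "fourier_is_function u g" "(\<lambda>\<xi>. complex_of_real (k \<xi>) * g \<xi>) \<in> square_integrable"
    using u unfolding Bspace_def by blast
  then have "g \<in> borel_measurable lebesgue" "weighted_square k g < \<infinity>"
    using square_integrable_weighted[OF k] by blast+
  with g(1) tempered_function_of_weighted_square[OF k] show thesis by (intro that)
qed

lemma Bspace_intro:
  assumes k: "k \<in> Kpol" and u: "u \<in> distributions" "fourier_is_function u g"
    and g: "g \<in> borel_measurable lebesgue" "weighted_square k g < \<infinity>"
  shows "u \<in> Bspace k"
  using u g square_integrable_weighted[OF k, of g] unfolding Bspace_def by blast

text \<open>Any two transforms of \<open>u\<close> agree almost everywhere, so that the one chosen by \<open>Bnorm\<close> can be replaced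
  by \<open>g\<close>.\<close>

lemma Bnorm_square:
  assumes k: "k \<in> Kpol" and u: "u \<in> Bspace k" and ug: "fourier_is_function u g"
  shows "(Bnorm k u)\<^sup>2 = weighted_square k g"
proof -
  define s where "s = (SOME g. fourier_is_function u g)"
  have us: "fourier_is_function u s"
    unfolding s_def by (rule someI[where P = "fourier_is_function u", OF ug])
  obtain g' where g': "fourier_is_function u g'" "tempered_function g'" "g' \<in> borel_measurable lebesgue"
    "weighted_square k g' < \<infinity>"
    by (rule Bspace_elim[OF k u])
  have sg: "weighted_square k s = weighted_square k g"
    by (rule weighted_square_cong_AE[OF fourier_is_function_unique[OF us ug]])
  have sg': "weighted_square k s = weighted_square k g'"
    by (rule weighted_square_cong_AE[OF fourier_is_function_unique[OF us g'(1)]])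
  have "locally_integrable s" using us unfolding fourier_is_function_def by blast
  then have sm: "s \<in> borel_measurable lebesgue" by (rule locally_integrable_measurable)
  have n: "(norm (complex_of_real (k \<xi>) * s \<xi>))\<^sup>2 = (k \<xi> * norm (s \<xi>))\<^sup>2" for \<xi>
    using Kpol_pos[OF k, of \<xi>] by (simp add: norm_mult)
  have "(\<lambda>\<xi>. complex_of_real (k \<xi>) * s \<xi>) \<in> square_integrable"
    by (rule iffD2[OF square_integrable_weighted[OF k] conjI[OF sm]]) (simp only: sg' g'(4))
  then have i: "integrable lebesgue (\<lambda>\<xi>. (k \<xi> * norm (s \<xi>))\<^sup>2)"
    unfolding square_integrable_def mem_Collect_eq n by (rule conjunct2)
  have "(Bnorm k u)\<^sup>2 = (ennreal (L2norm (\<lambda>\<xi>. complex_of_real (k \<xi>) * s \<xi>)))\<^sup>2"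
    unfolding Bnorm_def s_def if_P[OF u] ..
  also have "\<dots> = ennreal (LINT \<xi>|lebesgue. (k \<xi> * norm (s \<xi>))\<^sup>2)"
    unfolding L2norm_def n by (simp add: ennreal_power)
  also have "\<dots> = weighted_square k s"
    unfolding weighted_square_def by (rule nn_integral_eq_integral[OF i, symmetric]) simp
  finally show ?thesis by (simp only: sg)
qed


section \<open>The integer lattice\<close>

lemma integer_lattice_norm_ge_1:
  assumes "\<gamma> \<in> integer_lattice" "\<gamma> \<noteq> 0" shows "1 \<le> norm \<gamma>"
proof -
  obtain i where i: "\<gamma> $ i \<noteq> 0" using assms(2) by (auto simp: vec_eq_iff)
  obtain z where z: "\<gamma> $ i = of_int z"
    using assms(1) by (auto simp: integer_lattice_def elim: Ints_cases)
  have "1 \<le> \<bar>\<gamma> $ i\<bar>" using i unfolding z by simp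
  also have "\<dots> \<le> norm \<gamma>" by (rule component_le_norm_cart)
  finally show ?thesis .
qed

lemma closed_nonzero_lattice: "closed (integer_lattice - {0})"
proof (rule discrete_imp_closed[of 1], simp, intro ballI impI)
  fix x y :: "real ^ 'n"
  assume *: "x \<in> integer_lattice - {0}" "y \<in> integer_lattice - {0}" "dist y x < 1"
  then have "y - x \<in> integer_lattice" using integer_lattice_diff by blast
  then show "y = x" using * integer_lattice_norm_ge_1[of "y - x"] by (force simp: dist_norm)
qed

lemma finite_lattice_ball: "finite {\<gamma> \<in> integer_lattice. norm (\<gamma> :: real ^ 'n) \<le> R}"
proof -
  obtain m :: nat where m: "R \<le> real m" using real_arch_simple by blast
  let ?F = "PiE (UNIV :: 'n set) (\<lambda>_. {- int m..int m})"
  have "finite ?F" by (intro finite_PiE) auto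
  moreover have "{\<gamma> \<in> integer_lattice. norm (\<gamma> :: real ^ 'n) \<le> R} \<subseteq> (\<lambda>f. \<chi> i. real_of_int (f i)) ` ?F"
  proof
    fix \<gamma> :: "real ^ 'n" assume \<gamma>: "\<gamma> \<in> {\<gamma> \<in> integer_lattice. norm \<gamma> \<le> R}"
    then have "\<forall>i. \<exists>z. \<gamma> $ i = of_int z" by (auto simp: integer_lattice_def elim: Ints_cases)
    then obtain f where f: "\<And>i. \<gamma> $ i = real_of_int (f i)" by metis
    have "\<bar>real_of_int (f i)\<bar> \<le> real m" for i
      using component_le_norm_cart[of \<gamma> i] \<gamma> m unfolding f[symmetric] by simp
    then have "f i \<in> {- int m..int m}" for i
      by (simp add: abs_le_iff) (metis minus_le_iff of_int_le_iff of_int_minus of_int_of_nat_eq)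
    then have "f \<in> ?F" by auto
    moreover have "\<gamma> = (\<chi> i. real_of_int (f i))" by (simp add: vec_eq_iff f)
    ultimately show "\<gamma> \<in> (\<lambda>f. \<chi> i. real_of_int (f i)) ` ?F" by blast
  qed
  ultimately show ?thesis by (rule finite_surj)
qed


section \<open>Locally finite sums of translates\<close>

lemma test_seminorm_bounds:
  fixes \<phi> :: "real ^ 'n \<Rightarrow> complex"
  assumes \<phi>: "\<phi> \<in> test_functions"
  shows "bdd_above (range (\<lambda>x. norm (partials \<alpha> \<phi> x)))" "0 \<le> (SUP x. norm (partials \<alpha> \<phi> x))"
proof -
  obtain B where B: "schwartz_bound (length \<alpha>) B \<phi>"
    by (rule schwartz_bound_exists[OF test_functions_schwartz[OF \<phi>]])
  have "norm (partials \<alpha> \<phi> x) \<le> B" for x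
    using schwartz_boundD[OF B order_refl, of 0 x] by simp
  then show b: "bdd_above (range (\<lambda>x. norm (partials \<alpha> \<phi> x)))" by (auto simp: bdd_above_def)
  have "norm (partials \<alpha> \<phi> 0) \<le> (SUP x. norm (partials \<alpha> \<phi> x))"
    by (rule cSUP_upper[OF UNIV_I b])
  then show "0 \<le> (SUP x. norm (partials \<alpha> \<phi> x))"
    by (rule order_trans[OF norm_ge_zero])
qed

lemma test_seminorm_nonneg:
  assumes "\<phi> \<in> test_functions" shows "0 \<le> test_seminorm m \<phi>"
  unfolding test_seminorm_def by (intro sum_nonneg test_seminorm_bounds(2)[OF assms])

lemma test_seminorm_mono:
  fixes \<phi> :: "real ^ 'n \<Rightarrow> complex"
  assumes "\<phi> \<in> test_functions" "m \<le> m'" shows "test_seminorm m \<phi> \<le> test_seminorm m' \<phi>"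
  unfolding test_seminorm_def
proof (rule sum_mono2)
  show "finite {\<alpha> :: 'n list. length \<alpha> \<le> m'}"
    using finite_lists_length_le[of "UNIV :: 'n set" m'] by simp
qed (use assms(2) test_seminorm_bounds(2)[OF assms(1)] in auto)

lemma test_seminorm_translate:
  fixes \<phi> :: "real ^ 'n \<Rightarrow> complex"
  assumes "\<phi> \<in> test_functions"
  shows "test_seminorm m (\<lambda>x. \<phi> (x + a)) = test_seminorm m \<phi>"
proof -
  have "range (\<lambda>x. norm (partials \<alpha> \<phi> (x + a))) = range (\<lambda>x. norm (partials \<alpha> \<phi> x))" for \<alpha>
  proof (intro set_eqI iffI)
    fix z assume "z \<in> range (\<lambda>x. norm (partials \<alpha> \<phi> x))"
    then obtain x where "z = norm (partials \<alpha> \<phi> x)" by blast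
    then have "z = norm (partials \<alpha> \<phi> ((x - a) + a))" by simp
    then show "z \<in> range (\<lambda>x. norm (partials \<alpha> \<phi> (x + a)))" by blast
  qed blast
  then show ?thesis
    unfolding test_seminorm_def partials_translate[OF test_functions_smooth[OF assms]] by (simp only:)
qed

lemma distributions_translate:
  fixes u :: "(real ^ 'n \<Rightarrow> complex) \<Rightarrow> complex"
  assumes u: "u \<in> distributions" shows "translate \<gamma> u \<in> distributions"
  unfolding distributions_def linear_form_on_def
proof (intro CollectI conjI ballI allI impI)
  fix \<phi> \<psi> :: "real ^ 'n \<Rightarrow> complex" assume "\<phi> \<in> test_functions" "\<psi> \<in> test_functions"
  then show "translate \<gamma> u (\<lambda>x. \<phi> x + \<psi> x) = translate \<gamma> u \<phi> + translate \<gamma> u \<psi>"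
    unfolding translate_def by (intro distributions_add[OF u] test_functions_translate)
next
  fix c and \<phi> :: "real ^ 'n \<Rightarrow> complex" assume "\<phi> \<in> test_functions"
  then show "translate \<gamma> u (\<lambda>x. c * \<phi> x) = c * translate \<gamma> u \<phi>"
    unfolding translate_def by (intro distributions_cmult[OF u] test_functions_translate)
next
  fix L :: "(real ^ 'n) set" assume L: "compact L"
  have "compact ((\<lambda>x. x - \<gamma>) ` L)"
    by (intro compact_continuous_image continuous_intros L)
  then obtain C m where C: "\<forall>\<phi>\<in>test_functions. fun_support \<phi> \<subseteq> (\<lambda>x. x - \<gamma>) ` L \<longrightarrow> norm (u \<phi>) \<le> C * test_seminorm m \<phi>"
    using u unfolding distributions_def by blast
  show "\<exists>C m. \<forall>\<phi>\<in>test_functions. fun_support \<phi> \<subseteq> L \<longrightarrow> norm (translate \<gamma> u \<phi>) \<le> C * test_seminorm m \<phi>"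
  proof (intro exI ballI impI)
    fix \<phi> :: "real ^ 'n \<Rightarrow> complex" assume \<phi>: "\<phi> \<in> test_functions" "fun_support \<phi> \<subseteq> L"
    have "fun_support (\<lambda>x. \<phi> (x + \<gamma>)) \<subseteq> (\<lambda>x. x - \<gamma>) ` L"
      unfolding fun_support_translate using \<phi>(2) by blast
    then show "norm (translate \<gamma> u \<phi>) \<le> C * test_seminorm m \<phi>"
      using C test_functions_translate[OF \<phi>(1)] unfolding translate_def
      by (metis test_seminorm_translate[OF \<phi>(1)])
  qed
qed

lemma distribution_supported_vanishes:
  assumes u: "u \<in> distributions_supported K" and \<phi>: "\<phi> \<in> test_functions" "fun_support \<phi> \<inter> K = {}"
  shows "u \<phi> = 0"
  by (rule distribution_vanishes_off_support[OF _ \<phi>(1)]) (use u \<phi>(2) in \<open>auto simp: distributions_supported_def\<close>)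

text \<open>The indices that contribute to the value of the sum on a test function with support \<open>L\<close>.\<close>

definition meeting :: "(real ^ 'n) set \<Rightarrow> (real ^ 'n) set \<Rightarrow> (real ^ 'n) set" where
  "meeting K L = {\<gamma> \<in> integer_lattice. \<exists>x\<in>K. x + \<gamma> \<in> L}"

lemma finite_meeting:
  fixes K L :: "(real ^ 'n) set"
  assumes "compact K" "compact L" shows "finite (meeting K L)"
proof -
  obtain R where R: "\<And>x. x \<in> K \<Longrightarrow> norm x \<le> R"
    using compact_imp_bounded[OF assms(1)] bounded_iff by metis
  obtain R' where R': "\<And>x. x \<in> L \<Longrightarrow> norm x \<le> R'"
    using compact_imp_bounded[OF assms(2)] bounded_iff by metis
  have "meeting K L \<subseteq> {\<gamma> \<in> integer_lattice. norm \<gamma> \<le> R' + R}"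
  proof
    fix \<gamma> assume "\<gamma> \<in> meeting K L"
    then obtain x where x: "\<gamma> \<in> integer_lattice" "x \<in> K" "x + \<gamma> \<in> L" by (auto simp: meeting_def)
    have "norm \<gamma> \<le> norm (x + \<gamma>) + norm x" using norm_triangle_ineq4[of "x + \<gamma>" x] by simp
    then show "\<gamma> \<in> {\<gamma> \<in> integer_lattice. norm \<gamma> \<le> R' + R}" using x R[of x] R'[of "x + \<gamma>"] by simp
  qed
  then show ?thesis using finite_lattice_ball finite_subset by blast
qed

context
  fixes K :: "(real ^ 'n) set" and u :: "real ^ 'n \<Rightarrow> (real ^ 'n \<Rightarrow> complex) \<Rightarrow> complex"
  assumes K: "compact K" and u: "\<And>\<gamma>. \<gamma> \<in> integer_lattice \<Longrightarrow> u \<gamma> \<in> distributions_supported K"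
begin

lemma translate_vanishes:
  assumes \<phi>: "\<phi> \<in> test_functions" and \<gamma>: "\<gamma> \<in> integer_lattice" "\<gamma> \<notin> meeting K (fun_support \<phi>)"
  shows "translate \<gamma> (u \<gamma>) \<phi> = 0"
  unfolding translate_def
proof (rule distribution_supported_vanishes[OF u[OF \<gamma>(1)] test_functions_translate[OF \<phi>]])
  show "fun_support (\<lambda>x. \<phi> (x + \<gamma>)) \<inter> K = {}"
    unfolding fun_support_translate using \<gamma> by (auto simp: meeting_def)
qed

lemma translates_sum_eq:
  assumes \<phi>: "\<phi> \<in> test_functions" and \<Gamma>: "finite \<Gamma>" "\<Gamma> \<subseteq> integer_lattice" "meeting K (fun_support \<phi>) \<subseteq> \<Gamma>"
  shows "translates_sum u \<phi> = (\<Sum>\<gamma>\<in>\<Gamma>. translate \<gamma> (u \<gamma>) \<phi>)"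
    and "(\<lambda>\<gamma>. translate \<gamma> (u \<gamma>) \<phi>) summable_on integer_lattice"
proof -
  have z: "translate \<gamma> (u \<gamma>) \<phi> = 0" if "\<gamma> \<in> integer_lattice - \<Gamma>" for \<gamma>
    using translate_vanishes[OF \<phi>, of \<gamma>] that \<Gamma>(3) by blast
  have "infsum (\<lambda>\<gamma>. translate \<gamma> (u \<gamma>) \<phi>) integer_lattice = infsum (\<lambda>\<gamma>. translate \<gamma> (u \<gamma>) \<phi>) \<Gamma>"
    by (rule infsum_cong_neutral) (use z \<Gamma>(2) in auto)
  then show "translates_sum u \<phi> = (\<Sum>\<gamma>\<in>\<Gamma>. translate \<gamma> (u \<gamma>) \<phi>)"
    unfolding translates_sum_def using \<Gamma>(1) by simp
  have "(\<lambda>\<gamma>. translate \<gamma> (u \<gamma>) \<phi>) summable_on integer_lattice \<longleftrightarrow> (\<lambda>\<gamma>. translate \<gamma> (u \<gamma>) \<phi>) summable_on \<Gamma>"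
    by (rule summable_on_cong_neutral) (use z \<Gamma>(2) in auto)
  then show "(\<lambda>\<gamma>. translate \<gamma> (u \<gamma>) \<phi>) summable_on integer_lattice"
    using \<Gamma>(1) by simp
qed

lemma meeting_lattice: "meeting K L \<subseteq> integer_lattice"
  by (auto simp: meeting_def)

lemma meeting_mono: "L \<subseteq> L' \<Longrightarrow> meeting K L \<subseteq> meeting K L'"
  by (auto simp: meeting_def)

lemma translates_sum_eq_compact:
  assumes "\<phi> \<in> test_functions" "compact L" "fun_support \<phi> \<subseteq> L"
  shows "translates_sum u \<phi> = (\<Sum>\<gamma>\<in>meeting K L. translate \<gamma> (u \<gamma>) \<phi>)"
  by (rule translates_sum_eq(1)[OF assms(1) finite_meeting[OF K assms(2)] meeting_lattice meeting_mono[OF assms(3)]])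

lemma translates_summable:
  assumes "\<phi> \<in> test_functions"
  shows "(\<lambda>\<gamma>. translate \<gamma> (u \<gamma>) \<phi>) summable_on integer_lattice"
  by (rule translates_sum_eq(2)[OF assms finite_meeting[OF K test_functions_compact[OF assms]] meeting_lattice order_refl])

lemma translates_sum_distribution: "translates_sum u \<in> distributions"
  unfolding distributions_def linear_form_on_def
proof (intro CollectI conjI ballI allI impI)
  have d: "translate \<gamma> (u \<gamma>) \<in> distributions" if "\<gamma> \<in> meeting K L" for \<gamma> L
    using u[of \<gamma>] that meeting_lattice by (intro distributions_translate) (auto simp: distributions_supported_def)
  {
    fix \<phi> \<psi> :: "real ^ 'n \<Rightarrow> complex" assume *: "\<phi> \<in> test_functions" "\<psi> \<in> test_functions"
    let ?L = "fun_support \<phi> \<union> fun_support \<psi>"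
    have L: "compact ?L" by (rule compact_Un[OF *[THEN test_functions_compact]])
    have "translates_sum u (\<lambda>x. \<phi> x + \<psi> x) = (\<Sum>\<gamma>\<in>meeting K ?L. translate \<gamma> (u \<gamma>) (\<lambda>x. \<phi> x + \<psi> x))"
      by (rule translates_sum_eq_compact[OF test_functions_add[OF *] L fun_support_add])
    also have "\<dots> = (\<Sum>\<gamma>\<in>meeting K ?L. translate \<gamma> (u \<gamma>) \<phi> + translate \<gamma> (u \<gamma>) \<psi>)"
      by (intro sum.cong refl distributions_add[OF d *])
    also have "\<dots> = translates_sum u \<phi> + translates_sum u \<psi>"
      unfolding sum.distrib translates_sum_eq_compact[OF *(1) L Un_upper1] translates_sum_eq_compact[OF *(2) L Un_upper2] ..
    finally show "translates_sum u (\<lambda>x. \<phi> x + \<psi> x) = translates_sum u \<phi> + translates_sum u \<psi>" .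
  next
    fix c and \<phi> :: "real ^ 'n \<Rightarrow> complex" assume *: "\<phi> \<in> test_functions"
    let ?L = "fun_support \<phi>"
    have L: "compact ?L" by (rule test_functions_compact[OF *])
    have "translates_sum u (\<lambda>x. c * \<phi> x) = (\<Sum>\<gamma>\<in>meeting K ?L. translate \<gamma> (u \<gamma>) (\<lambda>x. c * \<phi> x))"
      by (rule translates_sum_eq_compact[OF test_functions_cmult[OF *] L fun_support_mult_right])
    also have "\<dots> = (\<Sum>\<gamma>\<in>meeting K ?L. c * translate \<gamma> (u \<gamma>) \<phi>)"
      by (intro sum.cong refl distributions_cmult[OF d *])
    also have "\<dots> = c * translates_sum u \<phi>"
      unfolding translates_sum_eq_compact[OF * L order_refl] sum_distrib_left ..
    finally show "translates_sum u (\<lambda>x. c * \<phi> x) = c * translates_sum u \<phi>" .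
  next
    fix L :: "(real ^ 'n) set" assume L: "compact L"
    have "\<forall>\<gamma>\<in>meeting K L. \<exists>C m. \<forall>\<phi>\<in>test_functions. fun_support \<phi> \<subseteq> L \<longrightarrow>
        norm (translate \<gamma> (u \<gamma>) \<phi>) \<le> C * test_seminorm m \<phi>"
      using d L unfolding distributions_def by blast
    from bchoice[OF this] obtain C where "\<forall>\<gamma>\<in>meeting K L. \<exists>m. \<forall>\<phi>\<in>test_functions. fun_support \<phi> \<subseteq> L \<longrightarrow>
        norm (translate \<gamma> (u \<gamma>) \<phi>) \<le> C \<gamma> * test_seminorm m \<phi>" ..
    from bchoice[OF this] obtain m where C: "\<forall>\<gamma>\<in>meeting K L. \<forall>\<phi>\<in>test_functions. fun_support \<phi> \<subseteq> L \<longrightarrow>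
        norm (translate \<gamma> (u \<gamma>) \<phi>) \<le> C \<gamma> * test_seminorm (m \<gamma>) \<phi>" ..
    define M where "M = (\<Sum>\<gamma>\<in>meeting K L. m \<gamma>)"
    have fin: "finite (meeting K L)" by (rule finite_meeting[OF K L])
    show "\<exists>C m. \<forall>\<phi>\<in>test_functions. fun_support \<phi> \<subseteq> L \<longrightarrow> norm (translates_sum u \<phi>) \<le> C * test_seminorm m \<phi>"
    proof (intro exI ballI impI)
      fix \<phi> :: "real ^ 'n \<Rightarrow> complex" assume \<phi>: "\<phi> \<in> test_functions" "fun_support \<phi> \<subseteq> L"
      have "norm (translates_sum u \<phi>) \<le> (\<Sum>\<gamma>\<in>meeting K L. norm (translate \<gamma> (u \<gamma>) \<phi>))"
        unfolding translates_sum_eq_compact[OF \<phi>(1) L \<phi>(2)] by (rule norm_sum)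
      also have "\<dots> \<le> (\<Sum>\<gamma>\<in>meeting K L. \<bar>C \<gamma>\<bar> * test_seminorm M \<phi>)"
      proof (rule sum_mono)
        fix \<gamma> assume \<gamma>: "\<gamma> \<in> meeting K L"
        have mM: "m \<gamma> \<le> M" unfolding M_def by (rule member_le_sum[OF \<gamma> _ fin]) auto
        have "norm (translate \<gamma> (u \<gamma>) \<phi>) \<le> C \<gamma> * test_seminorm (m \<gamma>) \<phi>" using C \<gamma> \<phi> by blast
        also have "\<dots> \<le> \<bar>C \<gamma>\<bar> * test_seminorm (m \<gamma>) \<phi>"
          by (rule mult_right_mono[OF abs_ge_self test_seminorm_nonneg[OF \<phi>(1)]])
        also have "\<dots> \<le> \<bar>C \<gamma>\<bar> * test_seminorm M \<phi>"
          by (rule mult_left_mono[OF test_seminorm_mono[OF \<phi>(1) mM]]) simp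
        finally show "norm (translate \<gamma> (u \<gamma>) \<phi>) \<le> \<bar>C \<gamma>\<bar> * test_seminorm M \<phi>" .
      qed
      finally show "norm (translates_sum u \<phi>) \<le> (\<Sum>\<gamma>\<in>meeting K L. \<bar>C \<gamma>\<bar>) * test_seminorm M \<phi>"
        by (simp only: sum_distrib_right)
    qed
  }
qed

end


section \<open>A cut-off that separates the translates\<close>

text \<open>The compact set \<open>K - K\<close> has a positive distance \<open>d\<close> from the closed set of nonzero lattice points. A
  cut-off supported within distance \<open>d / 2\<close> of \<open>K\<close> cannot reach \<open>K + \<gamma>\<close>.\<close>

lemma separating_cutoff:
  fixes K :: "(real ^ 'n) set"
  assumes K: "compact K" and disj: "{x - y | x y. x \<in> K \<and> y \<in> K} \<inter> integer_lattice = {0}"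
  obtains h W where "h \<in> test_functions" "open W" "K \<subseteq> W" "\<And>x. x \<in> W \<Longrightarrow> h x = 1"
    "\<And>x \<gamma>. x \<in> K \<Longrightarrow> \<gamma> \<in> integer_lattice \<Longrightarrow> x + \<gamma> \<in> fun_support h \<Longrightarrow> \<gamma> = 0"
proof -
  have "compact {x - y | x y. x \<in> K \<and> y \<in> K}" by (rule compact_differences[OF K K])
  moreover have "{x - y | x y. x \<in> K \<and> y \<in> K} \<inter> (integer_lattice - {0}) = {}" using disj by blast
  ultimately obtain d where d: "d > 0"
    "\<forall>x\<in>{x - y | x y. x \<in> K \<and> y \<in> K}. \<forall>\<gamma>\<in>integer_lattice - {0}. d \<le> dist x \<gamma>"
    using separate_compact_closed[OF _ closed_nonzero_lattice] by blast
  obtain h :: "real ^ 'n \<Rightarrow> real" and W L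
    where h: "smooth (\<lambda>x. complex_of_real (h x))" "\<And>x. 0 \<le> h x" "\<And>x. h x \<le> 1"
      "open W" "K \<subseteq> W" "\<And>x. x \<in> W \<Longrightarrow> h x = 1"
      "compact L" "\<And>x. x \<in> L \<Longrightarrow> \<exists>y\<in>K. dist y x \<le> d / 2" "\<And>x. x \<notin> L \<Longrightarrow> h x = 0"
    using cutoff_exists[OF K, of "d / 2"] d(1) by (metis half_gt_zero)
  have t: "(\<lambda>x. complex_of_real (h x)) \<in> test_functions" "fun_support (\<lambda>x. complex_of_real (h x)) \<subseteq> L"
    using test_functionsI[OF h(1) h(7)] h(9) by simp_all
  show thesis
  proof (rule that[OF t(1) h(4,5)])
    show "complex_of_real (h x) = 1" if "x \<in> W" for x using h(6)[OF that] by simp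
    fix x \<gamma> assume x: "x \<in> K" and \<gamma>: "\<gamma> \<in> integer_lattice" and s: "x + \<gamma> \<in> fun_support (\<lambda>x. complex_of_real (h x))"
    show "\<gamma> = 0"
    proof (rule ccontr)
      assume "\<gamma> \<noteq> 0"
      obtain y where y: "y \<in> K" "dist y (x + \<gamma>) \<le> d / 2" using h(8) s t(2) by blast
      have "d \<le> dist (y - x) \<gamma>" using d(2) y(1) x \<gamma> \<open>\<gamma> \<noteq> 0\<close> by blast
      also have "\<dots> = dist y (x + \<gamma>)" by (simp add: dist_norm algebra_simps)
      finally show False using y(2) d(1) by linarith
    qed
  qed
qed

lemma cutoff_mult_eq:
  assumes v: "v \<in> distributions_supported K" and h: "h \<in> test_functions" "open W" "K \<subseteq> W" "\<And>x. x \<in> W \<Longrightarrow> h x = 1"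
    and \<theta>: "\<theta> \<in> test_functions"
  shows "v \<theta> = v (\<lambda>x. h x * \<theta> x)"
proof -
  have vd: "v \<in> distributions" using v by (simp add: distributions_supported_def)
  let ?\<psi> = "\<lambda>x. (1 - h x) * \<theta> x"
  have \<psi>: "?\<psi> \<in> test_functions"
    by (rule test_functions_mult[OF smooth_diff[OF smooth_const test_functions_smooth[OF h(1)]] \<theta>])
  have "fun_support ?\<psi> \<subseteq> - W"
    by (rule fun_support_minimal) (use h(2,4) in auto)
  then have "v ?\<psi> = 0"
    by (intro distribution_supported_vanishes[OF v \<psi>]) (use h(3) in auto)
  moreover have "v (\<lambda>x. h x * \<theta> x + ?\<psi> x) = v (\<lambda>x. h x * \<theta> x) + v ?\<psi>"
    by (rule distributions_add[OF vd test_functions_mult[OF test_functions_smooth[OF h(1)] \<theta>] \<psi>])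
  moreover have "(\<lambda>x. h x * \<theta> x + ?\<psi> x) = \<theta>" by (simp add: algebra_simps)
  ultimately show ?thesis by simp
qed

lemma ennreal_infsum_eq_SUP:
  fixes N :: "'a \<Rightarrow> ennreal"
  shows "infsum N A = (SUP F\<in>{F. finite F \<and> F \<subseteq> A}. sum N F)"
  by (rule infsumI[OF nonneg_has_sum_complete]) simp

lemma ennreal_sum_le_infsum:
  fixes N :: "'a \<Rightarrow> ennreal"
  assumes "finite F" "F \<subseteq> A" shows "sum N F \<le> infsum N A"
  unfolding ennreal_infsum_eq_SUP using assms by (intro SUP_upper) auto

text \<open>The rate \<open>(1 / 4) ^ m\<close> of the tails is the one that \<open>weighted_square_limit\<close> asks for.\<close>

lemma exhausting_sets:
  fixes N :: "real ^ 'n \<Rightarrow> ennreal"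
  assumes "infsum N integer_lattice < \<infinity>"
  obtains \<Gamma> :: "nat \<Rightarrow> (real ^ 'n) set" where "\<And>m. finite (\<Gamma> m)" "\<And>m. \<Gamma> m \<subseteq> integer_lattice"
    "\<And>m j. m \<le> j \<Longrightarrow> \<Gamma> m \<subseteq> \<Gamma> j" "\<And>F. finite F \<Longrightarrow> F \<subseteq> integer_lattice \<Longrightarrow> \<exists>m. F \<subseteq> \<Gamma> m"
    "\<And>m F. finite F \<Longrightarrow> F \<subseteq> integer_lattice - \<Gamma> m \<Longrightarrow> sum N F \<le> ennreal ((1 / 4) ^ m)"
proof -
  define S where "S = infsum N integer_lattice"
  have S: "S \<noteq> top" using assms by (simp add: S_def)
  have "\<exists>F. finite F \<and> F \<subseteq> integer_lattice \<and> S \<le> sum N F + ennreal ((1 / 4) ^ m)" for m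
  proof (rule ccontr)
    assume "\<not> ?thesis"
    then have *: "sum N F + ennreal ((1 / 4) ^ m) \<le> S" if "finite F" "F \<subseteq> integer_lattice" for F
      using that by (auto simp: not_le less_imp_le)
    have "S + ennreal ((1 / 4) ^ m) = (SUP F\<in>{F. finite F \<and> F \<subseteq> integer_lattice}. sum N F + ennreal ((1 / 4) ^ m))"
      unfolding S_def ennreal_infsum_eq_SUP by (rule ennreal_SUP_add_left[symmetric]) auto
    also have "\<dots> \<le> S" by (rule SUP_least) (use * in auto)
    finally have "S + ennreal ((1 / 4) ^ m) \<le> S + 0" by simp
    then have "ennreal ((1 / 4) ^ m) \<le> 0" using S by (simp only: ennreal_add_left_cancel_le) simp
    then show False by simp
  qed
  then obtain F where F: "\<And>m. finite (F m)" "\<And>m. F m \<subseteq> integer_lattice" "\<And>m. S \<le> sum N (F m) + ennreal ((1 / 4) ^ m)"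
    by metis
  \<comment> \<open>The sets \<open>F i\<close> control the tails, the balls make sure that every lattice point is reached.\<close>
  define \<Gamma> where "\<Gamma> m = (\<Union>i\<le>m. F i) \<union> {\<gamma> \<in> integer_lattice. norm \<gamma> \<le> real m}" for m :: nat
  show thesis
  proof (rule that[of \<Gamma>])
    show "finite (\<Gamma> m)" for m unfolding \<Gamma>_def using F(1) finite_lattice_ball by blast
    show "\<Gamma> m \<subseteq> integer_lattice" for m unfolding \<Gamma>_def using F(2) by blast
    show "\<Gamma> m \<subseteq> \<Gamma> j" if "m \<le> j" for m j
      unfolding \<Gamma>_def using that by (fastforce intro: order_trans)
    show "\<exists>m. G \<subseteq> \<Gamma> m" if G: "finite G" "G \<subseteq> integer_lattice" for G
    proof -
      obtain R where R: "\<forall>\<gamma>\<in>G. norm \<gamma> \<le> R" using finite_imp_bounded[OF G(1)] bounded_iff by blast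
      obtain m :: nat where "R \<le> real m" using real_arch_simple by blast
      then have "G \<subseteq> \<Gamma> m" unfolding \<Gamma>_def using R G(2) by force
      then show ?thesis ..
    qed
    show "sum N G \<le> ennreal ((1 / 4) ^ m)" if G: "finite G" "G \<subseteq> integer_lattice - \<Gamma> m" for m G
    proof -
      have disj: "F m \<inter> G = {}" using G(2) unfolding \<Gamma>_def by blast
      have "sum N (F m) + sum N G = sum N (F m \<union> G)"
        by (rule sum.union_disjoint[symmetric, OF F(1) G(1) disj])
      also have "\<dots> \<le> S" unfolding S_def
        by (rule ennreal_sum_le_infsum) (use F(1,2) G in auto)
      also have "\<dots> \<le> sum N (F m) + ennreal ((1 / 4) ^ m)" by (rule F(3))
      finally have le: "sum N (F m) + sum N G \<le> sum N (F m) + ennreal ((1 / 4) ^ m)" .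
      have "sum N (F m) \<le> S" unfolding S_def by (rule ennreal_sum_le_infsum[OF F(1,2)])
      then have "sum N (F m) \<noteq> top" using S by (auto simp: top_unique)
      then show ?thesis using le by (simp only: ennreal_add_left_cancel_le) simp
    qed
  qed
qed


section \<open>The equivalence of norms\<close>

lemma Bnorm_finite: "u \<in> Bspace k \<Longrightarrow> Bnorm k u < \<infinity>"
  by (simp add: Bnorm_def)

text \<open>If \<open>v\<close> is supported in \<open>K\<close> then \<open>v = h v\<close>, so its transform reproduces itself under
  convolution with the transform of \<open>h\<close>.\<close>

lemma reproducing_formula:
  fixes g h :: "real ^ 'n \<Rightarrow> complex"
  assumes v: "v \<in> distributions_supported K" "fourier_is_function v g" "tempered_function g"
    and h: "h \<in> test_functions" "open W" "K \<subseteq> W" "\<And>x. x \<in> W \<Longrightarrow> h x = 1"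
  shows "AE \<xi> in lebesgue. g \<xi> = inverse ((2 * complex_of_real pi) ^ CARD('n)) * convolve (fourier h) g \<xi>"
proof (rule fourier_is_function_unique[OF v(2)])
  show "fourier_is_function v (\<lambda>\<xi>. inverse ((2 * complex_of_real pi) ^ CARD('n)) * convolve (fourier h) g \<xi>)"
    by (rule fourier_is_function_mult[OF v(2,3) h(1)]) (rule cutoff_mult_eq[OF v(1) h])
qed

text \<open>The transforms \<open>P F\<close> of the partial sums obey \<open>synthesis_estimate\<close>, because up to a constant
  each \<open>g\<^sub>\<gamma>\<close> equals its convolution with \<open>H\<close> almost everywhere, by \<open>reproducing_formula\<close>. Applied to differences, the estimate yields a limit \<open>G\<close>.
  That \<open>G\<close> is the transform of the whole sum is verified with Parseval's formula: paired with
  \<open>inverse_fourier \<theta>\<close>, the functions \<open>P F\<close> give the value of the partial sum at \<open>\<theta>\<close>, which is eventually the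
  value of the whole sum.\<close>

lemma synthesis:
  fixes k :: "real ^ 'n \<Rightarrow> real" and K :: "(real ^ 'n) set"
  assumes k: "k \<in> Kpol" and K: "compact K"
    and h: "h \<in> test_functions" "open W" "K \<subseteq> W" "\<And>x. x \<in> W \<Longrightarrow> h x = 1"
  shows "\<exists>C\<ge>0. \<forall>u. (\<forall>\<gamma>\<in>integer_lattice. u \<gamma> \<in> Bspace k \<inter> distributions_supported K) \<longrightarrow>
    (\<Sum>\<^sub>\<infinity>\<gamma>\<in>integer_lattice. (Bnorm k (u \<gamma>))\<^sup>2) < \<infinity> \<longrightarrow>
    translates_sum u \<in> Bspace k \<and>
    (Bnorm k (translates_sum u))\<^sup>2 \<le> ennreal C * (\<Sum>\<^sub>\<infinity>\<gamma>\<in>integer_lattice. (Bnorm k (u \<gamma>))\<^sup>2)"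
proof -
  let ?c = "inverse ((2 * complex_of_real pi) ^ CARD('n))"
  define H where "H = fourier h"
  have H: "H \<in> schwartz_functions"
    unfolding H_def by (rule fourier_schwartz[OF test_functions_schwartz[OF h(1)]])
  note km = Kpol_measurable[OF k]
  obtain C0 where C0: "0 \<le> C0" "\<forall>\<Gamma> g. finite \<Gamma> \<longrightarrow> \<Gamma> \<subseteq> integer_lattice \<longrightarrow> (\<forall>\<gamma>\<in>\<Gamma>. tempered_function (g \<gamma>)) \<longrightarrow>
    weighted_square k (\<lambda>\<xi>. \<Sum>\<gamma>\<in>\<Gamma>. character \<gamma> \<xi> * convolve H (g \<gamma>) \<xi>) \<le>
      ennreal C0 * (\<Sum>\<gamma>\<in>\<Gamma>. weighted_square k (g \<gamma>))"
    using synthesis_estimate[OF k H] by blast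
  define C where "C = (norm ?c)\<^sup>2 * C0"
  have C: "0 \<le> C" using C0(1) by (simp add: C_def)
  show ?thesis
  proof (intro exI[of _ C] conjI[OF C] allI impI)
    fix u :: "real ^ 'n \<Rightarrow> (real ^ 'n \<Rightarrow> complex) \<Rightarrow> complex"
    assume u: "\<forall>\<gamma>\<in>integer_lattice. u \<gamma> \<in> Bspace k \<inter> distributions_supported K"
      and fin: "(\<Sum>\<^sub>\<infinity>\<gamma>\<in>integer_lattice. (Bnorm k (u \<gamma>))\<^sup>2) < \<infinity>"
    have uK: "u \<gamma> \<in> distributions_supported K" if "\<gamma> \<in> integer_lattice" for \<gamma> using u that by blast
    have "\<forall>\<gamma>\<in>integer_lattice. \<exists>g. fourier_is_function (u \<gamma>) g \<and> tempered_function g \<and>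
        g \<in> borel_measurable lebesgue \<and> weighted_square k g < \<infinity>"
    proof
      fix \<gamma> :: "real ^ 'n" assume "\<gamma> \<in> integer_lattice"
      then have "u \<gamma> \<in> Bspace k" using u by blast
      then show "\<exists>g. fourier_is_function (u \<gamma>) g \<and> tempered_function g \<and> g \<in> borel_measurable lebesgue \<and> weighted_square k g < \<infinity>"
        by (rule Bspace_elim[OF k]) blast
    qed
    from bchoice[OF this] obtain g where g: "\<forall>\<gamma>\<in>integer_lattice. fourier_is_function (u \<gamma>) (g \<gamma>) \<and>
        tempered_function (g \<gamma>) \<and> g \<gamma> \<in> borel_measurable lebesgue \<and> weighted_square k (g \<gamma>) < \<infinity>" ..
    have N: "(Bnorm k (u \<gamma>))\<^sup>2 = weighted_square k (g \<gamma>)" if "\<gamma> \<in> integer_lattice" for \<gamma>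
      using u g that by (intro Bnorm_square[OF k]) blast+
    define N where "N \<gamma> = (Bnorm k (u \<gamma>))\<^sup>2" for \<gamma>
    define S where "S = infsum N integer_lattice"
    have Sfin: "S < \<infinity>" using fin by (simp only: S_def N_def[abs_def])
    obtain \<Gamma> where \<Gamma>: "\<And>m. finite (\<Gamma> m)" "\<And>m. \<Gamma> m \<subseteq> integer_lattice" "\<And>m j. m \<le> j \<Longrightarrow> \<Gamma> m \<subseteq> \<Gamma> j"
      "\<And>F. finite F \<Longrightarrow> F \<subseteq> integer_lattice \<Longrightarrow> \<exists>m. F \<subseteq> \<Gamma> m"
      "\<And>m F. finite F \<Longrightarrow> F \<subseteq> integer_lattice - \<Gamma> m \<Longrightarrow> sum N F \<le> ennreal ((1 / 4) ^ m)"
      using exhausting_sets[OF Sfin[unfolded S_def]] by metis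
    define P where "P F \<xi> = (\<Sum>\<gamma>\<in>F. character \<gamma> \<xi> * g \<gamma> \<xi>)" for F \<xi>
    have Pm: "P F \<in> borel_measurable lebesgue" if "F \<subseteq> integer_lattice" for F
      unfolding P_def[abs_def] using g that
      by (intro borel_measurable_sum borel_measurable_times measurable_lebesgue_of_borel[OF borel_measurable_character]) blast
    have est: "weighted_square k (P F) \<le> ennreal C * sum N F" if F: "finite F" "F \<subseteq> integer_lattice" for F
    proof -
      have "AE \<xi> in lebesgue. \<forall>\<gamma>\<in>F. g \<gamma> \<xi> = ?c * convolve H (g \<gamma>) \<xi>"
      proof (rule AE_finite_allI[OF F(1)])
        fix \<gamma> assume "\<gamma> \<in> F"
        then have "\<gamma> \<in> integer_lattice" using F(2) by blast
        then show "AE \<xi> in lebesgue. g \<gamma> \<xi> = ?c * convolve H (g \<gamma>) \<xi>"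
          unfolding H_def using g uK by (intro reproducing_formula[OF _ _ _ h]) blast+
      qed
      then have "AE \<xi> in lebesgue. P F \<xi> = ?c * (\<Sum>\<gamma>\<in>F. character \<gamma> \<xi> * convolve H (g \<gamma>) \<xi>)"
      proof (rule AE_mp, intro AE_I2 impI)
        fix \<xi> assume "\<forall>\<gamma>\<in>F. g \<gamma> \<xi> = ?c * convolve H (g \<gamma>) \<xi>"
        then have "P F \<xi> = (\<Sum>\<gamma>\<in>F. character \<gamma> \<xi> * (?c * convolve H (g \<gamma>) \<xi>))"
          unfolding P_def by (intro sum.cong refl) simp
        also have "\<dots> = ?c * (\<Sum>\<gamma>\<in>F. character \<gamma> \<xi> * convolve H (g \<gamma>) \<xi>)"
          unfolding sum_distrib_left by (simp only: mult.left_commute)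
        finally show "P F \<xi> = ?c * (\<Sum>\<gamma>\<in>F. character \<gamma> \<xi> * convolve H (g \<gamma>) \<xi>)" .
      qed
      then have "weighted_square k (P F) = weighted_square k (\<lambda>\<xi>. ?c * (\<Sum>\<gamma>\<in>F. character \<gamma> \<xi> * convolve H (g \<gamma>) \<xi>))"
        by (rule weighted_square_cong_AE)
      also have "\<dots> = ennreal ((norm ?c)\<^sup>2) * weighted_square k (\<lambda>\<xi>. \<Sum>\<gamma>\<in>F. character \<gamma> \<xi> * convolve H (g \<gamma>) \<xi>)"
      proof (rule weighted_square_cmult[OF km])
        have cm: "convolve H (g \<gamma>) \<in> borel_measurable lebesgue" if "\<gamma> \<in> F" for \<gamma>
        proof -
          have "tempered_function (g \<gamma>)" using g that F(2) by blast
          from convolve_tempered[OF this H] show ?thesis by (simp add: tempered_function_def)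
        qed
        show "(\<lambda>\<xi>. \<Sum>\<gamma>\<in>F. character \<gamma> \<xi> * convolve H (g \<gamma>) \<xi>) \<in> borel_measurable lebesgue"
          by (intro borel_measurable_sum borel_measurable_times measurable_lebesgue_of_borel[OF borel_measurable_character] cm)
      qed
      also have "\<dots> \<le> ennreal ((norm ?c)\<^sup>2) * (ennreal C0 * (\<Sum>\<gamma>\<in>F. weighted_square k (g \<gamma>)))"
      proof (rule mult_left_mono)
        have "\<forall>\<gamma>\<in>F. tempered_function (g \<gamma>)" using g F(2) by blast
        then show "weighted_square k (\<lambda>\<xi>. \<Sum>\<gamma>\<in>F. character \<gamma> \<xi> * convolve H (g \<gamma>) \<xi>) \<le> ennreal C0 * (\<Sum>\<gamma>\<in>F. weighted_square k (g \<gamma>))"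
          using C0(2) F by blast
      qed simp
      also have "(\<Sum>\<gamma>\<in>F. weighted_square k (g \<gamma>)) = sum N F"
        by (rule sum.cong[OF refl]) (use N F(2) in \<open>auto simp: N_def\<close>)
      also have "ennreal ((norm ?c)\<^sup>2) * (ennreal C0 * sum N F) = ennreal C * sum N F"
        using C0(1) by (simp add: C_def ennreal_mult' mult.assoc)
      finally show ?thesis .
    qed
    have bound: "weighted_square k (P (\<Gamma> m)) \<le> ennreal C * S" for m
      using est[OF \<Gamma>(1,2), of m] ennreal_sum_le_infsum[OF \<Gamma>(1,2), of N m] unfolding S_def
      by (meson mult_left_mono order_trans zero_le)
    have tail: "weighted_square k (\<lambda>\<xi>. P (\<Gamma> j) \<xi> - P (\<Gamma> m) \<xi>) \<le> ennreal (C * (1 / 4) ^ m)" if "m \<le> j" for m j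
    proof -
      have eq: "(\<lambda>\<xi>. P (\<Gamma> j) \<xi> - P (\<Gamma> m) \<xi>) = P (\<Gamma> j - \<Gamma> m)"
        unfolding P_def by (intro ext sum_diff[symmetric] \<Gamma>(1) \<Gamma>(3)[OF that])
      have "weighted_square k (P (\<Gamma> j - \<Gamma> m)) \<le> ennreal C * sum N (\<Gamma> j - \<Gamma> m)"
        by (rule est) (use \<Gamma>(1,2) in auto)
      also have "\<dots> \<le> ennreal C * ennreal ((1 / 4) ^ m)"
        by (rule mult_left_mono[OF \<Gamma>(5)]) (use \<Gamma>(1,2) in auto)
      also have "\<dots> = ennreal (C * (1 / 4) ^ m)" using C by (simp add: ennreal_mult)
      finally show ?thesis unfolding eq .
    qed
    \<comment> \<open>By \<open>bound\<close> and \<open>tail\<close>, the transforms of the partial sums converge.\<close>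
    obtain G where G: "G \<in> borel_measurable lebesgue" "weighted_square k G \<le> ennreal C * S"
      "\<And>m. weighted_square k (\<lambda>\<xi>. G \<xi> - P (\<Gamma> m) \<xi>) \<le> ennreal (C * (1 / 4) ^ m)"
      using weighted_square_limit[OF k Pm[OF \<Gamma>(2)] bound C tail] by metis
    have Gfin: "weighted_square k G < \<infinity>"
      using G(2) Sfin by (metis ennreal_mult_less_top ennreal_less_top infinity_ennreal_def order_le_less_trans)
    have Gt: "tempered_function G" by (rule tempered_function_of_weighted_square[OF k G(1) Gfin])
    have ff: "fourier_is_function (translates_sum u) G"
    proof (rule fourier_is_functionI[OF Gt])
      fix \<theta> :: "real ^ 'n \<Rightarrow> complex" assume \<theta>: "\<theta> \<in> test_functions"
      define \<psi> where "\<psi> = inverse_fourier \<theta>"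
      have \<psi>: "\<psi> \<in> schwartz_functions"
        unfolding \<psi>_def by (rule inverse_fourier_schwartz[OF test_functions_schwartz[OF \<theta>]])
      have \<psi>m: "\<psi> \<in> borel_measurable lebesgue"
        by (rule measurable_lebesgue_of_borel[OF schwartz_measurable[OF \<psi>]])
      let ?F = "meeting K (fun_support \<theta>)"
      have Ffin: "finite ?F" by (rule finite_meeting[OF K test_functions_compact[OF \<theta>]])
      have "?F \<subseteq> integer_lattice" by (auto simp: meeting_def)
      then obtain m0 where m0: "?F \<subseteq> \<Gamma> m0" using \<Gamma>(4)[OF Ffin] by blast
      have tg: "tempered_function (g \<gamma>)" "fourier_is_function (u \<gamma>) (g \<gamma>)" if "\<gamma> \<in> \<Gamma> m" for m \<gamma>
        using g that \<Gamma>(2) by blast+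
      have ti: "integrable lebesgue (\<lambda>\<xi>. character \<gamma> \<xi> * g \<gamma> \<xi> * \<psi> \<xi>)" if "\<gamma> \<in> \<Gamma> m" for m \<gamma>
        by (rule tempered_function_integrable_schwartz[OF tempered_function_modulate[OF tg(1)[OF that]] \<psi>])
      have Pi: "integrable lebesgue (\<lambda>\<xi>. P (\<Gamma> m) \<xi> * \<psi> \<xi>)" for m
        unfolding P_def sum_distrib_right by (rule Bochner_Integration.integrable_sum[OF ti])
      have Ptrans: "(LINT \<xi>|lebesgue. P (\<Gamma> m) \<xi> * \<psi> \<xi>) = (\<Sum>\<gamma>\<in>\<Gamma> m. translate \<gamma> (u \<gamma>) \<theta>)" for m
      proof -
        have "(LINT \<xi>|lebesgue. P (\<Gamma> m) \<xi> * \<psi> \<xi>) = (\<Sum>\<gamma>\<in>\<Gamma> m. LINT \<xi>|lebesgue. character \<gamma> \<xi> * g \<gamma> \<xi> * \<psi> \<xi>)"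
          unfolding P_def sum_distrib_right by (rule Bochner_Integration.integral_sum[OF ti])
        also have "\<dots> = (\<Sum>\<gamma>\<in>\<Gamma> m. translate \<gamma> (u \<gamma>) \<theta>)"
        proof (rule sum.cong[OF refl])
          fix \<gamma> assume \<gamma>: "\<gamma> \<in> \<Gamma> m"
          show "(LINT \<xi>|lebesgue. character \<gamma> \<xi> * g \<gamma> \<xi> * \<psi> \<xi>) = translate \<gamma> (u \<gamma>) \<theta>"
            unfolding \<psi>_def
            by (rule fourier_is_functionD[symmetric, OF fourier_is_function_translate[OF tg(2,1)[OF \<gamma>]]
                  tempered_function_modulate[OF tg(1)[OF \<gamma>]] \<theta>])
        qed
        finally show ?thesis .
      qed
      have ev: "(LINT \<xi>|lebesgue. P (\<Gamma> m) \<xi> * \<psi> \<xi>) = translates_sum u \<theta>" if "m0 \<le> m" for m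
      proof -
        have "?F \<subseteq> \<Gamma> m" using m0 \<Gamma>(3)[OF that] by blast
        from translates_sum_eq(1)[OF K uK \<theta> \<Gamma>(1,2) this] show ?thesis unfolding Ptrans by (rule sym)
      qed
      have Gi: "integrable lebesgue (\<lambda>\<xi>. G \<xi> * \<psi> \<xi>)"
        by (rule tempered_function_integrable_schwartz[OF Gt \<psi>])
      obtain V where V: "weighted_square (\<lambda>\<xi>. inverse (k \<xi>)) \<psi> = ennreal V" "0 \<le> V"
        using weighted_square_schwartz[OF Kpol_inverse[OF k] \<psi>]
        by (cases "weighted_square (\<lambda>\<xi>. inverse (k \<xi>)) \<psi>") auto
      define e where "e = norm ((LINT \<xi>|lebesgue. G \<xi> * \<psi> \<xi>) - translates_sum u \<theta>)"
      have small: "e\<^sup>2 \<le> C * V * (1 / 4) ^ m" if "m0 \<le> m" for m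
      proof -
        have eq: "(LINT \<xi>|lebesgue. (G \<xi> - P (\<Gamma> m) \<xi>) * \<psi> \<xi>) = (LINT \<xi>|lebesgue. G \<xi> * \<psi> \<xi>) - translates_sum u \<theta>"
          unfolding left_diff_distrib Bochner_Integration.integral_diff[OF Gi Pi] ev[OF that] ..
        have m: "(\<lambda>\<xi>. G \<xi> - P (\<Gamma> m) \<xi>) \<in> borel_measurable lebesgue"
          by (rule borel_measurable_diff[OF G(1) Pm[OF \<Gamma>(2)]])
        have i: "integrable lebesgue (\<lambda>\<xi>. (G \<xi> - P (\<Gamma> m) \<xi>) * \<psi> \<xi>)"
          unfolding left_diff_distrib by (rule Bochner_Integration.integrable_diff[OF Gi Pi])
        have "(ennreal e)\<^sup>2 \<le> weighted_square k (\<lambda>\<xi>. G \<xi> - P (\<Gamma> m) \<xi>) * ennreal V"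
          using weighted_pairing[OF k m \<psi>m i] unfolding eq e_def V(1) .
        also have "\<dots> \<le> ennreal (C * (1 / 4) ^ m) * ennreal V"
          by (rule mult_right_mono[OF G(3)]) simp
        also have "\<dots> = ennreal (C * (1 / 4) ^ m * V)"
          using C V(2) by (simp add: ennreal_mult)
        finally have "ennreal (e\<^sup>2) \<le> ennreal (C * (1 / 4) ^ m * V)"
          by (simp add: ennreal_power e_def)
        moreover have "0 \<le> C * (1 / 4) ^ m * V" using C V(2) by simp
        ultimately show ?thesis by (simp add: mult_ac)
      qed
      have "(\<lambda>m. C * V * (1 / 4 :: real) ^ m) \<longlonglongrightarrow> C * V * 0"
        by (intro tendsto_mult tendsto_const LIMSEQ_realpow_zero) auto
      then have "e\<^sup>2 \<le> C * V * 0"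
        by (rule tendsto_lowerbound) (use small in \<open>auto simp: eventually_sequentially\<close>)
      then have "e = 0" by simp
      then show "translates_sum u \<theta> = (LINT \<xi>|lebesgue. G \<xi> * inverse_fourier \<theta> \<xi>)"
        by (simp add: e_def \<psi>_def)
    qed
    have B: "translates_sum u \<in> Bspace k"
      by (rule Bspace_intro[OF k translates_sum_distribution[OF K uK] ff G(1) Gfin])
    moreover have "(Bnorm k (translates_sum u))\<^sup>2 \<le> ennreal C * S"
      unfolding Bnorm_square[OF k B ff] by (rule G(2))
    ultimately show "translates_sum u \<in> Bspace k \<and>
        (Bnorm k (translates_sum u))\<^sup>2 \<le> ennreal C * (\<Sum>\<^sub>\<infinity>\<gamma>\<in>integer_lattice. (Bnorm k (u \<gamma>))\<^sup>2)"
      unfolding S_def N_def[abs_def] by blast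
  qed
qed

text \<open>The cut-off isolates each piece: \<open>u\<^sub>\<gamma>\<close> is \<open>h\<close> times the translate of the sum by \<open>- \<gamma>\<close>, so that up to
  a constant its transform is the convolution of \<open>H\<close> with a modulation of the transform of the sum. The estimate for
  infinitely many indices is the supremum of those for finite sets.\<close>

lemma analysis:
  fixes k :: "real ^ 'n \<Rightarrow> real" and K :: "(real ^ 'n) set"
  assumes k: "k \<in> Kpol" and K: "compact K"
    and h: "h \<in> test_functions" "open W" "K \<subseteq> W" "\<And>x. x \<in> W \<Longrightarrow> h x = 1"
    and sep: "\<And>x \<gamma>. x \<in> K \<Longrightarrow> \<gamma> \<in> integer_lattice \<Longrightarrow> x + \<gamma> \<in> fun_support h \<Longrightarrow> \<gamma> = 0"
  shows "\<exists>C\<ge>0. \<forall>u. (\<forall>\<gamma>\<in>integer_lattice. u \<gamma> \<in> Bspace k \<inter> distributions_supported K) \<longrightarrow>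
    translates_sum u \<in> Bspace k \<longrightarrow>
    (\<Sum>\<^sub>\<infinity>\<gamma>\<in>integer_lattice. (Bnorm k (u \<gamma>))\<^sup>2) \<le> ennreal C * (Bnorm k (translates_sum u))\<^sup>2"
proof -
  let ?c = "inverse ((2 * complex_of_real pi) ^ CARD('n))"
  define H where "H = fourier h"
  have H: "H \<in> schwartz_functions"
    unfolding H_def by (rule fourier_schwartz[OF test_functions_schwartz[OF h(1)]])
  note km = Kpol_measurable[OF k]
  obtain C0 where C0: "0 \<le> C0" "\<forall>\<Gamma> g. finite \<Gamma> \<longrightarrow> \<Gamma> \<subseteq> integer_lattice \<longrightarrow> tempered_function g \<longrightarrow>
    (\<Sum>\<gamma>\<in>\<Gamma>. weighted_square k (convolve H (\<lambda>\<xi>. character (- \<gamma>) \<xi> * g \<xi>))) \<le> ennreal C0 * weighted_square k g"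
    using analysis_estimate[OF k H] by blast
  define C where "C = (norm ?c)\<^sup>2 * C0"
  have C: "0 \<le> C" using C0(1) by (simp add: C_def)
  show ?thesis
  proof (intro exI[of _ C] conjI[OF C] allI impI)
    fix u :: "real ^ 'n \<Rightarrow> (real ^ 'n \<Rightarrow> complex) \<Rightarrow> complex"
    assume u: "\<forall>\<gamma>\<in>integer_lattice. u \<gamma> \<in> Bspace k \<inter> distributions_supported K"
      and U: "translates_sum u \<in> Bspace k"
    have uK: "u \<gamma> \<in> distributions_supported K" if "\<gamma> \<in> integer_lattice" for \<gamma> using u that by blast
    obtain g where g: "fourier_is_function (translates_sum u) g" "tempered_function g"
      "g \<in> borel_measurable lebesgue" "weighted_square k g < \<infinity>"
      by (rule Bspace_elim[OF k U])
    \<comment> \<open>By the separation property, only the translate with index \<open>\<gamma>\<close> meets the support of \<open>h\<close> shifted by \<open>\<gamma>\<close>.\<close>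
    have iso: "u \<gamma> \<theta> = translate (- \<gamma>) (translates_sum u) (\<lambda>x. h x * \<theta> x)"
      if \<gamma>: "\<gamma> \<in> integer_lattice" and \<theta>: "\<theta> \<in> test_functions" for \<gamma> \<theta>
    proof -
      define \<phi> where "\<phi> x = h (x - \<gamma>) * \<theta> (x - \<gamma>)" for x
      have h\<theta>: "(\<lambda>x. h x * \<theta> x) \<in> test_functions"
        by (rule test_functions_mult[OF test_functions_smooth[OF h(1)] \<theta>])
      have \<phi>: "\<phi> \<in> test_functions"
        using test_functions_translate[OF h\<theta>, of "- \<gamma>"] by (simp add: \<phi>_def[abs_def])
      have "fun_support \<phi> = (\<lambda>x. x + \<gamma>) ` fun_support (\<lambda>x. h x * \<theta> x)"
        using fun_support_translate[of "\<lambda>x. h x * \<theta> x" "- \<gamma>"] by (simp add: \<phi>_def[abs_def])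
      then have supp: "fun_support \<phi> \<subseteq> (\<lambda>x. x + \<gamma>) ` fun_support h"
        using fun_support_mult_left[of h \<theta>] by blast
      have "\<delta> = \<gamma>" if \<delta>: "\<delta> \<in> meeting K (fun_support \<phi>)" for \<delta>
      proof -
        have "\<delta> \<in> integer_lattice \<and> (\<exists>x\<in>K. x + \<delta> \<in> fun_support \<phi>)"
          using \<delta> unfolding meeting_def by blast
        then obtain x where x: "\<delta> \<in> integer_lattice" "x \<in> K" "x + \<delta> \<in> fun_support \<phi>" by blast
        then obtain y where y: "y \<in> fun_support h" "x + \<delta> = y + \<gamma>" using supp by blast
        have "x + (\<delta> - \<gamma>) = (x + \<delta>) - \<gamma>" by (rule add_diff_eq)
        also have "\<dots> = y" unfolding y(2) by (rule add_diff_cancel_right')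
        finally have "x + (\<delta> - \<gamma>) \<in> fun_support h" using y(1) by (rule ssubst)
        then have "\<delta> - \<gamma> = 0" by (rule sep[OF x(2) integer_lattice_diff[OF x(1) \<gamma>]])
        then show ?thesis by simp
      qed
      then have "meeting K (fun_support \<phi>) \<subseteq> {\<gamma>}" by blast
      then have "translates_sum u \<phi> = (\<Sum>\<delta>\<in>{\<gamma>}. translate \<delta> (u \<delta>) \<phi>)"
        by (intro translates_sum_eq(1)[OF K uK \<phi>]) (use \<gamma> in auto)
      also have "\<dots> = u \<gamma> (\<lambda>x. h x * \<theta> x)" by (simp add: translate_def \<phi>_def)
      also have "\<dots> = u \<gamma> \<theta>" by (rule cutoff_mult_eq[symmetric, OF uK[OF \<gamma>] h \<theta>])
      finally show ?thesis by (simp add: translate_def \<phi>_def[abs_def])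
    qed
    have N: "(Bnorm k (u \<gamma>))\<^sup>2 = ennreal ((norm ?c)\<^sup>2) * weighted_square k (convolve H (\<lambda>\<xi>. character (- \<gamma>) \<xi> * g \<xi>))"
      if \<gamma>: "\<gamma> \<in> integer_lattice" for \<gamma>
    proof -
      note tm = tempered_function_modulate[OF g(2), of "- \<gamma>"]
      have f: "fourier_is_function (u \<gamma>) (\<lambda>y. ?c * convolve H (\<lambda>\<xi>. character (- \<gamma>) \<xi> * g \<xi>) y)"
        unfolding H_def
        by (rule fourier_is_function_mult[OF fourier_is_function_translate[OF g(1,2)] tm h(1)]) (rule iso[OF \<gamma>])
      have uB: "u \<gamma> \<in> Bspace k" using u \<gamma> by blast
      have "convolve H (\<lambda>\<xi>. character (- \<gamma>) \<xi> * g \<xi>) \<in> borel_measurable lebesgue"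
        using convolve_tempered[OF tm H] by (simp add: tempered_function_def)
      from weighted_square_cmult[OF km this] show ?thesis
        unfolding Bnorm_square[OF k uB f] .
    qed
    have "(\<Sum>\<gamma>\<in>F. (Bnorm k (u \<gamma>))\<^sup>2) \<le> ennreal C * weighted_square k g" if F: "finite F" "F \<subseteq> integer_lattice" for F
    proof -
      have "(\<Sum>\<gamma>\<in>F. (Bnorm k (u \<gamma>))\<^sup>2) =
          (\<Sum>\<gamma>\<in>F. ennreal ((norm ?c)\<^sup>2) * weighted_square k (convolve H (\<lambda>\<xi>. character (- \<gamma>) \<xi> * g \<xi>)))"
        by (rule sum.cong[OF refl N]) (use F(2) in blast)
      also have "\<dots> = ennreal ((norm ?c)\<^sup>2) * (\<Sum>\<gamma>\<in>F. weighted_square k (convolve H (\<lambda>\<xi>. character (- \<gamma>) \<xi> * g \<xi>)))"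
        by (rule sum_distrib_left[symmetric])
      also have "\<dots> \<le> ennreal ((norm ?c)\<^sup>2) * (ennreal C0 * weighted_square k g)"
        by (rule mult_left_mono) (use C0(2) F g(2) in auto)
      also have "\<dots> = ennreal C * weighted_square k g"
        using C0(1) by (simp add: C_def ennreal_mult' mult.assoc)
      finally show ?thesis .
    qed
    then have "(\<Sum>\<^sub>\<infinity>\<gamma>\<in>integer_lattice. (Bnorm k (u \<gamma>))\<^sup>2) \<le> ennreal C * weighted_square k g"
      unfolding ennreal_infsum_eq_SUP by (intro SUP_least) blast
    then show "(\<Sum>\<^sub>\<infinity>\<gamma>\<in>integer_lattice. (Bnorm k (u \<gamma>))\<^sup>2) \<le> ennreal C * (Bnorm k (translates_sum u))\<^sup>2"
      unfolding Bnorm_square[OF k U g(1)] .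
  qed
qed

lemma root2_le:
  assumes "a\<^sup>2 \<le> ennreal C * b" "0 \<le> C" "C \<le> D\<^sup>2" "0 \<le> D" "b < \<infinity>"
  shows "a \<le> ennreal D * ennreal_root2 b"
proof -
  obtain s where s: "b = ennreal s" "0 \<le> s" using assms(5) by (cases b) auto
  have root: "ennreal_root2 b = ennreal (sqrt s)" using s by (simp add: ennreal_root2_def)
  have "a\<^sup>2 \<le> ennreal (C * s)" using assms(1) s assms(2) by (simp add: ennreal_mult)
  then have "a \<noteq> top" by (auto simp: top_unique power2_eq_square ennreal_top_mult)
  then obtain r where r: "a = ennreal r" "0 \<le> r" by (cases a) auto
  have "r\<^sup>2 \<le> C * s" using \<open>a\<^sup>2 \<le> ennreal (C * s)\<close> r s(2) assms(2) by (simp add: ennreal_power)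
  also have "\<dots> \<le> D\<^sup>2 * s" using assms(3) s(2) by (rule mult_right_mono)
  also have "\<dots> = (D * sqrt s)\<^sup>2" using s(2) by (simp add: power_mult_distrib)
  finally have "r \<le> D * sqrt s" by (rule power2_le_imp_le) (use assms(4) s(2) in simp)
  then show ?thesis unfolding root r(1) using assms(4) s(2) by (simp add: ennreal_mult[symmetric] ennreal_leI)
qed

lemma root2_square: "ennreal_root2 (a\<^sup>2) = a"
proof (cases a)
  case (real r)
  then have "a\<^sup>2 = ennreal (r\<^sup>2)" by (simp add: ennreal_power)
  then show ?thesis using real by (simp add: ennreal_root2_def)
next
  case top
  then have "a\<^sup>2 = top" by (simp add: power2_eq_square ennreal_top_mult)
  then show ?thesis using top by (simp add: ennreal_root2_def)
qed

lemma square_root2: "(ennreal_root2 a)\<^sup>2 = a"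
proof (cases a)
  case (real r)
  then have "ennreal_root2 a = ennreal (sqrt r)" by (simp add: ennreal_root2_def)
  then show ?thesis using real by (simp add: ennreal_power)
next
  case top
  then have "ennreal_root2 a = top" by (simp add: ennreal_root2_def)
  then show ?thesis using top by (simp add: power2_eq_square ennreal_top_mult)
qed

theorem lemma2p8:
  fixes k :: "real ^ 'n \<Rightarrow> real" and K :: "(real ^ 'n) set"
  assumes "k \<in> Kpol"
    and "compact K"
    and "{x - y | x y. x \<in> K \<and> y \<in> K} \<inter> integer_lattice = {0}"
  shows "(\<forall>u. (\<forall>\<gamma>\<in>integer_lattice. u \<gamma> \<in> Bspace k \<inter> distributions_supported K) \<longrightarrow>
            (\<forall>\<phi>\<in>test_functions. (\<lambda>\<gamma>. translate \<gamma> (u \<gamma>) \<phi>) summable_on integer_lattice) \<and>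
            translates_sum u \<in> distributions \<and>
            (translates_sum u \<in> Bspace k \<longleftrightarrow>
              (\<Sum>\<^sub>\<infinity>\<gamma>\<in>integer_lattice. (Bnorm k (u \<gamma>))\<^sup>2) < \<infinity>)) \<and>
         (\<exists>C\<ge>1::real. \<forall>u.
            (\<forall>\<gamma>\<in>integer_lattice. u \<gamma> \<in> Bspace k \<inter> distributions_supported K) \<longrightarrow>
            ennreal (inverse C) * Bnorm k (translates_sum u)
              \<le> ennreal_root2 (\<Sum>\<^sub>\<infinity>\<gamma>\<in>integer_lattice. (Bnorm k (u \<gamma>))\<^sup>2) \<and>
            ennreal_root2 (\<Sum>\<^sub>\<infinity>\<gamma>\<in>integer_lattice. (Bnorm k (u \<gamma>))\<^sup>2)
              \<le> ennreal C * Bnorm k (translates_sum u))"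
proof -
  obtain h W where h: "h \<in> test_functions" "open W" "K \<subseteq> W" "\<And>x. x \<in> W \<Longrightarrow> h x = 1"
    "\<And>x \<gamma>. x \<in> K \<Longrightarrow> \<gamma> \<in> integer_lattice \<Longrightarrow> x + \<gamma> \<in> fun_support h \<Longrightarrow> \<gamma> = 0"
    using separating_cutoff[OF assms(2,3)] by metis
  define adm where "adm u \<longleftrightarrow> (\<forall>\<gamma>\<in>integer_lattice. u \<gamma> \<in> Bspace k \<inter> distributions_supported K)"
    for u :: "real ^ 'n \<Rightarrow> (real ^ 'n \<Rightarrow> complex) \<Rightarrow> complex"
  define S where "S u = (\<Sum>\<^sub>\<infinity>\<gamma>\<in>integer_lattice. (Bnorm k (u \<gamma>))\<^sup>2)"
    for u :: "real ^ 'n \<Rightarrow> (real ^ 'n \<Rightarrow> complex) \<Rightarrow> complex"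
  have "\<exists>C\<ge>0. \<forall>u. adm u \<longrightarrow> S u < \<infinity> \<longrightarrow>
      translates_sum u \<in> Bspace k \<and> (Bnorm k (translates_sum u))\<^sup>2 \<le> ennreal C * S u"
    unfolding adm_def S_def by (rule synthesis[OF assms(1,2) h(1-4)])
  then obtain C1 where C1: "0 \<le> C1" "\<And>u. adm u \<Longrightarrow> S u < \<infinity> \<Longrightarrow> translates_sum u \<in> Bspace k"
    "\<And>u. adm u \<Longrightarrow> S u < \<infinity> \<Longrightarrow> (Bnorm k (translates_sum u))\<^sup>2 \<le> ennreal C1 * S u" by blast
  have "\<exists>C\<ge>0. \<forall>u. adm u \<longrightarrow> translates_sum u \<in> Bspace k \<longrightarrow>
      S u \<le> ennreal C * (Bnorm k (translates_sum u))\<^sup>2"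
    unfolding adm_def S_def by (rule analysis[OF assms(1,2) h])
  then obtain C2 where C2: "0 \<le> C2" "\<And>u. adm u \<Longrightarrow> translates_sum u \<in> Bspace k \<Longrightarrow>
      S u \<le> ennreal C2 * (Bnorm k (translates_sum u))\<^sup>2" by blast
  have supp: "u \<gamma> \<in> distributions_supported K" if "adm u" "\<gamma> \<in> integer_lattice" for u \<gamma>
    using that unfolding adm_def by blast
  have iff: "translates_sum u \<in> Bspace k \<longleftrightarrow> S u < \<infinity>" if "adm u" for u
  proof
    assume U: "translates_sum u \<in> Bspace k"
    then have "Bnorm k (translates_sum u) < top" using Bnorm_finite[OF U] by simp
    then have "ennreal C2 * (Bnorm k (translates_sum u))\<^sup>2 < top"
      by (simp add: ennreal_mult_less_top power2_eq_square)
    with C2(2)[OF that U] show "S u < \<infinity>" by simp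
  qed (rule C1(2)[OF that])
  have "(\<forall>\<phi>\<in>test_functions. (\<lambda>\<gamma>. translate \<gamma> (u \<gamma>) \<phi>) summable_on integer_lattice) \<and>
      translates_sum u \<in> distributions \<and> (translates_sum u \<in> Bspace k \<longleftrightarrow> S u < \<infinity>)" if u: "adm u" for u
    by (intro conjI ballI translates_summable[OF assms(2) supp[OF u]]
        translates_sum_distribution[OF assms(2) supp[OF u]] iff[OF u])
  then have "\<forall>u. adm u \<longrightarrow> (\<forall>\<phi>\<in>test_functions. (\<lambda>\<gamma>. translate \<gamma> (u \<gamma>) \<phi>) summable_on integer_lattice) \<and>
      translates_sum u \<in> distributions \<and> (translates_sum u \<in> Bspace k \<longleftrightarrow> S u < \<infinity>)"
    by (intro allI impI)
  moreover have "\<exists>C\<ge>1::real. \<forall>u. adm u \<longrightarrow>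
      ennreal (inverse C) * Bnorm k (translates_sum u) \<le> ennreal_root2 (S u) \<and>
      ennreal_root2 (S u) \<le> ennreal C * Bnorm k (translates_sum u)"
  proof -
    \<comment> \<open>As \<open>D \<ge> 1\<close>, the square of \<open>D\<close> dominates both constants, which refer to squares of norms.\<close>
    define D where "D = 1 + C1 + C2"
    have D: "1 \<le> D" "0 \<le> D" using C1(1) C2(1) by (auto simp: D_def)
    have DD: "D \<le> D\<^sup>2" using D by (simp add: power2_eq_square)
    have D12: "C1 \<le> D\<^sup>2" "C2 \<le> D\<^sup>2" using DD C1(1) C2(1) by (auto simp: D_def)
    show ?thesis
    proof (intro exI[of _ D] conjI[OF D(1)] allI impI)
      fix u assume u: "adm u"
      show "ennreal (inverse D) * Bnorm k (translates_sum u) \<le> ennreal_root2 (S u) \<and>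
          ennreal_root2 (S u) \<le> ennreal D * Bnorm k (translates_sum u)"
      proof (cases "S u < \<infinity>")
        case True
        then have U: "translates_sum u \<in> Bspace k" using iff[OF u] by blast
        have "Bnorm k (translates_sum u) \<le> ennreal D * ennreal_root2 (S u)"
          by (rule root2_le[OF C1(3)[OF u True] C1(1) D12(1) D(2) True])
        then have "ennreal (inverse D) * Bnorm k (translates_sum u) \<le> ennreal (inverse D) * (ennreal D * ennreal_root2 (S u))"
          by (rule mult_left_mono) simp
        also have "\<dots> = ennreal_root2 (S u)"
          using D by (simp add: mult.assoc[symmetric] ennreal_mult[symmetric])
        finally have 1: "ennreal (inverse D) * Bnorm k (translates_sum u) \<le> ennreal_root2 (S u)" .
        have "ennreal_root2 (S u) \<le> ennreal D * ennreal_root2 ((Bnorm k (translates_sum u))\<^sup>2)"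
        proof (rule root2_le[OF _ C2(1) D12(2) D(2)])
          show "(ennreal_root2 (S u))\<^sup>2 \<le> ennreal C2 * (Bnorm k (translates_sum u))\<^sup>2"
            unfolding square_root2 by (rule C2(2)[OF u U])
          show "(Bnorm k (translates_sum u))\<^sup>2 < \<infinity>"
            using Bnorm_finite[OF U] by (simp add: power2_eq_square ennreal_mult_less_top)
        qed
        then show ?thesis using 1 unfolding root2_square by blast
      next
        case False
        then have "S u = \<infinity>" by (simp add: less_top[symmetric])
        moreover have "Bnorm k (translates_sum u) = \<infinity>"
          using iff[OF u] False by (simp add: Bnorm_def)
        ultimately show ?thesis using D by (simp add: ennreal_root2_def ennreal_mult_top)
      qed
    qed
  qed
  ultimately show ?thesis unfolding adm_def S_def by (rule conjI)
qed

end
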